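(* For $n\ge 1$ and $\lambda,\mu\in\mathcal P_n$ consider the following two lists of assertions. List A: (A1) For every $x\in[0,\infty)^n$, $\ \dfrac{P_\lambda(x;\tau)}{P_\lambda(\mathbf 1;\tau)}-\dfrac{P_\mu(x;\tau)}{P_\mu(\mathbf 1;\tau)}\in\mathbb F_{\ge0}^{\mathbb R}$. (A2) For every $\tau_0\in[0,\infty]$ and every $x\in[0,\infty)^n$, $\ \dfrac{P_\lambda(x;\tau_0)}{P_\lambda(\mathbf 1;\tau_0)}-\dfrac{P_\mu(x;\tau_0)}{P_\mu(\mathbf 1;\tau_0)}\ge 0$. (A3) For some $\tau_0\in[0,\infty]$, one has for every $x\in(0,1)^n\cup(1,\infty)^n$: $\ \dfrac{P_\lambda(x;\tau_0)}{P_\lambda(\mathbf 1;\tau_0)}-\dfrac{P_\mu(x;\tau_0)}{P_\mu(\mathbf 1;\tau_0)}\ge 0$. (A4) $\lambda$ majorizes $\mu$. List B: (B1) For every $x\in[0,\infty)^n$, $\ \dfrac{P_\lambda(x+\mathbf 1;\tau)}{P_\lambda(\mathbf 1;\tau)}-\dfrac{P_\mu(x+\mathbf 1;\tau)}{P_\mu(\mathbf 1;\tau)}\in\mathbb F_{\ge0}^{\mathbb R}$. (B2) For every $\tau_0\in[0,\infty]$ and every $x\in[0,\infty)^n$, $\ \dfrac{P_\lambda(x+\mathbf 1;\tau_0)}{P_\lambda(\mathbf 1;\tau_0)}-\dfrac{P_\mu(x+\mathbf 1;\tau_0)}{P_\mu(\mathbf 1;\tau_0)}\ge 0$. (B3)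 For some $\tau_0\in[0,\infty]$, one has for every $x\in[0,\infty)^n$: $\ \dfrac{P_\lambda(x+\mathbf 1;\tau_0)}{P_\lambda(\mathbf 1;\tau_0)}-\dfrac{P_\mu(x+\mathbf 1;\tau_0)}{P_\mu(\mathbf 1;\tau_0)}\ge 0$. (B4) $\lambda$ weakly majorizes $\mu$. Then: (i) If $n=2$, then for all $\lambda,\mu\in\mathcal P_2$ the assertions (A1)--(A4) are equivalent, and the assertions (B1)--(B4) are equivalent. (ii) For any $n\ge1$ and any $\lambda\in\mathcal P_n$ with $|\lambda|\le n$, if $\mu=(1^{|\lambda|})$, then (A1)--(A4) are equivalent, and (B1)--(B4) are equivalent. (iii) For any $n\ge1$ and any $\lambda,\mu\in\mathcal P_n$ each having at most two nonzero parts, the assertions (A2)--(A4) are equivalent, and the assertions (B2)--(B4) are equivalent.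
   Context: $\mathcal P_n$ is the set of partitions $\lambda=(\lambda_1\ge\dots\ge\lambda_n\ge0)$ of length at most $n$ (integer entries, padded by zeros); $|\lambda|=\sum_i\lambda_i$; $(1^k)$ is the partition with $k$ parts equal to $1$. $\mathbf 1=(1,\dots,1)\in\mathbb R^n$. For $\lambda,\mu\in\mathcal P_n$: $\lambda$ weakly majorizes $\mu$ if $\sum_{i=1}^k\lambda_i\ge\sum_{i=1}^k\mu_i$ for $k=1,\dots,n$; $\lambda$ majorizes $\mu$ ($\lambda\succcurlyeq\mu$) if moreover $|\lambda|=|\mu|$. Jack polynomials: let $\tau$ be an indeterminate. On the ring of symmetric functions over $\mathbb Q(\tau)$ in infinitely many variables define $\langle p_\lambda,p_\mu\rangle=\delta_{\lambda\mu}z_\lambda\tau^{-\ell(\lambda)}$, where $p_\lambda$ are power sums, $\ell(\lambda)$ is the number of nonzero parts, $z_\lambda=\prod_{i}i^{m_i}m_i!$ with $m_i$ the number of parts equal to $i$. The Jack symmetric functions $P_\lambda$ are the unique pairwise orthogonal family of the form $P_\lambda=m_\lambda+\sum_{\mu\ne\lambda,\ \lambda\succcurlyeq\mu}K_{\lambda\mu}(\tau)m_\mu$ ($m_\mu$ the monomial symmetric functions), and $P_\lambda(x;\tau)$ is the restriction of $P_\lambda$ to $n$ variables $x=(x_1,\dots,x_n)$ (Macdonald's $P_\lambda^{(\alpha)}$ with $\alpha=1/\tau$). For $\tau_0\in[0,\infty]$, $P_\lambda(x;\tau_0)$ is the coefficientwise specialization $\tau=\tau_0$ (limit $\tau\to\infty$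 if $\tau_0=\infty$); thus $\tau_0=0,1,\infty$ give the monomial symmetric polynomial $m_\lambda$, the Schur polynomial $s_\lambda$, and the elementary symmetric polynomial $e_{\lambda'}$ ($\lambda'$ the conjugate partition) respectively. $\mathbb F_{\ge0}^{\mathbb R}=\{f/g : f,g\in\mathbb R_{\ge0}[\tau],\ g\ne0\}$; for a fixed real vector $x$, expressions such as $P_\lambda(x;\tau)/P_\lambda(\mathbf 1;\tau)$ are regarded as elements of $\mathbb R(\tau)$. *)

theory Defs
  imports
    "HOL-Analysis.Analysis"
    "HOL-Library.Poly_Mapping"
    "HOL-Computational_Algebra.Computational_Algebra"
    "HOL-Computational_Algebra.Field_as_Ring"
begin

abbreviation lookup :: "('a \<Rightarrow>\<^sub>0 'b::zero) \<Rightarrow> 'a \<Rightarrow> 'b" where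
  "lookup \<equiv> Poly_Mapping.lookup"

abbreviation keys :: "('a \<Rightarrow>\<^sub>0 'b::zero) \<Rightarrow> 'a set" where
  "keys \<equiv> Poly_Mapping.keys"


section \<open>Partitions\<close>

text \<open>
  A finitely supported function \<open>nat \<Rightarrow>\<^sub>0 nat\<close> plays two roles below: it is the exponent vector of a
  monomial in the variables \<open>x\<^sub>0, x\<^sub>1, \<dots>\<close>, and, when weakly decreasing, it is a partition.
  Indices start at 0, so the part usually written \<open>\<lambda>\<^sub>i\<close> is \<open>lookup l (i - 1)\<close>.
\<close>

type_synonym expvec = "nat \<Rightarrow>\<^sub>0 nat"

definition is_partition :: "expvec \<Rightarrow> bool" where
  "is_partition l \<longleftrightarrow> (\<forall>i j. i \<le> j \<longrightarrow> lookup l j \<le> lookup l i)"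

definition partitions_upto :: "nat \<Rightarrow> expvec set" where
  "partitions_upto n = {l. is_partition l \<and> keys l \<subseteq> {..<n}}"

definition part_size :: "expvec \<Rightarrow> nat" where
  "part_size l = (\<Sum>i\<in>keys l. lookup l i)"

definition plength :: "expvec \<Rightarrow> nat" where
  "plength l = card (keys l)"

definition part_mult :: "expvec \<Rightarrow> nat \<Rightarrow> nat" where
  "part_mult l r = card {i \<in> keys l. lookup l i = r}"

definition ones :: "nat \<Rightarrow> expvec" where
  "ones k = (\<Sum>i<k. Poly_Mapping.single i 1)"

text \<open>For partitions of length at most \<open>n\<close>, the inequalities with \<open>k > n\<close> repeat the one with \<open>k = n\<close>.\<close>

definition weakly_majorizes :: "expvec \<Rightarrow> expvec \<Rightarrow> bool" where
  "weakly_majorizes l m \<longleftrightarrow> (\<forall>k. (\<Sum>i<k. lookup l i) \<ge> (\<Sum>i<k. lookup m i))"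

definition majorizes :: "expvec \<Rightarrow> expvec \<Rightarrow> bool" where
  "majorizes l m \<longleftrightarrow> weakly_majorizes l m \<and> part_size l = part_size m"


section \<open>Symmetric functions over the field of rational functions in \<open>\<tau>\<close>\<close>

text \<open>
  A formal power series in infinitely many variables is given by its family of coefficients.
\<close>

type_synonym 'a mseries = "expvec \<Rightarrow> 'a"

type_synonym ratfun = "rat poly fract"

definition tau :: ratfun where
  "tau = Fract [:0, 1:] 1"

definition mseries_one :: "'a::comm_semiring_1 mseries" where
  "mseries_one e = (if e = 0 then 1 else 0)"

definition mseries_mult :: "'a::comm_semiring_1 mseries \<Rightarrow> 'a mseries \<Rightarrow> 'a mseries" where
  "mseries_mult f g e = (\<Sum>(a, b) \<in> {(a, b). a + b = e}. f a * g b)"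

definition monomial_sym :: "expvec \<Rightarrow> 'a::comm_semiring_1 mseries" where
  "monomial_sym l e = (if \<exists>\<pi>. bij \<pi> \<and> (\<forall>i. lookup e i = lookup l (\<pi> i)) then 1 else 0)"

definition power_sum :: "nat \<Rightarrow> 'a::comm_semiring_1 mseries" where
  "power_sum r e = (if \<exists>i. e = Poly_Mapping.single i r then 1 else 0)"

text \<open>The nonzero parts of a partition \<open>l\<close> sit at the indices \<open>0, \<dots>, plength l - 1\<close>.\<close>

definition power_sum_part :: "expvec \<Rightarrow> 'a::comm_semiring_1 mseries" where
  "power_sum_part l =
     foldr (\<lambda>i. mseries_mult (power_sum (lookup l i))) [0..<plength l] mseries_one"

definition zee :: "expvec \<Rightarrow> nat" where
  "zee l = (\<Prod>r \<in> lookup l ` keys l. r ^ part_mult l r * fact (part_mult l r))"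

text \<open>
  The \<open>p\<^sub>\<lambda>\<close> form a basis of the symmetric functions over \<open>\<rat>(\<tau>)\<close>; \<open>power_sum_coeffs f\<close> are
  the coordinates of \<open>f\<close> in this basis, and \<open>jack_inner\<close> is the bilinear form with
  \<open>\<langle>p\<^sub>\<lambda>, p\<^sub>\<mu>\<rangle> = \<delta> z\<^sub>\<lambda> \<tau>\<^bsup>-\<ell>(\<lambda>)\<^esup>\<close>.
\<close>

definition power_sum_coeffs :: "ratfun mseries \<Rightarrow> (expvec \<Rightarrow>\<^sub>0 ratfun)" where
  "power_sum_coeffs f = (THE c. (\<forall>l\<in>keys c. is_partition l) \<and>
     (\<forall>e. f e = (\<Sum>l\<in>keys c. lookup c l * power_sum_part l e)))"

definition jack_inner :: "ratfun mseries \<Rightarrow> ratfun mseries \<Rightarrow> ratfun" where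
  "jack_inner f g = (\<Sum>l\<in>keys (power_sum_coeffs f).
     lookup (power_sum_coeffs f) l * lookup (power_sum_coeffs g) l *
     (of_nat (zee l) / tau ^ plength l))"


section \<open>Jack symmetric functions\<close>

definition is_jack_family :: "(expvec \<Rightarrow> ratfun mseries) \<Rightarrow> bool" where
  "is_jack_family P \<longleftrightarrow>
     (\<forall>l. is_partition l \<longrightarrow>
        (\<exists>K. \<forall>e. P l e = monomial_sym l e +
           (\<Sum>m | is_partition m \<and> m \<noteq> l \<and> majorizes l m. K m * monomial_sym m e))) \<and>
     (\<forall>l m. is_partition l \<and> is_partition m \<and> l \<noteq> m \<longrightarrow> jack_inner (P l) (P m) = 0)"

text \<open>
  The definite description ranges over the value at \<open>l\<close> because \<open>is_jack_family P\<close> does not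
  constrain \<open>P\<close> outside of partitions.
\<close>

definition jack :: "expvec \<Rightarrow> ratfun mseries" where
  "jack l = (THE f. \<exists>P. is_jack_family P \<and> P l = f)"

text \<open>
  Restriction to the first \<open>n\<close> variables, evaluated at \<open>(x\<^sub>0, \<dots>, x\<^bsub>n-1\<^esub>)\<close>. The sum is finite
  for series of bounded degree.
\<close>

definition eval_vars :: "nat \<Rightarrow> 'a::comm_semiring_1 mseries \<Rightarrow> (nat \<Rightarrow> 'a) \<Rightarrow> 'a" where
  "eval_vars n f x =
     (\<Sum>e | keys e \<subseteq> {..<n} \<and> f e \<noteq> 0. f e * (\<Prod>i<n. x i ^ lookup e i))"

definition real_num :: "ratfun \<Rightarrow> real poly" where
  "real_num r = map_poly of_rat (fst (quot_of_fract r))"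

definition real_den :: "ratfun \<Rightarrow> real poly" where
  "real_den r = map_poly of_rat (snd (quot_of_fract r))"

text \<open>The embedding of \<open>\<rat>(\<tau>)\<close> into \<open>\<real>(\<tau>)\<close>.\<close>

definition ratfun_to_real :: "ratfun \<Rightarrow> real poly fract" where
  "ratfun_to_real r = Fract (real_num r) (real_den r)"

text \<open>
  Specialization of a rational function, written in lowest terms, at a point of \<open>[0, \<infinity>]\<close>.
\<close>

definition specialize :: "ennreal \<Rightarrow> ratfun \<Rightarrow> real" where
  "specialize t r =
     (if t = \<infinity> then Lim at_top (\<lambda>s. poly (real_num r) s / poly (real_den r) s)
      else poly (real_num r) (enn2real t) / poly (real_den r) (enn2real t))"

text \<open>\<open>P\<^sub>\<lambda>(x; \<tau>)\<close> in \<open>\<real>(\<tau>)\<close> for a fixed real vector \<open>x\<close>, and \<open>P\<^sub>\<lambda>(x; \<tau>\<^sub>0)\<close>.\<close>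

definition jack_gen :: "nat \<Rightarrow> expvec \<Rightarrow> (nat \<Rightarrow> real) \<Rightarrow> real poly fract" where
  "jack_gen n l x = eval_vars n (\<lambda>e. ratfun_to_real (jack l e)) (\<lambda>i. Fract [:x i:] 1)"

definition jack_at :: "nat \<Rightarrow> ennreal \<Rightarrow> expvec \<Rightarrow> (nat \<Rightarrow> real) \<Rightarrow> real" where
  "jack_at n t l x = eval_vars n (\<lambda>e. specialize t (jack l e)) x"


section \<open>The two lists of assertions\<close>

text \<open>
  A vector in \<open>\<real>\<^sup>n\<close> is a function \<open>x :: nat \<Rightarrow> real\<close> of which only the values at \<open>i < n\<close> are used, and
  \<open>\<tau>\<^sub>0 \<in> [0, \<infinity>]\<close> is a value of type \<open>ennreal\<close>.
\<close>

definition nonneg_ratfuns :: "real poly fract set" where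
  "nonneg_ratfuns = {Fract f g | f g. (\<forall>i. coeff f i \<ge> 0) \<and> (\<forall>i. coeff g i \<ge> 0) \<and> g \<noteq> 0}"

definition diff_gen :: "nat \<Rightarrow> expvec \<Rightarrow> expvec \<Rightarrow> (nat \<Rightarrow> real) \<Rightarrow> real poly fract" where
  "diff_gen n l m x = jack_gen n l x / jack_gen n l (\<lambda>_. 1) - jack_gen n m x / jack_gen n m (\<lambda>_. 1)"

definition diff_at :: "nat \<Rightarrow> ennreal \<Rightarrow> expvec \<Rightarrow> expvec \<Rightarrow> (nat \<Rightarrow> real) \<Rightarrow> real" where
  "diff_at n t l m x =
     jack_at n t l x / jack_at n t l (\<lambda>_. 1) - jack_at n t m x / jack_at n t m (\<lambda>_. 1)"

definition A1 :: "nat \<Rightarrow> expvec \<Rightarrow> expvec \<Rightarrow> bool" where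
  "A1 n l m \<longleftrightarrow> (\<forall>x. (\<forall>i<n. x i \<ge> 0) \<longrightarrow> diff_gen n l m x \<in> nonneg_ratfuns)"

definition A2 :: "nat \<Rightarrow> expvec \<Rightarrow> expvec \<Rightarrow> bool" where
  "A2 n l m \<longleftrightarrow> (\<forall>t. \<forall>x. (\<forall>i<n. x i \<ge> 0) \<longrightarrow> diff_at n t l m x \<ge> 0)"

definition A3 :: "nat \<Rightarrow> expvec \<Rightarrow> expvec \<Rightarrow> bool" where
  "A3 n l m \<longleftrightarrow> (\<exists>t. \<forall>x. (\<forall>i<n. 0 < x i \<and> x i < 1) \<or> (\<forall>i<n. 1 < x i) \<longrightarrow>
     diff_at n t l m x \<ge> 0)"

definition A4 :: "nat \<Rightarrow> expvec \<Rightarrow> expvec \<Rightarrow> bool" where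
  "A4 n l m \<longleftrightarrow> majorizes l m"

definition B1 :: "nat \<Rightarrow> expvec \<Rightarrow> expvec \<Rightarrow> bool" where
  "B1 n l m \<longleftrightarrow>
     (\<forall>x. (\<forall>i<n. x i \<ge> 0) \<longrightarrow> diff_gen n l m (\<lambda>i. x i + 1) \<in> nonneg_ratfuns)"

definition B2 :: "nat \<Rightarrow> expvec \<Rightarrow> expvec \<Rightarrow> bool" where
  "B2 n l m \<longleftrightarrow> (\<forall>t. \<forall>x. (\<forall>i<n. x i \<ge> 0) \<longrightarrow> diff_at n t l m (\<lambda>i. x i + 1) \<ge> 0)"

definition B3 :: "nat \<Rightarrow> expvec \<Rightarrow> expvec \<Rightarrow> bool" where
  "B3 n l m \<longleftrightarrow> (\<exists>t. \<forall>x. (\<forall>i<n. x i \<ge> 0) \<longrightarrow> diff_at n t l m (\<lambda>i. x i + 1) \<ge> 0)"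

definition B4 :: "nat \<Rightarrow> expvec \<Rightarrow> expvec \<Rightarrow> bool" where
  "B4 n l m \<longleftrightarrow> weakly_majorizes l m"

end

theory Submission
  imports Defs
begin

text \<open>
  In power sum coordinates the Nazarov--Sklyanin Lax matrix, whose entries are multiplications by
  power sums and derivations along them, is self-adjoint for the Jack inner product, and so are the
  operators \<open>T\<^sub>k\<close> built from its powers. In monomial coordinates the \<open>T\<^sub>k\<close> are triangular for
  dominance, with eigenvalues that are polynomials in \<open>\<tau>\<close> with constant term \<open>\<Sum> \<lambda>\<^sub>i\<^sup>k\<close>; these
  separate partitions. Hence \<open>m\<^sub>\<lambda>\<close> minus its projection to the span of the lower \<open>m\<^sub>\<mu>\<close> is
  an eigenvector of all \<open>T\<^sub>k\<close>, these vectors are orthogonal, and they are the Jack functions. The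
  eigenvalue equation of \<open>T\<^sub>2\<close> is a recursion with positive coefficients for the monomial
  coefficients, which therefore are quotients of polynomials with nonnegative coefficients and are
  finite and continuous in \<open>\<tau> \<in> [0, \<infinity>]\<close>.

  For two rows, \<open>f\<^sub>a\<^sub>b(x) = P\<^sub>a\<^sub>b(x) / P\<^sub>a\<^sub>b(\<one>)\<close> satisfies
  \<open>d/ds f\<^sub>a\<^sub>b(x + s\<one>) = A f\<^bsub>a-1,b\<^esub> + B f\<^bsub>a,b-1\<^esub>\<close> with explicit nonnegative \<open>A\<close> and \<open>B\<close>.
  Comparing coefficients of powers of \<open>s\<close> inductively reduces the effect of moving a box to vectors \<open>x\<close>
  with a zero coordinate, that is, to fewer variables, and shows that adding a box increases
  \<open>f\<close> on \<open>x + \<one>\<close>. For \<open>\<mu> = (1\<^sup>d)\<close>, the polynomial \<open>P\<^sub>\<lambda>\<close> is a nonnegative combination of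
  symmetrized monomials, each of which dominates the one of \<open>(1\<^sup>d)\<close> by Muirhead's argument.

  Conversely, at \<open>x = (s, \<dots>, s, 2, \<dots>, 2)\<close> with \<open>k\<close> entries \<open>s \<rightarrow> \<infinity>\<close> the order of growth is
  \<open>s\<close> to the sum of the first \<open>k\<close> parts, and \<open>x = (1/2, \<dots>, 1/2)\<close> compares the sizes.
\<close>

section \<open>Exponent vectors, shapes and dominance\<close>

text \<open>Dominance is only a partial order, so orthogonalizing along it leaves open whether
  incomparable partitions give orthogonal functions. A single operator cannot settle this:
  \<open>eigval 1\<close> takes the same value at (4,1,1) and (3,3). Hence the whole family. The
  index is shifted: \<open>tower k\<close> is T_(k+1).

  In two rows everything rests on one commutator. The translation x + s1 acts on power sums through
  the derivation p_k -> k p_(k-1) with p_0 = n. Its part with k >= 2 is, up to a factor and a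
  multiple of d/dp_1, the commutator of d/dp_1 with T_2, so it acts on each Pieri term by a
  difference of eigenvalues, in effect by the content of the removed box. Comparing the coefficients
  of p_1^d and p_2 p_1^(d-2) then eliminates the unknown Pieri coefficients, and normalization
  eliminates n; what is left is A and B.

  The sufficiency proofs stay inside the set of quotients of polynomials with nonnegative
  coefficients, which is closed under sums, products and quotients; the points 0 and infinity are
  reached as limits from positive \<open>tau\<close>.\<close>

definition shape :: "expvec \<Rightarrow> nat multiset" where
  "shape e = image_mset (lookup e) (mset_set (keys e))"

lemma part_size_superset:
  assumes "finite A" "keys e \<subseteq> A"
  shows "part_size e = (\<Sum>i\<in>A. lookup e i)"
  unfolding part_size_def
  by (rule sum.mono_neutral_left) (use assms in \<open>auto simp: in_keys_iff\<close>)

lemma part_size_add [simp]: "part_size (a + b) = part_size a + part_size b"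
proof -
  let ?A = "keys a \<union> keys b"
  have "part_size (a + b) = (\<Sum>i\<in>?A. lookup (a + b) i)"
    by (rule part_size_superset) (auto simp: in_keys_iff lookup_add)
  also have "\<dots> = (\<Sum>i\<in>?A. lookup a i) + (\<Sum>i\<in>?A. lookup b i)"
    by (simp add: lookup_add sum.distrib)
  also have "(\<Sum>i\<in>?A. lookup a i) = part_size a"
    by (rule part_size_superset [symmetric]) auto
  also have "(\<Sum>i\<in>?A. lookup b i) = part_size b"
    by (rule part_size_superset [symmetric]) auto
  finally show ?thesis .
qed

lemma part_size_single [simp]: "part_size (Poly_Mapping.single i k) = k"
proof -
  have "part_size (Poly_Mapping.single i k) = (\<Sum>j\<in>{i}. lookup (Poly_Mapping.single i k) j)"
    by (rule part_size_superset) auto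
  then show ?thesis by simp
qed

lemma part_size_zero [simp]: "part_size 0 = 0"
  by (simp add: part_size_def)

lemma part_size_eq_0_iff [simp]: "part_size e = 0 \<longleftrightarrow> e = 0"
proof
  assume "part_size e = 0"
  then have "\<forall>i\<in>keys e. lookup e i = 0"
    unfolding part_size_def by (subst (asm) sum_eq_0_iff) auto
  then show "e = 0"
    by (auto intro!: poly_mapping_eqI simp: in_keys_iff)
qed auto

lemma minus_single_add:
  fixes e :: expvec
  assumes "k \<le> lookup e i"
  shows "e - Poly_Mapping.single i k + Poly_Mapping.single i k = e"
  by (rule poly_mapping_eqI) (use assms in \<open>auto simp: lookup_add lookup_minus lookup_single when_def\<close>)

lemma part_size_minus_single:
  assumes "k \<le> lookup e i"
  shows "part_size (e - Poly_Mapping.single i k) = part_size e - k"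
proof -
  have "part_size (e - Poly_Mapping.single i k + Poly_Mapping.single i k) = part_size e"
    by (simp add: minus_single_add assms)
  then show ?thesis by simp
qed

lemma lookup_le_part_size: "lookup e i \<le> part_size e"
proof (cases "i \<in> keys e")
  case True
  then show ?thesis
    unfolding part_size_def by (intro member_le_sum) auto
qed (simp add: in_keys_iff)

lemma sum_mset_shape [simp]: "sum_mset (shape e) = part_size e"
  by (simp add: shape_def part_size_def sum_unfold_sum_mset)

lemma zero_notin_shape [simp]: "0 \<notin># shape e"
  by (auto simp: shape_def in_keys_iff)

lemma size_shape [simp]: "size (shape e) = plength e"
  by (simp add: shape_def plength_def)

lemma count_shape: "count (shape e) v = card {i \<in> keys e. lookup e i = v}"
proof -
  have "count (shape e) v = card (lookup e -` {v} \<inter> keys e)"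
    by (simp add: shape_def count_image_mset)
  also have "lookup e -` {v} \<inter> keys e = {i \<in> keys e. lookup e i = v}" by auto
  finally show ?thesis .
qed

lemma shape_eqI:
  assumes "bij \<pi>" "\<And>i. lookup e i = lookup l (\<pi> i)"
  shows "shape e = shape l"
proof -
  have inj: "inj \<pi>" using assms(1) by (rule bij_is_inj)
  have k: "keys l = \<pi> ` keys e"
  proof
    show "keys l \<subseteq> \<pi> ` keys e"
    proof
      fix x assume x: "x \<in> keys l"
      obtain i where "x = \<pi> i" using assms(1) by (metis bij_pointE)
      with x show "x \<in> \<pi> ` keys e" by (simp add: in_keys_iff assms(2))
    qed
    show "\<pi> ` keys e \<subseteq> keys l" by (auto simp: in_keys_iff assms(2))
  qed
  have "shape l = image_mset (lookup l) (image_mset \<pi> (mset_set (keys e)))"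
    unfolding shape_def k by (subst image_mset_mset_set) (auto intro: inj_on_subset[OF inj])
  also have "\<dots> = image_mset (lookup l \<circ> \<pi>) (mset_set (keys e))"
    by (simp only: multiset.map_comp)
  also have "\<dots> = shape e"
    unfolding shape_def by (rule image_mset_cong) (simp add: assms(2))
  finally show ?thesis by simp
qed

text \<open>The fibres over each value are equally large, so an element of \<open>A\<close> can be
  matched with any element of \<open>B\<close> of the same value and both removed.\<close>

lemma image_mset_eq_bij_betw:
  assumes "finite A" "finite B" "image_mset f (mset_set A) = image_mset g (mset_set B)"
  shows "\<exists>h. bij_betw h A B \<and> (\<forall>a\<in>A. f a = g (h a))"
  using assms
proof (induction A arbitrary: B rule: finite_induct)
  case empty
  then show ?case by (auto simp: mset_set_empty_iff bij_betw_def)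
next
  case (insert a A)
  have "f a \<in># image_mset g (mset_set B)"
    unfolding insert.prems(2) [symmetric] using insert.hyps by simp
  then obtain b where b: "b \<in> B" "g b = f a"
    using insert.prems(1) by auto
  have B: "mset_set B = add_mset b (mset_set (B - {b}))"
    using insert.prems(1) b by (simp add: mset_set.remove)
  have "image_mset f (mset_set A) = image_mset g (mset_set (B - {b}))"
    using insert.prems(2) insert.hyps b by (simp add: B)
  then obtain h where h: "bij_betw h A (B - {b})" "\<forall>a\<in>A. f a = g (h a)"
    using insert.IH [of "B - {b}"] insert.prems(1) by auto
  define h' where "h' = h(a := b)"
  have "bij_betw h' A (B - {b})"
    using h(1) insert.hyps(2) by (auto simp: h'_def intro!: bij_betw_cong[THEN iffD1, OF _ h(1)])
  then have "bij_betw h' (insert a A) (insert b (B - {b}))"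
    using insert.hyps(2) by (intro bij_betw_combine[of h' A _ "{a}" "{b}", simplified])
      (auto simp: h'_def bij_betw_def)
  then have "bij_betw h' (insert a A) B"
    using b(1) by (simp add: insert_absorb)
  moreover have "\<forall>x\<in>insert a A. f x = g (h' x)"
    using b h(2) insert.hyps by (simp add: h'_def)
  ultimately show ?case by blast
qed

text \<open>The supports are matched by values. Inside the finite union of the two supports the
  complements are equally large and can be matched too, and outside it the identity works; the
  pieces glue to a bijection of all indices, as \<open>monomial_sym\<close> demands.\<close>

lemma shape_eqD:
  assumes "shape e = shape l"
  shows "\<exists>\<pi>. bij \<pi> \<and> (\<forall>i. lookup e i = lookup l (\<pi> i))"
proof -
  obtain h where h: "bij_betw h (keys e) (keys l)" "\<forall>i\<in>keys e. lookup e i = lookup l (h i)"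
    using image_mset_eq_bij_betw [OF _ _ assms [unfolded shape_def]] by auto
  let ?U = "keys e \<union> keys l"
  have "card (?U - keys e) = card (?U - keys l)"
    using bij_betw_same_card[OF h(1)] by (simp add: card_Diff_subset)
  then obtain h2 where h2: "bij_betw h2 (?U - keys e) (?U - keys l)"
    by (metis finite_Diff finite_UnI finite_keys finite_same_card_bij)
  define \<pi> where "\<pi> = (\<lambda>i. if i \<in> keys e then h i else if i \<in> ?U then h2 i else i)"
  have 1: "bij_betw \<pi> (keys e) (keys l)"
    using h(1) by (rule bij_betw_cong[THEN iffD1, rotated]) (auto simp: \<pi>_def)
  have 2: "bij_betw \<pi> (?U - keys e) (?U - keys l)"
    using h2 by (rule bij_betw_cong[THEN iffD1, rotated]) (auto simp: \<pi>_def)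
  have 3: "bij_betw \<pi> (- ?U) (- ?U)"
    using bij_betw_id by (rule bij_betw_cong[THEN iffD1, rotated]) (auto simp: \<pi>_def)
  have 4: "bij_betw \<pi> (keys e \<union> (?U - keys e)) (keys l \<union> (?U - keys l))"
    by (rule bij_betw_combine[OF 1 2]) auto
  have "bij_betw \<pi> ((keys e \<union> (?U - keys e)) \<union> (- ?U)) ((keys l \<union> (?U - keys l)) \<union> (- ?U))"
    by (rule bij_betw_combine[OF 4 3]) auto
  moreover have "(keys e \<union> (?U - keys e)) \<union> (- ?U) = UNIV" "(keys l \<union> (?U - keys l)) \<union> (- ?U) = UNIV"
    by auto
  ultimately have "bij \<pi>" by simp
  moreover have "lookup e i = lookup l (\<pi> i)" for i
  proof -
    consider "i \<in> keys e" | "i \<in> ?U - keys e" | "i \<notin> ?U" by blast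
    then show ?thesis
    proof cases
      case 2
      then have "h2 i \<notin> keys l" using h2 by (auto simp: bij_betw_def)
      with 2 show ?thesis by (auto simp: \<pi>_def in_keys_iff)
    next
      case 1
      then show ?thesis using h(2) by (simp add: \<pi>_def)
    next
      case 3
      then have "\<pi> i = i" by (simp add: \<pi>_def)
      with 3 show ?thesis by (simp add: in_keys_iff)
    qed
  qed
  ultimately show ?thesis by blast
qed

lemma monomial_sym_shape: "monomial_sym l e = (if shape e = shape l then 1 else 0)"
  unfolding monomial_sym_def using shape_eqD shape_eqI by (auto 0 3)

definition eswap :: "nat \<Rightarrow> nat \<Rightarrow> expvec \<Rightarrow> expvec" where
  "eswap i j e = Poly_Mapping.update i (lookup e j) (Poly_Mapping.update j (lookup e i) e)"

lemma lookup_eswap: "lookup (eswap i j e) k = (if k = i then lookup e j else if k = j then lookup e i else lookup e k)"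
  by (auto simp: eswap_def lookup_update)

lemma shape_eswap [simp]: "shape (eswap i j e) = shape e"
  by (rule shape_eqI[of "Transposition.transpose i j"]) (auto simp: lookup_eswap Transposition.transpose_def)

lemma part_size_shape: "shape e = shape e' \<Longrightarrow> part_size e = part_size e'"
  by (metis sum_mset_shape)

lemma part_size_eswap [simp]: "part_size (eswap i j e) = part_size e"
  using part_size_shape shape_eswap by blast

section \<open>Partitions as sorted representatives of multisets of parts\<close>

definition part_of :: "nat multiset \<Rightarrow> expvec" where
  "part_of N = Poly_Mapping.nth (rev (sorted_list_of_multiset N))"

lemma shape_nth:
  assumes "0 \<notin> set xs"
  shows "shape (Poly_Mapping.nth xs) = mset xs"
proof -
  have nz: "xs ! i \<noteq> 0" if "i < length xs" for i
    using assms that by (metis nth_mem)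
  have k: "keys (Poly_Mapping.nth xs) = {..<length xs}"
    using nz by (auto simp del: keys_nth simp add: in_keys_iff nth_default_def split: if_splits)
  have "shape (Poly_Mapping.nth xs) = image_mset (nth_default 0 xs) (mset_set {..<length xs})"
    unfolding shape_def k by (intro image_mset_cong) simp
  also have "\<dots> = image_mset (\<lambda>i. xs ! i) (mset_set {..<length xs})"
    by (intro image_mset_cong) (auto simp: nth_default_def)
  also have "mset_set {..<length xs} = mset [0..<length xs]"
    by (simp add: atLeast0LessThan)
  also have "image_mset (\<lambda>i. xs ! i) (mset [0..<length xs]) = mset (map (\<lambda>i. xs ! i) [0..<length xs])"
    by simp
  also have "map (\<lambda>i. xs ! i) [0..<length xs] = xs" by (rule map_nth)
  finally show ?thesis .
qed

lemma shape_part_of [simp]: "0 \<notin># N \<Longrightarrow> shape (part_of N) = N"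
  unfolding part_of_def by (subst shape_nth) auto

lemma is_partition_part_of [simp]: "is_partition (part_of N)"
proof -
  let ?xs = "rev (sorted_list_of_multiset N)"
  have s: "sorted_wrt (\<ge>) ?xs"
    by (simp add: sorted_wrt_rev)
  show ?thesis
    unfolding is_partition_def part_of_def
  proof (intro allI impI)
    fix i j :: nat assume "i \<le> j"
    then show "lookup (Poly_Mapping.nth ?xs) j \<le> lookup (Poly_Mapping.nth ?xs) i"
      using sorted_wrt_nth_less[OF s, of i j]
      by (cases "i = j"; cases "j < length ?xs") (simp_all add: nth_default_def)
  qed
qed

text \<open>The indices with entry at least \<open>v\<close> form an initial segment, whose length
  is a part of the conjugate partition. So a partition is determined by its multiset of
  parts.\<close>

lemma partition_lookup_iff:
  assumes "is_partition l" "0 < v"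
  shows "v \<le> lookup l i \<longleftrightarrow> i < size {#x \<in># shape l. v \<le> x#}"
proof -
  define A where "A = {i. v \<le> lookup l i}"
  have A: "A = {i \<in> keys l. v \<le> lookup l i}"
    using assms(2) by (auto simp: A_def in_keys_iff)
  have fin: "finite A" by (simp add: A)
  have card: "size {#x \<in># shape l. v \<le> x#} = card A"
    by (simp add: shape_def filter_mset_image_mset A filter_mset_mset_set)
  have "A \<subseteq> {..<card A}"
  proof
    fix j assume "j \<in> A"
    then have "{..j} \<subseteq> A"
      using assms(1) unfolding A_def is_partition_def by (auto intro: order_trans)
    then have "card {..j} \<le> card A" using fin card_mono by blast
    then show "j \<in> {..<card A}" by simp
  qed
  then have "A = {..<card A}" by (intro card_subset_eq) auto
  then have "i \<in> A \<longleftrightarrow> i < card A" by blast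
  then show ?thesis unfolding card by (simp add: A_def)
qed

lemma partition_eqI:
  assumes "is_partition l" "is_partition l'" "shape l = shape l'"
  shows "l = l'"
proof (rule poly_mapping_eqI)
  fix i
  have "v \<le> lookup l i \<longleftrightarrow> v \<le> lookup l' i" if "0 < v" for v
    using partition_lookup_iff[OF assms(1) that] partition_lookup_iff[OF assms(2) that] assms(3) by simp
  from this[of "lookup l i"] this[of "lookup l' i"] show "lookup l i = lookup l' i"
    by linarith
qed

lemma part_of_shape [simp]: "is_partition l \<Longrightarrow> part_of (shape l) = l"
  by (rule partition_eqI) auto

definition MP :: "nat \<Rightarrow> nat multiset set" where
  "MP d = {N. 0 \<notin># N \<and> sum_mset N = d}"

lemma size_le_sum_mset: "0 \<notin># N \<Longrightarrow> size N \<le> sum_mset (N :: nat multiset)"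
  by (induction N) auto

lemma finite_MP [simp]: "finite (MP d)"
proof -
  have "MP d \<subseteq> mset ` {xs. set xs \<subseteq> {..d} \<and> length xs \<le> d}"
  proof
    fix N assume "N \<in> MP d"
    then have "0 \<notin># N" "sum_mset N = d" by (auto simp: MP_def)
    moreover have "x \<in># N \<Longrightarrow> x \<le> sum_mset N" for x
      by (metis insert_DiffM le_add1 sum_mset.add_mset)
    moreover obtain xs where "N = mset xs" by (metis ex_mset)
    ultimately show "N \<in> mset ` {xs. set xs \<subseteq> {..d} \<and> length xs \<le> d}"
      using size_le_sum_mset[of N] by (auto intro!: image_eqI[of _ _ xs])
  qed
  then show ?thesis
    by (rule finite_subset) (intro finite_imageI finite_lists_length_le, auto)
qed

lemma shape_in_MP [simp]: "shape e \<in> MP d \<longleftrightarrow> part_size e = d"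
  by (auto simp: MP_def)

lemma finite_partitions_size [simp]: "finite {m. is_partition m \<and> part_size m = d}"
proof (rule finite_imageD)
  show "finite (shape ` {m. is_partition m \<and> part_size m = d})"
    by (rule finite_subset[OF _ finite_MP[of d]]) auto
  show "inj_on shape {m. is_partition m \<and> part_size m = d}"
    by (auto intro!: inj_onI intro: partition_eqI)
qed

text \<open>Sums over arbitrary finite index sets replace the partial sums, so \<open>e\<close> need
  not be sorted and only its shape matters. The operators below pass through unsorted exponent
  vectors.\<close>

definition dominates :: "expvec \<Rightarrow> expvec \<Rightarrow> bool" where
  "dominates l e \<longleftrightarrow> part_size e = part_size l \<and>
     (\<forall>S. finite S \<longrightarrow> (\<Sum>i\<in>S. lookup e i) \<le> (\<Sum>i<card S. lookup l i))"

lemma dominates_shape: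
  assumes "shape e = shape e'"
  shows "dominates l e \<longleftrightarrow> dominates l e'"
proof -
  have *: "dominates l e" if d: "dominates l e'" and s: "shape e = shape e'" for e e'
  proof -
    obtain \<pi> where p: "bij \<pi>" "\<forall>i. lookup e i = lookup e' (\<pi> i)"
      using shape_eqD[OF s] by blast
    have inj: "inj_on \<pi> S" for S using p(1) by (meson bij_is_inj inj_on_subset subset_UNIV)
    show ?thesis
      unfolding dominates_def
    proof (intro conjI allI impI)
      show "part_size e = part_size l" using d part_size_shape[OF s] by (simp add: dominates_def)
      fix S :: "nat set" assume "finite S"
      have "(\<Sum>i\<in>S. lookup e i) = (\<Sum>i\<in>\<pi> ` S. lookup e' i)"
        using p(2) by (simp add: sum.reindex[OF inj])
      also have "\<dots> \<le> (\<Sum>i<card (\<pi> ` S). lookup l i)"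
        using d \<open>finite S\<close> by (simp add: dominates_def)
      also have "card (\<pi> ` S) = card S" by (rule card_image[OF inj])
      finally show "(\<Sum>i\<in>S. lookup e i) \<le> (\<Sum>i<card S. lookup l i)" .
    qed
  qed
  show ?thesis using *[of e' e] *[of e e'] assms by auto
qed

lemma partition_sum_le:
  assumes "is_partition e" "finite S"
  shows "(\<Sum>i\<in>S. lookup e i) \<le> (\<Sum>i<card S. lookup e i)"
  using assms(2)
proof (induction "card S" arbitrary: S)
  case (Suc k)
  define s where "s = Max S"
  have S: "S \<noteq> {}" using Suc.hyps(2) by auto
  have sS: "s \<in> S" using S Suc.prems by (simp add: s_def)
  \<comment> \<open>The largest of \<open>k + 1\<close> distinct indices is at least
    \<open>k\<close>, so its entry is at most the one at position \<open>k\<close>.\<close>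
  have "S \<subseteq> {..s}" using Suc.prems by (auto simp: s_def)
  then have "card S \<le> card {..s}" by (rule card_mono[rotated]) auto
  then have ks: "k \<le> s" using Suc.hyps(2) by simp
  have "(\<Sum>i\<in>S. lookup e i) = lookup e s + (\<Sum>i\<in>S-{s}. lookup e i)"
    using Suc.prems sS by (rule sum.remove)
  also have "\<dots> \<le> lookup e k + (\<Sum>i<k. lookup e i)"
  proof (rule add_mono)
    show "lookup e s \<le> lookup e k" using assms(1) ks by (simp add: is_partition_def)
    have "k = card (S - {s})" using Suc.hyps(2) Suc.prems sS by simp
    then show "(\<Sum>i\<in>S-{s}. lookup e i) \<le> (\<Sum>i<k. lookup e i)"
      using Suc.hyps(1)[of "S - {s}"] Suc.prems by simp
  qed
  also have "\<dots> = (\<Sum>i<card S. lookup e i)" using Suc.hyps(2)[symmetric] by simp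
  finally show ?case .
qed auto

lemma dominates_iff_majorizes:
  assumes "is_partition e"
  shows "dominates l e \<longleftrightarrow> majorizes l e"
proof
  assume d: "dominates l e"
  show "majorizes l e"
    unfolding majorizes_def weakly_majorizes_def
  proof (intro conjI allI)
    fix k show "(\<Sum>i<k. lookup e i) \<le> (\<Sum>i<k. lookup l i)"
      using d unfolding dominates_def by (metis finite_lessThan card_lessThan)
  qed (use d in \<open>simp add: dominates_def\<close>)
next
  assume m: "majorizes l e"
  show "dominates l e"
    unfolding dominates_def
  proof (intro conjI allI impI)
    fix S :: "nat set" assume "finite S"
    then have "(\<Sum>i\<in>S. lookup e i) \<le> (\<Sum>i<card S. lookup e i)" by (rule partition_sum_le[OF assms])
    also have "\<dots> \<le> (\<Sum>i<card S. lookup l i)" using m by (simp add: majorizes_def weakly_majorizes_def)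
    finally show "(\<Sum>i\<in>S. lookup e i) \<le> (\<Sum>i<card S. lookup l i)" .
  qed (use m in \<open>simp add: majorizes_def\<close>)
qed

lemma dominates_refl: "is_partition l \<Longrightarrow> dominates l l"
  by (simp add: dominates_iff_majorizes majorizes_def weakly_majorizes_def)

lemma dominates_trans: "dominates l m \<Longrightarrow> dominates m e \<Longrightarrow> dominates l e"
  unfolding dominates_def by (metis finite_lessThan card_lessThan le_trans)

lemma dominates_antisym:
  assumes "is_partition l" "is_partition m" "dominates l m" "dominates m l"
  shows "l = m"
proof (rule poly_mapping_eqI)
  fix i
  have eq: "(\<Sum>i<k. lookup l i) = (\<Sum>i<k. lookup m i)" for k
    using assms(3,4) unfolding dominates_iff_majorizes[OF assms(1)] dominates_iff_majorizes[OF assms(2)]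
      majorizes_def weakly_majorizes_def by (meson le_antisym)
  show "lookup l i = lookup m i" using eq[of i] eq[of "Suc i"] by simp
qed

lemma dominates_part_size: "dominates l e \<Longrightarrow> part_size e = part_size l"
  by (simp add: dominates_def)

definition upd2 :: "nat \<Rightarrow> nat \<Rightarrow> expvec \<Rightarrow> nat \<Rightarrow> nat \<Rightarrow> expvec" where
  "upd2 i j e a b = Poly_Mapping.update i a (Poly_Mapping.update j b e)"

lemma lookup_upd2: "lookup (upd2 i j e a b) k = (if k = i then a else if k = j then b else lookup e k)"
  by (auto simp: upd2_def lookup_update)

lemma part_size_upd2:
  assumes "i \<noteq> j" "a + b = lookup e i + lookup e j"
  shows "part_size (upd2 i j e a b) = part_size e"
proof -
  let ?A = "insert i (insert j (keys e))" and ?B = "keys e - {i, j}"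
  have "part_size f = (\<Sum>k\<in>?A. lookup f k)" if "\<And>k. k \<noteq> i \<Longrightarrow> k \<noteq> j \<Longrightarrow> lookup f k = lookup e k" for f
  proof (rule part_size_superset)
    show "keys f \<subseteq> ?A"
    proof
      fix x assume "x \<in> keys f"
      then show "x \<in> ?A" using that[of x] by (cases "x = i"; cases "x = j") (auto simp: in_keys_iff)
    qed
  qed simp
  moreover have "?A = insert i (insert j ?B)" by auto
  ultimately have *: "part_size f = lookup f i + lookup f j + (\<Sum>k\<in>?B. lookup f k)"
    if "\<And>k. k \<noteq> i \<Longrightarrow> k \<noteq> j \<Longrightarrow> lookup f k = lookup e k" for f
    using that assms(1) by simp
  show ?thesis
    using *[of e] *[of "upd2 i j e a b"] assms by (simp add: lookup_upd2)
qed

text \<open>If two entries move closer together at fixed sum, no bound is violated: an index set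
  containing both positions keeps its sum, and one containing a single position is compared with the
  set that has the position of the larger old-style entry \<open>a\<close> or \<open>b\<close>
  instead. This is what makes the operators below triangular.\<close>

lemma dominates_squeeze:
  assumes "dominates l (upd2 i j e a b)" "i \<noteq> j" "a + b = lookup e i + lookup e j"
    "max (lookup e i) (lookup e j) \<le> max a b"
  shows "dominates l e"
  unfolding dominates_def
proof (intro conjI allI impI)
  let ?e = "upd2 i j e a b"
  show "part_size e = part_size l"
    using assms(1) part_size_upd2[OF assms(2,3)] by (simp add: dominates_def)
  fix S :: "nat set" assume S: "finite S"
  have d: "(\<Sum>k\<in>T. lookup ?e k) \<le> (\<Sum>k<card T. lookup l k)" if "finite T" for T
    using assms(1) that by (simp add: dominates_def)
  have off: "(\<Sum>k\<in>T. lookup ?e k) = (\<Sum>k\<in>T. lookup e k)" if "i \<notin> T" "j \<notin> T" for T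
    by (rule sum.cong) (use that in \<open>auto simp: lookup_upd2\<close>)
  let ?T = "S - {i, j}"
  have T: "(\<Sum>k\<in>insert p ?T. lookup f k) = lookup f p + (\<Sum>k\<in>?T. lookup f k)" "card (insert p ?T) = Suc (card ?T)"
    if "p \<in> {i,j}" for p and f :: expvec using S that by auto
  have one: "lookup e p + (\<Sum>k\<in>?T. lookup e k) \<le> (\<Sum>k<Suc (card ?T). lookup l k)" if "p \<in> {i, j}" for p
  proof -
    have "lookup e p \<le> max a b" using assms(4) that by auto
    moreover have "a + (\<Sum>k\<in>?T. lookup e k) \<le> (\<Sum>k<Suc (card ?T). lookup l k)"
      using d[of "insert i ?T"] S off[of ?T] unfolding T(1)[of i, simplified] T(2)[of i, simplified] by (simp add: lookup_upd2)
    moreover have "b + (\<Sum>k\<in>?T. lookup e k) \<le> (\<Sum>k<Suc (card ?T). lookup l k)"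
      using d[of "insert j ?T"] S off[of ?T] assms(2) unfolding T(1)[of j, simplified] T(2)[of j, simplified] by (simp add: lookup_upd2)
    ultimately show ?thesis by linarith
  qed
  consider "i \<in> S" "j \<in> S" | "i \<notin> S" "j \<notin> S" | p where "p \<in> {i, j}" "S = insert p ?T" by blast
  then show "(\<Sum>k\<in>S. lookup e k) \<le> (\<Sum>k<card S. lookup l k)"
  proof cases
    case 1
    have S2: "(\<Sum>k\<in>S. lookup f k) = lookup f i + (lookup f j + (\<Sum>k\<in>?T. lookup f k))" for f :: expvec
    proof -
      have "(\<Sum>k\<in>S. lookup f k) = lookup f i + (\<Sum>k\<in>S - {i}. lookup f k)"
        using S 1(1) by (rule sum.remove)
      also have "(\<Sum>k\<in>S - {i}. lookup f k) = lookup f j + (\<Sum>k\<in>S - {i} - {j}. lookup f k)"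
        by (rule sum.remove) (use S 1 assms(2) in auto)
      also have "S - {i} - {j} = ?T" by auto
      finally show ?thesis .
    qed
    have "(\<Sum>k\<in>S. lookup e k) = (\<Sum>k\<in>S. lookup ?e k)"
      using off[of ?T] assms(2,3) unfolding S2[of e] S2[of ?e] by (simp add: lookup_upd2)
    then show ?thesis using d[OF S] by simp
  next
    case 2
    then show ?thesis using off d[OF S] by simp
  next
    case 3
    have "(\<Sum>k\<in>S. lookup e k) = lookup e p + (\<Sum>k\<in>?T. lookup e k)" "card S = Suc (card ?T)"
      using T[OF 3(1)] 3(2) by metis+
    then show ?thesis using one[OF 3(1)] by simp
  qed
qed

section \<open>Power sums in monomial and in power sum coordinates\<close>

text \<open>The junk value \<open>0\<close> for \<open>k = 0\<close> keeps all these multiplication operators commuting.\<close>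

definition mul_psum :: "nat \<Rightarrow> 'a::comm_semiring_1 mseries \<Rightarrow> 'a mseries" where
  "mul_psum k f e = (if k = 0 then 0
     else \<Sum>i\<in>keys e. if k \<le> lookup e i then f (e - Poly_Mapping.single i k) else 0)"

lemma mul_psum_0 [simp]: "mul_psum 0 f = (\<lambda>_. 0)"
  by (simp add: mul_psum_def fun_eq_iff)

lemma mul_psum_zero [simp]: "mul_psum k (\<lambda>_. 0) = (\<lambda>_. 0)"
  by (simp add: mul_psum_def fun_eq_iff)

lemma mul_psum_superset:
  assumes "0 < k" "finite A" "keys e \<subseteq> A"
  shows "mul_psum k f e = (\<Sum>i\<in>A. if k \<le> lookup e i then f (e - Poly_Mapping.single i k) else 0)"
proof -
  have "(\<Sum>i\<in>keys e. if k \<le> lookup e i then f (e - Poly_Mapping.single i k) else 0)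
      = (\<Sum>i\<in>A. if k \<le> lookup e i then f (e - Poly_Mapping.single i k) else 0)"
    using assms by (intro sum.mono_neutral_left) (auto simp: in_keys_iff)
  then show ?thesis using assms(1) by (simp add: mul_psum_def)
qed

lemma keys_minus_subset: "keys (e - f) \<subseteq> keys (e :: expvec)"
  by (auto simp: in_keys_iff lookup_minus)

lemma mul_psum_commute: "mul_psum k (mul_psum l f) = mul_psum l (mul_psum k f)"
proof
  fix e :: expvec
  show "mul_psum k (mul_psum l f) e = mul_psum l (mul_psum k f) e"
  proof (cases "k = 0 \<or> l = 0")
    case True
    then show ?thesis by auto
  next
    case False
    have *: "mul_psum k (mul_psum l f) e = (\<Sum>i\<in>keys e. \<Sum>j\<in>keys e.
        if k \<le> lookup e i \<and> l \<le> lookup (e - Poly_Mapping.single i k) j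
        then f (e - (Poly_Mapping.single i k + Poly_Mapping.single j l)) else 0)"
      if "0 < k" "0 < l" for k l
    proof -
      have "mul_psum k (mul_psum l f) e = (\<Sum>i\<in>keys e. if k \<le> lookup e i then
          (\<Sum>j\<in>keys e. if l \<le> lookup (e - Poly_Mapping.single i k) j
             then f (e - Poly_Mapping.single i k - Poly_Mapping.single j l) else 0) else 0)"
        unfolding mul_psum_def[of k] using that
        by (auto intro!: sum.cong mul_psum_superset dest: keys_minus_subset[THEN subsetD])
      then show ?thesis
        by (auto simp: diff_diff_add intro!: sum.cong)
    qed
    have cond: "k \<le> lookup e i \<and> l \<le> lookup (e - Poly_Mapping.single i k) j \<longleftrightarrow>
        l \<le> lookup e j \<and> k \<le> lookup (e - Poly_Mapping.single j l) i" for i j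
      by (auto simp: lookup_minus lookup_single when_def)
    have kl: "0 < k" "0 < l" using False by auto
    show ?thesis
      unfolding *[OF kl] *[OF kl(2,1)]
      by (subst sum.swap, intro sum.cong refl, rule if_cong[OF cond]) (simp_all only: add.commute)
  qed
qed

lemma mseries_mult_power_sum:
  assumes "0 < k"
  shows "mseries_mult (power_sum k) f = mul_psum k f"
proof
  fix e :: expvec
  let ?I = "{i \<in> keys e. k \<le> lookup e i}"
  \<comment> \<open>A sum over an infinite index set would be 0, so the decompositions of
    \<open>e\<close> have to be finite in number.\<close>
  have "finite {(a, b). a + b = e}"
  proof (rule finite_subset)
    have inj: "inj_on lookup A" for A :: "expvec set" by (rule inj_onI) (simp add: lookup_inject)
    have "lookup ` {a. \<exists>b. a + b = e} \<subseteq> {g. \<forall>i. (i \<in> keys e \<longrightarrow> g i \<in> {..part_size e}) \<and> (i \<notin> keys e \<longrightarrow> g i = 0)}"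
    proof clarify
      fix i and a b :: expvec
      assume "e = a + b"
      then show "(i \<in> keys (a + b) \<longrightarrow> lookup a i \<in> {..part_size (a + b)}) \<and> (i \<notin> keys (a + b) \<longrightarrow> lookup a i = 0)"
        using lookup_le_part_size[of "a + b" i] by (auto simp: in_keys_iff lookup_add)
    qed
    then have "finite (lookup ` {a. \<exists>b. a + b = e})"
      by (rule finite_subset) (rule finite_set_of_finite_funs, auto)
    then have fin: "finite {a. \<exists>b. a + b = e}" by (rule finite_imageD) (rule inj)
    show "{(a, b). a + b = e} \<subseteq> {a. \<exists>b. a + b = e} \<times> {a. \<exists>b. a + b = e}"
      by clarsimp (metis add.commute)
    show "finite ({a. \<exists>b. a + b = e} \<times> {a. \<exists>b. a + b = e})" using fin by simp
  qed
  moreover have "inj_on (\<lambda>i. (Poly_Mapping.single i k, e - Poly_Mapping.single i k)) ?I"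
    using assms by (intro inj_onI) (metis Pair_inject lookup_single_eq lookup_single_not_eq neq0_conv)
  moreover have "power_sum k (Poly_Mapping.single i k) = (1 :: 'a)" for i
    by (auto simp: power_sum_def)
  ultimately have "mul_psum k f e = (\<Sum>(a, b) \<in> (\<lambda>i. (Poly_Mapping.single i k, e - Poly_Mapping.single i k)) ` ?I. power_sum k a * f b)"
    using assms by (simp add: sum.reindex mul_psum_def sum.inter_filter[symmetric])
  also have "\<dots> = (\<Sum>(a, b) \<in> {(a, b). a + b = e}. power_sum k a * f b)"
  proof (rule sum.mono_neutral_left)
    show "finite {(a, b). a + b = e}" by fact
    show "(\<lambda>i. (Poly_Mapping.single i k, e - Poly_Mapping.single i k)) ` ?I \<subseteq> {(a, b). a + b = e}"
      using minus_single_add[of k e] by (auto simp: add.commute)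
    show "\<forall>p\<in>{(a, b). a + b = e} - (\<lambda>i. (Poly_Mapping.single i k, e - Poly_Mapping.single i k)) ` ?I.
        (case p of (a, b) \<Rightarrow> power_sum k a * f b) = 0"
    proof clarify
      fix a b assume e: "e = a + b" and n: "(a, b) \<notin> (\<lambda>i. (Poly_Mapping.single i k, a + b - Poly_Mapping.single i k)) ` {i \<in> keys (a + b). k \<le> lookup (a + b) i}"
      have "\<not> (\<exists>i. a = Poly_Mapping.single i k)"
      proof
        assume "\<exists>i. a = Poly_Mapping.single i k"
        then obtain i where i: "a = Poly_Mapping.single i k" ..
        then have "k \<le> lookup (a + b) i" by (simp add: lookup_add)
        moreover have "i \<in> keys (a + b)" using calculation assms by (simp add: in_keys_iff)
        moreover have "b = a + b - Poly_Mapping.single i k" using i by simp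
        ultimately show False using n i by blast
      qed
      then show "power_sum k a * f b = 0" by (simp add: power_sum_def)
    qed
  qed
  finally show "mseries_mult (power_sum k) f e = mul_psum k f e"
    by (simp add: mseries_mult_def)
qed

lemma mul_psum_sum:
  "mul_psum k (\<lambda>e. \<Sum>x\<in>A. c x * f x e) e = (\<Sum>x\<in>A. c x * mul_psum k (f x) e)"
proof (cases "k = 0")
  case False
  have "mul_psum k (\<lambda>e. \<Sum>x\<in>A. c x * f x e) e =
     (\<Sum>i\<in>keys e. \<Sum>x\<in>A. c x * (if k \<le> lookup e i then f x (e - Poly_Mapping.single i k) else 0))"
    using False by (auto simp: mul_psum_def intro!: sum.cong)
  then show ?thesis using False
    by (subst (asm) sum.swap) (simp add: mul_psum_def sum_distrib_left)
qed auto

lemma of_nat_mul_psum: "of_nat (mul_psum k f e) = mul_psum k (\<lambda>e. of_nat (f e)) e"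
  by (auto simp: mul_psum_def intro!: sum.cong)

text \<open>\<open>pmono N e\<close> counts the ways to place the parts of \<open>N\<close> on
  variables so that they add up to \<open>e\<close>. The coefficients are natural numbers and thus
  shared by all coefficient rings; the fold is independent of the order because the multiplications
  commute.\<close>

definition pmono :: "nat multiset \<Rightarrow> nat mseries" where
  "pmono N = fold_mset mul_psum mseries_one N"

lemma pmono_empty [simp]: "pmono {#} = mseries_one"
  by (simp add: pmono_def)

lemma pmono_add_mset [simp]: "pmono (add_mset k N) = mul_psum k (pmono N)"
proof -
  interpret comp_fun_commute "mul_psum :: nat \<Rightarrow> nat mseries \<Rightarrow> nat mseries"
    by standard (auto simp: fun_eq_iff mul_psum_commute)
  show ?thesis by (simp add: pmono_def)
qed

lemma partition_keys: "is_partition l \<Longrightarrow> keys l = {..<plength l}"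
proof -
  assume l: "is_partition l"
  have "keys l \<subseteq> {..<card (keys l)}"
  proof
    fix j assume "j \<in> keys l"
    then have "{..j} \<subseteq> keys l"
      using l unfolding is_partition_def by (metis atMost_iff in_keys_iff le_zero_eq subsetI)
    then have "card {..j} \<le> card (keys l)" by (intro card_mono) auto
    then show "j \<in> {..<card (keys l)}" by simp
  qed
  then show ?thesis unfolding plength_def by (intro card_subset_eq) auto
qed

lemma power_sum_part_pmono:
  assumes "is_partition l"
  shows "power_sum_part l e = (of_nat (pmono (shape l) e) :: 'a::comm_semiring_1)"
proof -
  have *: "foldr (\<lambda>i. mseries_mult (power_sum (lookup l i))) xs mseries_one =
      (\<lambda>e. of_nat (pmono (mset (map (lookup l) xs)) e) :: 'a)" if "set xs \<subseteq> keys l" for xs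
    using that
  proof (induction xs)
    case Nil
    then show ?case by (auto simp: mseries_one_def)
  next
    case (Cons i xs)
    then show ?case by (simp add: mseries_mult_power_sum in_keys_iff of_nat_mul_psum)
  qed
  have "mset (map (lookup l) [0..<plength l]) = shape l"
    by (simp add: shape_def partition_keys[OF assms] atLeast0LessThan)
  then show ?thesis
    using *[of "[0..<plength l]"] by (simp add: power_sum_part_def partition_keys[OF assms] atLeast0LessThan fun_eq_iff)
qed

lemma pmono_part_size:
  assumes "pmono N e \<noteq> 0"
  shows "part_size e = sum_mset N"
  using assms
proof (induction N arbitrary: e)
  case empty
  then show ?case by (auto simp: mseries_one_def split: if_splits)
next
  case (add k N)
  from add.prems have "\<exists>i. k \<le> lookup e i \<and> pmono N (e - Poly_Mapping.single i k) \<noteq> 0"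
    by (rule contrapos_np) (auto simp: mul_psum_def intro!: sum.neutral)
  then obtain i where "k \<le> lookup e i" "pmono N (e - Poly_Mapping.single i k) \<noteq> 0" by blast
  then show ?case
    using add.IH[of "e - Poly_Mapping.single i k"] part_size_minus_single[of k e i] lookup_le_part_size[of e i]
    by auto
qed

definition symmetric_series :: "'a mseries \<Rightarrow> bool" where
  "symmetric_series f \<longleftrightarrow> (\<forall>e e'. shape e = shape e' \<longrightarrow> f e = f e')"

lemma symmetric_seriesD: "symmetric_series f \<Longrightarrow> shape e = shape e' \<Longrightarrow> f e = f e'"
  unfolding symmetric_series_def by blast

lemma symmetric_mul_psum:
  assumes "symmetric_series f"
  shows "symmetric_series (mul_psum k f)"
  unfolding symmetric_series_def
proof (intro allI impI)
  fix e e' :: expvec assume s: "shape e = shape e'"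
  obtain \<pi> where p: "bij \<pi>" "\<forall>i. lookup e i = lookup e' (\<pi> i)" using shape_eqD[OF s] by blast
  have "bij_betw \<pi> (keys e) (keys e')"
  proof (rule bij_betwI')
    show "\<And>x y. (\<pi> x = \<pi> y) = (x = y)" by (rule inj_eq[OF bij_is_inj[OF p(1)]])
    fix x assume "x \<in> keys e"
    then show "\<pi> x \<in> keys e'" using p(2)[rule_format, of x] by (simp add: in_keys_iff)
  next
    fix y assume y: "y \<in> keys e'"
    obtain x where x: "y = \<pi> x" using surjD[OF bij_is_surj[OF p(1)]] by blast
    then have "x \<in> keys e" using y x p(2)[rule_format, of x] by (simp add: in_keys_iff)
    then show "\<exists>x\<in>keys e. y = \<pi> x" using x by blast
  qed
  then have 1: "(\<Sum>i\<in>keys e. if k \<le> lookup e' (\<pi> i) then f (e' - Poly_Mapping.single (\<pi> i) k) else 0)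
      = (\<Sum>i\<in>keys e'. if k \<le> lookup e' i then f (e' - Poly_Mapping.single i k) else 0)"
    by (rule sum.reindex_bij_betw[where g = "\<lambda>i. if k \<le> lookup e' i then f (e' - Poly_Mapping.single i k) else 0"])
  have 2: "f (e - Poly_Mapping.single i k) = f (e' - Poly_Mapping.single (\<pi> i) k)" for i
  proof (rule symmetric_seriesD[OF assms], rule shape_eqI[OF p(1)])
    fix j show "lookup (e - Poly_Mapping.single i k) j = lookup (e' - Poly_Mapping.single (\<pi> i) k) (\<pi> j)"
      by (simp only: lookup_minus lookup_single when_def inj_eq[OF bij_is_inj[OF p(1)]] p(2)[rule_format])
  qed
  have 3: "(\<Sum>i\<in>keys e. if k \<le> lookup e i then f (e - Poly_Mapping.single i k) else 0)
      = (\<Sum>i\<in>keys e. if k \<le> lookup e' (\<pi> i) then f (e' - Poly_Mapping.single (\<pi> i) k) else 0)"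
    by (rule sum.cong[OF refl]) (simp only: 2 p(2)[rule_format])
  show "mul_psum k f e = mul_psum k f e'" unfolding mul_psum_def 3 1 ..
qed

lemma symmetric_pmono: "symmetric_series (pmono N)"
proof (induction N)
  case empty
  have "e = 0 \<longleftrightarrow> e' = 0" if "shape e = shape e'" for e e'
    using part_size_shape[OF that] by (metis part_size_eq_0_iff)
  then show ?case unfolding pmono_empty symmetric_series_def mseries_one_def by metis
qed (simp add: symmetric_mul_psum)

text \<open>\<open>c\<close> may have entries in all degrees; at \<open>e\<close> only those of its
  degree are read, which keeps the sum finite.\<close>

definition psum_series :: "(nat multiset \<Rightarrow> 'a::comm_semiring_1) \<Rightarrow> 'a mseries" where
  "psum_series c e = (\<Sum>N\<in>MP (part_size e). c N * of_nat (pmono N e))"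

lemma symmetric_psum_series: "symmetric_series (psum_series c)"
  unfolding symmetric_series_def psum_series_def
proof (intro allI impI)
  fix e e' :: expvec assume s: "shape e = shape e'"
  show "(\<Sum>N\<in>MP (part_size e). c N * of_nat (pmono N e)) = (\<Sum>N\<in>MP (part_size e'). c N * of_nat (pmono N e'))"
    unfolding part_size_shape[OF s] symmetric_seriesD[OF symmetric_pmono s] ..
qed

text \<open>In the coordinates given by the products of power sums: multiplication by \<open>p\<^sub>k\<close>, and the
  derivation \<open>k \<partial>/\<partial>p\<^sub>k\<close>.\<close>

definition pmul :: "nat \<Rightarrow> (nat multiset \<Rightarrow> 'a::comm_semiring_1) \<Rightarrow> nat multiset \<Rightarrow> 'a" where
  "pmul k c N = (if k \<in># N then c (N - {#k#}) else 0)"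

definition pder :: "nat \<Rightarrow> (nat multiset \<Rightarrow> 'a::comm_semiring_1) \<Rightarrow> nat multiset \<Rightarrow> 'a" where
  "pder k c N = of_nat (k * (count N k + 1)) * c (add_mset k N)"

lemma sum_MP_contains:
  fixes g :: "nat multiset \<Rightarrow> 'a::comm_monoid_add"
  assumes "0 < k"
  shows "(\<Sum>N\<in>MP d. if k \<in># N then g N else 0) = (if k \<le> d then \<Sum>N\<in>MP (d - k). g (add_mset k N) else 0)"
proof (cases "k \<le> d")
  case True
  have "(\<Sum>N\<in>MP d. if k \<in># N then g N else 0) = (\<Sum>N\<in>{N\<in>MP d. k \<in># N}. g N)"
    by (simp add: sum.inter_filter)
  also have "\<dots> = (\<Sum>N\<in>MP (d - k). g (add_mset k N))"
  proof (rule sum.reindex_bij_witness[of _ "add_mset k" "\<lambda>N. N - {#k#}"])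
    fix N assume "N \<in> {N \<in> MP d. k \<in># N}"
    then show "add_mset k (N - {#k#}) = N" "g (add_mset k (N - {#k#})) = g N" "N - {#k#} \<in> MP (d - k)"
      by (auto simp: MP_def sum_mset_diff dest: in_diffD)
  next
    fix N assume "N \<in> MP (d - k)"
    then show "add_mset k N - {#k#} = N" "add_mset k N \<in> {N \<in> MP d. k \<in># N}"
      using True assms by (auto simp: MP_def)
  qed
  finally show ?thesis using True by simp
next
  case False
  have "k \<notin># N" if "N \<in> MP d" for N
    using that False sum_mset.remove[of k N] by (auto simp: MP_def)
  then show ?thesis using False by (auto intro!: sum.neutral)
qed

lemma psum_series_pmul:
  assumes "0 < k"
  shows "psum_series (pmul k c) e = mul_psum k (psum_series c) e"
proof -
  have "psum_series (pmul k c) e = (\<Sum>N\<in>MP (part_size e). if k \<in># N then c (N - {#k#}) * of_nat (pmono N e) else 0)"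
    by (auto simp: psum_series_def pmul_def intro!: sum.cong)
  also have "\<dots> = (if k \<le> part_size e then \<Sum>N\<in>MP (part_size e - k). c N * of_nat (mul_psum k (pmono N) e) else 0)"
    by (simp add: sum_MP_contains[OF assms])
  also have "\<dots> = mul_psum k (psum_series c) e"
  proof (cases "k \<le> part_size e")
    case True
    have "mul_psum k (psum_series c) e = mul_psum k (\<lambda>e'. \<Sum>N\<in>MP (part_size e - k). c N * of_nat (pmono N e')) e"
      unfolding mul_psum_def by (auto simp: psum_series_def part_size_minus_single intro!: sum.cong)
    also have "\<dots> = (\<Sum>N\<in>MP (part_size e - k). c N * mul_psum k (\<lambda>e. of_nat (pmono N e)) e)"
      by (rule mul_psum_sum)
    finally show ?thesis using True by (simp add: of_nat_mul_psum)
  next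
    case False
    then have "\<not> k \<le> lookup e i" for i using lookup_le_part_size[of e i] by linarith
    then show ?thesis using False by (simp add: mul_psum_def)
  qed
  finally show ?thesis .
qed

text \<open>Chain rule for the Euler operator of x_0, a derivation that sends p_k to k x_0^k,
  compared at the coefficient of \<open>e\<close>.\<close>

lemma pmono_euler:
  assumes "0 \<notin># N"
  shows "lookup e 0 * pmono N e =
    (\<Sum>k\<in>#N. if k \<le> lookup e 0 then k * pmono (N - {#k#}) (e - Poly_Mapping.single 0 k) else 0)"
  using assms
proof (induction N arbitrary: e)
  case empty
  then show ?case by (simp add: mseries_one_def)
next
  case (add k N)
  have k: "0 < k" and N: "0 \<notin># N" using add.prems by auto
  let ?A = "insert 0 (keys e)"
  have "lookup e 0 * pmono (add_mset k N) e =
      (\<Sum>i\<in>?A. if k \<le> lookup e i then lookup e 0 * pmono N (e - Poly_Mapping.single i k) else 0)"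
    by (subst pmono_add_mset, subst mul_psum_superset[of k ?A]) (use k in \<open>auto simp: sum_distrib_left intro!: sum.cong\<close>)
  also have "\<dots> = (\<Sum>i\<in>?A. if k \<le> lookup e i then lookup (e - Poly_Mapping.single i k) 0 * pmono N (e - Poly_Mapping.single i k)
       + (if i = 0 then k * pmono N (e - Poly_Mapping.single 0 k) else 0) else 0)"
    by (intro sum.cong) (auto simp: lookup_minus lookup_single algebra_simps diff_mult_distrib)
  also have "\<dots> = (\<Sum>i\<in>?A. if k \<le> lookup e i then lookup (e - Poly_Mapping.single i k) 0 * pmono N (e - Poly_Mapping.single i k) else 0)
      + (\<Sum>i\<in>?A. if i = 0 then (if k \<le> lookup e 0 then k * pmono N (e - Poly_Mapping.single 0 k) else 0) else 0)"
    unfolding sum.distrib[symmetric] by (intro sum.cong) auto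
  also have "(\<Sum>i\<in>?A. if i = 0 then (if k \<le> lookup e 0 then k * pmono N (e - Poly_Mapping.single 0 k) else 0) else 0)
      = (if k \<le> lookup e 0 then k * pmono N (e - Poly_Mapping.single 0 k) else 0)"
    by (subst sum.delta) auto
  also have "(\<Sum>i\<in>?A. if k \<le> lookup e i then lookup (e - Poly_Mapping.single i k) 0 * pmono N (e - Poly_Mapping.single i k) else 0)
      = (\<Sum>i\<in>?A. \<Sum>l\<in>#N. if k \<le> lookup e i \<and> l \<le> lookup (e - Poly_Mapping.single i k) 0
           then l * pmono (N - {#l#}) (e - Poly_Mapping.single i k - Poly_Mapping.single 0 l) else 0)"
    by (intro sum.cong refl) (simp add: add.IH[OF N] image_mset_If)
  also have "\<dots> = (\<Sum>l\<in>#N. \<Sum>i\<in>?A. if k \<le> lookup e i \<and> l \<le> lookup (e - Poly_Mapping.single i k) 0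
           then l * pmono (N - {#l#}) (e - Poly_Mapping.single i k - Poly_Mapping.single 0 l) else 0)"
    by (simp add: sum_unfold_sum_mset sum_mset.swap[of _ N])
  also have "\<dots> = (\<Sum>l\<in>#N. if l \<le> lookup e 0 then l * pmono (add_mset k N - {#l#}) (e - Poly_Mapping.single 0 l) else 0)"
  proof (intro arg_cong[where f = sum_mset] image_mset_cong)
    fix l assume l: "l \<in># N"
    have eq: "add_mset k N - {#l#} = add_mset k (N - {#l#})" using l by (simp add: multi_union_self_other_eq)
    show "(\<Sum>i\<in>?A. if k \<le> lookup e i \<and> l \<le> lookup (e - Poly_Mapping.single i k) 0
           then l * pmono (N - {#l#}) (e - Poly_Mapping.single i k - Poly_Mapping.single 0 l) else 0) =
        (if l \<le> lookup e 0 then l * pmono (add_mset k N - {#l#}) (e - Poly_Mapping.single 0 l) else 0)"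
    proof (cases "l \<le> lookup e 0")
      case True
      have cond: "k \<le> lookup e i \<and> l \<le> lookup (e - Poly_Mapping.single i k) 0 \<longleftrightarrow>
          k \<le> lookup (e - Poly_Mapping.single 0 l) i" for i
        using True by (auto simp: lookup_minus lookup_single when_def)
      have minus: "e - Poly_Mapping.single i k - Poly_Mapping.single 0 l = e - Poly_Mapping.single 0 l - Poly_Mapping.single i k" for i
        by (simp add: diff_diff_add add.commute)
      have "mul_psum k (pmono (N - {#l#})) (e - Poly_Mapping.single 0 l) =
         (\<Sum>i\<in>?A. if k \<le> lookup (e - Poly_Mapping.single 0 l) i
           then pmono (N - {#l#}) (e - Poly_Mapping.single 0 l - Poly_Mapping.single i k) else 0)"
        by (rule mul_psum_superset) (use k keys_minus_subset[of e] in auto)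
      then show ?thesis
        using True unfolding eq pmono_add_mset cond minus by (simp add: sum_distrib_left if_distrib cong: if_cong)
    next
      case False
      then have "\<not> l \<le> lookup (e - Poly_Mapping.single i k) 0" for i
        by (simp add: lookup_minus)
      with False show ?thesis by simp
    qed
  qed
  finally show ?case by simp
qed

lemma sum_mset_multiplicity:
  "(\<Sum>k\<in>#N. g k) = (\<Sum>k\<in>set_mset N. count N k * (g k :: nat))"
proof (induction N)
  case (add x N)
  have "(\<Sum>k\<in>set_mset (add_mset x N). count (add_mset x N) k * g k)
     = (\<Sum>k\<in>insert x (set_mset N). (if k = x then g k else 0) + count N k * g k)"
    by (intro sum.cong) auto
  also have "\<dots> = g x + (\<Sum>k\<in>insert x (set_mset N). count N k * g k)"
    by (simp add: sum.distrib sum.delta)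
  also have "(\<Sum>k\<in>insert x (set_mset N). count N k * g k) = (\<Sum>k\<in>set_mset N. count N k * g k)"
    by (intro sum.mono_neutral_right) (auto simp: count_eq_zero_iff)
  finally show ?case using add by simp
qed simp

text \<open>The same chain rule with multiplicities collected into \<open>pder\<close>. It trades
  the exponent of one variable for derivations in the power sums and is the bridge between the two
  coordinate systems.\<close>

lemma psum_series_euler:
  fixes c :: "nat multiset \<Rightarrow> 'a::comm_semiring_1"
  shows "of_nat (lookup e 0) * psum_series c e =
    (\<Sum>k=1..lookup e 0. psum_series (pder k c) (e - Poly_Mapping.single 0 k))"
proof -
  let ?d = "part_size e"
  have pm: "of_nat (lookup e 0) * of_nat (pmono N e) =
     (\<Sum>k=1..lookup e 0. of_nat (count N k * k * pmono (N - {#k#}) (e - Poly_Mapping.single 0 k)) :: 'a)"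
    if "N \<in> MP ?d" for N
  proof -
    let ?g = "\<lambda>k. if k \<le> lookup e 0 then k * pmono (N - {#k#}) (e - Poly_Mapping.single 0 k) else 0"
    have N: "0 \<notin># N" using that by (simp add: MP_def)
    have "lookup e 0 * pmono N e = (\<Sum>k\<in>set_mset N. count N k * ?g k)"
      by (subst pmono_euler[OF N]) (rule sum_mset_multiplicity)
    also have "\<dots> = (\<Sum>k\<in>{1..lookup e 0} \<union> set_mset N. count N k * ?g k)"
      by (rule sum.mono_neutral_left) (auto simp: count_eq_zero_iff)
    also have "\<dots> = (\<Sum>k=1..lookup e 0. count N k * ?g k)"
    proof (rule sum.mono_neutral_right)
      show "\<forall>k\<in>{1..lookup e 0} \<union> set_mset N - {1..lookup e 0}. count N k * ?g k = 0"
      proof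
        fix k assume "k \<in> {1..lookup e 0} \<union> set_mset N - {1..lookup e 0}"
        then have "k \<in># N" "k \<notin> {1..lookup e 0}" by auto
        then have "\<not> k \<le> lookup e 0" using N by (cases "k = 0") auto
        then show "count N k * ?g k = 0" by simp
      qed
    qed auto
    also have "\<dots> = (\<Sum>k=1..lookup e 0. count N k * k * pmono (N - {#k#}) (e - Poly_Mapping.single 0 k))"
      by (intro sum.cong) auto
    finally have *: "lookup e 0 * pmono N e = (\<Sum>k=1..lookup e 0. count N k * k * pmono (N - {#k#}) (e - Poly_Mapping.single 0 k))" .
    show ?thesis unfolding of_nat_mult[symmetric] * of_nat_sum ..
  qed
  have "of_nat (lookup e 0) * psum_series c e = (\<Sum>N\<in>MP ?d. c N * (of_nat (lookup e 0) * of_nat (pmono N e)))"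
    by (simp add: psum_series_def sum_distrib_left ac_simps)
  also have "\<dots> = (\<Sum>N\<in>MP ?d. \<Sum>k=1..lookup e 0. c N * of_nat (count N k * k * pmono (N - {#k#}) (e - Poly_Mapping.single 0 k)))"
    by (intro sum.cong refl) (simp add: pm sum_distrib_left)
  also have "\<dots> = (\<Sum>k=1..lookup e 0. \<Sum>N\<in>MP ?d. c N * of_nat (count N k * k * pmono (N - {#k#}) (e - Poly_Mapping.single 0 k)))"
    by (rule sum.swap)
  also have "\<dots> = (\<Sum>k=1..lookup e 0. psum_series (pder k c) (e - Poly_Mapping.single 0 k))"
  proof (intro sum.cong refl)
    fix k assume "k \<in> {1..lookup e 0}"
    then have k: "0 < k" "k \<le> lookup e 0" by auto
    have kd: "k \<le> ?d" using k(2) lookup_le_part_size[of e 0] by linarith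
    have "(\<Sum>N\<in>MP ?d. c N * of_nat (count N k * k * pmono (N - {#k#}) (e - Poly_Mapping.single 0 k)))
       = (\<Sum>N\<in>MP ?d. if k \<in># N then c N * of_nat (count N k * k * pmono (N - {#k#}) (e - Poly_Mapping.single 0 k)) else 0)"
      by (intro sum.cong) (simp_all add: not_in_iff del: count_eq_zero_iff)
    also have "\<dots> = psum_series (pder k c) (e - Poly_Mapping.single 0 k)"
      unfolding sum_MP_contains[OF k(1)] psum_series_def part_size_minus_single[OF k(2)] pder_def
      using kd by (auto intro!: sum.cong simp: ac_simps)
    finally show "(\<Sum>N\<in>MP ?d. c N * of_nat (count N k * k * pmono (N - {#k#}) (e - Poly_Mapping.single 0 k))) = \<dots>" .
  qed
  finally show ?thesis .
qed

lemma shape_remove_part: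
  assumes "lookup e i = k" "0 < k"
  shows "shape e = add_mset k (shape (e - Poly_Mapping.single i k))"
proof -
  have k: "keys (e - Poly_Mapping.single i k) = keys e - {i}"
    using assms by (auto simp: in_keys_iff lookup_minus lookup_single when_def split: if_splits)
  have "i \<in> keys e" using assms by (simp add: in_keys_iff)
  then have "mset_set (keys e) = add_mset i (mset_set (keys e - {i}))"
    by (simp add: mset_set.remove)
  then have "shape e = add_mset k (image_mset (lookup e) (mset_set (keys e - {i})))"
    using assms by (simp add: shape_def)
  also have "image_mset (lookup e) (mset_set (keys e - {i})) = shape (e - Poly_Mapping.single i k)"
    unfolding shape_def k by (rule image_mset_cong) (auto simp: lookup_minus lookup_single when_def)
  finally show ?thesis .
qed

text \<open>Every monomial of a product of power sums arises by adding up parts on common variables,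
  so it has at most as many entries as there are parts, and as many only if no parts were merged.
  This makes the passage from power sums to monomials triangular in the number of parts.\<close>

lemma pmono_nonzeroD:
  assumes "pmono N e \<noteq> 0" "0 \<notin># N"
  shows "plength e \<le> size N \<and> (plength e = size N \<longrightarrow> shape e = N)"
  using assms
proof (induction N arbitrary: e)
  case empty
  then have "e = 0" by (simp add: mseries_one_def split: if_splits)
  then show ?case by (simp add: plength_def shape_def)
next
  case (add k N)
  have k: "0 < k" using add.prems by auto
  from add.prems(1) have "\<exists>i. k \<le> lookup e i \<and> pmono N (e - Poly_Mapping.single i k) \<noteq> 0"
    by (rule contrapos_np) (auto simp: mul_psum_def intro!: sum.neutral)
  then obtain i where i: "k \<le> lookup e i" "pmono N (e - Poly_Mapping.single i k) \<noteq> 0" by blast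
  have IH: "plength (e - Poly_Mapping.single i k) \<le> size N"
     "plength (e - Poly_Mapping.single i k) = size N \<Longrightarrow> shape (e - Poly_Mapping.single i k) = N"
    using add.IH[OF i(2)] add.prems by auto
  show ?case
  proof (cases "lookup e i = k")
    case True
    have s: "shape e = add_mset k (shape (e - Poly_Mapping.single i k))"
      by (rule shape_remove_part[OF True k])
    then have "plength e = Suc (plength (e - Poly_Mapping.single i k))"
      by (metis size_shape size_add_mset)
    then show ?thesis using IH s by simp
  next
    case False
    then have "keys (e - Poly_Mapping.single i k) = keys e"
      using i(1) by (auto simp: in_keys_iff lookup_minus lookup_single when_def split: if_splits)
    then have "plength e = plength (e - Poly_Mapping.single i k)" by (simp add: plength_def)
    then show ?thesis using IH(1) by simp
  qed
qed

lemma pmono_shape_pos: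
  assumes "shape e = N"
  shows "0 < pmono N e"
  using assms
proof (induction N arbitrary: e)
  case empty
  then have "part_size e = 0" by (metis sum_mset_shape sum_mset.empty)
  then show ?case by (simp add: mseries_one_def)
next
  case (add k N)
  have k: "0 < k" using add.prems by (metis zero_notin_shape gr0I union_single_eq_member)
  have "k \<in># shape e" using add.prems by simp
  then obtain i where i: "i \<in> keys e" "lookup e i = k" by (auto simp: shape_def)
  have "shape (e - Poly_Mapping.single i k) = N"
    using shape_remove_part[OF i(2) k] add.prems by simp
  then have "0 < pmono N (e - Poly_Mapping.single i k)" by (rule add.IH)
  then show ?case
    using i k by (auto simp: mul_psum_def intro!: sum_pos2[of _ i])
qed

lemma psum_series_add: "psum_series (\<lambda>N. a N + b N) e = psum_series a e + psum_series b e"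
  by (simp add: psum_series_def algebra_simps sum.distrib)

lemma psum_series_diff:
  "psum_series (\<lambda>N. a N - b N) e = psum_series a e - (psum_series b e :: 'a::comm_ring_1)"
  by (simp add: psum_series_def algebra_simps sum_subtractf)

lemma psum_series_scale: "psum_series (\<lambda>N. r * a N) e = r * psum_series a e"
  by (simp add: psum_series_def sum_distrib_left mult.assoc)

lemma psum_series_zero [simp]: "psum_series (\<lambda>N. 0) e = 0"
  by (simp add: psum_series_def)

lemma psum_series_sum: "psum_series (\<lambda>N. \<Sum>x\<in>A. a x N) e = (\<Sum>x\<in>A. psum_series (a x) e)"
  by (induction A rule: infinite_finite_induct) (simp_all add: psum_series_add)

text \<open>Among the multisets with nonzero coefficient take \<open>N0\<close> with the most parts.
  The monomial whose exponents are the parts of \<open>N0\<close> occurs in no other term.\<close>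

lemma psum_series_eq_0D:
  fixes c :: "nat multiset \<Rightarrow> 'a::field_char_0"
  assumes z: "\<And>e. part_size e = d \<Longrightarrow> psum_series c e = 0" and "N \<in> MP d"
  shows "c N = 0"
proof (rule ccontr)
  assume "c N \<noteq> 0"
  define A where "A = {N \<in> MP d. c N \<noteq> 0}"
  have A: "finite A" "A \<noteq> {}" using \<open>c N \<noteq> 0\<close> assms(2) by (auto simp: A_def)
  define r where "r = Max (size ` A)"
  have "r \<in> size ` A" unfolding r_def using A by (intro Max_in) auto
  then obtain N0 where N0: "N0 \<in> A" "size N0 = r" by auto
  have max: "size M \<le> r" if "M \<in> A" for M using that A by (simp add: r_def)
  define e where "e = part_of N0"
  have N0': "N0 \<in> MP d" "c N0 \<noteq> 0" "0 \<notin># N0" using N0 by (auto simp: A_def MP_def)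
  have e: "shape e = N0" using N0' by (simp add: e_def)
  then have pd: "part_size e = d" using N0' shape_in_MP by metis
  have "psum_series c e = (\<Sum>N\<in>{N0}. c N * of_nat (pmono N e))"
    unfolding psum_series_def pd
  proof (rule sum.mono_neutral_right)
    show "\<forall>M\<in>MP d - {N0}. c M * of_nat (pmono M e) = 0"
    proof
      fix M assume M: "M \<in> MP d - {N0}"
      show "c M * of_nat (pmono M e) = 0"
      proof (rule ccontr)
        assume "c M * of_nat (pmono M e) \<noteq> 0"
        then have "c M \<noteq> 0" and p: "pmono M e \<noteq> 0" by auto
        then have "size M \<le> r" using max M by (auto simp: A_def)
        moreover have "0 \<notin># M" using M by (auto simp: MP_def)
        moreover have "plength e = r" using e N0(2) by (metis size_shape)
        ultimately have "shape e = M" using pmono_nonzeroD[OF p] by auto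
        then show False using e M by auto
      qed
    qed
  qed (use N0' in auto)
  then have "c N0 * of_nat (pmono N0 e) = 0" using z[OF pd] by simp
  then show False using N0'(2) pmono_shape_pos[OF e] by simp
qed

text \<open>The triangular system is solved from the longest shapes down; \<open>m\<close> is the
  number of lengths treated so far, counted downwards from \<open>d\<close>.\<close>

lemma psum_series_surj:
  fixes f :: "'a::field_char_0 mseries"
  assumes "symmetric_series f"
  shows "\<exists>c. (\<forall>N. N \<notin> MP d \<longrightarrow> c N = 0) \<and> (\<forall>e. part_size e = d \<longrightarrow> psum_series c e = f e)"
proof -
  have ple: "plength e \<le> part_size e" for e
    using size_le_sum_mset[of "shape e"] by simp
  have "\<exists>c. \<forall>e. part_size e = d \<and> d < plength e + m \<longrightarrow> psum_series c e = f e" for m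
  proof (induction m)
    case 0
    have "\<not> (part_size e = d \<and> d < plength e + 0)" for e using ple[of e] by auto
    then show ?case by blast
  next
    case (Suc m)
    then obtain c where c: "part_size e = d \<Longrightarrow> d < plength e + m \<Longrightarrow> psum_series c e = f e" for e by blast
    \<comment> \<open>The correction involves only multisets with \<open>d - m\<close> parts, so
      longer shapes are left alone. It divides by the diagonal entry, which is positive.\<close>
    define \<delta> where "\<delta> N = (if size N + m = d then (f (part_of N) - psum_series c (part_of N)) / of_nat (pmono N (part_of N)) else 0)" for N
    have "psum_series (\<lambda>N. c N + \<delta> N) e = f e" if e: "part_size e = d" "d < plength e + Suc m" for e
    proof -
      have split: "psum_series (\<lambda>N. c N + \<delta> N) e = psum_series c e + (\<Sum>N\<in>MP d. \<delta> N * of_nat (pmono N e))"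
        by (simp add: psum_series_def e(1) algebra_simps sum.distrib)
      show ?thesis
      proof (cases "d < plength e + m")
        case True
        have "\<delta> N * of_nat (pmono N e) = 0" if "N \<in> MP d" for N
        proof (cases "size N + m = d")
          case sz: True
          have "0 \<notin># N" using that by (simp add: MP_def)
          then have "pmono N e = 0" using pmono_nonzeroD[of N e] sz True by linarith
          then show ?thesis by simp
        qed (simp add: \<delta>_def)
        then have "(\<Sum>N\<in>MP d. \<delta> N * of_nat (pmono N e)) = 0" by (rule sum.neutral[rule_format])
        then show ?thesis using split c[OF e(1) True] by simp
      next
        case False
        then have pe: "plength e + m = d" using e(2) by simp
        let ?N = "shape e"
        have "(\<Sum>N\<in>MP d. \<delta> N * of_nat (pmono N e)) = (\<Sum>N\<in>{?N}. \<delta> N * of_nat (pmono N e))"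
        proof (rule sum.mono_neutral_right)
          show "\<forall>N\<in>MP d - {?N}. \<delta> N * of_nat (pmono N e) = 0"
          proof
            fix N assume N: "N \<in> MP d - {?N}"
            then have N0: "0 \<notin># N" by (simp add: MP_def)
            show "\<delta> N * of_nat (pmono N e) = 0"
            proof (cases "size N + m = d")
              case True
              then have "pmono N e = 0" using pmono_nonzeroD[of N e] pe N N0 by auto
              then show ?thesis by simp
            qed (simp add: \<delta>_def)
          qed
        qed (use e(1) in auto)
        also have "\<dots> = \<delta> ?N * of_nat (pmono ?N e)" by simp
        also have "\<delta> ?N = (f e - psum_series c e) / of_nat (pmono ?N e)"
        proof -
          have s: "shape (part_of ?N) = shape e" by simp
          have "size ?N + m = d" using pe by simp
          then show ?thesis
            unfolding \<delta>_def symmetric_seriesD[OF assms s] symmetric_seriesD[OF symmetric_psum_series s]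
              symmetric_seriesD[OF symmetric_pmono s] by simp
        qed
        also have "\<dots> * of_nat (pmono ?N e) = f e - psum_series c e"
          using pmono_shape_pos[of e ?N] by simp
        finally show ?thesis using split by simp
      qed
    qed
    then show ?case by blast
  qed
  from this[of "Suc d"] obtain c where c: "part_size e = d \<Longrightarrow> psum_series c e = f e" for e by auto
  have "psum_series (\<lambda>N. if N \<in> MP d then c N else 0) e = f e" if "part_size e = d" for e
    using c[OF that] that by (simp add: psum_series_def)
  then show ?thesis by (intro exI[of _ "\<lambda>N. if N \<in> MP d then c N else 0"]) auto
qed

section \<open>The inner product in power sum coordinates\<close>

definition pz :: "nat multiset \<Rightarrow> nat" where
  "pz N = (\<Prod>r\<in>set_mset N. r ^ count N r * fact (count N r))"

lemma zee_pz: "zee l = pz (shape l)"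
proof -
  have "set_mset (shape l) = lookup l ` keys l" by (simp add: shape_def)
  moreover have "count (shape l) r = part_mult l r" for r
    by (simp add: count_shape part_mult_def)
  ultimately show ?thesis by (simp add: zee_def pz_def)
qed

lemma pz_superset:
  assumes "finite A" "set_mset N \<subseteq> A"
  shows "pz N = (\<Prod>r\<in>A. r ^ count N r * fact (count N r))"
  unfolding pz_def using assms
  by (intro prod.mono_neutral_left) (auto simp: not_in_iff simp del: count_eq_zero_iff)

lemma pz_add_mset: "pz (add_mset k N) = pz N * (k * (count N k + 1))"
proof -
  let ?A = "insert k (set_mset N)" and ?B = "set_mset N - {k}"
  have A: "?A = insert k ?B" by auto
  have "pz M = k ^ count M k * fact (count M k) * (\<Prod>r\<in>?B. r ^ count M r * fact (count M r))" if "set_mset M \<subseteq> ?A" for M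
  proof -
    have "pz M = (\<Prod>r\<in>insert k ?B. r ^ count M r * fact (count M r))"
      by (rule pz_superset) (use that in auto)
    then show ?thesis by (subst (asm) prod.insert) (simp_all add: mult.assoc)
  qed
  moreover have "(\<Prod>r\<in>?B. r ^ count (add_mset k N) r * fact (count (add_mset k N) r)) = (\<Prod>r\<in>?B. r ^ count N r * fact (count N r))"
    by (intro prod.cong) auto
  ultimately have "pz (add_mset k N) = k ^ Suc (count N k) * fact (Suc (count N k)) * (\<Prod>r\<in>?B. r ^ count N r * fact (count N r))"
    "pz N = k ^ count N k * fact (count N k) * (\<Prod>r\<in>?B. r ^ count N r * fact (count N r))"
    by (simp_all add: subset_insertI)
  then show ?thesis by (simp add: algebra_simps)
qed

definition pinner :: "nat \<Rightarrow> (nat multiset \<Rightarrow> ratfun) \<Rightarrow> (nat multiset \<Rightarrow> ratfun) \<Rightarrow> ratfun" where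
  "pinner d c c' = (\<Sum>N\<in>MP d. c N * c' N * (of_nat (pz N) / tau ^ size N))"

text \<open>The order of \<open>ratfun\<close> compares leading coefficients. In it all weights of
  \<open>pinner\<close> are positive, which is the source of its definiteness.\<close>

lemma tau_pos: "0 < tau"
  by (simp add: tau_def zero_less_Fract_iff less_poly_def pos_poly_def)

lemma pz_pos: "0 \<notin># N \<Longrightarrow> 0 < pz N"
  unfolding pz_def
proof (rule prod_pos)
  fix r assume "0 \<notin># N" "r \<in># N"
  then have "r \<noteq> 0" by metis
  then show "0 < r ^ count N r * fact (count N r)" by simp
qed

lemma pinner_anisotropic:
  assumes "pinner d c c = 0" "N \<in> MP d"
  shows "c N = 0"
proof -
  have "0 \<le> c M * c M * (of_nat (pz M) / tau ^ size M)" for M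
    using tau_pos by simp
  then have "c N * c N * (of_nat (pz N) / tau ^ size N) = 0"
    using assms unfolding pinner_def by (subst (asm) sum_nonneg_eq_0_iff) auto
  moreover have "0 < pz N" using assms(2) by (intro pz_pos) (simp add: MP_def)
  ultimately show ?thesis using tau_pos by simp
qed

lemma pinner_commute: "pinner d c c' = pinner d c' c"
  by (simp add: pinner_def mult.commute)

text \<open>Adding a part \<open>k\<close> multiplies z by k (m_k + 1), the factor in
  \<open>pder\<close>, and lengthens the multiset by one, which accounts for
  \<open>tau\<close>.\<close>

lemma pinner_adjoint:
  assumes "0 < k" "k \<le> d"
  shows "tau * pinner d (pmul k c) c' = pinner (d - k) c (pder k c')"
proof -
  have "pinner d (pmul k c) c' = (\<Sum>N\<in>MP d. if k \<in># N then c (N - {#k#}) * c' N * (of_nat (pz N) / tau ^ size N) else 0)"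
    unfolding pinner_def by (intro sum.cong) (auto simp: pmul_def)
  also have "\<dots> = (\<Sum>N\<in>MP (d - k). c N * c' (add_mset k N) * (of_nat (pz (add_mset k N)) / tau ^ size (add_mset k N)))"
    using assms by (simp add: sum_MP_contains)
  finally have eq: "pinner d (pmul k c) c' = \<dots>" .
  show ?thesis
    unfolding eq pinner_def[of "d - k"] pder_def pz_add_mset sum_distrib_left using tau_pos
    by (intro sum.cong refl) (simp add: field_simps)
qed

lemma pinner_add_left: "pinner d (\<lambda>N. a N + b N) c = pinner d a c + pinner d b c"
  by (simp add: pinner_def algebra_simps sum.distrib add_divide_distrib)

lemma pinner_diff_left: "pinner d (\<lambda>N. a N - b N) c = pinner d a c - pinner d b c"
  by (simp add: pinner_def algebra_simps sum_subtractf diff_divide_distrib)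

lemma pinner_scale_left: "pinner d (\<lambda>N. r * a N) c = r * pinner d a c"
  by (simp add: pinner_def sum_distrib_left mult.assoc)

lemma pinner_zero_left [simp]: "pinner d (\<lambda>N. 0) c = 0"
  by (simp add: pinner_def)

lemma pinner_sum_left: "pinner d (\<lambda>N. \<Sum>x\<in>A. a x N) c = (\<Sum>x\<in>A. pinner d (a x) c)"
  by (induction A rule: infinite_finite_induct) (simp_all add: pinner_add_left)

lemma pinner_cong:
  "(\<And>N. N \<in> MP d \<Longrightarrow> a N = a' N) \<Longrightarrow> (\<And>N. N \<in> MP d \<Longrightarrow> b N = b' N) \<Longrightarrow> pinner d a b = pinner d a' b'"
  unfolding pinner_def by (intro sum.cong) auto

lemma psum_expansion_series:
  assumes "\<forall>l\<in>keys C. is_partition l"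
  shows "(\<Sum>l\<in>keys C. lookup C l * power_sum_part l e) = psum_series (\<lambda>N. lookup C (part_of N) :: ratfun) e"
proof -
  have "(\<Sum>l\<in>keys C. lookup C l * power_sum_part l e) = (\<Sum>l\<in>keys C. lookup C l * of_nat (pmono (shape l) e))"
    using assms by (intro sum.cong refl) (simp add: power_sum_part_pmono)
  also have "\<dots> = (\<Sum>l\<in>{l. is_partition l \<and> part_size l = part_size e}. lookup C l * of_nat (pmono (shape l) e))"
  proof (rule sum.mono_neutral_cong)
    show "lookup C l * of_nat (pmono (shape l) e) = 0" if "l \<in> keys C - {l. is_partition l \<and> part_size l = part_size e}" for l
      using that assms pmono_part_size[of "shape l" e] by auto
  qed (auto simp: in_keys_iff)
  also have "\<dots> = (\<Sum>N\<in>MP (part_size e). lookup C (part_of N) * of_nat (pmono N e))"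
    by (rule sum.reindex_bij_witness[of _ part_of shape]) (auto simp: MP_def simp flip: sum_mset_shape)
  finally show ?thesis by (simp add: psum_series_def)
qed

text \<open>The definite description in \<open>power_sum_coeffs\<close> denotes because the products
  of power sums are linearly independent.\<close>

lemma power_sum_coeffs_eqI:
  assumes "\<forall>l\<in>keys C. is_partition l" "\<And>e. f e = psum_series (\<lambda>N. lookup C (part_of N)) e"
  shows "power_sum_coeffs f = C"
  unfolding power_sum_coeffs_def
proof (rule the_equality)
  show "(\<forall>l\<in>keys C. is_partition l) \<and> (\<forall>e. f e = (\<Sum>l\<in>keys C. lookup C l * power_sum_part l e))"
    using assms psum_expansion_series by simp
  fix C' assume C': "(\<forall>l\<in>keys C'. is_partition l) \<and> (\<forall>e. f e = (\<Sum>l\<in>keys C'. lookup C' l * power_sum_part l e))"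
  then have eq: "psum_series (\<lambda>N. lookup C' (part_of N)) e = psum_series (\<lambda>N. lookup C (part_of N)) e" for e
    using psum_expansion_series[of C' e] assms(2)[of e] by simp
  show "C' = C"
  proof (rule poly_mapping_eqI)
    fix l
    show "lookup C' l = lookup C l"
    proof (cases "is_partition l")
      case True
      have "lookup C' (part_of (shape l)) - lookup C (part_of (shape l)) = 0"
      proof (rule psum_series_eq_0D[of "part_size l" "\<lambda>N. lookup C' (part_of N) - lookup C (part_of N)"])
        fix e
        show "psum_series (\<lambda>N. lookup C' (part_of N) - lookup C (part_of N)) e = 0"
          using eq[of e] by (simp add: psum_series_diff)
      qed simp
      then show ?thesis using True by simp
    next
      case False
      then show ?thesis using assms(1) C' by (metis in_keys_iff)
    qed
  qed
qed

definition homogeneous :: "nat \<Rightarrow> 'a::zero mseries \<Rightarrow> bool" where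
  "homogeneous d f \<longleftrightarrow> (\<forall>e. f e \<noteq> 0 \<longrightarrow> part_size e = d)"

text \<open>For symmetric \<open>f\<close> the choice is unique: linear independence fixes the
  values on \<open>MP d\<close>, and the others are normalized to 0.\<close>

definition psum_coords :: "nat \<Rightarrow> ratfun mseries \<Rightarrow> nat multiset \<Rightarrow> ratfun" where
  "psum_coords d f = (SOME c. (\<forall>N. N \<notin> MP d \<longrightarrow> c N = 0) \<and> (\<forall>e. part_size e = d \<longrightarrow> psum_series c e = f e))"

lemma psum_coords:
  assumes "symmetric_series f"
  shows "N \<notin> MP d \<Longrightarrow> psum_coords d f N = 0"
    and "part_size e = d \<Longrightarrow> psum_series (psum_coords d f) e = f e"
  using someI_ex[OF psum_series_surj[OF assms, of d]] unfolding psum_coords_def by blast+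

lemma psum_coords_eqI:
  assumes "\<And>e. part_size e = d \<Longrightarrow> psum_series c e = f e" "symmetric_series f" "N \<in> MP d"
  shows "psum_coords d f N = c N"
proof -
  have "psum_coords d f N - c N = 0"
    by (rule psum_series_eq_0D[of d "\<lambda>N. psum_coords d f N - c N"])
      (simp_all add: psum_series_diff assms psum_coords(2)[OF assms(2)])
  then show ?thesis by simp
qed

lemma power_sum_coeffs_homogeneous:
  assumes "symmetric_series f" "homogeneous d f"
  shows "lookup (power_sum_coeffs f) l = (if is_partition l then psum_coords d f (shape l) else 0)"
proof -
  define g where "g l = (if is_partition l then psum_coords d f (shape l) else 0)" for l
  have "{l. g l \<noteq> 0} \<subseteq> {l. is_partition l \<and> part_size l = d}"
  proof
    fix l assume "l \<in> {l. g l \<noteq> 0}"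
    then have "is_partition l" "psum_coords d f (shape l) \<noteq> 0" by (auto simp: g_def split: if_splits)
    then show "l \<in> {l. is_partition l \<and> part_size l = d}"
      using psum_coords(1)[OF assms(1), of "shape l" d] by auto
  qed
  then have "finite {l. g l \<noteq> 0}"
    by (rule finite_subset) simp
  then have lk: "lookup (Abs_poly_mapping g) = g" by (simp add: Abs_poly_mapping_inverse)
  have "power_sum_coeffs f = Abs_poly_mapping g"
  proof (rule power_sum_coeffs_eqI)
    show "\<forall>l\<in>keys (Abs_poly_mapping g). is_partition l"
    proof
      fix l assume "l \<in> keys (Abs_poly_mapping g)"
      then have "lookup (Abs_poly_mapping g) l \<noteq> 0" by (rule in_keys_iff[THEN iffD1])
      then show "is_partition l" unfolding lk by (simp add: g_def split: if_splits)
    qed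
    fix e
    have "psum_series (\<lambda>N. lookup (Abs_poly_mapping g) (part_of N)) e = psum_series (psum_coords d f) e"
      unfolding lk psum_series_def by (intro sum.cong) (auto simp: g_def MP_def)
    also have "\<dots> = f e"
    proof (cases "part_size e = d")
      case False
      then have "\<And>N. N \<in> MP (part_size e) \<Longrightarrow> N \<notin> MP d" by (auto simp: MP_def)
      then have "psum_series (psum_coords d f) e = 0"
        unfolding psum_series_def using psum_coords(1)[OF assms(1)] by (intro sum.neutral) auto
      then show ?thesis using False assms(2) by (auto simp: homogeneous_def)
    qed (rule psum_coords(2)[OF assms(1)])
    finally show "f e = psum_series (\<lambda>N. lookup (Abs_poly_mapping g) (part_of N)) e" by simp
  qed
  then show ?thesis by (simp add: lk g_def)
qed

lemma jack_inner_homogeneous: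
  assumes "symmetric_series f" "homogeneous d f" "symmetric_series g" "homogeneous d' g"
  shows "jack_inner f g = (if d = d' then pinner d (psum_coords d f) (psum_coords d g) else 0)"
proof -
  let ?C = "power_sum_coeffs f" and ?C' = "power_sum_coeffs g"
  let ?P = "{l. is_partition l \<and> part_size l = d}"
  have f: "lookup ?C l = (if is_partition l then psum_coords d f (shape l) else 0)" for l
    by (rule power_sum_coeffs_homogeneous[OF assms(1,2)])
  have g: "lookup ?C' l = (if is_partition l then psum_coords d' g (shape l) else 0)" for l
    by (rule power_sum_coeffs_homogeneous[OF assms(3,4)])
  have "jack_inner f g = (\<Sum>l\<in>?P. lookup ?C l * lookup ?C' l * (of_nat (zee l) / tau ^ plength l))"
    unfolding jack_inner_def
  proof (rule sum.mono_neutral_left)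
    show "keys ?C \<subseteq> ?P"
    proof
      fix l assume "l \<in> keys ?C"
      then have "lookup ?C l \<noteq> 0" by (rule in_keys_iff[THEN iffD1])
      then have "is_partition l" "psum_coords d f (shape l) \<noteq> 0" unfolding f by (auto split: if_splits)
      then show "l \<in> ?P" using psum_coords(1)[OF assms(1), of "shape l" d] by auto
    qed
  qed (auto simp: in_keys_iff)
  also have "\<dots> = (\<Sum>l\<in>?P. psum_coords d f (shape l) * psum_coords d' g (shape l) * (of_nat (pz (shape l)) / tau ^ size (shape l)))"
    by (intro sum.cong refl) (simp add: f g zee_pz)
  also have "\<dots> = (\<Sum>N\<in>MP d. psum_coords d f N * psum_coords d' g N * (of_nat (pz N) / tau ^ size N))"
    by (rule sum.reindex_bij_witness[of _ part_of shape]) (auto simp: MP_def simp flip: sum_mset_shape)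
  also have "\<dots> = (if d = d' then pinner d (psum_coords d f) (psum_coords d g) else 0)"
  proof (cases "d = d'")
    case False
    then have "\<And>N. N \<in> MP d \<Longrightarrow> N \<notin> MP d'" by (auto simp: MP_def)
    then show ?thesis using False psum_coords(1)[OF assms(3)] by (auto intro!: sum.neutral)
  qed (simp add: pinner_def)
  finally show ?thesis .
qed

section \<open>A family of self-adjoint operators\<close>

text \<open>The Lax matrix of Nazarov and Sklyanin, restricted to the indices \<open>1, \<dots>, D\<close>: its entry in row \<open>b\<close> and column
  \<open>a\<close> is \<open>\<tau> p\<^bsub>a-b\<^esub>\<close> above and \<open>(b-a) \<partial>/\<partial>p\<^bsub>b-a\<^esub>\<close> below the diagonal.\<close>

definition lax :: "nat \<Rightarrow> (nat \<Rightarrow> nat multiset \<Rightarrow> ratfun) \<Rightarrow> nat \<Rightarrow> nat multiset \<Rightarrow> ratfun" where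
  "lax D u b N = (1 - tau) * of_nat b * u b N + tau * (\<Sum>a\<in>{b<..D}. pmul (a - b) (u a) N)
     + (\<Sum>a\<in>{1..<b}. pder (b - a) (u a) N)"

text \<open>The entry with index \<open>a\<close> is taken in degree \<open>D - a\<close>: it stands
  for the cofactor of x_0^a in a series of degree \<open>D\<close>.\<close>

definition linner :: "nat \<Rightarrow> (nat \<Rightarrow> nat multiset \<Rightarrow> ratfun) \<Rightarrow> (nat \<Rightarrow> nat multiset \<Rightarrow> ratfun) \<Rightarrow> ratfun" where
  "linner D u v = (\<Sum>a=1..D. pinner (D - a) (u a) (v a))"

text \<open>Adjointness moves the entries above the diagonal to the other argument, where they
  become the entries below it with \<open>u\<close> and \<open>v\<close> exchanged. The right hand
  side is then visibly symmetric.\<close>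

lemma linner_lax:
  "linner D (lax D u) v = (\<Sum>b=1..D. (1 - tau) * of_nat b * pinner (D - b) (u b) (v b))
     + (\<Sum>b=1..D. \<Sum>a\<in>{1..<b}. pinner (D - b) (pder (b - a) (v a)) (u b))
     + (\<Sum>b=1..D. \<Sum>a\<in>{1..<b}. pinner (D - b) (pder (b - a) (u a)) (v b))"
proof -
  have "linner D (lax D u) v = (\<Sum>b=1..D. (1 - tau) * of_nat b * pinner (D - b) (u b) (v b)
      + (\<Sum>a\<in>{b<..D}. tau * pinner (D - b) (pmul (a - b) (u a)) (v b))
      + (\<Sum>a\<in>{1..<b}. pinner (D - b) (pder (b - a) (u a)) (v b)))"
    unfolding linner_def lax_def
    by (intro sum.cong refl) (simp add: pinner_add_left pinner_scale_left pinner_sum_left sum_distrib_left)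
  also have "\<dots> = (\<Sum>b=1..D. (1 - tau) * of_nat b * pinner (D - b) (u b) (v b))
     + (\<Sum>b=1..D. \<Sum>a\<in>{b<..D}. pinner (D - a) (pder (a - b) (v b)) (u a))
     + (\<Sum>b=1..D. \<Sum>a\<in>{1..<b}. pinner (D - b) (pder (b - a) (u a)) (v b))"
  proof -
    have eq: "tau * pinner (D - b) (pmul (a - b) (u a)) (v b) = pinner (D - a) (pder (a - b) (v b)) (u a)"
      if "a \<in> {b<..D}" for a b
    proof -
      have "0 < a - b" "a - b \<le> D - b" "D - b - (a - b) = D - a" using that by auto
      then show ?thesis
        using pinner_adjoint[of "a - b" "D - b" "u a" "v b"] pinner_commute by metis
    qed
    show ?thesis
      unfolding sum.distrib by (intro arg_cong2[of _ _ _ _ plus] sum.cong refl eq)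
  qed
  also have "(\<Sum>b=1..D. \<Sum>a\<in>{b<..D}. pinner (D - a) (pder (a - b) (v b)) (u a))
      = (\<Sum>b=1..D. \<Sum>a\<in>{1..<b}. pinner (D - b) (pder (b - a) (v a)) (u b))"
    unfolding sum.Sigma[OF finite_atLeastAtMost ballI[OF finite_greaterThanAtMost]] sum.Sigma[OF finite_atLeastAtMost ballI[OF finite_atLeastLessThan]]
    by (rule sum.reindex_bij_witness[of _ prod.swap prod.swap]) auto
  finally show ?thesis .
qed

lemma lax_self_adjoint: "linner D (lax D u) v = linner D u (lax D v)"
proof -
  have "linner D u (lax D v) = linner D (lax D v) u" by (simp add: linner_def pinner_commute)
  then show ?thesis unfolding linner_lax by (simp add: pinner_commute add_ac)
qed

lemma lax_pow_self_adjoint: "linner D ((lax D ^^ k) u) v = linner D u ((lax D ^^ k) v)"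
  by (induction k arbitrary: u) (simp_all add: lax_self_adjoint funpow_swap1)

text \<open>A row of multiplications times a power of the Lax matrix times a column of derivations.
  Row and column are adjoint up to \<open>tau\<close>, so self-adjointness is inherited from the
  matrix.\<close>

definition tower :: "nat \<Rightarrow> nat \<Rightarrow> (nat multiset \<Rightarrow> ratfun) \<Rightarrow> nat multiset \<Rightarrow> ratfun" where
  "tower k D c N = (\<Sum>a=1..D. pmul a ((lax D ^^ k) (\<lambda>b. pder b c) a) N)"

lemma tower_self_adjoint: "pinner D (tower k D c) c' = pinner D c (tower k D c')"
proof -
  have *: "tau * pinner D (tower k D c) c' = linner D ((lax D ^^ k) (\<lambda>b. pder b c)) (\<lambda>b. pder b c')" for c c'
  proof -
    have "tau * pinner D (tower k D c) c' = (\<Sum>a=1..D. tau * pinner D (pmul a ((lax D ^^ k) (\<lambda>b. pder b c) a)) c')"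
      unfolding tower_def pinner_sum_left by (rule sum_distrib_left)
    also have "\<dots> = linner D ((lax D ^^ k) (\<lambda>b. pder b c)) (\<lambda>b. pder b c')"
      unfolding linner_def by (intro sum.cong refl) (simp add: pinner_adjoint)
    finally show ?thesis .
  qed
  have "tau * pinner D (tower k D c) c' = tau * pinner D (tower k D c') c"
  proof -
    have "linner D ((lax D ^^ k) (\<lambda>b. pder b c)) (\<lambda>b. pder b c') = linner D (\<lambda>b. pder b c) ((lax D ^^ k) (\<lambda>b. pder b c'))"
      by (rule lax_pow_self_adjoint)
    also have "\<dots> = linner D ((lax D ^^ k) (\<lambda>b. pder b c')) (\<lambda>b. pder b c)"
      unfolding linner_def by (intro sum.cong refl pinner_commute)
    finally show ?thesis by (simp only: *)
  qed
  then show ?thesis using tau_pos by (simp add: pinner_commute)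
qed

section \<open>The Lax matrix in monomial coordinates\<close>

definition shift_series :: "nat \<Rightarrow> 'a::zero mseries \<Rightarrow> 'a mseries" where
  "shift_series a f e = (if a \<le> lookup e 0 then f (e - Poly_Mapping.single 0 a) else 0)"

text \<open>The series sum of x_0^a u_a, where u_a involves all variables including x_0.\<close>

definition lift_series :: "(nat \<Rightarrow> nat multiset \<Rightarrow> ratfun) \<Rightarrow> ratfun mseries" where
  "lift_series u e = (\<Sum>a=1..lookup e 0. psum_series (u a) (e - Poly_Mapping.single 0 a))"

text \<open>For a series h divisible by x_0 this is the coefficient at \<open>e\<close> of (x_j h -
  x_0 h') / (x_0 - x_j), where h' is h with x_0 and x_j exchanged. Divisibility is why the second
  sum starts at 1.\<close>

definition exch :: "nat \<Rightarrow> ratfun mseries \<Rightarrow> ratfun mseries" where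
  "exch j h e = (let s = lookup e 0 + lookup e j in
     (\<Sum>a\<in>{max (lookup e 0) (lookup e j)<..s}. h (upd2 0 j e a (s - a)))
   - (\<Sum>a\<in>{1..min (lookup e 0) (lookup e j)}. h (upd2 0 j e a (s - a))))"

text \<open>With t for the first argument of \<open>G\<close>, the summand is invariant under t -> r
  - t. Reflected in this way, the subtracted sum consists of the terms of the first one with t at
  least \<open>max c d\<close>. What remains is the left hand side, up to one more reflection if
  \<open>c < d\<close>.\<close>

lemma exchange_sum:
  fixes G :: "nat \<Rightarrow> nat \<Rightarrow> 'a::ab_group_add"
  assumes sym: "\<And>t t'. G t t' = G t' t" and a: "1 \<le> a"
  shows "(\<Sum>b\<in>{b\<in>{1..<a}. b \<le> c \<and> a - b \<le> d}. G (c - b) (d - (a - b)))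
    = (\<Sum>x\<in>{x\<in>{max c d<..c + d}. a \<le> x}. G (x - a) (c + d - x))
    - (\<Sum>x\<in>{x\<in>{1..min c d}. a \<le> x}. G (x - a) (c + d - x))"
proof (cases "a \<le> c + d")
  case False
  then have "{b\<in>{1..<a}. b \<le> c \<and> a - b \<le> d} = {}" "{x\<in>{max c d<..c + d}. a \<le> x} = {}" "{x\<in>{1..min c d}. a \<le> x} = {}"
    by auto
  then show ?thesis by (simp only: sum.empty diff_zero)
next
  case True
  define r where "r = c + d - a"
  define F where "F t = G t (r - t)" for t
  let ?M = "max c d"
  define T where "T = {t. ?M < t + a \<and> t < ?M \<and> t \<le> r}"
  define T1 where "T1 = {t. c < t + a \<and> t < c \<and> t \<le> r}"
  define U where "U = {t. ?M \<le> t \<and> t \<le> r}"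
  have fin: "finite T" "finite U" by (auto simp: T_def U_def)
  have L: "(\<Sum>b\<in>{b\<in>{1..<a}. b \<le> c \<and> a - b \<le> d}. G (c - b) (d - (a - b))) = sum F T1"
    by (rule sum.reindex_bij_witness[of _ "\<lambda>t. c - t" "\<lambda>b. c - b"])
      (use a True in \<open>auto simp: T1_def F_def r_def intro!: arg_cong2[of _ _ _ _ G]\<close>)
  have R1: "(\<Sum>x\<in>{x\<in>{?M<..c + d}. a \<le> x}. G (x - a) (c + d - x)) = sum F (T \<union> U)"
    by (rule sum.reindex_bij_witness[of _ "\<lambda>t. t + a" "\<lambda>x. x - a"])
      (use a True in \<open>auto simp: T_def U_def F_def r_def intro!: arg_cong2[of _ _ _ _ G]\<close>)
  have refl: "F (r - t) = F t" if "t \<le> r" for t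
    using that sym[of "r - t" t] by (simp add: F_def)
  have R2: "(\<Sum>x\<in>{x\<in>{1..min c d}. a \<le> x}. G (x - a) (c + d - x)) = sum F U"
  proof (rule sum.reindex_bij_witness[of _ "\<lambda>t. r - t + a" "\<lambda>x. r - (x - a)"])
    fix x assume x: "x \<in> {x\<in>{1..min c d}. a \<le> x}"
    have "G (x - a) (c + d - x) = F (x - a)" using x True by (auto simp: F_def r_def intro!: arg_cong2[of _ _ _ _ G])
    moreover have "x - a \<le> r" using x by (auto simp: r_def)
    ultimately show "F (r - (x - a)) = G (x - a) (c + d - x)" using refl[of "x - a"] by (simp only:)
  qed (use a True in \<open>auto simp: U_def r_def\<close>)
  have "T \<inter> U = {}" by (auto simp: T_def U_def)
  then have "sum F (T \<union> U) - sum F U = sum F T" using fin by (simp add: sum.union_disjoint)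
  moreover have "sum F T1 = sum F T"
  proof (cases "d \<le> c")
    case True
    then have "?M = c" by simp
    then show ?thesis by (simp add: T_def T1_def)
  next
    case False
    then have M: "?M = d" by simp
    show ?thesis
    proof (rule sum.reindex_bij_witness[of _ "\<lambda>t. r - t" "\<lambda>t. r - t"])
      fix t assume "t \<in> T1"
      then show "F (r - t) = F t" by (intro refl) (simp add: T1_def)
    qed (use a True False in \<open>auto simp: T_def T1_def M r_def\<close>)
  qed
  ultimately show ?thesis unfolding L R1 R2 by simp
qed

text \<open>The geometric sum of x_0^b x_j^(a-b) over 0 < b < a equals (x_j x_0^a - x_0 x_j^a) /
  (x_0 - x_j), which for symmetric \<open>f\<close> is the operator behind \<open>exch\<close>. The
  variable x_0 in p_(a-b) contributes x_0^a once for each b.\<close>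

lemma shift_mul_psum:
  assumes f: "symmetric_series f" and a: "1 \<le> a"
  shows "(\<Sum>b\<in>{1..<a}. if b \<le> lookup e 0 then mul_psum (a - b) f (e - Poly_Mapping.single 0 b) else 0)
    = of_nat (a - 1) * shift_series a f e + (\<Sum>j\<in>keys e - {0}. exch j (shift_series a f) e)"
proof -
  let ?s = "Poly_Mapping.single :: nat \<Rightarrow> nat \<Rightarrow> expvec"
  let ?g = "\<lambda>b i. if b \<le> lookup e 0 \<and> a - b \<le> lookup (e - ?s 0 b) i then f (e - ?s 0 b - ?s i (a - b)) else 0"
  let ?A = "insert 0 (keys e - {0})"
  have "(\<Sum>b\<in>{1..<a}. if b \<le> lookup e 0 then mul_psum (a - b) f (e - ?s 0 b) else 0)
      = (\<Sum>b\<in>{1..<a}. \<Sum>i\<in>?A. ?g b i)"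
  proof (intro sum.cong refl)
    fix b assume b: "b \<in> {1..<a}"
    have "mul_psum (a - b) f (e - ?s 0 b) = (\<Sum>i\<in>?A. if a - b \<le> lookup (e - ?s 0 b) i then f (e - ?s 0 b - ?s i (a - b)) else 0)"
      by (rule mul_psum_superset) (use b keys_minus_subset[of e "?s 0 b"] in auto)
    then show "(if b \<le> lookup e 0 then mul_psum (a - b) f (e - ?s 0 b) else 0) = (\<Sum>i\<in>?A. ?g b i)"
      by (cases "b \<le> lookup e 0") (simp_all only: if_True if_False simp_thms sum.neutral_const)
  qed
  also have "\<dots> = (\<Sum>i\<in>?A. \<Sum>b\<in>{1..<a}. ?g b i)" by (rule sum.swap)
  also have "\<dots> = (\<Sum>b\<in>{1..<a}. ?g b 0) + (\<Sum>i\<in>keys e - {0}. \<Sum>b\<in>{1..<a}. ?g b i)"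
    by (rule sum.insert) auto
  also have "(\<Sum>b\<in>{1..<a}. ?g b 0) = (\<Sum>b\<in>{1..<a}. shift_series a f e)"
  proof (intro sum.cong refl)
    fix b assume b: "b \<in> {1..<a}"
    have "e - ?s 0 b - ?s 0 (a - b) = e - ?s 0 a"
      using b by (simp add: diff_diff_add flip: single_add)
    then show "?g b 0 = shift_series a f e"
      using b by (auto simp: shift_series_def lookup_minus)
  qed
  also have "\<dots> = of_nat (a - 1) * shift_series a f e" by simp
  also have "(\<Sum>i\<in>keys e - {0}. \<Sum>b\<in>{1..<a}. ?g b i) = (\<Sum>j\<in>keys e - {0}. exch j (shift_series a f) e)"
  proof (intro sum.cong refl)
    fix j assume j: "j \<in> keys e - {0}"
    then have j0: "j \<noteq> 0" by simp
    define G where "G t t' = f (upd2 0 j e t t')" for t t'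
    have Gsym: "G t t' = G t' t" for t t'
    proof -
      have "upd2 0 j e t t' = eswap 0 j (upd2 0 j e t' t)"
        using j0 by (intro poly_mapping_eqI) (simp add: lookup_upd2 lookup_eswap)
      then show ?thesis unfolding G_def by (intro symmetric_seriesD[OF f]) simp
    qed
    let ?c = "lookup e 0" and ?d = "lookup e j"
    have "(\<Sum>b\<in>{1..<a}. ?g b j) = (\<Sum>b\<in>{1..<a}. if b \<le> ?c \<and> a - b \<le> ?d then G (?c - b) (?d - (a - b)) else 0)"
    proof (intro sum.cong refl)
      fix b
      have "e - ?s 0 b - ?s j (a - b) = upd2 0 j e (?c - b) (?d - (a - b))"
        using j0 by (intro poly_mapping_eqI) (auto simp: lookup_upd2 lookup_minus lookup_single when_def)
      moreover have "lookup (e - ?s 0 b) j = ?d" using j0 by (simp add: lookup_minus lookup_single)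
      ultimately show "?g b j = (if b \<le> ?c \<and> a - b \<le> ?d then G (?c - b) (?d - (a - b)) else 0)"
        by (simp add: G_def)
    qed
    also have "\<dots> = (\<Sum>b\<in>{b\<in>{1..<a}. b \<le> ?c \<and> a - b \<le> ?d}. G (?c - b) (?d - (a - b)))"
      by (rule sum.inter_filter[symmetric]) simp
    also have "\<dots> = (\<Sum>x\<in>{x\<in>{max ?c ?d<..?c + ?d}. a \<le> x}. G (x - a) (?c + ?d - x))
        - (\<Sum>x\<in>{x\<in>{1..min ?c ?d}. a \<le> x}. G (x - a) (?c + ?d - x))"
      by (rule exchange_sum[OF Gsym a])
    also have "\<dots> = (\<Sum>x\<in>{max ?c ?d<..?c + ?d}. if a \<le> x then G (x - a) (?c + ?d - x) else 0)
        - (\<Sum>x\<in>{1..min ?c ?d}. if a \<le> x then G (x - a) (?c + ?d - x) else 0)"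
      by (subst (1 2) sum.inter_filter) simp_all
    also have "\<dots> = exch j (shift_series a f) e"
    proof -
      have "shift_series a f (upd2 0 j e x (?c + ?d - x)) = (if a \<le> x then G (x - a) (?c + ?d - x) else 0)" for x
      proof -
        have "upd2 0 j e x (?c + ?d - x) - ?s 0 a = upd2 0 j e (x - a) (?c + ?d - x)"
          by (intro poly_mapping_eqI) (auto simp: lookup_upd2 lookup_minus lookup_single when_def)
        then show ?thesis by (simp add: shift_series_def lookup_upd2 G_def)
      qed
      then show ?thesis by (simp add: exch_def Let_def)
    qed
    finally show "(\<Sum>b\<in>{1..<a}. ?g b j) = exch j (shift_series a f) e" .
  qed
  finally show ?thesis .
qed

lemma exch_cong:
  assumes "\<And>e'. part_size e' = part_size e \<Longrightarrow> h e' = h' e'" "j \<noteq> 0"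
  shows "exch j h e = exch j h' e"
proof -
  have "h (upd2 0 j e a (lookup e 0 + lookup e j - a)) = h' (upd2 0 j e a (lookup e 0 + lookup e j - a))"
    if "a \<le> lookup e 0 + lookup e j" for a
    using assms that by (intro assms(1) part_size_upd2) auto
  then show ?thesis
    unfolding exch_def Let_def by (intro arg_cong2[of _ _ _ _ minus] sum.cong) auto
qed

lemma exch_sum: "exch j (\<lambda>e. \<Sum>x\<in>A. h x e) e = (\<Sum>x\<in>A. exch j (h x) e)"
  unfolding exch_def Let_def sum_subtractf by (subst (1 2) sum.swap) simp

lemma lift_series_shift:
  assumes "part_size e = D"
  shows "lift_series u e = (\<Sum>a=1..D. shift_series a (psum_series (u a)) e)"
proof -
  have "lookup e 0 \<le> D" using lookup_le_part_size[of e 0] assms by simp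
  then have "(\<Sum>a=1..lookup e 0. shift_series a (psum_series (u a)) e) = (\<Sum>a=1..D. shift_series a (psum_series (u a)) e)"
    by (intro sum.mono_neutral_left) (auto simp: shift_series_def)
  then show ?thesis by (simp add: lift_series_def shift_series_def)
qed

text \<open>The derivations and the summand b of the diagonal combine to the Euler operator of x_0.
  The multiplications give the exchange terms and (a - 1) x_0^a u_a; against the summand -tau b of
  the diagonal only the term with \<open>- tau\<close> is left.\<close>

lemma lift_series_lax:
  assumes D: "part_size e = D"
  shows "lift_series (lax D u) e = (of_nat (lookup e 0) - tau) * lift_series u e
     + tau * (\<Sum>j\<in>keys e - {0}. exch j (lift_series u) e)"
proof -
  let ?s = "\<lambda>b. e - Poly_Mapping.single 0 b"
  let ?A = "\<lambda>a. psum_series (u a)"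
  let ?c = "lookup e 0"
  have cD: "?c \<le> D" using lookup_le_part_size[of e 0] D by simp
  have "lift_series (lax D u) e = (\<Sum>b=1..?c. (1 - tau) * of_nat b * ?A b (?s b)
      + tau * (\<Sum>a\<in>{b<..D}. mul_psum (a - b) (?A a) (?s b)) + (\<Sum>a\<in>{1..<b}. psum_series (pder (b - a) (u a)) (?s b)))"
    unfolding lift_series_def
  proof (intro sum.cong refl)
    fix b
    have "lax D u b = (\<lambda>N. (1 - tau) * of_nat b * u b N + tau * (\<Sum>a\<in>{b<..D}. pmul (a - b) (u a) N)
     + (\<Sum>a\<in>{1..<b}. pder (b - a) (u a) N))" by (simp add: fun_eq_iff lax_def)
    then show "psum_series (lax D u b) (?s b) = (1 - tau) * of_nat b * ?A b (?s b)
      + tau * (\<Sum>a\<in>{b<..D}. mul_psum (a - b) (?A a) (?s b)) + (\<Sum>a\<in>{1..<b}. psum_series (pder (b - a) (u a)) (?s b))"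
      by (simp only: psum_series_add psum_series_scale psum_series_sum) (simp add: psum_series_pmul)
  qed
  also have "\<dots> = ((\<Sum>b=1..?c. of_nat b * ?A b (?s b)) + (\<Sum>b=1..?c. \<Sum>a\<in>{1..<b}. psum_series (pder (b - a) (u a)) (?s b)))
      + tau * ((\<Sum>b=1..?c. \<Sum>a\<in>{b<..D}. mul_psum (a - b) (?A a) (?s b)) - (\<Sum>b=1..?c. of_nat b * ?A b (?s b)))"
    by (simp add: sum.distrib sum_distrib_left algebra_simps sum_subtractf)
  also have "(\<Sum>b=1..?c. of_nat b * ?A b (?s b)) + (\<Sum>b=1..?c. \<Sum>a\<in>{1..<b}. psum_series (pder (b - a) (u a)) (?s b))
      = of_nat ?c * lift_series u e"
  proof -
    have "of_nat ?c * ?A a (?s a) = of_nat a * ?A a (?s a) + (\<Sum>b\<in>{a<..?c}. psum_series (pder (b - a) (u a)) (?s b))"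
      if "a \<in> {1..?c}" for a
    proof -
      have lk: "lookup (?s a) 0 = ?c - a" by (simp add: lookup_minus)
      have "of_nat (?c - a) * ?A a (?s a) = (\<Sum>k=1..?c - a. psum_series (pder k (u a)) (?s a - Poly_Mapping.single 0 k))"
        using psum_series_euler[of "?s a" "u a"] unfolding lk .
      also have "\<dots> = (\<Sum>b\<in>{a<..?c}. psum_series (pder (b - a) (u a)) (?s b))"
        by (rule sum.reindex_bij_witness[of _ "\<lambda>b. b - a" "\<lambda>k. a + k"])
          (use that in \<open>auto simp: diff_diff_add single_add\<close>)
      finally have "of_nat (?c - a) * ?A a (?s a) = \<dots>" .
      moreover have "(of_nat ?c :: ratfun) = of_nat a + of_nat (?c - a)"
        using that by (simp flip: of_nat_add)
      ultimately show ?thesis by (simp add: distrib_right)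
    qed
    then have "of_nat ?c * lift_series u e = (\<Sum>a=1..?c. of_nat a * ?A a (?s a))
        + (\<Sum>a=1..?c. \<Sum>b\<in>{a<..?c}. psum_series (pder (b - a) (u a)) (?s b))"
      by (simp add: lift_series_def sum_distrib_left sum.distrib)
    also have "(\<Sum>a=1..?c. \<Sum>b\<in>{a<..?c}. psum_series (pder (b - a) (u a)) (?s b))
       = (\<Sum>b=1..?c. \<Sum>a\<in>{1..<b}. psum_series (pder (b - a) (u a)) (?s b))"
      unfolding sum.Sigma[OF finite_atLeastAtMost ballI[OF finite_greaterThanAtMost]] sum.Sigma[OF finite_atLeastAtMost ballI[OF finite_atLeastLessThan]]
      by (rule sum.reindex_bij_witness[of _ prod.swap prod.swap]) auto
    finally show ?thesis by simp
  qed
  also have "(\<Sum>b=1..?c. \<Sum>a\<in>{b<..D}. mul_psum (a - b) (?A a) (?s b)) - (\<Sum>b=1..?c. of_nat b * ?A b (?s b))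
      = (\<Sum>j\<in>keys e - {0}. exch j (lift_series u) e) - lift_series u e"
  proof -
    have "(\<Sum>b=1..?c. \<Sum>a\<in>{b<..D}. mul_psum (a - b) (?A a) (?s b))
        = (\<Sum>b=1..D. \<Sum>a\<in>{b<..D}. if b \<le> ?c then mul_psum (a - b) (?A a) (?s b) else 0)"
      using cD by (intro sum.mono_neutral_cong_left) auto
    also have "\<dots> = (\<Sum>a=1..D. \<Sum>b\<in>{1..<a}. if b \<le> ?c then mul_psum (a - b) (?A a) (?s b) else 0)"
      unfolding sum.Sigma[OF finite_atLeastAtMost ballI[OF finite_greaterThanAtMost]] sum.Sigma[OF finite_atLeastAtMost ballI[OF finite_atLeastLessThan]]
      by (rule sum.reindex_bij_witness[of _ prod.swap prod.swap]) auto
    also have "\<dots> = (\<Sum>a=1..D. of_nat (a - 1) * shift_series a (?A a) e + (\<Sum>j\<in>keys e - {0}. exch j (shift_series a (?A a)) e))"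
      by (intro sum.cong refl shift_mul_psum symmetric_psum_series) auto
    also have "\<dots> = (\<Sum>a=1..D. of_nat a * shift_series a (?A a) e) - (\<Sum>a=1..D. shift_series a (?A a) e)
        + (\<Sum>a=1..D. \<Sum>j\<in>keys e - {0}. exch j (shift_series a (?A a)) e)"
      unfolding sum.distrib sum_subtractf[symmetric]
      by (intro arg_cong2[of _ _ _ _ plus] sum.cong refl) (auto simp: algebra_simps of_nat_diff)
    also have "(\<Sum>a=1..D. shift_series a (?A a) e) = lift_series u e"
      by (rule lift_series_shift[OF D, symmetric])
    also have "(\<Sum>a=1..D. \<Sum>j\<in>keys e - {0}. exch j (shift_series a (?A a)) e)
        = (\<Sum>j\<in>keys e - {0}. exch j (lift_series u) e)"
    proof -
      have eq: "exch j (lift_series u) e = (\<Sum>a=1..D. exch j (shift_series a (?A a)) e)" if "j \<noteq> 0" for j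
      proof -
        have "exch j (lift_series u) e = exch j (\<lambda>e. \<Sum>a=1..D. shift_series a (?A a) e) e"
          by (rule exch_cong) (use D that in \<open>auto simp: lift_series_shift\<close>)
        then show ?thesis by (simp add: exch_sum)
      qed
      show ?thesis by (subst sum.swap, intro sum.cong refl eq[symmetric]) auto
    qed
    also have "(\<Sum>a=1..D. of_nat a * shift_series a (?A a) e) = (\<Sum>b=1..?c. of_nat b * ?A b (?s b))"
      using cD by (intro sum.mono_neutral_cong_right) (auto simp: shift_series_def)
    finally show ?thesis by simp
  qed
  finally show ?thesis by (simp add: algebra_simps)
qed

text \<open>Iterates of Heckman's differential-reflection operator, lowered by \<open>tau\<close>
  for each variable so that it survives infinitely many of them: positions \<open>j\<close> outside
  \<open>keys e\<close> would contribute 0.\<close>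

primrec xt :: "nat \<Rightarrow> ratfun mseries \<Rightarrow> ratfun mseries" where
  "xt 0 f = (\<lambda>e. of_nat (lookup e 0) * f e)"
| "xt (Suc k) f = (\<lambda>e. (of_nat (lookup e 0) - tau) * xt k f e + tau * (\<Sum>j\<in>keys e - {0}. exch j (xt k f) e))"

text \<open>Each variable takes the role of x_0 in turn, which makes the result symmetric
  again.\<close>

definition xtower :: "nat \<Rightarrow> ratfun mseries \<Rightarrow> ratfun mseries" where
  "xtower k f e = (\<Sum>i\<in>keys e. xt k f (eswap 0 i e))"

lemma lift_series_tower:
  assumes "part_size e = D"
  shows "lift_series ((lax D ^^ k) (\<lambda>b. pder b c)) e = xt k (psum_series c) e"
  using assms
proof (induction k arbitrary: e)
  case 0
  then show ?case by (simp add: lift_series_def psum_series_euler)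
next
  case (Suc k)
  have "exch j (lift_series ((lax D ^^ k) (\<lambda>b. pder b c))) e = exch j (xt k (psum_series c)) e" if "j \<noteq> 0" for j
    by (rule exch_cong) (use Suc that in auto)
  then have "(\<Sum>j\<in>keys e - {0}. exch j (lift_series ((lax D ^^ k) (\<lambda>b. pder b c))) e) = (\<Sum>j\<in>keys e - {0}. exch j (xt k (psum_series c)) e)"
    by (intro sum.cong) auto
  then show ?case using Suc by (simp add: lift_series_lax)
qed

text \<open>Two faces of one operator: self-adjointness is visible in power sum coordinates,
  triangularity in monomial ones.\<close>

lemma psum_series_tower:
  assumes "part_size e = D"
  shows "psum_series (tower k D c) e = xtower k (psum_series c) e"
proof -
  let ?u = "(lax D ^^ k) (\<lambda>b. pder b c)"
  have "psum_series (tower k D c) e = (\<Sum>a=1..D. mul_psum a (psum_series (?u a)) e)"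
  proof -
    have "tower k D c = (\<lambda>N. \<Sum>a=1..D. pmul a (?u a) N)" by (simp add: fun_eq_iff tower_def)
    then show ?thesis by (simp only: psum_series_sum) (simp add: psum_series_pmul)
  qed
  also have "\<dots> = (\<Sum>a=1..D. \<Sum>i\<in>keys e. shift_series a (psum_series (?u a)) (eswap 0 i e))"
  proof (intro sum.cong refl)
    fix a assume a: "a \<in> {1..D}"
    have "psum_series (?u a) (e - Poly_Mapping.single i a) = psum_series (?u a) (eswap 0 i e - Poly_Mapping.single 0 a)" for i
    proof (rule symmetric_seriesD[OF symmetric_psum_series])
      have "eswap 0 i e - Poly_Mapping.single 0 a = eswap 0 i (e - Poly_Mapping.single i a)"
        by (intro poly_mapping_eqI) (auto simp: lookup_eswap lookup_minus lookup_single when_def)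
      then show "shape (e - Poly_Mapping.single i a) = shape (eswap 0 i e - Poly_Mapping.single 0 a)" by simp
    qed
    then show "mul_psum a (psum_series (?u a)) e = (\<Sum>i\<in>keys e. shift_series a (psum_series (?u a)) (eswap 0 i e))"
      using a by (simp add: mul_psum_def shift_series_def lookup_eswap cong: if_cong)
  qed
  also have "\<dots> = (\<Sum>i\<in>keys e. lift_series ?u (eswap 0 i e))"
    using assms by (subst sum.swap) (simp add: lift_series_shift[of _ D])
  also have "\<dots> = xtower k (psum_series c) e"
    using assms by (simp add: xtower_def lift_series_tower)
  finally show ?thesis .
qed

text \<open>\<open>exch\<close> reads its argument only at vectors whose two entries lie at least as
  far apart as those of \<open>e\<close>, so \<open>dominates_squeeze\<close> applies. With a set
  \<open>M\<close> of bounds the statement also covers series supported strictly below a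
  partition.\<close>

lemma xt_support:
  assumes "\<And>e. f e \<noteq> 0 \<Longrightarrow> \<exists>m\<in>M. dominates m e" "xt k f e \<noteq> 0"
  shows "\<exists>m\<in>M. dominates m e"
  using assms(2)
proof (induction k arbitrary: e)
  case 0
  then show ?case using assms(1) by auto
next
  case (Suc k)
  show ?case
  proof (cases "xt k f e = 0")
    case True
    then have "(\<Sum>j\<in>keys e - {0}. exch j (xt k f) e) \<noteq> 0" using Suc.prems by auto
    then obtain j where j: "j \<in> keys e - {0}" "exch j (xt k f) e \<noteq> 0"
      by (meson sum.not_neutral_contains_not_neutral)
    let ?s = "lookup e 0 + lookup e j"
    have "\<exists>a. (a \<in> {max (lookup e 0) (lookup e j)<..?s} \<or> a \<in> {1..min (lookup e 0) (lookup e j)}) \<and> xt k f (upd2 0 j e a (?s - a)) \<noteq> 0"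
    proof (rule ccontr)
      assume n: "\<not> ?thesis"
      have "(\<Sum>a\<in>{max (lookup e 0) (lookup e j)<..?s}. xt k f (upd2 0 j e a (?s - a))) = 0"
           "(\<Sum>a\<in>{1..min (lookup e 0) (lookup e j)}. xt k f (upd2 0 j e a (?s - a))) = 0"
        using n by (intro sum.neutral ballI; blast)+
      then show False using j(2) by (simp add: exch_def)
    qed
    then obtain a where a: "a \<in> {max (lookup e 0) (lookup e j)<..?s} \<or> a \<in> {1..min (lookup e 0) (lookup e j)}"
      "xt k f (upd2 0 j e a (?s - a)) \<noteq> 0" by blast
    obtain m where m: "m \<in> M" "dominates m (upd2 0 j e a (?s - a))" using Suc.IH[OF a(2)] by blast
    have "dominates m e"
      by (rule dominates_squeeze[OF m(2)]) (use j a(1) in auto)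
    then show ?thesis using m by blast
  qed (rule Suc.IH)
qed

lemma xtower_support:
  assumes "\<And>e. f e \<noteq> 0 \<Longrightarrow> \<exists>m\<in>M. dominates m e" "xtower k f e \<noteq> 0"
  shows "\<exists>m\<in>M. dominates m e"
proof -
  obtain i where "xt k f (eswap 0 i e) \<noteq> 0"
    using assms(2) unfolding xtower_def by (meson sum.not_neutral_contains_not_neutral)
  then obtain m where "m \<in> M" "dominates m (eswap 0 i e)" using xt_support assms(1) by blast
  then show ?thesis using dominates_shape[OF shape_eswap] by blast
qed

lemma exch_add: "exch j (\<lambda>e. f e + g e) e = exch j f e + exch j g e"
  by (simp add: exch_def Let_def sum.distrib)

lemma xt_add: "xt k (\<lambda>e. f e + g e) = (\<lambda>e. xt k f e + xt k g e)"
proof (induction k)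
  case (Suc k)
  show ?case by (rule ext) (simp add: Suc exch_add algebra_simps sum.distrib)
qed (simp add: distrib_left)

lemma xtower_add: "xtower k (\<lambda>e. f e + g e) e = xtower k f e + xtower k g e"
  by (simp add: xtower_def xt_add sum.distrib)

section \<open>Eigenvalues at \<open>tau\<close> = 0\<close>

definition const_term :: "ratfun \<Rightarrow> rat \<Rightarrow> bool" where
  "const_term r v \<longleftrightarrow> (\<exists>q. r = Fract q 1 \<and> poly q 0 = v)"

lemma const_term_unique: "const_term r v \<Longrightarrow> const_term r w \<Longrightarrow> v = w"
  by (auto simp: const_term_def eq_fract)

lemma const_term_add: "const_term r v \<Longrightarrow> const_term r' v' \<Longrightarrow> const_term (r + r') (v + v')"
  unfolding const_term_def
  by (elim exE conjE, rule_tac x = "q + qa" in exI) auto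

lemma const_term_diff: "const_term r v \<Longrightarrow> const_term r' v' \<Longrightarrow> const_term (r - r') (v - v')"
  unfolding const_term_def
  by (elim exE conjE, rule_tac x = "q - qa" in exI) auto

lemma const_term_mult: "const_term r v \<Longrightarrow> const_term r' v' \<Longrightarrow> const_term (r * r') (v * v')"
  unfolding const_term_def
  by (elim exE conjE, rule_tac x = "q * qa" in exI) auto

lemma const_term_of_nat: "const_term (of_nat n) (of_nat n)"
  unfolding const_term_def by (rule exI[of _ "of_nat n"]) (simp add: of_nat_fract)

lemma const_term_0: "const_term 0 0" and const_term_1: "const_term 1 1"
  using const_term_of_nat[of 0] const_term_of_nat[of 1] by simp_all

lemma const_term_tau: "const_term tau 0"
  unfolding const_term_def tau_def by auto

lemma const_term_sum: "(\<And>x. x \<in> A \<Longrightarrow> const_term (r x) (v x)) \<Longrightarrow> const_term (sum r A) (sum v A)"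
  by (induction A rule: infinite_finite_induct) (simp_all add: const_term_0 const_term_add)

text \<open>The exchange terms carry a factor \<open>tau\<close>; at \<open>tau\<close> = 0 only the
  multiplication by the exponent of x_0 is left.\<close>

lemma const_term_xt:
  assumes "\<And>e. const_term (f e) (g e)"
  shows "const_term (xt k f e) (of_nat (lookup e 0) ^ Suc k * g e)"
proof (induction k arbitrary: e)
  case 0
  then show ?case using assms by (simp add: const_term_mult const_term_of_nat)
next
  case (Suc k)
  let ?g = "\<lambda>e. of_nat (lookup e 0) ^ Suc k * g e :: rat"
  have ex: "\<exists>v. const_term (exch j (xt k f) e) v" for j
  proof -
    let ?s = "lookup e 0 + lookup e j"
    have "const_term (exch j (xt k f) e) ((\<Sum>a\<in>{max (lookup e 0) (lookup e j)<..?s}. ?g (upd2 0 j e a (?s - a)))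
        - (\<Sum>a\<in>{1..min (lookup e 0) (lookup e j)}. ?g (upd2 0 j e a (?s - a))))"
      unfolding exch_def Let_def by (intro const_term_diff const_term_sum Suc.IH)
    then show ?thesis by blast
  qed
  then obtain v where v: "\<And>j. const_term (exch j (xt k f) e) (v j)" by metis
  have "const_term (xt (Suc k) f e) ((of_nat (lookup e 0) - 0) * ?g e + 0 * (\<Sum>j\<in>keys e - {0}. v j))"
    unfolding xt.simps
    by (intro const_term_add const_term_mult const_term_diff const_term_of_nat const_term_tau const_term_sum Suc.IH v)
  then show ?case by (simp add: mult.assoc)
qed

lemma const_term_xtower:
  assumes "\<And>e. const_term (f e) (g e)"
  shows "const_term (xtower k f e) (\<Sum>i\<in>keys e. of_nat (lookup e i) ^ Suc k * g (eswap 0 i e))"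
proof -
  have "const_term (xtower k f e) (\<Sum>i\<in>keys e. of_nat (lookup (eswap 0 i e) 0) ^ Suc k * g (eswap 0 i e))"
    unfolding xtower_def by (intro const_term_sum const_term_xt assms)
  then show ?thesis by (simp add: lookup_eswap)
qed

text \<open>Equal power sums mean that the differences of multiplicities are annihilated by x q(x)
  for every polynomial q. Choosing q to vanish at all values but \<open>v\<close> isolates the
  multiplicity of \<open>v\<close>; the factor x does no harm because 0 does not occur.\<close>

lemma multiset_power_sums_eq:
  fixes N M :: "nat multiset"
  assumes "0 \<notin># N" "0 \<notin># M"
    and eq: "\<And>k. (\<Sum>x\<in>#N. (of_nat x :: rat) ^ Suc k) = (\<Sum>x\<in>#M. of_nat x ^ Suc k)"
  shows "N = M"
proof (rule multiset_eqI)
  fix v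
  let ?A = "set_mset N \<union> set_mset M"
  define \<delta> where "\<delta> x = (of_nat (count N x) - of_nat (count M x) :: rat)" for x
  have cnt: "(\<Sum>x\<in>#K. g x) = (\<Sum>x\<in>?A. of_nat (count K x) * g x)" if "set_mset K \<subseteq> ?A" for g :: "nat \<Rightarrow> rat" and K
    using that
  proof (induction K)
    case (add x K)
    have "(\<Sum>y\<in>?A. of_nat (count (add_mset x K) y) * g y) = (\<Sum>y\<in>?A. (if y = x then g x else 0) + of_nat (count K y) * g y)"
      by (intro sum.cong) (auto simp: algebra_simps)
    also have "\<dots> = g x + (\<Sum>y\<in>?A. of_nat (count K y) * g y)"
      using add.prems by (simp add: sum.distrib)
    finally show ?case using add by simp
  qed simp
  have z: "(\<Sum>x\<in>?A. \<delta> x * of_nat x ^ Suc k) = 0" for k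
    using eq[of k] by (simp add: cnt \<delta>_def algebra_simps sum_subtractf)
  have zp: "(\<Sum>x\<in>?A. \<delta> x * of_nat x * poly q (of_nat x)) = 0" for q
  proof -
    have "(\<Sum>x\<in>?A. \<delta> x * of_nat x * poly q (of_nat x)) = (\<Sum>x\<in>?A. \<Sum>k\<le>degree q. coeff q k * (\<delta> x * of_nat x ^ Suc k))"
      by (intro sum.cong refl) (simp add: poly_altdef sum_distrib_left algebra_simps)
    also have "\<dots> = (\<Sum>k\<le>degree q. coeff q k * (\<Sum>x\<in>?A. \<delta> x * of_nat x ^ Suc k))"
      by (subst sum.swap) (simp add: sum_distrib_left)
    finally show ?thesis by (simp only: z mult_zero_right sum.neutral_const)
  qed
  show "count N v = count M v"
  proof (cases "v \<in> ?A")
    case True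
    define q where "q = (\<Prod>u\<in>?A - {v}. [:- of_nat u, 1:] :: rat poly)"
    have pq: "poly q x = (\<Prod>u\<in>?A - {v}. x - of_nat u)" for x
      by (simp add: q_def poly_prod)
    have "(\<Sum>x\<in>?A. \<delta> x * of_nat x * poly q (of_nat x)) = (\<Sum>x\<in>{v}. \<delta> x * of_nat x * poly q (of_nat x))"
    proof (rule sum.mono_neutral_right)
      show "\<forall>x\<in>?A - {v}. \<delta> x * of_nat x * poly q (of_nat x) = 0"
      proof
        fix x assume "x \<in> ?A - {v}"
        then have "poly q (of_nat x) = 0" unfolding pq by (intro prod_zero) auto
        then show "\<delta> x * of_nat x * poly q (of_nat x) = 0" by simp
      qed
    qed (use True in auto)
    then have "\<delta> v * of_nat v * poly q (of_nat v) = 0" using zp[of q] by simp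
    moreover have "poly q (of_nat v) \<noteq> 0" unfolding pq by (subst prod_zero_iff) auto
    moreover have "v \<noteq> 0" using True assms by (auto intro: ccontr)
    ultimately show ?thesis by (simp add: \<delta>_def)
  next
    case False
    then show ?thesis by (simp add: not_in_iff del: count_eq_zero_iff)
  qed
qed

section \<open>Existence and uniqueness of the Jack symmetric functions\<close>

definition ip :: "nat \<Rightarrow> ratfun mseries \<Rightarrow> ratfun mseries \<Rightarrow> ratfun" where
  "ip d f g = pinner d (psum_coords d f) (psum_coords d g)"

lemma ip_commute: "ip d f g = ip d g f"
  by (simp add: ip_def pinner_commute)

lemma symmetric_sum:
  assumes "\<And>x. x \<in> A \<Longrightarrow> symmetric_series (f x)"
  shows "symmetric_series (\<lambda>e. \<Sum>x\<in>A. r x * f x e :: 'a::semiring_0)"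
  unfolding symmetric_series_def
proof (intro allI impI sum.cong refl)
  fix e e' :: expvec and x assume "shape e = shape e'" "x \<in> A"
  then show "r x * f x e = r x * f x e'" using symmetric_seriesD[OF assms] by metis
qed

lemma symmetric_diff:
  assumes "symmetric_series f" "symmetric_series g"
  shows "symmetric_series (\<lambda>e. f e - g e)"
  unfolding symmetric_series_def
proof (intro allI impI)
  fix e e' :: expvec assume s: "shape e = shape e'"
  show "f e - g e = f e' - g e'"
    unfolding symmetric_seriesD[OF assms(1) s] symmetric_seriesD[OF assms(2) s] ..
qed

lemma symmetric_scale:
  assumes "symmetric_series f"
  shows "symmetric_series (\<lambda>e. r * f e)"
  unfolding symmetric_series_def
proof (intro allI impI)
  fix e e' :: expvec assume s: "shape e = shape e'"
  show "r * f e = r * f e'" unfolding symmetric_seriesD[OF assms(1) s] ..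
qed

lemma symmetric_monomial_sym: "symmetric_series (monomial_sym l)"
  unfolding symmetric_series_def monomial_sym_shape by metis

lemma ip_sum_left:
  assumes "\<And>x. x \<in> A \<Longrightarrow> symmetric_series (f x)"
  shows "ip d (\<lambda>e. \<Sum>x\<in>A. r x * f x e) g = (\<Sum>x\<in>A. r x * ip d (f x) g)"
proof -
  have "psum_coords d (\<lambda>e. \<Sum>x\<in>A. r x * f x e) N = (\<Sum>x\<in>A. r x * psum_coords d (f x) N)" if "N \<in> MP d" for N
    by (rule psum_coords_eqI[OF _ symmetric_sum[OF assms] that])
      (simp_all add: psum_series_sum psum_series_scale psum_coords(2)[OF assms])
  then have "ip d (\<lambda>e. \<Sum>x\<in>A. r x * f x e) g = pinner d (\<lambda>N. \<Sum>x\<in>A. r x * psum_coords d (f x) N) (psum_coords d g)"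
    unfolding ip_def by (intro pinner_cong) auto
  then show ?thesis by (simp add: pinner_sum_left pinner_scale_left ip_def)
qed

lemma ip_diff_left:
  assumes "symmetric_series f" "symmetric_series f'"
  shows "ip d (\<lambda>e. f e - f' e) g = ip d f g - ip d f' g"
proof -
  have "psum_coords d (\<lambda>e. f e - f' e) N = psum_coords d f N - psum_coords d f' N" if "N \<in> MP d" for N
    by (rule psum_coords_eqI[OF _ symmetric_diff[OF assms] that])
      (simp add: psum_series_diff psum_coords(2)[OF assms(1)] psum_coords(2)[OF assms(2)])
  then have "ip d (\<lambda>e. f e - f' e) g = pinner d (\<lambda>N. psum_coords d f N - psum_coords d f' N) (psum_coords d g)"
    unfolding ip_def by (intro pinner_cong) auto
  then show ?thesis by (simp add: pinner_diff_left ip_def)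
qed

lemma ip_scale_left: "symmetric_series f \<Longrightarrow> ip d (\<lambda>e. r * f e) g = r * ip d f g"
  using ip_sum_left[of "{()}" "\<lambda>_. f" d "\<lambda>_. r" g] by simp

lemma ip_diff_right:
  assumes "symmetric_series f" "symmetric_series f'"
  shows "ip d g (\<lambda>e. f e - f' e) = ip d g f - ip d g f'"
  using ip_diff_left[OF assms, of d g] by (simp add: ip_commute)

lemma ip_scale_right: "symmetric_series f \<Longrightarrow> ip d g (\<lambda>e. r * f e) = r * ip d g f"
  using ip_scale_left[of f d r g] by (simp add: ip_commute)

lemma ip_sum_right:
  assumes "\<And>x. x \<in> A \<Longrightarrow> symmetric_series (f x)"
  shows "ip d g (\<lambda>e. \<Sum>x\<in>A. r x * f x e) = (\<Sum>x\<in>A. r x * ip d g (f x))"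
  using ip_sum_left[of A f d r g] assms by (simp add: ip_commute)

lemma ip_anisotropic:
  assumes "symmetric_series f" "ip d f f = 0" "part_size e = d"
  shows "f e = 0"
proof -
  have "psum_series (psum_coords d f) e = 0"
    unfolding psum_series_def assms(3) using pinner_anisotropic assms(2)[unfolded ip_def]
    by (intro sum.neutral ballI) auto
  then show ?thesis using psum_coords(2)[OF assms(1,3)] by simp
qed

lemma xt_cong:
  assumes "\<And>e. part_size e = d \<Longrightarrow> f e = g e" "part_size e = d"
  shows "xt k f e = xt k g e"
  using assms(2)
proof (induction k arbitrary: e)
  case (Suc k)
  have "exch j (xt k f) e = exch j (xt k g) e" if "j \<noteq> 0" for j
    by (rule exch_cong) (use Suc that in auto)
  then have "(\<Sum>j\<in>keys e - {0}. exch j (xt k f) e) = (\<Sum>j\<in>keys e - {0}. exch j (xt k g) e)"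
    by (intro sum.cong) auto
  then show ?case using Suc by simp
qed (simp add: assms(1))

lemma xtower_cong:
  assumes "\<And>e. part_size e = d \<Longrightarrow> f e = g e" "part_size e = d"
  shows "xtower k f e = xtower k g e"
  unfolding xtower_def by (intro sum.cong refl xt_cong[where d = d]) (use assms in auto)

definition top_op :: "nat \<Rightarrow> nat \<Rightarrow> ratfun mseries \<Rightarrow> ratfun mseries" where
  "top_op k d f e = (if part_size e = d then xtower k f e else 0)"

lemma top_op_psum:
  assumes "symmetric_series f"
  shows "top_op k d f e = (if part_size e = d then psum_series (tower k d (psum_coords d f)) e else 0)"
proof -
  show ?thesis
  proof (cases "part_size e = d")
    case True
    have "xtower k f e = xtower k (psum_series (psum_coords d f)) e"
      by (rule xtower_cong[OF _ True]) (simp add: psum_coords(2)[OF assms])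
    then show ?thesis using True by (simp add: top_op_def psum_series_tower)
  qed (simp add: top_op_def)
qed

lemma symmetric_top_op:
  assumes "symmetric_series f"
  shows "symmetric_series (top_op k d f)"
  unfolding symmetric_series_def top_op_psum[OF assms]
proof (intro allI impI)
  fix e e' :: expvec assume s: "shape e = shape e'"
  show "(if part_size e = d then psum_series (tower k d (psum_coords d f)) e else 0)
     = (if part_size e' = d then psum_series (tower k d (psum_coords d f)) e' else 0)"
    unfolding part_size_shape[OF s] symmetric_seriesD[OF symmetric_psum_series s] ..
qed

lemma psum_coords_top_op:
  assumes "symmetric_series f" "N \<in> MP d"
  shows "psum_coords d (top_op k d f) N = tower k d (psum_coords d f) N"
  by (rule psum_coords_eqI[OF _ symmetric_top_op[OF assms(1)] assms(2)]) (simp add: top_op_psum[OF assms(1)])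

lemma ip_top_op:
  assumes "symmetric_series f" "symmetric_series g"
  shows "ip d (top_op k d f) g = ip d f (top_op k d g)"
proof -
  have "ip d (top_op k d f) g = pinner d (tower k d (psum_coords d f)) (psum_coords d g)"
    unfolding ip_def by (intro pinner_cong) (auto simp: psum_coords_top_op[OF assms(1)])
  also have "\<dots> = pinner d (psum_coords d f) (tower k d (psum_coords d g))"
    by (rule tower_self_adjoint)
  also have "\<dots> = ip d f (top_op k d g)"
    unfolding ip_def by (intro pinner_cong) (auto simp: psum_coords_top_op[OF assms(2)])
  finally show ?thesis .
qed

text \<open>Gram-Schmidt for a family that may be dependent: \<open>w\<close> and the new vector are
  both projected off the old ones first. If the projected new vector has norm 0, it vanishes in
  degree \<open>d\<close> and nothing has to be subtracted.\<close>

lemma orthogonal_projection: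
  assumes "finite I" "\<And>i. i \<in> I \<Longrightarrow> symmetric_series (v i)" "symmetric_series w"
  shows "\<exists>a. \<forall>i\<in>I. ip d (\<lambda>e. w e - (\<Sum>i\<in>I. a i * v i e)) (v i) = 0"
  using assms
proof (induction I arbitrary: w rule: finite_induct)
  case (insert x I)
  have vI: "\<And>i. i \<in> I \<Longrightarrow> symmetric_series (v i)" and vx: "symmetric_series (v x)" using insert.prems by auto
  obtain a where a: "\<forall>i\<in>I. ip d (\<lambda>e. w e - (\<Sum>i\<in>I. a i * v i e)) (v i) = 0"
    using insert.IH[OF vI insert.prems(2)] by blast
  obtain b where b: "\<forall>i\<in>I. ip d (\<lambda>e. v x e - (\<Sum>i\<in>I. b i * v i e)) (v i) = 0"
    using insert.IH[OF vI vx] by blast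
  define w' where "w' = (\<lambda>e. w e - (\<Sum>i\<in>I. a i * v i e))"
  define v' where "v' = (\<lambda>e. v x e - (\<Sum>i\<in>I. b i * v i e))"
  have sS: "symmetric_series (\<lambda>e. \<Sum>i\<in>I. c i * v i e)" for c by (rule symmetric_sum[OF vI])
  have sw: "symmetric_series w'" unfolding w'_def by (rule symmetric_diff[OF insert.prems(2) sS])
  have sv: "symmetric_series v'" unfolding v'_def by (rule symmetric_diff[OF vx sS])
  have w'I: "ip d w' (v i) = 0" "ip d v' (v i) = 0" if "i \<in> I" for i
    using a b that by (simp_all add: w'_def v'_def)
  have ortho: "ip d u v' = ip d u (v x)" if "\<And>i. i \<in> I \<Longrightarrow> ip d u (v i) = 0" for u
    unfolding v'_def using that
    by (simp add: ip_diff_right[OF vx sS] ip_sum_right[OF vI] cong: sum.cong)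
  define t where "t = (if ip d v' v' = 0 then 0 else ip d w' v' / ip d v' v')"
  have key: "ip d w' v' = t * ip d v' v'"
  proof (cases "ip d v' v' = 0")
    case True
    have "v' e = 0" if "part_size e = d" for e by (rule ip_anisotropic[OF sv True that])
    then have "psum_coords d v' N = 0" if "N \<in> MP d" for N
      using psum_coords_eqI[of d "\<lambda>_. 0" v' N] sv that by simp
    then have "ip d w' v' = 0" unfolding ip_def pinner_def by (intro sum.neutral) simp
    then show ?thesis using True by simp
  qed (simp add: t_def)
  define c where "c i = (if i = x then t else a i - t * b i)" for i
  have "(\<lambda>e. w e - (\<Sum>i\<in>insert x I. c i * v i e)) = (\<lambda>e. w' e - t * v' e)"
  proof
    fix e
    have "(\<Sum>i\<in>I. c i * v i e) = (\<Sum>i\<in>I. a i * v i e) - t * (\<Sum>i\<in>I. b i * v i e)"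
      using insert.hyps(2) unfolding sum_distrib_left sum_subtractf[symmetric]
      by (intro sum.cong) (auto simp: c_def algebra_simps)
    then show "w e - (\<Sum>i\<in>insert x I. c i * v i e) = w' e - t * v' e"
      using insert.hyps by (simp add: w'_def v'_def c_def algebra_simps)
  qed
  moreover have "ip d (\<lambda>e. w' e - t * v' e) (v i) = 0" if "i \<in> insert x I" for i
  proof (cases "i = x")
    case True
    then show ?thesis
      using key ortho[of w'] ortho[of v'] w'I
      by (simp add: ip_diff_left[OF sw symmetric_scale[OF sv]] ip_scale_left[OF sv])
  next
    case False
    then show ?thesis using that w'I
      by (simp add: ip_diff_left[OF sw symmetric_scale[OF sv]] ip_scale_left[OF sv])
  qed
  ultimately show ?case by (intro exI[of _ c]) simp
qed simp

definition below :: "expvec \<Rightarrow> expvec set" where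
  "below l = {m. is_partition m \<and> m \<noteq> l \<and> dominates l m}"

lemma finite_below [simp]: "finite (below l)"
  by (rule finite_subset[OF _ finite_partitions_size[of "part_size l"]]) (auto simp: below_def dominates_def)

definition dom_space :: "expvec \<Rightarrow> ratfun mseries set" where
  "dom_space l = {f. symmetric_series f \<and> (\<forall>e. f e \<noteq> 0 \<longrightarrow> dominates l e)}"

lemma dom_space_expand:
  assumes "f \<in> dom_space l" "is_partition l"
  shows "f e = f l * monomial_sym l e + (\<Sum>m\<in>below l. f m * monomial_sym m e)"
proof -
  have sym: "symmetric_series f" and supp: "\<And>e. f e \<noteq> 0 \<Longrightarrow> dominates l e"
    using assms by (auto simp: dom_space_def)
  let ?m = "part_of (shape e)"
  have s: "shape ?m = shape e" "is_partition ?m" by simp_all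
  have fe: "f ?m = f e" by (rule symmetric_seriesD[OF sym s(1)])
  have ms: "(monomial_sym m e :: ratfun) = (if m = ?m then 1 else 0)" if "is_partition m" for m
    using that s by (auto simp: monomial_sym_shape)
  have "(\<Sum>m\<in>below l. f m * monomial_sym m e) = (\<Sum>m\<in>below l. if m = ?m then f e else 0)"
    by (intro sum.cong refl) (auto simp: ms below_def fe)
  also have "\<dots> = (if ?m \<in> below l then f e else 0)" by (simp add: sum.delta)
  finally have 1: "(\<Sum>m\<in>below l. f m * monomial_sym m e) = (if ?m \<in> below l then f e else 0)" .
  show ?thesis
  proof (cases "f e = 0")
    case True
    then show ?thesis using 1 ms[OF assms(2)] fe by (cases "l = ?m") simp_all
  next
    case False
    then have "dominates l ?m" using supp dominates_shape[OF s(1)] by blast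
    then show ?thesis using 1 ms[OF assms(2)] fe s(2) by (auto simp: below_def)
  qed
qed

lemma monomial_sym_dom_space: "is_partition m \<Longrightarrow> dominates l m \<Longrightarrow> monomial_sym m \<in> dom_space l"
  unfolding dom_space_def
proof (intro CollectI conjI symmetric_monomial_sym allI impI)
  fix e assume "dominates l m" "monomial_sym m e \<noteq> (0 :: ratfun)"
  then show "dominates l e" using dominates_shape[of e m l] by (simp add: monomial_sym_shape split: if_splits)
qed

lemma dom_space_diff: "f \<in> dom_space l \<Longrightarrow> g \<in> dom_space l \<Longrightarrow> (\<lambda>e. f e - g e) \<in> dom_space l"
  unfolding dom_space_def
proof (intro CollectI conjI allI impI)
  fix e assume "f \<in> {f. symmetric_series f \<and> (\<forall>e. f e \<noteq> 0 \<longrightarrow> dominates l e)}"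
    "g \<in> {f. symmetric_series f \<and> (\<forall>e. f e \<noteq> 0 \<longrightarrow> dominates l e)}" "f e - g e \<noteq> 0"
  then show "dominates l e" by (cases "f e = 0") auto
qed (simp add: symmetric_diff)

lemma dom_space_scale: "f \<in> dom_space l \<Longrightarrow> (\<lambda>e. r * f e) \<in> dom_space l"
  by (simp add: dom_space_def symmetric_scale)

lemma dom_space_sum:
  assumes "\<And>x. x \<in> A \<Longrightarrow> f x \<in> dom_space l"
  shows "(\<lambda>e. \<Sum>x\<in>A. r x * f x e) \<in> dom_space l"
proof -
  have "dominates l e" if ne: "(\<Sum>x\<in>A. r x * f x e) \<noteq> 0" for e
  proof -
    obtain x where "x \<in> A" "r x * f x e \<noteq> 0" using ne by (meson sum.not_neutral_contains_not_neutral)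
    then show ?thesis using assms[of x] by (simp add: dom_space_def)
  qed
  moreover have "symmetric_series (\<lambda>e. \<Sum>x\<in>A. r x * f x e)"
    by (rule symmetric_sum) (use assms in \<open>simp add: dom_space_def\<close>)
  ultimately show ?thesis by (simp add: dom_space_def)
qed

lemma dom_space_symmetric: "f \<in> dom_space l \<Longrightarrow> symmetric_series f"
  by (simp add: dom_space_def)

lemma dom_space_top_op:
  assumes "f \<in> dom_space l"
  shows "top_op k d f \<in> dom_space l"
proof -
  have "dominates l e" if "top_op k d f e \<noteq> 0" for e
  proof -
    have "xtower k f e \<noteq> 0" using that by (simp add: top_op_def split: if_splits)
    then show ?thesis using xtower_support[of f "{l}" k e] assms by (auto simp: dom_space_def)
  qed
  then show ?thesis using symmetric_top_op[OF dom_space_symmetric[OF assms]] by (simp add: dom_space_def)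
qed

text \<open>An element without leading term is supported below partitions strictly below
  \<open>l\<close>, and the operator does not leave the region that these dominate.\<close>

lemma top_op_leading_zero:
  assumes "f \<in> dom_space l" "is_partition l" "f l = 0"
  shows "xtower k f l = 0"
proof (rule ccontr)
  assume nz: "xtower k f l \<noteq> 0"
  have "\<exists>m\<in>below l. dominates m e" if "f e \<noteq> 0" for e
  proof (intro bexI)
    let ?m = "part_of (shape e)"
    have s: "shape ?m = shape e" by simp
    show "dominates ?m e" using dominates_refl[of ?m] dominates_shape[OF s] by simp
    have "f ?m = f e" using symmetric_seriesD[OF dom_space_symmetric[OF assms(1)] s] .
    then have "?m \<noteq> l" using that assms(3) by auto
    moreover have "dominates l ?m" using assms(1) that dominates_shape[OF s] by (simp add: dom_space_def)
    ultimately show "?m \<in> below l" by (simp add: below_def)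
  qed
  then obtain m where "m \<in> below l" "dominates m l" using xtower_support[OF _ nz] by blast
  then show False using dominates_antisym[of l m] assms(2) by (auto simp: below_def)
qed

text \<open>Orthogonality is imposed only within the cone below \<open>l\<close>; between
  incomparable partitions it has to come from the operators.\<close>

definition jackP :: "expvec \<Rightarrow> ratfun mseries" where
  "jackP l = (SOME P. P \<in> dom_space l \<and> P l = 1 \<and>
     (\<forall>f\<in>dom_space l. f l = 0 \<longrightarrow> ip (part_size l) P f = 0))"

lemma monomial_below_zero: "is_partition l \<Longrightarrow> m \<in> below l \<Longrightarrow> monomial_sym m l = 0"
  using partition_eqI by (auto simp: monomial_sym_shape below_def)

lemma jackP:
  assumes l: "is_partition l"
  shows "jackP l \<in> dom_space l" "jackP l l = 1"
    "\<And>f. f \<in> dom_space l \<Longrightarrow> f l = 0 \<Longrightarrow> ip (part_size l) (jackP l) f = 0"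
proof -
  let ?m = "monomial_sym :: expvec \<Rightarrow> ratfun mseries"
  obtain a where a: "\<forall>m\<in>below l. ip (part_size l) (\<lambda>e. ?m l e - (\<Sum>m\<in>below l. a m * ?m m e)) (?m m) = 0"
    using orthogonal_projection[where I = "below l" and v = ?m and w = "?m l" and d = "part_size l",
        OF finite_below symmetric_monomial_sym symmetric_monomial_sym] by blast
  define P where "P = (\<lambda>e. ?m l e - (\<Sum>m\<in>below l. a m * ?m m e))"
  have 1: "P \<in> dom_space l"
    unfolding P_def
    by (intro dom_space_diff dom_space_sum monomial_sym_dom_space) (use l dominates_refl in \<open>auto simp: below_def\<close>)
  have "(\<Sum>m\<in>below l. a m * ?m m l) = 0"
    by (rule sum.neutral) (simp add: monomial_below_zero[OF l])
  then have 2: "P l = 1" by (simp add: P_def monomial_sym_shape)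
  have 3: "ip (part_size l) P f = 0" if f: "f \<in> dom_space l" "f l = 0" for f
  proof -
    have "f = (\<lambda>e. \<Sum>m\<in>below l. f m * ?m m e)"
    proof
      fix e show "f e = (\<Sum>m\<in>below l. f m * ?m m e)"
        by (subst dom_space_expand[OF f(1) l]) (simp add: f(2))
    qed
    then have "ip (part_size l) P f = ip (part_size l) P (\<lambda>e. \<Sum>m\<in>below l. f m * ?m m e)" by simp
    also have "\<dots> = (\<Sum>m\<in>below l. f m * ip (part_size l) P (?m m))"
      by (rule ip_sum_right[OF symmetric_monomial_sym])
    also have "\<dots> = 0" by (rule sum.neutral) (use a in \<open>simp add: P_def\<close>)
    finally show ?thesis .
  qed
  have "\<exists>P. P \<in> dom_space l \<and> P l = 1 \<and> (\<forall>f\<in>dom_space l. f l = 0 \<longrightarrow> ip (part_size l) P f = 0)"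
    by (intro exI[of _ P] conjI ballI impI 1 2 3)
  then have *: "jackP l \<in> dom_space l \<and> jackP l l = 1 \<and> (\<forall>f\<in>dom_space l. f l = 0 \<longrightarrow> ip (part_size l) (jackP l) f = 0)"
    unfolding jackP_def by (rule someI_ex)
  show "jackP l \<in> dom_space l" "jackP l l = 1"
    "\<And>f. f \<in> dom_space l \<Longrightarrow> f l = 0 \<Longrightarrow> ip (part_size l) (jackP l) f = 0"
    by (rule *[THEN conjunct1], rule *[THEN conjunct2, THEN conjunct1], rule *[THEN conjunct2, THEN conjunct2, rule_format])
qed

definition eigval :: "nat \<Rightarrow> expvec \<Rightarrow> ratfun" where
  "eigval k l = xtower k (jackP l) l"

text \<open>The defect f = T P - c P has no leading term, so P is orthogonal to f and, by
  triangularity, to T f. Moving T across, f is orthogonal to T P - c P, that is, to itself.\<close>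

lemma jackP_eigen:
  assumes l: "is_partition l" and e: "part_size e = part_size l"
  shows "xtower k (jackP l) e = eigval k l * jackP l e"
proof -
  let ?d = "part_size l" and ?P = "jackP l"
  let ?T = "top_op k ?d"
  note P = jackP[OF l]
  have sP: "symmetric_series ?P" by (rule dom_space_symmetric[OF P(1)])
  have sT: "symmetric_series (?T ?P)" by (rule symmetric_top_op[OF sP])
  define f where "f = (\<lambda>e. ?T ?P e - eigval k l * ?P e)"
  have f: "f \<in> dom_space l"
    unfolding f_def by (intro dom_space_diff dom_space_scale dom_space_top_op P(1))
  have sf: "symmetric_series f" by (rule dom_space_symmetric[OF f])
  have fl: "f l = 0" by (simp add: f_def top_op_def eigval_def P(2))
  have "?T f l = 0" using top_op_leading_zero[OF f l fl] by (simp add: top_op_def)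
  then have "ip ?d ?P (?T f) = 0" by (intro P(3) dom_space_top_op f)
  then have "ip ?d (?T ?P) f = 0" using ip_top_op[OF sP sf] by simp
  moreover have "ip ?d ?P f = 0" by (rule P(3)[OF f fl])
  moreover have "ip ?d f f = ip ?d (?T ?P) f - eigval k l * ip ?d ?P f"
    by (subst (1) f_def) (simp add: ip_diff_left[OF sT symmetric_scale[OF sP]] ip_scale_left[OF sP])
  ultimately have "ip ?d f f = 0" by simp
  then have "f e = 0" by (rule ip_anisotropic[OF sf _ e])
  then show ?thesis using e by (simp add: f_def top_op_def)
qed

text \<open>The part of \<open>jackP l\<close> below its leading monomial does not reach the
  coefficient at \<open>l\<close>, so the eigenvalue can be read off from
  \<open>monomial_sym l\<close>, whose coefficients are free of \<open>tau\<close>.\<close>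

lemma eigval_const_term:
  assumes l: "is_partition l"
  shows "const_term (eigval k l) (\<Sum>x\<in>#shape l. of_nat x ^ Suc k)"
proof -
  let ?m = "monomial_sym l :: ratfun mseries"
  let ?r = "\<lambda>e. jackP l e - ?m e"
  have r: "?r \<in> dom_space l"
    by (intro dom_space_diff jackP(1)[OF l] monomial_sym_dom_space l dominates_refl)
  have "xtower k (jackP l) l = xtower k (\<lambda>e. ?m e + ?r e) l" by simp
  also have "\<dots> = xtower k ?m l + xtower k ?r l" by (rule xtower_add)
  also have "xtower k ?r l = 0"
    by (rule top_op_leading_zero[OF r l]) (simp add: jackP(2)[OF l] monomial_sym_shape)
  finally have "eigval k l = xtower k ?m l" by (simp add: eigval_def)
  moreover have "const_term (xtower k ?m l) (\<Sum>i\<in>keys l. of_nat (lookup l i) ^ Suc k * monomial_sym l (eswap 0 i l))"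
    by (rule const_term_xtower) (simp add: monomial_sym_shape const_term_0 const_term_1)
  moreover have "(\<Sum>i\<in>keys l. of_nat (lookup l i) ^ Suc k * monomial_sym l (eswap 0 i l)) = (\<Sum>i\<in>keys l. of_nat (lookup l i) ^ Suc k :: rat)"
    by (simp add: monomial_sym_shape)
  moreover have "(\<Sum>x\<in>#shape l. of_nat x ^ Suc k) = (\<Sum>i\<in>keys l. of_nat (lookup l i) ^ Suc k :: rat)"
    by (simp add: shape_def sum_unfold_sum_mset multiset.map_comp comp_def)
  ultimately show ?thesis by simp
qed

text \<open>A nonzero inner product would force all eigenvalues to agree, and with their constant
  terms all power sums of the parts.\<close>

lemma jackP_orthogonal:
  assumes "is_partition l" "is_partition m" "l \<noteq> m" "part_size l = d" "part_size m = d"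
  shows "ip d (jackP l) (jackP m) = 0"
proof (rule ccontr)
  assume ne: "ip d (jackP l) (jackP m) \<noteq> 0"
  have "eigval k l = eigval k m" for k
  proof -
    have eig: "top_op k d (jackP p) = (\<lambda>e. eigval k p * jackP p e)" if "is_partition p" "part_size p = d" for p
    proof
      fix e
      show "top_op k d (jackP p) e = eigval k p * jackP p e"
      proof (cases "part_size e = d")
        case True
        then show ?thesis using jackP_eigen[of p e] that by (simp add: top_op_def)
      next
        case False
        then have "\<not> dominates p e" using that by (simp add: dominates_def)
        then have "jackP p e = 0" using jackP(1)[OF that(1)] by (auto simp: dom_space_def)
        then show ?thesis using False by (simp add: top_op_def)
      qed
    qed
    have s: "symmetric_series (jackP l)" "symmetric_series (jackP m)"
      using dom_space_symmetric jackP(1) assms by blast+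
    have "eigval k l * ip d (jackP l) (jackP m) = eigval k m * ip d (jackP l) (jackP m)"
      using ip_top_op[OF s, of d k] assms by (simp add: eig ip_scale_left[OF s(1)] ip_scale_right[OF s(2)])
    then show ?thesis using ne by simp
  qed
  then have "(\<Sum>x\<in>#shape l. (of_nat x :: rat) ^ Suc k) = (\<Sum>x\<in>#shape m. of_nat x ^ Suc k)" for k
    using const_term_unique[OF eigval_const_term[OF assms(1)]] eigval_const_term[OF assms(2)] by metis
  then have "shape l = shape m" by (intro multiset_power_sums_eq) auto
  then show False using partition_eqI assms by blast
qed

lemma dom_space_homogeneous: "f \<in> dom_space l \<Longrightarrow> homogeneous (part_size l) f"
  by (auto simp: dom_space_def homogeneous_def dominates_def)

lemma jack_inner_dom_space:
  assumes "f \<in> dom_space l" "g \<in> dom_space m"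
  shows "jack_inner f g = (if part_size l = part_size m then ip (part_size l) f g else 0)"
  unfolding ip_def
  by (rule jack_inner_homogeneous) (use assms dom_space_symmetric dom_space_homogeneous in auto)

lemma below_eq: "is_partition l \<Longrightarrow> {m. is_partition m \<and> m \<noteq> l \<and> majorizes l m} = below l"
  by (auto simp: below_def dominates_iff_majorizes)

lemma is_jack_family_jackP: "is_jack_family jackP"
  unfolding is_jack_family_def
proof (intro conjI allI impI)
  fix l assume l: "is_partition l"
  show "\<exists>K. \<forall>e. jackP l e = monomial_sym l e + (\<Sum>m | is_partition m \<and> m \<noteq> l \<and> majorizes l m. K m * monomial_sym m e)"
    unfolding below_eq[OF l]
  proof (intro exI allI)
    fix e show "jackP l e = monomial_sym l e + (\<Sum>m\<in>below l. jackP l m * monomial_sym m e)"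
      by (subst dom_space_expand[OF jackP(1)[OF l] l]) (simp add: jackP(2)[OF l])
  qed
next
  fix l m assume a: "is_partition l \<and> is_partition m \<and> l \<noteq> m"
  then show "jack_inner (jackP l) (jackP m) = 0"
    using jack_inner_dom_space[OF jackP(1) jackP(1), of l m] jackP_orthogonal[of l m]
    by (cases "part_size l = part_size m") simp_all
qed

text \<open>The given orthogonality only concerns members of the family. By induction along
  dominance the monomial functions below \<open>l\<close> lie in the span of the members there, so
  \<open>Q l\<close> is orthogonal to them and hence to its difference from \<open>jackP l\<close>.
  So is \<open>jackP l\<close>, and the difference has norm 0.\<close>

lemma is_jack_family_eq:
  assumes Q: "is_jack_family Q" and l: "is_partition l"
  shows "Q l = jackP l"
proof -
  have Qex: "\<exists>K. \<forall>e. Q m e = monomial_sym m e + (\<Sum>p\<in>below m. K p * monomial_sym p e)" if "is_partition m" for m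
    using Q that unfolding is_jack_family_def below_eq[OF that, symmetric] by blast
  have Qdom: "Q m \<in> dom_space m \<and> Q m m = 1" if m: "is_partition m" for m
  proof -
    obtain K where K: "Q m = (\<lambda>e. monomial_sym m e - (\<Sum>p\<in>below m. (- K p) * monomial_sym p e))"
      using Qex[OF m] by (auto simp: fun_eq_iff sum_negf)
    have "(\<Sum>p\<in>below m. (- K p) * monomial_sym p m) = 0"
      by (rule sum.neutral) (simp add: monomial_below_zero[OF m])
    moreover have "Q m \<in> dom_space m"
      unfolding K by (intro dom_space_diff dom_space_sum monomial_sym_dom_space)
        (use m dominates_refl in \<open>auto simp: below_def\<close>)
    ultimately show ?thesis by (simp add: K monomial_sym_shape)
  qed
  have orth: "ip (part_size l) (Q l) (Q m) = 0" if "m \<in> below l" for m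
  proof -
    have m: "is_partition m" "m \<noteq> l" "part_size m = part_size l" using that by (auto simp: below_def dominates_def)
    then have "jack_inner (Q l) (Q m) = 0" using Q l unfolding is_jack_family_def by metis
    then show ?thesis using jack_inner_dom_space[of "Q l" l "Q m" m] Qdom m l by simp
  qed
  have orth_m: "m \<in> below l \<longrightarrow> ip (part_size l) (Q l) (monomial_sym m) = 0" for m
  proof (induction "card (below m)" arbitrary: m rule: less_induct)
    case less
    show ?case
    proof
      assume ml: "m \<in> below l"
      then have m: "is_partition m" and lm: "dominates l m" "m \<noteq> l" by (auto simp: below_def)
      have sub: "p \<in> below l" if "p \<in> below m" for p
        using that lm l m dominates_trans[OF lm(1)] dominates_antisym[of l m] by (auto simp: below_def)
      have IH: "ip (part_size l) (Q l) (monomial_sym p) = 0" if p: "p \<in> below m" for p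
      proof -
        have "below p \<subset> below m"
        proof
          have "dominates m p" "is_partition p" "p \<noteq> m" using p by (auto simp: below_def)
          then show "below p \<subseteq> below m" using m dominates_trans[of m p] dominates_antisym[of m p] by (auto simp: below_def)
          show "below p \<noteq> below m" using p by (auto simp: below_def)
        qed
        then have "card (below p) < card (below m)" by (intro psubset_card_mono) auto
        then show ?thesis using less sub[OF p] by blast
      qed
      obtain K where K: "\<And>e. Q m e = monomial_sym m e + (\<Sum>p\<in>below m. K p * monomial_sym p e)"
        using Qex[OF m] by blast
      have eq: "monomial_sym m = (\<lambda>e. Q m e - (\<Sum>p\<in>below m. K p * monomial_sym p e))"
        by (rule ext) (simp add: K)
      have "ip (part_size l) (Q l) (monomial_sym m) = ip (part_size l) (Q l) (Q m) - (\<Sum>p\<in>below m. K p * ip (part_size l) (Q l) (monomial_sym p))"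
        by (subst eq) (simp add: ip_diff_right[OF dom_space_symmetric symmetric_sum[OF symmetric_monomial_sym]]
            Qdom[OF m] dom_space_symmetric[OF conjunct1[OF Qdom[OF m]]] ip_diff_right symmetric_sum[OF symmetric_monomial_sym]
            ip_sum_right[OF symmetric_monomial_sym])
      also have "\<dots> = 0" using orth[OF ml] IH by simp
      finally show "ip (part_size l) (Q l) (monomial_sym m) = 0" .
    qed
  qed
  let ?f = "\<lambda>e. Q l e - jackP l e"
  have f: "?f \<in> dom_space l" by (intro dom_space_diff jackP(1)[OF l] conjunct1[OF Qdom[OF l]])
  have fl: "?f l = 0" using jackP(2)[OF l] Qdom[OF l] by simp
  have sQ: "symmetric_series (Q l)" and sP: "symmetric_series (jackP l)"
    using dom_space_symmetric Qdom[OF l] jackP(1)[OF l] by blast+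
  have "?f = (\<lambda>e. \<Sum>m\<in>below l. ?f m * monomial_sym m e)"
  proof
    fix e show "?f e = (\<Sum>m\<in>below l. ?f m * monomial_sym m e)"
      using dom_space_expand[OF f l, of e] unfolding fl by simp
  qed
  then have "ip (part_size l) (Q l) ?f = ip (part_size l) (Q l) (\<lambda>e. \<Sum>m\<in>below l. ?f m * monomial_sym m e)" by (rule arg_cong)
  also have "\<dots> = 0" using orth_m by (simp add: ip_sum_right[OF symmetric_monomial_sym])
  finally have 1: "ip (part_size l) (Q l) ?f = 0" .
  have 2: "ip (part_size l) (jackP l) ?f = 0" by (rule jackP(3)[OF l f fl])
  have "ip (part_size l) ?f ?f = 0" using 1 2 by (simp add: ip_diff_left[OF sQ sP])
  then have "?f e = 0" for e
    using ip_anisotropic[OF dom_space_symmetric[OF f], of "part_size l" e] dom_space_homogeneous[OF f]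
    by (cases "part_size e = part_size l") (auto simp: homogeneous_def)
  then show ?thesis by (simp add: fun_eq_iff)
qed

lemma jack_eq_jackP: "is_partition l \<Longrightarrow> jack l = jackP l"
  unfolding jack_def by (rule the_equality) (use is_jack_family_jackP is_jack_family_eq in blast)+

section \<open>Positivity of the monomial coefficients\<close>

definition sq_sum :: "expvec \<Rightarrow> nat" where
  "sq_sum e = (\<Sum>i\<in>keys e. lookup e i ^ 2)"

text \<open>The sum of the squares of the conjugate parts; on a partition it is also the sum of 2i +
  1 times the part at index i.\<close>

definition min_sum :: "expvec \<Rightarrow> nat" where
  "min_sum e = (\<Sum>i\<in>keys e. \<Sum>j\<in>keys e. min (lookup e i) (lookup e j))"

lemma sq_sum_superset:
  assumes "finite A" "keys e \<subseteq> A"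
  shows "sq_sum e = (\<Sum>i\<in>A. lookup e i ^ 2)"
  unfolding sq_sum_def by (rule sum.mono_neutral_left) (use assms in \<open>auto simp: in_keys_iff\<close>)

lemma min_sum_superset:
  assumes "finite A" "keys e \<subseteq> A"
  shows "min_sum e = (\<Sum>i\<in>A. \<Sum>j\<in>A. min (lookup e i) (lookup e j))"
proof -
  have "(\<Sum>j\<in>keys e. min (lookup e i) (lookup e j)) = (\<Sum>j\<in>A. min (lookup e i) (lookup e j))" for i
    by (rule sum.mono_neutral_left) (use assms in \<open>auto simp: in_keys_iff\<close>)
  then have "min_sum e = (\<Sum>i\<in>keys e. \<Sum>j\<in>A. min (lookup e i) (lookup e j))"
    by (simp add: min_sum_def)
  also have "\<dots> = (\<Sum>i\<in>A. \<Sum>j\<in>A. min (lookup e i) (lookup e j))"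
    by (rule sum.mono_neutral_left) (use assms in \<open>auto simp: in_keys_iff\<close>)
  finally show ?thesis .
qed

lemma sq_sum_shape: "sq_sum e = (\<Sum>x\<in>#shape e. x ^ 2)"
  by (simp add: sq_sum_def shape_def sum_unfold_sum_mset multiset.map_comp comp_def)

lemma min_sum_shape: "min_sum e = (\<Sum>x\<in>#shape e. \<Sum>y\<in>#shape e. min x y)"
  by (simp add: min_sum_def shape_def sum_unfold_sum_mset multiset.map_comp comp_def)

lemma sq_sum_upd2:
  assumes "i \<noteq> j" "a + b = lookup e i + lookup e j" "max (lookup e i) (lookup e j) < a"
  shows "sq_sum e < sq_sum (upd2 i j e a b)"
proof -
  let ?A = "insert i (insert j (keys e))" and ?B = "keys e - {i, j}"
  have A: "?A = insert i (insert j ?B)" by auto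
  have split: "sq_sum f = (lookup f i)\<^sup>2 + ((lookup f j)\<^sup>2 + (\<Sum>k\<in>?B. (lookup f k)\<^sup>2))" if "keys f \<subseteq> ?A" for f
  proof -
    have "sq_sum f = (\<Sum>k\<in>insert i (insert j ?B). (lookup f k)\<^sup>2)"
      by (rule sq_sum_superset) (use that in auto)
    also have "\<dots> = (lookup f i)\<^sup>2 + (\<Sum>k\<in>insert j ?B. (lookup f k)\<^sup>2)"
      by (rule sum.insert) (use assms(1) in auto)
    also have "(\<Sum>k\<in>insert j ?B. (lookup f k)\<^sup>2) = (lookup f j)\<^sup>2 + (\<Sum>k\<in>?B. (lookup f k)\<^sup>2)"
      by (rule sum.insert) auto
    finally show ?thesis .
  qed
  have k: "keys (upd2 i j e a b) \<subseteq> ?A"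
    by (auto simp: upd2_def keys_update)
  have rest: "(\<Sum>k\<in>?B. (lookup (upd2 i j e a b) k)\<^sup>2) = (\<Sum>k\<in>?B. (lookup e k)\<^sup>2)"
    by (intro sum.cong) (auto simp: lookup_upd2)
  define p q where "p = lookup e i" and "q = lookup e j"
  have pq: "a + b = p + q" "p < a" "q < a" using assms by (auto simp: p_def q_def)
  obtain r where r: "a = p + r" "0 < r" using pq(2) less_imp_add_positive by blast
  then have q: "q = b + r" using pq(1) by simp
  have "p\<^sup>2 + q\<^sup>2 < a\<^sup>2 + b\<^sup>2"
  proof -
    have "b < p" using q r pq(3) by simp
    then have "b * r < p * r" using r(2) by (rule mult_strict_right_mono)
    then show ?thesis unfolding r(1) q power2_sum by linarith
  qed
  moreover have "sq_sum e = p\<^sup>2 + (q\<^sup>2 + (\<Sum>k\<in>?B. (lookup e k)\<^sup>2))"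
    unfolding p_def q_def by (rule split) auto
  moreover have "sq_sum (upd2 i j e a b) = a\<^sup>2 + (b\<^sup>2 + (\<Sum>k\<in>?B. (lookup e k)\<^sup>2))"
    unfolding split[OF k] rest using assms(1) by (simp add: lookup_upd2)
  ultimately show ?thesis by linarith
qed

text \<open>It rewrites weighted sums in terms of partial sums, the quantities that dominance
  controls.\<close>

lemma abel_summation:
  fixes w x :: "nat \<Rightarrow> int"
  shows "(\<Sum>i<n. w i * x i) = (\<Sum>k<n. (w k - w (Suc k)) * (\<Sum>i<Suc k. x i)) + w n * (\<Sum>i<n. x i)"
  by (induction n) (simp_all add: algebra_simps)

context
  fixes l m :: expvec and n :: nat and x :: "nat \<Rightarrow> int"
  assumes l: "is_partition l" and m: "is_partition m" and lm: "dominates l m" and ne: "l \<noteq> m"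
  defines "n \<equiv> max (plength l) (plength m)"
  defines "x \<equiv> (\<lambda>i. int (lookup l i) - int (lookup m i))"
begin

lemma keys_bound: "keys l \<subseteq> {..<n}" "keys m \<subseteq> {..<n}"
  using partition_keys[OF l] partition_keys[OF m] by (auto simp: n_def)

lemma partial_nonneg: "0 \<le> (\<Sum>i<k. x i)"
proof -
  have "(\<Sum>i<k. lookup m i) \<le> (\<Sum>i<k. lookup l i)"
    using lm unfolding dominates_iff_majorizes[OF m] majorizes_def weakly_majorizes_def by blast
  then have "int (\<Sum>i<k. lookup m i) \<le> int (\<Sum>i<k. lookup l i)" by (rule zle_int[THEN iffD2])
  then show ?thesis by (simp add: x_def sum_subtractf)
qed

lemma total_zero: "(\<Sum>i<n. x i) = 0"
proof -
  have "part_size l = (\<Sum>i<n. lookup l i)" "part_size m = (\<Sum>i<n. lookup m i)"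
    by (rule part_size_superset; use keys_bound in simp)+
  then have "(\<Sum>i<n. lookup l i) = (\<Sum>i<n. lookup m i)" using lm by (simp add: dominates_def)
  then have "int (\<Sum>i<n. lookup l i) = int (\<Sum>i<n. lookup m i)" by simp
  then show ?thesis by (simp add: x_def sum_subtractf)
qed

lemma differ: "\<exists>i<n. x i \<noteq> 0"
proof (rule ccontr)
  assume "\<not> ?thesis"
  then have "lookup l i = lookup m i" if "i < n" for i using that by (simp add: x_def)
  moreover have "lookup l i = lookup m i" if "\<not> i < n" for i
  proof -
    have "i \<notin> keys l" "i \<notin> keys m" using keys_bound that by auto
    then show ?thesis by (simp add: in_keys_iff)
  qed
  ultimately show False using ne poly_mapping_eqI[of l m] by blast
qed

text \<open>With l = m + x the difference is the sum of x_i^2 plus twice that of m_i x_i. The latter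
  is nonnegative by Abel summation, since \<open>m\<close> decreases and the partial sums of
  \<open>x\<close> are nonnegative.\<close>

lemma sq_sum_strict_dominates: "sq_sum m < sq_sum l"
proof -
  have "0 \<le> (\<Sum>i<n. int (lookup m i) * x i)"
  proof -
    have "0 \<le> (\<Sum>k<n. (int (lookup m k) - int (lookup m (Suc k))) * (\<Sum>i<Suc k. x i))"
    proof (rule sum_nonneg)
      fix k
      have "lookup m (Suc k) \<le> lookup m k" using m by (simp add: is_partition_def)
      then show "0 \<le> (int (lookup m k) - int (lookup m (Suc k))) * (\<Sum>i<Suc k. x i)"
        by (intro mult_nonneg_nonneg partial_nonneg) simp
    qed
    then show ?thesis unfolding abel_summation[of _ x] total_zero by simp
  qed
  moreover have "0 < (\<Sum>i<n. (x i)\<^sup>2)"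
  proof -
    obtain i where "i < n" "x i \<noteq> 0" using differ by blast
    then show ?thesis by (intro sum_pos2[of _ i]) auto
  qed
  moreover have "int (sq_sum l) - int (sq_sum m) = (\<Sum>i<n. (x i)\<^sup>2) + 2 * (\<Sum>i<n. int (lookup m i) * x i)"
  proof -
    have "sq_sum l = (\<Sum>i<n. (lookup l i)\<^sup>2)" "sq_sum m = (\<Sum>i<n. (lookup m i)\<^sup>2)"
      by (rule sq_sum_superset; use keys_bound in simp)+
    then have "int (sq_sum l) - int (sq_sum m) = (\<Sum>i<n. (int (lookup l i))\<^sup>2 - (int (lookup m i))\<^sup>2)"
      by (simp add: sum_subtractf)
    also have "\<dots> = (\<Sum>i<n. (x i)\<^sup>2 + 2 * (int (lookup m i) * x i))"
      by (intro sum.cong refl) (simp add: x_def power2_eq_square algebra_simps)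
    finally show ?thesis by (simp add: sum.distrib sum_distrib_left)
  qed
  ultimately show ?thesis by linarith
qed

text \<open>On partitions \<open>min_sum\<close> is linear with weights 2i + 1, so Abel summation
  turns the difference into twice the sum of the partial sums of \<open>x\<close>.\<close>

lemma min_sum_strict_dominates: "min_sum l < min_sum m"
proof -
  have mp: "(\<Sum>i<k. \<Sum>j<k. min (lookup p i) (lookup p j)) = (\<Sum>i<k. (2 * i + 1) * lookup p i)"
    if p: "is_partition p" for p k
  proof (induction k)
    case (Suc k)
    have "min (lookup p i) (lookup p k) = lookup p k" if "i < k" for i
      using p that by (simp add: is_partition_def min_absorb2)
    then have s: "(\<Sum>i<k. min (lookup p i) (lookup p k)) = k * lookup p k" "(\<Sum>i<k. min (lookup p k) (lookup p i)) = k * lookup p k"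
      by (simp_all add: min.commute)
    show ?case using Suc by (simp add: sum.distrib s algebra_simps)
  qed simp
  have "min_sum l = (\<Sum>i<n. \<Sum>j<n. min (lookup l i) (lookup l j))" "min_sum m = (\<Sum>i<n. \<Sum>j<n. min (lookup m i) (lookup m j))"
    by (rule min_sum_superset; use keys_bound in simp)+
  then have "int (min_sum m) - int (min_sum l) = (\<Sum>i<n. (- int (2 * i + 1)) * x i)"
    unfolding mp[OF l] mp[OF m] by (simp add: x_def algebra_simps sum_subtractf sum.distrib sum_negf)
  also have "\<dots> = (\<Sum>k<n. 2 * (\<Sum>i<Suc k. x i))"
    unfolding abel_summation[of _ x] total_zero by simp
  also have "\<dots> > 0"
  proof -
    \<comment> \<open>At the first index where \<open>l\<close> and \<open>m\<close> differ, the
      partial sum is a single nonzero term.\<close>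
    define j where "j = (LEAST i. x i \<noteq> 0)"
    obtain i where i: "i < n" "x i \<noteq> 0" using differ by blast
    have j: "x j \<noteq> 0" unfolding j_def by (rule LeastI[of "\<lambda>i. x i \<noteq> 0", OF i(2)])
    have jn: "j < n" using i Least_le[of "\<lambda>i. x i \<noteq> 0" i] by (simp add: j_def)
    have "x i = 0" if "i < j" for i using not_less_Least[of i "\<lambda>i. x i \<noteq> 0"] that by (auto simp: j_def)
    then have "(\<Sum>i<Suc j. x i) = x j" by simp
    then have "0 < 2 * (\<Sum>i<Suc j. x i)" using j partial_nonneg[of "Suc j"] by simp
    then show ?thesis using partial_nonneg jn by (intro sum_pos2[of _ j]) (auto simp del: sum.lessThan_Suc)
  qed
  finally show ?thesis by simp
qed

end

lemma dominates_sq_sum_le: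
  assumes "is_partition l" "dominates l e"
  shows "sq_sum e \<le> sq_sum l"
proof -
  let ?m = "part_of (shape e)"
  have "shape ?m = shape e" by simp
  then have "dominates l ?m" "sq_sum ?m = sq_sum e"
    using assms(2) dominates_shape[of ?m e l] by (auto simp: sq_sum_shape)
  then show ?thesis
    using sq_sum_strict_dominates[OF assms(1) is_partition_part_of, of "shape e"] by (cases "l = ?m") auto
qed

text \<open>No truncation occurs: \<open>a\<close> exceeds both old entries, so the factor is the
  positive difference of the two new ones.\<close>

definition spread :: "ratfun mseries \<Rightarrow> expvec \<Rightarrow> nat \<Rightarrow> nat \<Rightarrow> ratfun" where
  "spread f e i j = (\<Sum>a\<in>{max (lookup e i) (lookup e j)<..lookup e i + lookup e j}.
     of_nat (2 * a - (lookup e i + lookup e j)) * f (upd2 i j e a (lookup e i + lookup e j - a)))"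

text \<open>By symmetry of \<open>f\<close> the second sum of \<open>exch\<close> can be reflected
  and combined with the first. Only the term at the maximum of the two entries is left over, and it
  is the diagonal one.\<close>

lemma exch_xt_0:
  assumes f: "symmetric_series f" and j: "j \<noteq> 0"
  shows "exch j (xt 0 f) e = spread f e 0 j - of_nat (min (lookup e 0) (lookup e j)) * f e"
proof -
  let ?c = "lookup e 0" and ?d = "lookup e j"
  let ?s = "?c + ?d" and ?M = "max ?c ?d" and ?m = "min ?c ?d"
  define F where "F a = f (upd2 0 j e a (?s - a))" for a
  have Fsym: "F (?s - a) = F a" if "a \<le> ?s" for a
  proof -
    have "upd2 0 j e (?s - a) (?s - (?s - a)) = eswap 0 j (upd2 0 j e a (?s - a))"
      using that j by (intro poly_mapping_eqI) (simp add: lookup_upd2 lookup_eswap)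
    then show ?thesis unfolding F_def by (intro symmetric_seriesD[OF f]) simp
  qed
  have FM: "F ?M = f e"
  proof -
    have c: "upd2 0 j e ?c ?d = e" by (intro poly_mapping_eqI) (simp add: lookup_upd2)
    have "F ?c = f e" by (simp add: F_def c)
    then show ?thesis using Fsym[of ?c] by (auto simp: max_def)
  qed
  have "exch j (xt 0 f) e = (\<Sum>a\<in>{?M<..?s}. of_nat a * F a) - (\<Sum>a\<in>{1..?m}. of_nat a * F a)"
    using j by (simp add: exch_def Let_def lookup_upd2 F_def)
  also have "(\<Sum>a\<in>{1..?m}. of_nat a * F a) = (\<Sum>a\<in>{?M..<?s}. of_nat (?s - a) * F a)"
    by (rule sum.reindex_bij_witness[of _ "\<lambda>a. ?s - a" "\<lambda>a. ?s - a"]) (auto simp: Fsym)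
  also have "\<dots> = (\<Sum>a\<in>{?M..?s}. of_nat (?s - a) * F a)"
    by (rule sum.mono_neutral_left) auto
  also have "{?M..?s} = insert ?M {?M<..?s}" by auto
  also have "(\<Sum>a\<in>insert ?M {?M<..?s}. of_nat (?s - a) * F a) = of_nat (?s - ?M) * F ?M + (\<Sum>a\<in>{?M<..?s}. of_nat (?s - a) * F a)"
    by (rule sum.insert) auto
  also have "?s - ?M = ?m" by auto
  also have "(\<Sum>a\<in>{?M<..?s}. of_nat a * F a) - (of_nat ?m * F ?M + (\<Sum>a\<in>{?M<..?s}. of_nat (?s - a) * F a))
     = (\<Sum>a\<in>{?M<..?s}. of_nat (2 * a - ?s) * F a) - of_nat ?m * f e"
  proof -
    have "of_nat a * F a - of_nat (?s - a) * F a = of_nat (2 * a - ?s) * F a" if "a \<in> {?M<..?s}" for a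
    proof -
      have "a = (?s - a) + (2 * a - ?s)" using that by auto
      then have "(of_nat a :: ratfun) = of_nat (?s - a) + of_nat (2 * a - ?s)" by (metis of_nat_add)
      then show ?thesis by (simp add: algebra_simps)
    qed
    then have "(\<Sum>a\<in>{?M<..?s}. of_nat a * F a) - (\<Sum>a\<in>{?M<..?s}. of_nat (?s - a) * F a) = (\<Sum>a\<in>{?M<..?s}. of_nat (2 * a - ?s) * F a)"
      unfolding sum_subtractf[symmetric] by (rule sum.cong[OF refl])
    then show ?thesis by (simp add: FM algebra_simps)
  qed
  finally show ?thesis by (simp only: spread_def F_def)
qed

lemma xtower_1:
  assumes f: "symmetric_series f"
  shows "xtower 1 f e = (of_nat (sq_sum e) - tau * of_nat (min_sum e)) * f e
    + tau * (\<Sum>i\<in>keys e. \<Sum>j\<in>keys e - {i}. spread f e i j)"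
proof -
  have one: "xt 1 f (eswap 0 i e) = (of_nat ((lookup e i)\<^sup>2) - tau * of_nat (\<Sum>j\<in>keys e. min (lookup e i) (lookup e j))) * f e
      + tau * (\<Sum>j\<in>keys e - {i}. spread f e i j)" if i: "i \<in> keys e" for i
  proof -
    let ?e = "eswap 0 i e" and ?t = "Transposition.transpose 0 i"
    have lk: "lookup ?e (?t j) = lookup e j" for j
      by (simp add: lookup_eswap Transposition.transpose_def)
    have fe: "f ?e = f e" by (rule symmetric_seriesD[OF f]) simp
    have ex: "exch (?t j) (xt 0 f) ?e = spread f e i j - of_nat (min (lookup e i) (lookup e j)) * f e" if j: "j \<in> keys e - {i}" for j
    proof -
      have tj: "?t j \<noteq> 0" using j by (auto simp: Transposition.transpose_def)
      have sh: "f (upd2 0 (?t j) ?e a b) = f (upd2 i j e a b)" for a b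
      proof (rule symmetric_seriesD[OF f], rule shape_eqI[of ?t])
        fix k show "lookup (upd2 0 (?t j) ?e a b) k = lookup (upd2 i j e a b) (?t k)"
          using j by (auto simp: lookup_upd2 lookup_eswap Transposition.transpose_def)
      qed simp
      have "lookup ?e 0 = lookup e i" by (simp add: lookup_eswap)
      then show ?thesis
        unfolding exch_xt_0[OF f tj] by (simp add: spread_def lk sh fe)
    qed
    have bij: "bij_betw ?t (keys e - {i}) (keys ?e - {0})"
      by (rule bij_betw_byWitness[of _ ?t]) (auto simp: in_keys_iff lookup_eswap Transposition.transpose_def split: if_splits)
    have "(\<Sum>j\<in>keys ?e - {0}. exch j (xt 0 f) ?e) = (\<Sum>j\<in>keys e - {i}. exch (?t j) (xt 0 f) ?e)"
      by (rule sum.reindex_bij_betw[OF bij, symmetric])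
    also have "\<dots> = (\<Sum>j\<in>keys e - {i}. spread f e i j - of_nat (min (lookup e i) (lookup e j)) * f e)"
      by (rule sum.cong[OF refl ex])
    finally have "xt 1 f ?e = (of_nat (lookup e i) - tau) * of_nat (lookup e i) * f e
      + tau * (\<Sum>j\<in>keys e - {i}. spread f e i j - of_nat (min (lookup e i) (lookup e j)) * f e)"
      by (simp add: lookup_eswap fe mult.assoc)
    \<comment> \<open>The \<open>- tau\<close> in \<open>xt\<close> supplies the term j = i of
      \<open>min_sum\<close>.\<close>
    moreover have "(\<Sum>j\<in>keys e. min (lookup e i) (lookup e j)) = lookup e i + (\<Sum>j\<in>keys e - {i}. min (lookup e i) (lookup e j))"
      by (subst sum.remove[OF _ i]) auto
    ultimately show ?thesis
      by (simp add: algebra_simps sum_subtractf power2_eq_square sum_distrib_left)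
  qed
  have "xtower 1 f e = (\<Sum>i\<in>keys e. (of_nat ((lookup e i)\<^sup>2) - tau * of_nat (\<Sum>j\<in>keys e. min (lookup e i) (lookup e j))) * f e
      + tau * (\<Sum>j\<in>keys e - {i}. spread f e i j))"
    unfolding xtower_def by (rule sum.cong[OF refl one])
  then show ?thesis
    by (simp add: sum.distrib sq_sum_def min_sum_def sum_distrib_left sum_distrib_right sum_subtractf left_diff_distrib)
qed

lemma jackP_zero: "is_partition l \<Longrightarrow> \<not> dominates l e \<Longrightarrow> jackP l e = 0"
  using jackP(1)[of l] by (auto simp: dom_space_def)

text \<open>Spreading two entries of \<open>l\<close> raises \<open>sq_sum\<close> beyond anything
  that \<open>l\<close> dominates, so only the diagonal term is left.\<close>

lemma eigval_1:
  assumes l: "is_partition l"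
  shows "eigval 1 l = of_nat (sq_sum l) - tau * of_nat (min_sum l)"
proof -
  have "spread (jackP l) l i j = 0" if ij: "i \<in> keys l" "j \<in> keys l - {i}" for i j
    unfolding spread_def
  proof (rule sum.neutral, rule ballI)
    let ?s = "lookup l i + lookup l j"
    fix a assume a: "a \<in> {max (lookup l i) (lookup l j)<..?s}"
    have "sq_sum l < sq_sum (upd2 i j l a (?s - a))"
      by (rule sq_sum_upd2) (use a ij in auto)
    then have "\<not> dominates l (upd2 i j l a (?s - a))"
      using dominates_sq_sum_le[OF l] by (meson not_less)
    then show "of_nat (2 * a - ?s) * jackP l (upd2 i j l a (?s - a)) = 0"
      using jackP_zero[OF l] by simp
  qed
  then have "(\<Sum>i\<in>keys l. \<Sum>j\<in>keys l - {i}. spread (jackP l) l i j) = 0"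
    by (intro sum.neutral ballI) auto
  then show ?thesis
    unfolding eigval_def xtower_1[OF dom_space_symmetric[OF jackP(1)[OF l]]] jackP(2)[OF l] by simp
qed

text \<open>Tailored to specialization on all of [0, infinity]: the positive constant term keeps the
  denominator positive at every finite point, and the degree condition gives a finite limit at
  infinity. Unlike \<open>nonneg_ratfuns\<close> this set is not closed under division.\<close>

definition good :: "ratfun \<Rightarrow> bool" where
  "good r \<longleftrightarrow> (\<exists>f g. r = Fract f g \<and> (\<forall>i. 0 \<le> coeff f i) \<and> (\<forall>i. 0 \<le> coeff g i) \<and> 0 < coeff g 0 \<and> degree f \<le> degree g)"

lemma coeff_mult_nonneg:
  fixes f g :: "'a::linordered_idom poly"
  assumes "\<forall>i. 0 \<le> coeff f i" "\<forall>i. 0 \<le> coeff g i"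
  shows "0 \<le> coeff (f * g) i"
  unfolding coeff_mult using assms by (intro sum_nonneg) simp

lemma coeff_mult_0: "coeff (f * g) 0 = coeff f 0 * coeff g 0"
  by (simp add: coeff_mult)

lemma good_add:
  assumes "good r" "good r'"
  shows "good (r + r')"
proof -
  obtain f g where r: "r = Fract f g" "\<forall>i. 0 \<le> coeff f i" "\<forall>i. 0 \<le> coeff g i" "0 < coeff g 0" "degree f \<le> degree g"
    using assms(1) unfolding good_def by blast
  obtain f' g' where r': "r' = Fract f' g'" "\<forall>i. 0 \<le> coeff f' i" "\<forall>i. 0 \<le> coeff g' i" "0 < coeff g' 0" "degree f' \<le> degree g'"
    using assms(2) unfolding good_def by blast
  have nz: "g \<noteq> 0" "g' \<noteq> 0" using r r' by auto
  have "degree (f * g' + f' * g) \<le> degree (g * g')"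
  proof (rule degree_add_le)
    show "degree (f * g') \<le> degree (g * g')"
      using degree_mult_le[of f g'] r(5) by (simp add: degree_mult_eq[OF nz])
    show "degree (f' * g) \<le> degree (g * g')"
      using degree_mult_le[of f' g] r'(5) by (simp add: degree_mult_eq[OF nz])
  qed
  then show ?thesis
    unfolding good_def using r r' nz
    by (rule_tac exI[of _ "f * g' + f' * g"], rule_tac exI[of _ "g * g'"])
      (simp add: coeff_mult_nonneg coeff_mult_0)
qed

lemma good_mult:
  assumes "good r" "good r'"
  shows "good (r * r')"
proof -
  obtain f g where r: "r = Fract f g" "\<forall>i. 0 \<le> coeff f i" "\<forall>i. 0 \<le> coeff g i" "0 < coeff g 0" "degree f \<le> degree g"
    using assms(1) unfolding good_def by blast
  obtain f' g' where r': "r' = Fract f' g'" "\<forall>i. 0 \<le> coeff f' i" "\<forall>i. 0 \<le> coeff g' i" "0 < coeff g' 0" "degree f' \<le> degree g'"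
    using assms(2) unfolding good_def by blast
  have nz: "g \<noteq> 0" "g' \<noteq> 0" using r r' by auto
  have "degree (f * f') \<le> degree (g * g')"
    using degree_mult_le[of f f'] r(5) r'(5) by (simp add: degree_mult_eq[OF nz])
  then show ?thesis
    unfolding good_def using r r' nz
    by (rule_tac exI[of _ "f * f'"], rule_tac exI[of _ "g * g'"]) (simp add: coeff_mult_nonneg coeff_mult_0)
qed

lemma good_of_nat: "good (of_nat n)"
  unfolding good_def
  by (rule exI[of _ "of_nat n"], rule exI[of _ 1]) (auto simp: of_nat_fract of_nat_poly coeff_pCons split: nat.splits)

lemma good_0: "good 0" and good_1: "good 1"
  using good_of_nat[of 0] good_of_nat[of 1] by simp_all

lemma good_sum: "(\<And>x. x \<in> A \<Longrightarrow> good (f x)) \<Longrightarrow> good (sum f A)"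
  by (induction A rule: infinite_finite_induct) (simp_all add: good_0 good_add)

lemma good_tau_div:
  assumes "0 < a" "0 < b"
  shows "good (tau / (of_nat a + of_nat b * tau))"
proof -
  have "tau / (of_nat a + of_nat b * tau) = Fract [:0, 1:] [:of_nat a, of_nat b:]"
    using assms by (simp add: tau_def of_nat_fract of_nat_poly)
  then show ?thesis
    unfolding good_def using assms
    by (rule_tac exI[of _ "[:0, 1:]"], rule_tac exI[of _ "[:of_nat a, of_nat b:]"]) (auto simp: coeff_pCons split: nat.splits)
qed

text \<open>The eigenvalue equation says that (a + b tau) P(e) is tau times a nonnegative
  combination of coefficients at vectors with larger \<open>sq_sum\<close>. Strict monotonicity of
  \<open>sq_sum\<close> and \<open>min_sum\<close> makes a and b positive, and tau / (a + b tau) is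
  \<open>good\<close>.\<close>

lemma good_jackP:
  assumes l: "is_partition l"
  shows "good (jackP l e)"
proof (induction "sq_sum l - sq_sum e" arbitrary: e rule: less_induct)
  case less
  have sym: "symmetric_series (jackP l)" by (rule dom_space_symmetric[OF jackP(1)[OF l]])
  consider "\<not> dominates l e" | "shape e = shape l" | "dominates l e" "shape e \<noteq> shape l" by blast
  then show ?case
  proof cases
    case 1
    then show ?thesis by (simp add: jackP_zero[OF l] good_0)
  next
    case 2
    then show ?thesis using symmetric_seriesD[OF sym 2] by (simp add: jackP(2)[OF l] good_1)
  next
    case 3
    let ?m = "part_of (shape e)"
    have s: "shape ?m = shape e" by simp
    have lm: "dominates l ?m" "l \<noteq> ?m" using 3 dominates_shape[OF s] s by auto
    have sq: "sq_sum e < sq_sum l" and mn: "min_sum l < min_sum e"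
      using sq_sum_strict_dominates[OF l is_partition_part_of lm] min_sum_strict_dominates[OF l is_partition_part_of lm] s
      by (simp_all add: sq_sum_shape min_sum_shape)
    let ?S = "\<Sum>i\<in>keys e. \<Sum>j\<in>keys e - {i}. spread (jackP l) e i j"
    define a b where "a = sq_sum l - sq_sum e" and "b = min_sum e - min_sum l"
    have ab: "0 < a" "0 < b" "sq_sum l = sq_sum e + a" "min_sum e = min_sum l + b" using sq mn by (simp_all add: a_def b_def)
    let ?c = "of_nat a + of_nat b * tau"
    have ps: "part_size e = part_size l" using 3 by (simp add: dominates_def)
    have "?c * jackP l e = tau * ?S"
      using jackP_eigen[OF l ps, of 1] ab unfolding xtower_1[OF sym] eigval_1[OF l]
      by (simp add: algebra_simps)
    moreover have "0 < ?c" using ab tau_pos by (intro add_pos_pos mult_pos_pos) auto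
    ultimately have "jackP l e = tau / ?c * ?S" by (simp add: field_simps)
    moreover have "good ?S"
      unfolding spread_def
    proof (intro good_sum good_mult good_of_nat)
      fix i j a
      let ?s = "lookup e i + lookup e j"
      assume ij: "i \<in> keys e" "j \<in> keys e - {i}" "a \<in> {max (lookup e i) (lookup e j)<..?s}"
      show "good (jackP l (upd2 i j e a (?s - a)))"
      proof (cases "dominates l (upd2 i j e a (?s - a))")
        case True
        have "sq_sum e < sq_sum (upd2 i j e a (?s - a))" by (rule sq_sum_upd2) (use ij in auto)
        then show ?thesis using less[of "upd2 i j e a (?s - a)"] dominates_sq_sum_le[OF l True] by simp
      qed (simp add: jackP_zero[OF l] good_0)
    qed
    ultimately show ?thesis using good_mult[OF good_tau_div[OF ab(1,2)]] by simp
  qed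
qed

section \<open>Two-row partitions\<close>

declare One_nat_def [simp del] single_one [simp del]

definition two_rows :: "nat \<Rightarrow> nat \<Rightarrow> expvec" where
  "two_rows a b = Poly_Mapping.single 0 a + Poly_Mapping.single 1 b"

lemma lookup_two_rows: "lookup (two_rows a b) i = (if i = 0 then a else if i = 1 then b else 0)"
  by (auto simp: two_rows_def lookup_add lookup_single when_def)

lemma part_size_two_rows [simp]: "part_size (two_rows a b) = a + b"
  by (simp add: two_rows_def)

lemma is_partition_two_rows [simp]: "is_partition (two_rows a b) \<longleftrightarrow> b \<le> a"
  unfolding is_partition_def lookup_two_rows by (auto dest: spec[of _ 0])

lemma keys_two_rows: "keys (two_rows a b) \<subseteq> {0, 1}"
  by (auto simp: in_keys_iff lookup_two_rows split: if_splits)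

lemma two_rows_inject [simp]: "two_rows a b = two_rows a' b' \<longleftrightarrow> a = a' \<and> b = b'"
  using lookup_two_rows by (metis one_neq_zero)

lemma sq_sum_two_rows: "sq_sum (two_rows a b) = a\<^sup>2 + b\<^sup>2"
  using sq_sum_superset[OF _ keys_two_rows, of a b] by (simp add: lookup_two_rows)

lemma min_sum_two_rows: "b \<le> a \<Longrightarrow> min_sum (two_rows a b) = a + 3 * b"
  using min_sum_superset[OF _ keys_two_rows, of a b] by (simp add: lookup_two_rows)

lemma sum_two_rows: "2 \<le> k \<Longrightarrow> (\<Sum>i<k. lookup (two_rows a b) i) = a + b"
proof -
  assume "2 \<le> k"
  then have "(\<Sum>i<k. lookup (two_rows a b) i) = (\<Sum>i\<in>{0, 1}. lookup (two_rows a b) i)"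
    by (intro sum.mono_neutral_right) (auto simp: lookup_two_rows)
  then show ?thesis by (simp add: lookup_two_rows)
qed

lemma dominates_two_rows:
  "dominates (two_rows a b) e \<longleftrightarrow> part_size e = a + b \<and> (\<forall>i. lookup e i \<le> a)"
proof
  assume d: "dominates (two_rows a b) e"
  have "lookup e i \<le> a" for i
    using d[unfolded dominates_def, THEN conjunct2, rule_format, of "{i}"] by (simp add: lookup_two_rows)
  then show "part_size e = a + b \<and> (\<forall>i. lookup e i \<le> a)" using d by (simp add: dominates_def)
next
  assume e: "part_size e = a + b \<and> (\<forall>i. lookup e i \<le> a)"
  show "dominates (two_rows a b) e"
    unfolding dominates_def
  proof (intro conjI allI impI)
    fix S :: "nat set" assume S: "finite S"
    consider "card S = 0" | "card S = 1" | "2 \<le> card S" by linarith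
    then show "(\<Sum>i\<in>S. lookup e i) \<le> (\<Sum>i<card S. lookup (two_rows a b) i)"
    proof cases
      case 2
      then obtain i where "S = {i}" by (metis card_1_singletonE)
      then show ?thesis using e by (simp add: lookup_two_rows)
    next
      case 3
      have "(\<Sum>i\<in>S. lookup e i) \<le> (\<Sum>i\<in>S \<union> keys e. lookup e i)"
        using S by (intro sum_mono2) auto
      also have "\<dots> = part_size e" using S by (intro part_size_superset[symmetric]) auto
      finally show ?thesis using e sum_two_rows[OF 3, of a b] by simp
    qed (use S in auto)
  qed (use e in simp)
qed

lemma plength_le_2_two_rows:
  assumes "is_partition l" "plength l \<le> 2"
  shows "l = two_rows (lookup l 0) (lookup l 1)" "lookup l 1 \<le> lookup l 0"
proof -
  have "lookup l i = 0" if "2 \<le> i" for i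
  proof -
    have "i \<notin> keys l" using partition_keys[OF assms(1)] assms(2) that by auto
    then show ?thesis by (simp add: in_keys_iff)
  qed
  then show "l = two_rows (lookup l 0) (lookup l 1)"
    by (intro poly_mapping_eqI) (auto simp: lookup_two_rows not_less_eq_eq intro!: gr0I dest: Suc_leI)
  show "lookup l 1 \<le> lookup l 0" using assms(1) by (simp add: is_partition_def)
qed

section \<open>The derivative by p_1 of a two-row Jack function\<close>

definition jcoord :: "expvec \<Rightarrow> nat multiset \<Rightarrow> ratfun" where
  "jcoord l = psum_coords (part_size l) (jackP l)"

lemma psum_series_jcoord:
  assumes "is_partition l" "part_size e = part_size l"
  shows "psum_series (jcoord l) e = jackP l e"
  unfolding jcoord_def by (rule psum_coords(2)[OF dom_space_symmetric[OF jackP(1)[OF assms(1)]] assms(2)])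

lemma tower_jcoord:
  assumes l: "is_partition l" and N: "N \<in> MP (part_size l)"
  shows "tower k (part_size l) (jcoord l) N = eigval k l * jcoord l N"
proof -
  let ?d = "part_size l"
  have s: "symmetric_series (jackP l)" by (rule dom_space_symmetric[OF jackP(1)[OF l]])
  have "tower k ?d (jcoord l) N = psum_coords ?d (top_op k ?d (jackP l)) N"
    unfolding jcoord_def by (rule psum_coords_top_op[OF s N, symmetric])
  also have "\<dots> = eigval k l * jcoord l N"
  proof (rule psum_coords_eqI[OF _ symmetric_top_op[OF s] N])
    fix e assume e: "part_size e = ?d"
    then show "psum_series (\<lambda>N. eigval k l * jcoord l N) e = top_op k ?d (jackP l) e"
      by (simp add: psum_series_scale psum_series_jcoord[OF l] top_op_def jackP_eigen[OF l])
  qed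
  finally show ?thesis .
qed

text \<open>The Jack functions below \<open>p\<close> span \<open>dom_space p\<close>: subtracting
  the leading one leaves monomial functions of strictly smaller partitions.\<close>

lemma ip_span_jackP:
  assumes "is_partition p" "g \<in> dom_space p" "symmetric_series f"
    "\<And>m. is_partition m \<Longrightarrow> dominates p m \<Longrightarrow> ip d f (jackP m) = 0"
  shows "ip d f g = 0"
  using assms
proof (induction "card (below p)" arbitrary: p g rule: less_induct)
  case less
  let ?g = "\<lambda>e. g e - g p * jackP p e"
  note p = less.prems(1)
  have gp: "?g \<in> dom_space p" by (intro dom_space_diff dom_space_scale less.prems jackP(1))
  have "ip d f (monomial_sym m) = 0" if m: "m \<in> below p" for m
  proof (rule less.hyps)
    have mp: "is_partition m" "m \<noteq> p" "dominates p m" using m by (auto simp: below_def)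
    have "below m \<subset> below p"
    proof
      show "below m \<subseteq> below p"
        using mp p dominates_trans[OF mp(3)] dominates_antisym[of m p] by (auto simp: below_def)
      show "below m \<noteq> below p" using m by (auto simp: below_def)
    qed
    then show "card (below m) < card (below p)" by (intro psubset_card_mono) auto
    show "is_partition m" by (rule mp)
    show "monomial_sym m \<in> dom_space m" by (intro monomial_sym_dom_space mp dominates_refl)
    show "ip d f (jackP k) = 0" if "is_partition k" "dominates m k" for k
      using less.prems(4)[OF that(1)] dominates_trans[OF mp(3) that(2)] by blast
  qed (rule less.prems)
  note z = this
  have "?g = (\<lambda>e. \<Sum>m\<in>below p. ?g m * monomial_sym m e)"
  proof
    fix e show "?g e = (\<Sum>m\<in>below p. ?g m * monomial_sym m e)"
      using dom_space_expand[OF gp p, of e] by (simp add: jackP(2)[OF p])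
  qed
  then have "ip d f ?g = ip d f (\<lambda>e. \<Sum>m\<in>below p. ?g m * monomial_sym m e)" by (rule arg_cong)
  also have "\<dots> = (\<Sum>m\<in>below p. ?g m * ip d f (monomial_sym m))" by (rule ip_sum_right[OF symmetric_monomial_sym])
  also have "\<dots> = 0" by (rule sum.neutral) (simp add: z)
  finally have "ip d f ?g = 0" .
  moreover have "ip d f ?g = ip d f g - g p * ip d f (jackP p)"
    by (simp add: ip_diff_right ip_scale_right dom_space_symmetric[OF less.prems(2)]
      symmetric_scale dom_space_symmetric[OF jackP(1)[OF p]])
  ultimately show ?case using less.prems(4)[OF p dominates_refl[OF p]] by simp
qed

lemma ip_jackP_nonzero:
  assumes "is_partition m"
  shows "ip (part_size m) (jackP m) (jackP m) \<noteq> 0"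
  using ip_anisotropic[OF dom_space_symmetric[OF jackP(1)[OF assms]], of "part_size m" m] jackP(2)[OF assms] by auto

text \<open>After subtraction of the projections, what remains is orthogonal to all Jack functions
  below \<open>p\<close>, hence to all of \<open>dom_space p\<close> and to itself.\<close>

lemma dom_space_jackP_expand:
  assumes p: "is_partition p" and f: "f \<in> dom_space p" and d: "part_size p = d"
    and A: "finite A" "\<And>m. m \<in> A \<Longrightarrow> is_partition m \<and> dominates p m"
    and z: "\<And>m. is_partition m \<Longrightarrow> dominates p m \<Longrightarrow> m \<notin> A \<Longrightarrow> ip d f (jackP m) = 0"
  shows "\<exists>y. f = (\<lambda>e. \<Sum>m\<in>A. y m * jackP m e)"
proof -
  define y where "y m = ip d f (jackP m) / ip d (jackP m) (jackP m)" for m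
  define h where "h = (\<lambda>e. f e - (\<Sum>m\<in>A. y m * jackP m e))"
  have dm: "part_size m = d" if "dominates p m" for m using that d by (simp add: dominates_def)
  have jd: "jackP m \<in> dom_space p" if "m \<in> A" for m
    using jackP(1)[of m] A(2)[OF that] dominates_trans[of p m] by (simp add: dom_space_def)
  have sj: "symmetric_series (jackP m)" if "m \<in> A" for m using jd[OF that] by (rule dom_space_symmetric)
  have hp: "h \<in> dom_space p" unfolding h_def by (intro dom_space_diff dom_space_sum f jd)
  have sf: "symmetric_series f" by (rule dom_space_symmetric[OF f])
  have "ip d h (jackP k) = 0" if k: "is_partition k" "dominates p k" for k
  proof -
    have "ip d h (jackP k) = ip d f (jackP k) - (\<Sum>m\<in>A. y m * ip d (jackP m) (jackP k))"
      unfolding h_def by (subst ip_diff_left[OF sf symmetric_sum[OF sj]]) (simp_all add: ip_sum_left sj)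
    also have "(\<Sum>m\<in>A. y m * ip d (jackP m) (jackP k)) = (\<Sum>m\<in>A. if m = k then ip d f (jackP k) else 0)"
    proof (intro sum.cong refl)
      fix m assume m: "m \<in> A"
      show "y m * ip d (jackP m) (jackP k) = (if m = k then ip d f (jackP k) else 0)"
      proof (cases "m = k")
        case True
        then show ?thesis using ip_jackP_nonzero[OF k(1)] dm[OF k(2)] by (simp add: y_def)
      next
        case False
        then show ?thesis
          using jackP_orthogonal[of m k d] A(2)[OF m] k dm by simp
      qed
    qed
    also have "\<dots> = (if k \<in> A then ip d f (jackP k) else 0)" using A(1) by (simp add: sum.delta)
    finally show ?thesis using z[OF k] by auto
  qed
  then have "ip d h h = 0" by (rule ip_span_jackP[OF p hp dom_space_symmetric[OF hp]])
  then have "h e = 0" for e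
    using ip_anisotropic[OF dom_space_symmetric[OF hp], of d e] dom_space_homogeneous[OF hp] d
    by (cases "part_size e = d") (auto simp: homogeneous_def)
  then show ?thesis by (intro exI[of _ y]) (simp add: h_def fun_eq_iff)
qed

text \<open>The Euler identity at exponent 1: the derivative by p_1 reads off the coefficient linear
  in an additional variable.\<close>

lemma psum_series_pder_1:
  assumes "lookup e 0 = 0"
  shows "psum_series (pder 1 c) e = psum_series c (e + Poly_Mapping.single 0 1)"
  using psum_series_euler[of "e + Poly_Mapping.single 0 1" c] assms by (simp add: lookup_add)

definition jder :: "expvec \<Rightarrow> ratfun mseries" where
  "jder l e = (if part_size e + 1 = part_size l then psum_series (pder 1 (jcoord l)) e else 0)"

lemma jder_nonzero:
  assumes "is_partition l" "jder l e \<noteq> 0"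
  obtains e' where "shape e' = shape e" "dominates l (e' + Poly_Mapping.single 0 1)"
proof -
  have sz: "part_size e + 1 = part_size l" and nz: "psum_series (pder 1 (jcoord l)) e \<noteq> 0"
    using assms(2) by (auto simp: jder_def split: if_splits)
  \<comment> \<open>A variable absent from \<open>e\<close>, brought to position 0, serves as the
    additional one.\<close>
  obtain j where j: "j \<notin> keys e" using ex_new_if_finite[of "keys e"] by auto
  let ?e = "eswap 0 j e"
  have "lookup ?e 0 = 0" using j by (simp add: lookup_eswap in_keys_iff)
  then have "psum_series (pder 1 (jcoord l)) ?e = psum_series (jcoord l) (?e + Poly_Mapping.single 0 1)"
    by (rule psum_series_pder_1)
  also have "\<dots> = jackP l (?e + Poly_Mapping.single 0 1)"
    by (rule psum_series_jcoord[OF assms(1)]) (use sz in simp)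
  finally have "jackP l (?e + Poly_Mapping.single 0 1) \<noteq> 0"
    using nz symmetric_seriesD[OF symmetric_psum_series shape_eswap[of 0 j e], of "pder 1 (jcoord l)"] by simp
  then show ?thesis using jackP_zero[OF assms(1)] by (intro that[of ?e]) auto
qed

lemma symmetric_jder: "symmetric_series (jder l)"
  unfolding symmetric_series_def jder_def
proof (intro allI impI)
  fix e e' :: expvec assume s: "shape e = shape e'"
  show "(if part_size e + 1 = part_size l then psum_series (pder 1 (jcoord l)) e else 0)
    = (if part_size e' + 1 = part_size l then psum_series (pder 1 (jcoord l)) e' else 0)"
    unfolding part_size_shape[OF s] symmetric_seriesD[OF symmetric_psum_series s] ..
qed

lemma jder_dom_space:
  assumes "b \<le> a" "0 < a + b"
  shows "jder (two_rows a b) \<in> dom_space (if b = 0 then two_rows (a - 1) 0 else two_rows a (b - 1))"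
  unfolding dom_space_def
proof (intro CollectI conjI symmetric_jder allI impI)
  fix e assume nz: "jder (two_rows a b) e \<noteq> 0"
  obtain e' where e': "shape e' = shape e" "dominates (two_rows a b) (e' + Poly_Mapping.single 0 1)"
    using jder_nonzero[OF _ nz] assms by auto
  have sz: "part_size e' + 1 = a + b" and le: "\<And>i. lookup (e' + Poly_Mapping.single 0 1) i \<le> a"
    using e'(2) by (auto simp: dominates_two_rows)
  have "lookup e' i \<le> a" for i using le[of i] by (auto simp: lookup_add)
  moreover have "lookup e' i \<le> part_size e'" for i by (rule lookup_le_part_size)
  ultimately have "dominates (if b = 0 then two_rows (a - 1) 0 else two_rows a (b - 1)) e'"
    using sz assms by (auto simp: dominates_two_rows)
  then show "dominates (if b = 0 then two_rows (a - 1) 0 else two_rows a (b - 1)) e"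
    using dominates_shape[OF e'(1)] by blast
qed

lemma psum_coords_jder:
  assumes "N \<in> MP d" "part_size l = Suc d"
  shows "psum_coords d (jder l) N = pder 1 (jcoord l) N"
  by (rule psum_coords_eqI[OF _ symmetric_jder assms(1)]) (simp add: jder_def assms(2))

text \<open>Adjointness turns the derivative into multiplication by p_1. The product p_1 P_m is
  supported below \<open>m\<close> with a box added to its first row, so it only involves Jack
  functions there.\<close>

lemma ip_jder_jackP:
  assumes l: "is_partition l" and m: "is_partition m" and sz: "part_size l = Suc d" "part_size m = d"
    and nd: "\<not> dominates (m + Poly_Mapping.single 0 1) l"
  shows "ip d (jder l) (jackP m) = 0"
proof -
  let ?m = "m + Poly_Mapping.single 0 1"
  define Q where "Q = mul_psum 1 (jackP m)"
  have sm: "symmetric_series (jackP m)" by (rule dom_space_symmetric[OF jackP(1)[OF m]])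
  have sQ: "symmetric_series Q" unfolding Q_def by (rule symmetric_mul_psum[OF sm])
  have pm: "is_partition ?m"
    unfolding is_partition_def
  proof (intro allI impI)
    fix i j :: nat assume "i \<le> j"
    then have "lookup m j \<le> lookup m i" using m unfolding is_partition_def by blast
    then show "lookup ?m j \<le> lookup ?m i" using \<open>i \<le> j\<close> by (cases "j = 0"; cases "i = 0") (simp_all add: lookup_add lookup_single)
  qed
  have Q: "Q \<in> dom_space ?m"
    unfolding dom_space_def
  proof (intro CollectI conjI sQ allI impI)
    fix e assume "Q e \<noteq> 0"
    then have "\<exists>i. 1 \<le> lookup e i \<and> jackP m (e - Poly_Mapping.single i 1) \<noteq> 0"
      unfolding Q_def by (rule contrapos_np) (auto simp: mul_psum_def intro!: sum.neutral)
    then obtain i where i: "1 \<le> lookup e i" "jackP m (e - Poly_Mapping.single i 1) \<noteq> 0" by blast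
    let ?e = "e - Poly_Mapping.single i 1"
    have d: "dominates m ?e" using jackP_zero[OF m] i(2) by blast
    have "1 \<le> part_size e" using i(1) lookup_le_part_size[of e i] by linarith
    then have "part_size e = part_size ?m"
      using dominates_part_size[OF d] part_size_minus_single[OF i(1)] unfolding part_size_add part_size_single by linarith
    moreover have "(\<Sum>k\<in>S. lookup e k) \<le> (\<Sum>k<card S. lookup ?m k)" if S: "finite S" for S
    proof (cases "S = {}")
      case False
      then have c: "0 < card S" using S by auto
      have "(\<Sum>k\<in>S. lookup e k) \<le> (\<Sum>k\<in>S. lookup ?e k + (if k = i then 1 else 0))"
        by (intro sum_mono) (auto simp: lookup_minus lookup_single when_def)
      also have "\<dots> \<le> (\<Sum>k\<in>S. lookup ?e k) + 1" using S by (simp add: sum.distrib)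
      also have "\<dots> \<le> (\<Sum>k<card S. lookup m k) + 1" using d S by (simp add: dominates_def)
      also have "\<dots> = (\<Sum>k<card S. lookup m k + (if k = 0 then 1 else 0))" using c by (simp add: sum.distrib)
      also have "\<dots> = (\<Sum>k<card S. lookup ?m k)"
        by (intro sum.cong) (auto simp: lookup_add lookup_single when_def)
      finally show ?thesis .
    qed simp
    ultimately show "dominates ?m e" by (simp add: dominates_def)
  qed
  have szm: "part_size ?m = Suc d" using sz by simp
  have "ip (Suc d) (jackP l) Q = 0"
  proof (rule ip_span_jackP[OF pm Q dom_space_symmetric[OF jackP(1)[OF l]]])
    fix k assume k: "is_partition k" "dominates ?m k"
    then have "k \<noteq> l" "part_size k = Suc d" using nd szm by (auto simp: dominates_def)
    then show "ip (Suc d) (jackP l) (jackP k) = 0" using jackP_orthogonal[OF l k(1) _ sz(1)] by blast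
  qed
  moreover have "ip (Suc d) (jackP l) Q = pinner (Suc d) (jcoord l) (pmul 1 (jcoord m))"
  proof -
    have "psum_coords (Suc d) Q N = pmul 1 (jcoord m) N" if "N \<in> MP (Suc d)" for N
    proof (rule psum_coords_eqI[OF _ sQ that])
      fix e assume e: "part_size e = Suc d"
      have "psum_series (jcoord m) (e - Poly_Mapping.single i 1) = jackP m (e - Poly_Mapping.single i 1)" if "1 \<le> lookup e i" for i
        by (rule psum_series_jcoord[OF m]) (use e sz part_size_minus_single[OF that] in simp)
      then show "psum_series (pmul 1 (jcoord m)) e = Q e"
        unfolding Q_def psum_series_pmul[OF zero_less_one] mul_psum_def by (auto intro!: sum.cong)
    qed
    then show ?thesis unfolding ip_def jcoord_def[of l] sz(1)[symmetric] by (intro pinner_cong) (auto simp: sz)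
  qed
  moreover have "tau * pinner (Suc d) (pmul 1 (jcoord m)) (jcoord l) = pinner d (jcoord m) (pder 1 (jcoord l))"
    using pinner_adjoint[of 1 "Suc d"] by simp
  moreover have "ip d (jder l) (jackP m) = pinner d (pder 1 (jcoord l)) (jcoord m)"
    unfolding ip_def jcoord_def[of m] sz(2) by (intro pinner_cong) (auto simp: psum_coords_jder sz)
  ultimately show ?thesis by (simp add: pinner_commute)
qed

text \<open>Triangularity alone forces the Pieri expansion of the derivative of a two-row Jack function:
  \<open>\<mu>\<close> must lie below \<open>\<lambda>\<close> minus its last box, and \<open>\<mu>\<close> plus a box in its first row above \<open>\<lambda>\<close>.\<close>

lemma pder_1_jcoord_two_rows:
  assumes ab: "b \<le> a" "0 < a + b"
  obtains y1 y2 where "a = b \<Longrightarrow> y1 = 0" "b = 0 \<Longrightarrow> y2 = 0"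
    "\<And>N. N \<in> MP (a + b - 1) \<Longrightarrow> pder 1 (jcoord (two_rows a b)) N
        = y1 * jcoord (two_rows (a - 1) b) N + y2 * jcoord (two_rows a (b - 1)) N"
proof -
  let ?l = "two_rows a b" and ?d = "a + b - 1"
  let ?p = "if b = 0 then two_rows (a - 1) 0 else two_rows a (b - 1)"
  have p: "is_partition ?p" "part_size ?p = ?d" using ab by auto
  define A1 where "A1 = (if b < a then {two_rows (a - 1) b} else {})"
  define A2 where "A2 = (if 0 < b then {two_rows a (b - 1)} else {})"
  have disj: "A1 \<inter> A2 = {}" using ab by (auto simp: A1_def A2_def)
  have "\<exists>y. jder ?l = (\<lambda>e. \<Sum>m\<in>A1 \<union> A2. y m * jackP m e)"
  proof (rule dom_space_jackP_expand[OF p(1) jder_dom_space[OF ab] p(2)])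
    show "finite (A1 \<union> A2)" by (simp add: A1_def A2_def)
    fix m assume "m \<in> A1 \<union> A2"
    then show "is_partition m \<and> dominates ?p m"
      using ab by (auto simp: A1_def A2_def dominates_two_rows lookup_two_rows split: if_splits)
  next
    fix m assume m: "is_partition m" "dominates ?p m" "m \<notin> A1 \<union> A2"
    have szm: "part_size m = ?d" using m(2) p(2) by (simp add: dominates_def)
    show "ip ?d (jder ?l) (jackP m) = 0"
    proof (rule ip_jder_jackP)
      show "\<not> dominates (m + Poly_Mapping.single 0 1) ?l"
      proof
        assume "dominates (m + Poly_Mapping.single 0 1) ?l"
        then have d: "(\<Sum>i\<in>S. lookup ?l i) \<le> (\<Sum>i<card S. lookup (m + Poly_Mapping.single 0 1) i)" if "finite S" for S
          using that unfolding dominates_def by blast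
        have d1: "a \<le> lookup m 0 + 1" using d[of "{0}"] by (simp add: lookup_two_rows lookup_add)
        \<comment> \<open>The first two rows of \<open>m\<close> already account for its whole size,
          so there is no third row.\<close>
        have d2: "a + b \<le> lookup m 0 + lookup m 1 + 1"
          using d[of "{0, 1}"] by (simp add: lookup_two_rows lookup_add numeral_2_eq_2 lookup_single One_nat_def)
        have le: "lookup m 0 \<le> (if b = 0 then a - 1 else a)"
          using m(2) by (auto simp: dominates_two_rows split: if_splits)
        have "m = two_rows (lookup m 0) (lookup m 1)"
        proof (rule plength_le_2_two_rows(1)[OF m(1)])
          have "keys m \<subseteq> {0, 1}"
          proof
            fix i assume i: "i \<in> keys m"
            show "i \<in> {0, 1}"
            proof (rule ccontr)
              assume "i \<notin> {0, 1}"
              then have "(\<Sum>k\<in>{0, 1, i}. lookup m k) = lookup m 0 + lookup m 1 + lookup m i" by simp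
              moreover have "(\<Sum>k\<in>{0, 1, i}. lookup m k) \<le> (\<Sum>k\<in>{0, 1, i} \<union> keys m. lookup m k)"
                by (rule sum_mono2) auto
              moreover have "(\<Sum>k\<in>{0, 1, i} \<union> keys m. lookup m k) = part_size m"
                by (rule part_size_superset[symmetric]) auto
              ultimately have "lookup m i = 0" using d2 szm by linarith
              then show False using i by (simp add: in_keys_iff)
            qed
          qed
          then show "plength m \<le> 2" unfolding plength_def using card_mono[of "{0, 1}" "keys m"] by simp
        qed
        moreover have "lookup m 0 + lookup m 1 = ?d" using calculation szm by (metis part_size_two_rows)
        moreover have "lookup m 1 \<le> lookup m 0" using m(1) by (simp add: is_partition_def)
        ultimately obtain p q where pq: "m = two_rows p q" "p + q = ?d" "q \<le> p" "p = lookup m 0" by blast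
        have "p = a \<and> q + 1 = b \<or> p + 1 = a \<and> q = b"
          using d1 le ab pq(2,3) unfolding pq(4)[symmetric] by (auto split: if_splits)
        then have "m \<in> A1 \<union> A2"
          unfolding pq(1) A1_def A2_def using pq(3) by auto
        then show False using m(3) by blast
      qed
    qed (use m ab szm in auto)
  qed
  then obtain y where y: "jder ?l = (\<lambda>e. \<Sum>m\<in>A1 \<union> A2. y m * jackP m e)" by blast
  define y1 where "y1 = (if b < a then y (two_rows (a - 1) b) else 0)"
  define y2 where "y2 = (if 0 < b then y (two_rows a (b - 1)) else 0)"
  have jd: "jder ?l e = y1 * jackP (two_rows (a - 1) b) e + y2 * jackP (two_rows a (b - 1)) e" for e
    unfolding y by (subst sum.union_disjoint[OF _ _ disj]) (auto simp: A1_def A2_def y1_def y2_def)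
  show ?thesis
  proof (rule that)
    show "a = b \<Longrightarrow> y1 = 0" "b = 0 \<Longrightarrow> y2 = 0" by (simp_all add: y1_def y2_def)
    fix N assume N: "N \<in> MP ?d"
    have "pder 1 (jcoord ?l) N = psum_coords ?d (jder ?l) N"
      by (rule psum_coords_jder[OF N, symmetric]) (use ab in simp)
    also have "\<dots> = y1 * jcoord (two_rows (a - 1) b) N + y2 * jcoord (two_rows a (b - 1)) N"
    proof (rule psum_coords_eqI[OF _ symmetric_jder N])
      fix e assume e: "part_size e = ?d"
      have 1: "y1 * psum_series (jcoord (two_rows (a - 1) b)) e = y1 * jackP (two_rows (a - 1) b) e"
        using e ab by (cases "b < a") (auto simp: y1_def psum_series_jcoord)
      have 2: "y2 * psum_series (jcoord (two_rows a (b - 1))) e = y2 * jackP (two_rows a (b - 1)) e"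
        using e ab by (cases "0 < b") (auto simp: y2_def psum_series_jcoord)
      show "psum_series (\<lambda>N. y1 * jcoord (two_rows (a - 1) b) N + y2 * jcoord (two_rows a (b - 1)) N) e = jder ?l e"
        by (simp only: psum_series_add psum_series_scale 1 2 jd)
    qed
    finally show "pder 1 (jcoord ?l) N = y1 * jcoord (two_rows (a - 1) b) N + y2 * jcoord (two_rows a (b - 1)) N" .
  qed
qed

text \<open>The derivation p_k -> k p_(k-1) for k >= 2, that is, the part of the sum of all d/dx_i
  that does not see the number of variables.\<close>

definition plower :: "nat \<Rightarrow> (nat multiset \<Rightarrow> 'a::comm_semiring_1) \<Rightarrow> nat multiset \<Rightarrow> 'a" where
  "plower D c N = (\<Sum>a\<in>{2..D}. pmul (a - 1) (pder a c) N)"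

lemma pder_pmul: "pder 1 (pmul b v) N = pmul b (pder 1 v) N + (if b = 1 then v N else 0)"
proof (cases "b \<in># N")
  case True
  then obtain N' where N: "N = add_mset b N'" by (metis insert_DiffM)
  show ?thesis
    unfolding N by (cases "b = 1") (simp_all add: pder_def pmul_def algebra_simps add_mset_commute[of 1 b])
next
  case False
  have "count N b = 0" using False by (meson count_inI)
  with False show ?thesis by (cases "b = 1") (simp_all add: pder_def pmul_def)
qed

lemma pder_commute: "pder 1 (pder a v) N = pder a (pder 1 v) N"
  by (cases "a = 1") (simp_all add: pder_def add_mset_commute[of a 1] mult_ac)

lemma tower_1_alt:
  "tower 1 D c N = (\<Sum>b=1..D. pmul b (lax D (\<lambda>b. pder b c) b) N)"
  by (simp add: tower_def One_nat_def)

lemma pder_add: "pder k (\<lambda>N. a N + b N) N = pder k a N + pder k b N"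
  and pder_scale: "pder k (\<lambda>N. r * a N) N = r * pder k a N"
  by (simp_all add: pder_def algebra_simps)

lemma pder_sum: "pder k (\<lambda>N. \<Sum>x\<in>A. f x N) N = (\<Sum>x\<in>A. pder k (f x) N)"
  by (simp add: pder_def sum_distrib_left)

text \<open>The derivation by p_1 fails to commute only with multiplication by p_1, which sits in
  the entries next to the diagonal.\<close>

lemma pder_lax:
  assumes "1 \<le> b"
  shows "pder 1 (lax D (\<lambda>b. pder b c) b) N = lax D (\<lambda>b. pder b (pder 1 c)) b N
    + tau * (if b < D then pder (Suc b) c N else 0)"
proof -
  have "lax D (\<lambda>b. pder b c) b = (\<lambda>N. (1 - tau) * of_nat b * pder b c N + tau * (\<Sum>a\<in>{b<..D}. pmul (a - b) (pder a c) N)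
     + (\<Sum>a\<in>{1..<b}. pder (b - a) (pder a c) N))" by (simp add: fun_eq_iff lax_def)
  then have "pder 1 (lax D (\<lambda>b. pder b c) b) N = (1 - tau) * of_nat b * pder 1 (pder b c) N
     + tau * (\<Sum>a\<in>{b<..D}. pder 1 (pmul (a - b) (pder a c)) N) + (\<Sum>a\<in>{1..<b}. pder 1 (pder (b - a) (pder a c)) N)"
    by (simp only: pder_add pder_scale pder_sum)
  also have "(\<Sum>a\<in>{b<..D}. pder 1 (pmul (a - b) (pder a c)) N)
      = (\<Sum>a\<in>{b<..D}. pmul (a - b) (pder a (pder 1 c)) N) + (\<Sum>a\<in>{b<..D}. if a = Suc b then pder a c N else 0)"
  proof -
    have "pder 1 (pder a c) = pder a (pder 1 c)" for a by (rule ext) (rule pder_commute)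
    then show ?thesis
      unfolding sum.distrib[symmetric] by (intro sum.cong refl) (auto simp: pder_pmul)
  qed
  also have "(\<Sum>a\<in>{b<..D}. if a = Suc b then pder a c N else 0) = (if b < D then pder (Suc b) c N else 0)"
    by (subst sum.delta) auto
  also have "(\<Sum>a\<in>{1..<b}. pder 1 (pder (b - a) (pder a c)) N) = (\<Sum>a\<in>{1..<b}. pder (b - a) (pder a (pder 1 c)) N)"
  proof -
    have "pder 1 (pder a c) = pder a (pder 1 c)" for a by (rule ext) (rule pder_commute)
    then show ?thesis by (simp add: pder_commute)
  qed
  finally show ?thesis
    unfolding lax_def[of D "\<lambda>b. pder b (pder 1 c)" b N] by (simp add: pder_commute algebra_simps)
qed

text \<open>Multiplication by p_1 occurs twice: in the matrix, next to its diagonal, and in the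
  outer row. Each occurrence contributes one copy of tau times \<open>plower\<close>, and the outer
  one also the diagonal entry 1 - tau.\<close>

lemma pder_tower:
  assumes "1 \<le> D"
  shows "pder 1 (tower 1 D c) N = tower 1 D (pder 1 c) N + (1 - tau) * pder 1 c N + 2 * tau * plower D c N"
proof -
  let ?u = "\<lambda>b. pder b c"
  have "tower 1 D c = (\<lambda>N. \<Sum>b=1..D. pmul b (lax D ?u b) N)" by (simp add: fun_eq_iff tower_1_alt)
  then have "pder 1 (tower 1 D c) N = (\<Sum>b=1..D. pder 1 (pmul b (lax D ?u b)) N)" by (simp only: pder_sum)
  also have "\<dots> = (\<Sum>b=1..D. pmul b (pder 1 (lax D ?u b)) N) + (\<Sum>b=1..D. if b = 1 then lax D ?u b N else 0)"
    by (simp only: pder_pmul sum.distrib)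
  also have "(\<Sum>b=1..D. if b = 1 then lax D ?u b N else 0) = lax D ?u 1 N"
    using assms by (simp add: sum.delta)
  also have "\<dots> = (1 - tau) * pder 1 c N + tau * plower D c N"
  proof -
    have "{1<..D} = {2..D}" by auto
    then show ?thesis by (simp add: lax_def plower_def)
  qed
  also have "(\<Sum>b=1..D. pmul b (pder 1 (lax D ?u b)) N) = tower 1 D (pder 1 c) N + tau * plower D c N"
  proof -
    have "pmul b (pder 1 (lax D ?u b)) N = pmul b (lax D (\<lambda>b. pder b (pder 1 c)) b) N
       + tau * (if b < D then pmul b (pder (Suc b) c) N else 0)" if "b \<in> {1..D}" for b
      using that by (auto simp: pmul_def pder_lax)
    then have "(\<Sum>b=1..D. pmul b (pder 1 (lax D ?u b)) N) = tower 1 D (pder 1 c) N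
       + tau * (\<Sum>b=1..D. if b < D then pmul b (pder (Suc b) c) N else 0)"
      by (simp add: tower_1_alt sum.distrib sum_distrib_left)
    also have "(\<Sum>b=1..D. if b < D then pmul b (pder (Suc b) c) N else 0) = (\<Sum>b\<in>{b\<in>{1..D}. b < D}. pmul b (pder (Suc b) c) N)"
      by (rule sum.inter_filter[symmetric]) simp
    also have "\<dots> = plower D c N"
      unfolding plower_def by (rule sum.reindex_bij_witness[of _ "\<lambda>a. a - 1" Suc]) auto
    finally show ?thesis .
  qed
  finally show ?thesis by (simp add: algebra_simps)
qed

lemma pmul_large:
  assumes "sum_mset N < k"
  shows "pmul k v N = 0"
  using assms sum_mset.remove[of k N] by (auto simp: pmul_def)

text \<open>Differentiation lowers the degree but not the bound \<open>D\<close> on the indices; the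
  extra index only contributes multiplications by parts too large to occur.\<close>

lemma tower_1_degree:
  assumes "N \<in> MP D"
  shows "tower 1 (Suc D) c N = tower 1 D c N"
proof -
  have N: "sum_mset N = D" using assms by (simp add: MP_def)
  have "pmul b (lax (Suc D) (\<lambda>b. pder b c) b) N = pmul b (lax D (\<lambda>b. pder b c) b) N" if b: "b \<in> {1..D}" for b
  proof (cases "b \<in># N")
    case True
    then have "sum_mset (N - {#b#}) < Suc D - b" using N b sum_mset.remove[OF True] by simp
    then have "pmul (Suc D - b) (pder (Suc D) c) (N - {#b#}) = 0" by (rule pmul_large)
    moreover have "{b<..Suc D} = insert (Suc D) {b<..D}" using b by auto
    ultimately show ?thesis using True by (simp add: pmul_def lax_def)
  qed (simp add: pmul_def)
  moreover have "pmul (Suc D) (lax (Suc D) (\<lambda>b. pder b c) (Suc D)) N = 0" by (rule pmul_large) (simp add: N)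
  ultimately show ?thesis unfolding tower_1_alt by simp
qed

lemma tower_cong:
  assumes "\<And>N. N \<in> MP D \<Longrightarrow> c N = c' N" "N \<in> MP D"
  shows "tower k D c N = tower k D c' N"
proof -
  have "tower k D c N - tower k D c' N = 0"
  proof (rule psum_series_eq_0D[of D "\<lambda>N. tower k D c N - tower k D c' N", OF _ assms(2)])
    fix e assume e: "part_size e = D"
    have "xtower k (psum_series c) e = xtower k (psum_series c') e"
      by (rule xtower_cong[OF _ e]) (simp add: psum_series_def assms(1))
    then show "psum_series (\<lambda>N. tower k D c N - tower k D c' N) e = 0"
      by (simp add: psum_series_diff psum_series_tower[OF e])
  qed
  then show ?thesis by simp
qed

lemma tower_1_linear:
  "tower 1 D (\<lambda>N. y1 * c1 N + y2 * c2 N) N = y1 * tower 1 D c1 N + y2 * tower 1 D c2 N"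
proof -
  have p: "pder b (\<lambda>N. y1 * c1 N + y2 * c2 N) = (\<lambda>N. y1 * pder b c1 N + y2 * pder b c2 N)" for b
    by (rule ext) (simp add: pder_def algebra_simps)
  have m: "pmul k (\<lambda>N. y1 * a N + y2 * b N) N = y1 * pmul k a N + y2 * pmul k b N" for k a b N
    by (simp add: pmul_def)
  have d: "pder k (\<lambda>N. y1 * a N + y2 * b N) N = y1 * pder k a N + y2 * pder k b N" for k a b N
    by (simp add: pder_def algebra_simps)
  have "lax D (\<lambda>b. pder b (\<lambda>N. y1 * c1 N + y2 * c2 N)) b = (\<lambda>N. y1 * lax D (\<lambda>b. pder b c1) b N + y2 * lax D (\<lambda>b. pder b c2) b N)" for b
    by (rule ext) (simp add: lax_def p m d sum.distrib algebra_simps flip: sum_distrib_left)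
  then show ?thesis
    by (simp add: tower_1_alt m sum.distrib flip: sum_distrib_left)
qed

lemma eigval_1_two_rows:
  "b \<le> a \<Longrightarrow> eigval 1 (two_rows a b) = of_nat (a\<^sup>2 + b\<^sup>2) - tau * of_nat (a + 3 * b)"
  by (simp add: eigval_1 sq_sum_two_rows min_sum_two_rows)

text \<open>Applied to an eigenvector, the commutator multiplies each Pieri term by a difference of
  eigenvalues. Apart from the summand 1 - tau this is twice the content of the removed box: its
  column minus tau times its row, both counted from 0.\<close>

lemma plower_jcoord:
  assumes ab: "b \<le> a" "0 < a + b" and N: "N \<in> MP (a + b - 1)"
    and y: "a = b \<Longrightarrow> y1 = 0" "b = 0 \<Longrightarrow> y2 = 0"
    "\<And>N. N \<in> MP (a + b - 1) \<Longrightarrow> pder 1 (jcoord (two_rows a b)) N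
        = y1 * jcoord (two_rows (a - 1) b) N + y2 * jcoord (two_rows a (b - 1)) N"
  shows "tau * plower (a + b) (jcoord (two_rows a b)) N
    = of_nat (a - 1) * y1 * jcoord (two_rows (a - 1) b) N + (of_nat (b - 1) - tau) * y2 * jcoord (two_rows a (b - 1)) N"
proof -
  let ?l = "two_rows a b" and ?D = "a + b - 1"
  let ?c = "jcoord ?l" and ?c1 = "jcoord (two_rows (a - 1) b)" and ?c2 = "jcoord (two_rows a (b - 1))"
  have sD: "Suc ?D = a + b" using ab by simp
  have N1: "add_mset 1 N \<in> MP (a + b)" using N ab by (auto simp: MP_def)
  have 1: "pder 1 (tower 1 (a + b) ?c) N = eigval 1 ?l * pder 1 ?c N"
    using tower_jcoord[of ?l "add_mset 1 N" 1] N1 ab by (simp add: pder_def)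
  have "tower 1 (a + b) (pder 1 ?c) N = tower 1 ?D (pder 1 ?c) N"
    using tower_1_degree[OF N, of "pder 1 ?c"] unfolding sD .
  also have "\<dots> = tower 1 ?D (\<lambda>N. y1 * ?c1 N + y2 * ?c2 N) N" by (rule tower_cong[OF y(3) N])
  also have "\<dots> = y1 * tower 1 ?D ?c1 N + y2 * tower 1 ?D ?c2 N" by (rule tower_1_linear)
  also have "y1 * tower 1 ?D ?c1 N = y1 * (eigval 1 (two_rows (a - 1) b) * ?c1 N)"
  proof (cases "a = b")
    case False
    show ?thesis
    proof -
      have "a - 1 + b = ?D" using ab by linarith
      then show ?thesis using tower_jcoord[of "two_rows (a - 1) b" N 1] N ab False by simp
    qed
  qed (simp add: y(1))
  also have "\<dots> = y1 * ((of_nat ((a - 1)\<^sup>2 + b\<^sup>2) - tau * of_nat (a - 1 + 3 * b)) * ?c1 N)"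
    using y(1) ab by (cases "a = b") (simp_all add: eigval_1_two_rows)
  also have "y2 * tower 1 ?D ?c2 N = y2 * (eigval 1 (two_rows a (b - 1)) * ?c2 N)"
  proof (cases "b = 0")
    case False
    show ?thesis
    proof -
      have "a + (b - 1) = ?D" using False by linarith
      then show ?thesis using tower_jcoord[of "two_rows a (b - 1)" N 1] N ab by simp
    qed
  qed (simp add: y(2))
  also have "\<dots> = y2 * ((of_nat (a\<^sup>2 + (b - 1)\<^sup>2) - tau * of_nat (a + 3 * (b - 1))) * ?c2 N)"
    using y(2) ab by (cases "b = 0") (simp_all add: eigval_1_two_rows)
  finally have 2: "tower 1 (a + b) (pder 1 ?c) N = y1 * ((of_nat ((a - 1)\<^sup>2 + b\<^sup>2) - tau * of_nat (a - 1 + 3 * b)) * ?c1 N)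
     + y2 * ((of_nat (a\<^sup>2 + (b - 1)\<^sup>2) - tau * of_nat (a + 3 * (b - 1))) * ?c2 N)" .
  have 3: "pder 1 (tower 1 (a + b) ?c) N = tower 1 (a + b) (pder 1 ?c) N + (1 - tau) * pder 1 ?c N + 2 * tau * plower (a + b) ?c N"
    by (rule pder_tower) (use ab in linarith)
  have E: "eigval 1 ?l = of_nat (a\<^sup>2 + b\<^sup>2) - tau * of_nat (a + 3 * b)" using ab by (simp add: eigval_1_two_rows)
  have A: "of_nat (a - 1) = (of_nat a - 1 :: ratfun)"
  proof -
    have "1 \<le> a" using ab by linarith
    then show ?thesis by (simp add: of_nat_diff)
  qed
  \<comment> \<open>For b = 0 the truncated \<open>b - 1\<close> differs from the true difference,
    but then \<open>y2\<close> is 0.\<close>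
  have B: "of_nat (b - 1) * (y2 * ?c2 N) = (of_nat b - 1) * (y2 * ?c2 N)"
  proof (cases "b = 0")
    case False
    then have "of_nat (b - 1) = (of_nat b - 1 :: ratfun)" by (simp add: of_nat_diff)
    then show ?thesis by simp
  qed (simp add: y(2))
  have B2: "y2 * ((of_nat (a\<^sup>2 + (b - 1)\<^sup>2) - tau * of_nat (a + 3 * (b - 1))) * ?c2 N)
      = ((of_nat a)\<^sup>2 + (of_nat b - 1)\<^sup>2 - tau * (of_nat a + 3 * (of_nat b - 1))) * (y2 * ?c2 N)"
  proof (cases "b = 0")
    case False
    then have "of_nat (b - 1) = (of_nat b - 1 :: ratfun)" by (simp add: of_nat_diff)
    then show ?thesis by (simp only: of_nat_add of_nat_mult of_nat_power of_nat_numeral mult_ac)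
  qed (simp add: y(2))
  have A2: "y1 * ((of_nat ((a - 1)\<^sup>2 + b\<^sup>2) - tau * of_nat (a - 1 + 3 * b)) * ?c1 N)
      = ((of_nat a - 1)\<^sup>2 + (of_nat b)\<^sup>2 - tau * (of_nat a - 1 + 3 * of_nat b)) * (y1 * ?c1 N)"
    by (simp only: of_nat_add of_nat_mult of_nat_power of_nat_numeral A mult_ac)
  have ident: "(A\<^sup>2 + B\<^sup>2 - t * (A + 3 * B)) * (p + q)
      = (((A - 1)\<^sup>2 + B\<^sup>2 - t * (A - 1 + 3 * B)) * p + (A\<^sup>2 + (B - 1)\<^sup>2 - t * (A + 3 * (B - 1))) * q)
        + (1 - t) * (p + q) + 2 * ((A - 1) * p + (B - 1 - t) * q)" for A B t p q :: ratfun
    by (simp add: algebra_simps power2_eq_square)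
  have "(of_nat (a\<^sup>2 + b\<^sup>2) - tau * of_nat (a + 3 * b)) * (y1 * ?c1 N + y2 * ?c2 N)
     = (((of_nat a - 1)\<^sup>2 + (of_nat b)\<^sup>2 - tau * (of_nat a - 1 + 3 * of_nat b)) * (y1 * ?c1 N)
       + ((of_nat a)\<^sup>2 + (of_nat b - 1)\<^sup>2 - tau * (of_nat a + 3 * (of_nat b - 1))) * (y2 * ?c2 N))
       + (1 - tau) * (y1 * ?c1 N + y2 * ?c2 N) + 2 * tau * plower (a + b) ?c N"
    using 3 unfolding 1 2 E y(3)[OF N] A2 B2 .
  then have "2 * (tau * plower (a + b) ?c N) = 2 * ((of_nat a - 1) * (y1 * ?c1 N) + (of_nat b - 1 - tau) * (y2 * ?c2 N))"
    unfolding of_nat_add of_nat_mult of_nat_power of_nat_numeral ident mult.assoc by simp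
  then have "tau * plower (a + b) ?c N = of_nat (a - 1) * (y1 * ?c1 N) + (of_nat (b - 1) * (y2 * ?c2 N) - tau * (y2 * ?c2 N))"
    unfolding A B by (simp add: algebra_simps)
  then show ?thesis by (simp only: mult.assoc left_diff_distrib)
qed

section \<open>The coefficients of p_1^d and p_2 p_1^(d-2)\<close>

lemma pder_1_replicate: "pder 1 c (replicate_mset n 1) = of_nat (Suc n) * c (replicate_mset (Suc n) 1)"
  unfolding pder_def by (simp add: add.commute)

lemma pder_2_replicate: "pder 2 c (replicate_mset n 1) = 2 * c (add_mset 2 (replicate_mset n 1))"
  unfolding pder_def by simp

lemma pmul_replicate: "pmul k v (replicate_mset (Suc n) 1) = (if k = 1 then v (replicate_mset n 1) else 0)"
  unfolding pmul_def by simp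

lemma tower_1_replicate:
  "tower 1 (Suc (Suc d)) c (replicate_mset (Suc (Suc d)) 1)
    = (1 - tau) * (of_nat (Suc (Suc d)) * c (replicate_mset (Suc (Suc d)) 1)) + tau * (2 * c (add_mset 2 (replicate_mset d 1)))"
proof -
  let ?D = "Suc (Suc d)"
  have "tower 1 ?D c (replicate_mset ?D 1) = lax ?D (\<lambda>b. pder b c) 1 (replicate_mset (Suc d) 1)"
    unfolding tower_1_alt pmul_replicate by (subst sum.delta) auto
  also have "\<dots> = (1 - tau) * pder 1 c (replicate_mset (Suc d) 1)
      + tau * (\<Sum>a\<in>{1<..?D}. pmul (a - 1) (pder a c) (replicate_mset (Suc d) 1))"
    unfolding lax_def by simp
  also have "(\<Sum>a\<in>{1<..?D}. pmul (a - 1) (pder a c) (replicate_mset (Suc d) 1))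
      = (\<Sum>a\<in>{1<..?D}. if a = 2 then pder 2 c (replicate_mset d 1) else 0)"
    unfolding pmul_replicate by (intro sum.cong refl) auto
  also have "\<dots> = pder 2 c (replicate_mset d 1)"
    by (subst sum.delta) auto
  finally show ?thesis unfolding pder_1_replicate pder_2_replicate .
qed

text \<open>The eigenvalue equation at p_1^(d+2) involves only this coefficient and that of p_2
  p_1^d. Their explicit relation gives a second equation for the Pieri coefficients.\<close>

lemma leading_psum_coeffs:
  assumes ab: "b \<le> a" "a + b = Suc (Suc d)"
  shows "2 * tau * jcoord (two_rows a b) (add_mset 2 (replicate_mset d 1))
    = (of_nat (a\<^sup>2 + b\<^sup>2) - of_nat (a + b) - 2 * tau * of_nat b) * jcoord (two_rows a b) (replicate_mset (a + b) 1)"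
proof -
  let ?c = "jcoord (two_rows a b)"
  have "replicate_mset (a + b) 1 \<in> MP (part_size (two_rows a b))" by (simp add: MP_def)
  from tower_jcoord[OF _ this, of 1]
  have "tower 1 (a + b) ?c (replicate_mset (a + b) 1) = eigval 1 (two_rows a b) * ?c (replicate_mset (a + b) 1)"
    using ab(1) by simp
  moreover have "tower 1 (a + b) ?c (replicate_mset (a + b) 1) = (1 - tau) * (of_nat (a + b) * ?c (replicate_mset (a + b) 1)) + tau * (2 * ?c (add_mset 2 (replicate_mset d 1)))"
    unfolding ab(2) by (rule tower_1_replicate)
  ultimately show ?thesis
    unfolding eigval_1_two_rows[OF ab(1)] by (simp add: algebra_simps)
qed

section \<open>The embedding into the real rational functions\<close>

abbreviation of_rat_poly :: "rat poly \<Rightarrow> real poly" where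
  "of_rat_poly \<equiv> map_poly of_rat"

lemma of_rat_poly_add: "of_rat_poly (p + q) = of_rat_poly p + of_rat_poly q"
  by (rule poly_eqI) (simp add: coeff_map_poly of_rat_add)

lemma of_rat_poly_mult: "of_rat_poly (p * q) = of_rat_poly p * of_rat_poly q"
  by (rule poly_eqI) (simp add: coeff_map_poly coeff_mult of_rat_mult of_rat_sum)

lemma of_rat_poly_eq_0 [simp]: "of_rat_poly p = 0 \<longleftrightarrow> p = 0"
proof
  assume "of_rat_poly p = 0"
  then have "coeff (of_rat_poly p) i = 0" for i by simp
  then show "p = 0" by (intro poly_eqI) (simp add: coeff_map_poly)
qed simp

text \<open>The embedding is defined on lowest terms; cross multiplication frees it from
  them.\<close>

lemma ratfun_to_real_Fract:
  assumes "g \<noteq> 0"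
  shows "ratfun_to_real (Fract f g) = Fract (of_rat_poly f) (of_rat_poly g)"
proof -
  let ?q = "quot_of_fract (Fract f g)"
  have "Fract (fst ?q) (snd ?q) = Fract f g" by (rule Fract_quot_of_fract)
  then have "fst ?q * g = f * snd ?q"
    by (rule eq_fract(1)[THEN iffD1, OF snd_quot_of_fract_nonzero assms])
  then have "of_rat_poly (fst ?q) * of_rat_poly g = of_rat_poly f * of_rat_poly (snd ?q)"
    by (simp flip: of_rat_poly_mult)
  then show ?thesis
    using assms by (simp add: ratfun_to_real_def real_num_def real_den_def eq_fract)
qed

lemma ratfun_to_real_add: "ratfun_to_real (r + s) = ratfun_to_real r + ratfun_to_real s"
  by (cases r, cases s) (simp add: ratfun_to_real_Fract of_rat_poly_add of_rat_poly_mult)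

lemma ratfun_to_real_mult: "ratfun_to_real (r * s) = ratfun_to_real r * ratfun_to_real s"
  by (cases r, cases s) (simp add: ratfun_to_real_Fract of_rat_poly_mult)

lemma ratfun_to_real_0 [simp]: "ratfun_to_real 0 = 0"
  using ratfun_to_real_Fract[of 1 0] by (simp add: fract_collapse)

lemma ratfun_to_real_1 [simp]: "ratfun_to_real 1 = 1"
  using ratfun_to_real_Fract[of 1 1] by (simp add: fract_collapse)

lemma ratfun_to_real_of_nat [simp]: "ratfun_to_real (of_nat n) = of_nat n"
  by (induction n) (simp_all add: ratfun_to_real_add)

lemma ratfun_to_real_diff: "ratfun_to_real (r - s) = ratfun_to_real r - ratfun_to_real s"
  using ratfun_to_real_add[of "r - s" s] by simp

lemma ratfun_to_real_sum: "ratfun_to_real (sum f A) = (\<Sum>x\<in>A. ratfun_to_real (f x))"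
  by (induction A rule: infinite_finite_induct) (simp_all add: ratfun_to_real_add)

lemma ratfun_to_real_divide: "ratfun_to_real (r / s) = ratfun_to_real r / ratfun_to_real s"
proof (cases "s = 0")
  case False
  have "ratfun_to_real (r / s) * ratfun_to_real s = ratfun_to_real r"
    using False by (simp flip: ratfun_to_real_mult)
  moreover have "ratfun_to_real s * ratfun_to_real (1 / s) = 1"
    using False by (simp flip: ratfun_to_real_mult)
  then have "ratfun_to_real s \<noteq> 0" by auto
  ultimately show ?thesis by (simp add: field_simps)
qed simp

definition real_tau :: "real poly fract" where
  "real_tau = Fract [:0, 1:] 1"

lemma ratfun_to_real_tau [simp]: "ratfun_to_real tau = real_tau"
  unfolding tau_def real_tau_def by (simp add: ratfun_to_real_Fract map_poly_pCons)

lemma nonneg_ratfunsI: "(\<forall>i. 0 \<le> coeff f i) \<Longrightarrow> (\<forall>i. 0 \<le> coeff g i) \<Longrightarrow> g \<noteq> 0 \<Longrightarrow> Fract f g \<in> nonneg_ratfuns"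
  unfolding nonneg_ratfuns_def by blast

lemma nonneg_ratfunsE:
  assumes "x \<in> nonneg_ratfuns"
  obtains f g where "x = Fract f g" "\<forall>i. 0 \<le> coeff f i" "\<forall>i. 0 \<le> coeff g i" "g \<noteq> 0"
  using assms unfolding nonneg_ratfuns_def by blast

lemma nonneg_ratfuns_add: "x \<in> nonneg_ratfuns \<Longrightarrow> y \<in> nonneg_ratfuns \<Longrightarrow> x + y \<in> nonneg_ratfuns"
  by (elim nonneg_ratfunsE) (auto intro!: nonneg_ratfunsI simp: coeff_mult_nonneg)

lemma nonneg_ratfuns_mult: "x \<in> nonneg_ratfuns \<Longrightarrow> y \<in> nonneg_ratfuns \<Longrightarrow> x * y \<in> nonneg_ratfuns"
  by (elim nonneg_ratfunsE) (auto intro!: nonneg_ratfunsI simp: coeff_mult_nonneg)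

lemma nonneg_ratfuns_const: "0 \<le> c \<Longrightarrow> Fract [:c:] 1 \<in> nonneg_ratfuns"
  by (rule nonneg_ratfunsI) (auto simp: coeff_pCons split: nat.splits)

lemma nonneg_ratfuns_0: "0 \<in> nonneg_ratfuns" and nonneg_ratfuns_1: "1 \<in> nonneg_ratfuns"
  using nonneg_ratfuns_const[of 0] nonneg_ratfuns_const[of 1] by (simp_all add: fract_collapse flip: One_fract_def one_pCons)

lemma nonneg_ratfuns_inverse:
  assumes "x \<in> nonneg_ratfuns"
  shows "inverse x \<in> nonneg_ratfuns"
  using assms
proof (elim nonneg_ratfunsE)
  fix f g assume *: "x = Fract f g" "\<forall>i. 0 \<le> coeff f i" "\<forall>i. 0 \<le> coeff g i" "g \<noteq> 0"
  show ?thesis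
  proof (cases "f = 0")
    case True
    then show ?thesis using * by (simp add: fract_collapse nonneg_ratfuns_0)
  next
    case False
    then show ?thesis using * by (auto intro: nonneg_ratfunsI)
  qed
qed

lemma nonneg_ratfuns_divide: "x \<in> nonneg_ratfuns \<Longrightarrow> y \<in> nonneg_ratfuns \<Longrightarrow> x / y \<in> nonneg_ratfuns"
  unfolding divide_inverse by (intro nonneg_ratfuns_mult nonneg_ratfuns_inverse)

lemma nonneg_ratfuns_of_nat: "of_nat n \<in> nonneg_ratfuns"
  by (induction n) (simp_all add: nonneg_ratfuns_0 nonneg_ratfuns_1 nonneg_ratfuns_add)

lemma nonneg_ratfuns_tau: "real_tau \<in> nonneg_ratfuns"
  unfolding real_tau_def by (rule nonneg_ratfunsI) (auto simp: coeff_pCons split: nat.splits)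

lemma nonneg_ratfuns_sum: "(\<And>x. x \<in> A \<Longrightarrow> f x \<in> nonneg_ratfuns) \<Longrightarrow> sum f A \<in> nonneg_ratfuns"
  by (induction A rule: infinite_finite_induct) (simp_all add: nonneg_ratfuns_0 nonneg_ratfuns_add)

lemma nonneg_ratfuns_power: "x \<in> nonneg_ratfuns \<Longrightarrow> x ^ k \<in> nonneg_ratfuns"
  by (induction k) (simp_all add: nonneg_ratfuns_1 nonneg_ratfuns_mult)

lemma nonneg_ratfuns_prod: "(\<And>x. x \<in> A \<Longrightarrow> f x \<in> nonneg_ratfuns) \<Longrightarrow> prod f A \<in> nonneg_ratfuns"
  by (induction A rule: infinite_finite_induct) (simp_all add: nonneg_ratfuns_1 nonneg_ratfuns_mult)

lemma poly_nonneg_coeffs: "(\<forall>i. 0 \<le> coeff f i) \<Longrightarrow> (0 :: 'a::linordered_idom poly) \<le> f"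
  by (auto simp: less_eq_poly_def pos_poly_def less_le)

lemma nonneg_ratfuns_ge_0: "x \<in> nonneg_ratfuns \<Longrightarrow> 0 \<le> x"
proof (elim nonneg_ratfunsE)
  fix f g assume *: "x = Fract f g" "\<forall>i. 0 \<le> coeff f i" "\<forall>i. 0 \<le> coeff g i" "g \<noteq> 0"
  then have "0 \<le> f" "0 < g" using poly_nonneg_coeffs[of f] poly_nonneg_coeffs[of g] by auto
  then show "0 \<le> x" using * by (simp add: zero_le_Fract_iff)
qed

lemma good_nonneg: "good r \<Longrightarrow> ratfun_to_real r \<in> nonneg_ratfuns"
proof -
  assume "good r"
  then obtain f g where *: "r = Fract f g" "\<forall>i. 0 \<le> coeff f i" "\<forall>i. 0 \<le> coeff g i" "0 < coeff g 0"
    unfolding good_def by blast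
  then have "g \<noteq> 0" by auto
  then show ?thesis
    unfolding *(1) ratfun_to_real_Fract[OF \<open>g \<noteq> 0\<close>] using *
    by (intro nonneg_ratfunsI) (auto simp: coeff_map_poly)
qed

lemma real_tau_pos: "0 < real_tau"
  by (simp add: real_tau_def zero_less_Fract_iff less_poly_def pos_poly_def)

section \<open>Evaluation in finitely many variables\<close>

definition exps :: "nat \<Rightarrow> nat \<Rightarrow> expvec set" where
  "exps n d = {e. keys e \<subseteq> {..<n} \<and> part_size e = d}"

lemma finite_exps [simp]: "finite (exps n d)"
proof (rule finite_imageD)
  have "lookup ` exps n d \<subseteq> {g. \<forall>i. (i \<in> {..<n} \<longrightarrow> g i \<in> {..d}) \<and> (i \<notin> {..<n} \<longrightarrow> g i = 0)}"
  proof clarify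
    fix e i assume e: "e \<in> exps n d"
    have "lookup e i \<le> d" using e lookup_le_part_size[of e i] by (auto simp: exps_def)
    moreover have "lookup e i = 0" if "i \<notin> {..<n}" using e that by (auto simp: exps_def in_keys_iff)
    ultimately show "(i \<in> {..<n} \<longrightarrow> lookup e i \<in> {..d}) \<and> (i \<notin> {..<n} \<longrightarrow> lookup e i = 0)" by simp
  qed
  then show "finite (lookup ` exps n d)"
    by (rule finite_subset) (rule finite_set_of_finite_funs, auto)
  show "inj_on lookup (exps n d)" by (rule inj_onI) (simp add: lookup_inject)
qed

text \<open>Unlike in \<open>eval_vars\<close> the index set is independent of \<open>f\<close>, so
  evaluation is linear in \<open>f\<close>.\<close>

definition evaln :: "nat \<Rightarrow> nat \<Rightarrow> 'a::comm_semiring_1 mseries \<Rightarrow> (nat \<Rightarrow> 'a) \<Rightarrow> 'a" where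
  "evaln n d f x = (\<Sum>e\<in>exps n d. f e * (\<Prod>i<n. x i ^ lookup e i))"

lemma eval_vars_evaln:
  assumes "homogeneous d f"
  shows "eval_vars n f x = evaln n d f x"
  unfolding eval_vars_def evaln_def
proof (rule sum.mono_neutral_left)
  show "{e. keys e \<subseteq> {..<n} \<and> f e \<noteq> 0} \<subseteq> exps n d"
    using assms by (auto simp: homogeneous_def exps_def)
  show "\<forall>e\<in>exps n d - {e. keys e \<subseteq> {..<n} \<and> f e \<noteq> 0}. f e * (\<Prod>i<n. x i ^ lookup e i) = 0"
    by (auto simp: exps_def)
qed simp

lemma evaln_mul_psum:
  assumes k: "0 < k" "k \<le> d"
  shows "evaln n d (mul_psum k f) x = (\<Sum>i<n. x i ^ k) * evaln n (d - k) f x"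
proof -
  let ?m = "\<lambda>e. \<Prod>i<n. x i ^ lookup e i"
  let ?s = "Poly_Mapping.single :: nat \<Rightarrow> nat \<Rightarrow> expvec"
  have "evaln n d (mul_psum k f) x = (\<Sum>e\<in>exps n d. \<Sum>i<n. if k \<le> lookup e i then f (e - ?s i k) * ?m e else 0)"
    unfolding evaln_def
  proof (intro sum.cong refl)
    fix e assume "e \<in> exps n d"
    then have "mul_psum k f e = (\<Sum>i<n. if k \<le> lookup e i then f (e - ?s i k) else 0)"
      using k by (intro mul_psum_superset) (auto simp: exps_def)
    then show "mul_psum k f e * ?m e = (\<Sum>i<n. if k \<le> lookup e i then f (e - ?s i k) * ?m e else 0)"
      by (simp add: sum_distrib_right if_distrib[of "\<lambda>z. z * _"] cong: if_cong)
  qed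
  also have "\<dots> = (\<Sum>i<n. \<Sum>e\<in>exps n d. if k \<le> lookup e i then f (e - ?s i k) * ?m e else 0)"
    by (rule sum.swap)
  also have "\<dots> = (\<Sum>i<n. x i ^ k * evaln n (d - k) f x)"
  proof (intro sum.cong refl)
    fix i assume i: "i \<in> {..<n}"
    have "(\<Sum>e\<in>exps n d. if k \<le> lookup e i then f (e - ?s i k) * ?m e else 0)
        = (\<Sum>e\<in>{e\<in>exps n d. k \<le> lookup e i}. f (e - ?s i k) * ?m e)"
      by (rule sum.inter_filter[symmetric]) simp
    also have "\<dots> = (\<Sum>e\<in>exps n (d - k). f e * (x i ^ k * ?m e))"
    proof (rule sum.reindex_bij_witness[of _ "\<lambda>e. e + ?s i k" "\<lambda>e. e - ?s i k"])
      fix e assume e: "e \<in> {e\<in>exps n d. k \<le> lookup e i}"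
      then show ee: "e - ?s i k + ?s i k = e" by (intro minus_single_add) simp
      show "e - ?s i k \<in> exps n (d - k)"
        using e keys_minus_subset[of e "?s i k"] by (auto simp: exps_def part_size_minus_single)
      have "?m e = ?m (e - ?s i k + ?s i k)" unfolding ee ..
      also have "\<dots> = (\<Prod>j<n. x j ^ lookup (e - ?s i k) j * x j ^ lookup (?s i k) j)"
        by (simp add: lookup_add power_add)
      also have "\<dots> = ?m (e - ?s i k) * (\<Prod>j<n. x j ^ lookup (?s i k) j)" by (rule prod.distrib)
      also have "(\<Prod>j<n. x j ^ lookup (?s i k) j) = (\<Prod>j<n. if j = i then x j ^ k else 1)"
        by (intro prod.cong refl) (auto simp: lookup_single)
      also have "\<dots> = x i ^ k" using i by (simp add: prod.delta)
      finally show "f (e - ?s i k) * (x i ^ k * ?m (e - ?s i k)) = f (e - ?s i k) * ?m e"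
        by (simp add: mult.commute)
    next
      fix e assume e: "e \<in> exps n (d - k)"
      show "e + ?s i k - ?s i k = e" by simp
      have "keys (e + ?s i k) \<subseteq> {..<n}"
      proof
        fix j assume j: "j \<in> keys (e + ?s i k)"
        show "j \<in> {..<n}"
        proof (cases "j = i")
          case False
          then have "j \<in> keys e" using j by (simp add: in_keys_iff lookup_add lookup_single)
          then show ?thesis using e by (auto simp: exps_def)
        qed (use i in simp)
      qed
      then show "e + ?s i k \<in> {e\<in>exps n d. k \<le> lookup e i}"
        using e k by (simp add: exps_def lookup_add)
    qed
    finally show "(\<Sum>e\<in>exps n d. if k \<le> lookup e i then f (e - ?s i k) * ?m e else 0) = x i ^ k * evaln n (d - k) f x"
      by (simp add: evaln_def sum_distrib_left ac_simps)
  qed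
  finally show ?thesis by (simp add: sum_distrib_right)
qed

lemma exps_0: "exps n 0 = {0}"
  by (auto simp: exps_def)

lemma evaln_pmono:
  assumes "0 \<notin># N"
  shows "evaln n (sum_mset N) (\<lambda>e. of_nat (pmono N e)) x = (\<Prod>k\<in>#N. \<Sum>i<n. x i ^ k)"
  using assms
proof (induction N)
  case empty
  then show ?case by (simp add: evaln_def exps_0 mseries_one_def)
next
  case (add k N)
  have "(\<lambda>e. of_nat (pmono (add_mset k N) e)) = mul_psum k (\<lambda>e. of_nat (pmono N e) :: 'a)"
    by (rule ext) (simp add: of_nat_mul_psum)
  then have "evaln n (sum_mset (add_mset k N)) (\<lambda>e. of_nat (pmono (add_mset k N) e)) x
     = (\<Sum>i<n. x i ^ k) * evaln n (sum_mset (add_mset k N) - k) (\<lambda>e. of_nat (pmono N e)) x"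
    using add.prems by (simp only:) (intro evaln_mul_psum, auto)
  then show ?case using add by simp
qed

text \<open>The values substituted for the power sums need not come from a point; below they are
  polynomials in the shift s, or all equal to n.\<close>

definition peval :: "nat \<Rightarrow> (nat multiset \<Rightarrow> 'a::comm_semiring_1) \<Rightarrow> (nat \<Rightarrow> 'a) \<Rightarrow> 'a" where
  "peval d c \<pi> = (\<Sum>N\<in>MP d. c N * (\<Prod>k\<in>#N. \<pi> k))"

lemma evaln_psum_series: "evaln n d (psum_series c) x = peval d c (\<lambda>k. \<Sum>i<n. x i ^ k)"
proof -
  have "evaln n d (psum_series c) x = (\<Sum>e\<in>exps n d. \<Sum>N\<in>MP d. c N * (of_nat (pmono N e) * (\<Prod>i<n. x i ^ lookup e i)))"
    unfolding evaln_def by (intro sum.cong refl) (simp add: psum_series_def exps_def sum_distrib_right mult.assoc)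
  also have "\<dots> = (\<Sum>N\<in>MP d. c N * evaln n d (\<lambda>e. of_nat (pmono N e)) x)"
    by (subst sum.swap) (simp add: evaln_def sum_distrib_left)
  also have "\<dots> = peval d c (\<lambda>k. \<Sum>i<n. x i ^ k)"
    unfolding peval_def by (intro sum.cong refl) (auto simp: MP_def evaln_pmono)
  finally show ?thesis .
qed

lemma evaln_cong: "(\<And>e. part_size e = d \<Longrightarrow> f e = g e) \<Longrightarrow> evaln n d f x = evaln n d g x"
  unfolding evaln_def by (intro sum.cong) (auto simp: exps_def)

lemma sum_mset_range:
  assumes "N \<in> MP d"
  shows "(\<Sum>k\<in>#N. g k) = (\<Sum>k=1..d. if k \<in># N then of_nat (count N k) * (g k :: 'a::comm_semiring_1) else 0)"
proof -
  have *: "(\<Sum>k\<in>#K. g k) = (\<Sum>k\<in>A. of_nat (count K k) * g k)" if "finite A" "set_mset K \<subseteq> A" for K A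
    using that(2)
  proof (induction K)
    case (add x K)
    have "(\<Sum>y\<in>A. of_nat (count (add_mset x K) y) * g y) = (\<Sum>y\<in>A. (if y = x then g x else 0) + of_nat (count K y) * g y)"
      by (intro sum.cong) (auto simp: algebra_simps)
    also have "\<dots> = g x + (\<Sum>y\<in>A. of_nat (count K y) * g y)"
      using add.prems that(1) by (simp add: sum.distrib sum.delta)
    finally show ?case using add by simp
  qed simp
  have "set_mset N \<subseteq> {1..d}"
  proof
    fix k assume k: "k \<in># N"
    then have "k \<noteq> 0" using assms by (auto simp: MP_def intro: ccontr)
    moreover have "k \<le> d" using sum_mset.remove[OF k] assms by (simp add: MP_def)
    ultimately show "k \<in> {1..d}" by simp
  qed
  then have "(\<Sum>k\<in>#N. g k) = (\<Sum>k=1..d. of_nat (count N k) * g k)" by (intro *) auto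
  also have "\<dots> = (\<Sum>k=1..d. if k \<in># N then of_nat (count N k) * g k else 0)"
  proof (intro sum.cong refl)
    fix k show "of_nat (count N k) * g k = (if k \<in># N then of_nat (count N k) * g k else 0)"
    proof (cases "k \<in># N")
      case False
      then have "count N k = 0" by (meson count_inI)
      with False show ?thesis by simp
    qed simp
  qed
  finally show ?thesis .
qed

section \<open>Differentiation of a polynomial in power sums along the diagonal\<close>

lemma pderiv_sum: "pderiv (sum f A) = (\<Sum>x\<in>A. pderiv (f x))"
  by (induction A rule: infinite_finite_induct) (simp_all add: pderiv_add)

lemma const_poly_sum: "[:\<Sum>x\<in>A. f x:] = (\<Sum>x\<in>A. [:f x:])"
proof (induction A rule: infinite_finite_induct)
  case (insert x F)
  have "[:\<Sum>x\<in>insert x F. f x:] = [:f x:] + [:\<Sum>x\<in>F. f x:]" using insert.hyps by simp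
  then show ?case using insert by simp
qed simp_all

lemma pderiv_prod_mset:
  fixes \<pi> :: "nat \<Rightarrow> 'a::idom poly"
  assumes "\<And>k. 0 < k \<Longrightarrow> pderiv (\<pi> k) = of_nat k * \<pi> (k - 1)" "0 \<notin># N"
  shows "pderiv (\<Prod>k\<in>#N. \<pi> k) = (\<Sum>k\<in>#N. of_nat k * \<pi> (k - 1) * (\<Prod>j\<in>#N - {#k#}. \<pi> j))"
  using assms(2)
proof (induction N)
  case (add k N)
  have k: "0 < k" using add.prems by auto
  have "(\<Sum>l\<in>#N. of_nat l * \<pi> (l - 1) * (\<Prod>j\<in>#add_mset k N - {#l#}. \<pi> j))
      = (\<Sum>l\<in>#N. \<pi> k * (of_nat l * \<pi> (l - 1) * (\<Prod>j\<in>#N - {#l#}. \<pi> j)))"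
  proof (intro arg_cong[where f = sum_mset] image_mset_cong)
    fix l assume l: "l \<in># N"
    then have "add_mset k N - {#l#} = add_mset k (N - {#l#})" by (simp add: multi_union_self_other_eq)
    then show "of_nat l * \<pi> (l - 1) * (\<Prod>j\<in>#add_mset k N - {#l#}. \<pi> j) = \<pi> k * (of_nat l * \<pi> (l - 1) * (\<Prod>j\<in>#N - {#l#}. \<pi> j))"
      by (simp add: ac_simps)
  qed
  also have "\<dots> = \<pi> k * pderiv (\<Prod>j\<in>#N. \<pi> j)"
    using add by (simp add: sum_mset_distrib_left)
  finally show ?case
    using assms(1)[OF k] by (simp add: pderiv_mult ac_simps)
qed simp

text \<open>Chain rule for p_k(x + s1), whose derivative is k p_(k-1)(x + s1). For k = 1 this is the
  number of variables, whence the separate term with \<open>pder 1\<close>.\<close>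

lemma pderiv_peval:
  fixes c :: "nat multiset \<Rightarrow> 'a::idom" and \<pi> :: "nat \<Rightarrow> 'a poly"
  assumes \<pi>: "\<And>k. 0 < k \<Longrightarrow> pderiv (\<pi> k) = of_nat k * \<pi> (k - 1)" "\<pi> 0 = of_nat n" and d: "0 < d"
  shows "pderiv (peval d (\<lambda>N. [:c N:]) \<pi>) = peval (d - 1) (\<lambda>N. [:of_nat n * pder 1 c N + plower d c N:]) \<pi>"
proof -
  let ?P = "\<lambda>N. \<Prod>j\<in>#N. \<pi> j"
  have "pderiv (peval d (\<lambda>N. [:c N:]) \<pi>) = (\<Sum>N\<in>MP d. [:c N:] * pderiv (?P N))"
    by (simp add: peval_def pderiv_sum pderiv_smult)
  also have "\<dots> = (\<Sum>N\<in>MP d. \<Sum>k=1..d. if k \<in># N then [:c N:] * (of_nat (count N k) * (of_nat k * \<pi> (k - 1) * ?P (N - {#k#}))) else 0)"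
  proof (intro sum.cong refl)
    fix N assume N: "N \<in> MP d"
    then have "0 \<notin># N" by (simp add: MP_def)
    with \<pi>(1) have "pderiv (?P N) = (\<Sum>k\<in>#N. of_nat k * \<pi> (k - 1) * ?P (N - {#k#}))"
      by (rule pderiv_prod_mset)
    also have "\<dots> = (\<Sum>k=1..d. if k \<in># N then of_nat (count N k) * (of_nat k * \<pi> (k - 1) * ?P (N - {#k#})) else 0)"
      by (rule sum_mset_range[OF N])
    finally show "[:c N:] * pderiv (?P N) = (\<Sum>k=1..d. if k \<in># N then [:c N:] * (of_nat (count N k) * (of_nat k * \<pi> (k - 1) * ?P (N - {#k#}))) else 0)"
      by (simp only: sum_distrib_left if_distrib[of "\<lambda>z. [:c N:] * z"] mult_zero_right)
  qed
  also have "\<dots> = (\<Sum>k=1..d. \<Sum>N\<in>MP d. if k \<in># N then [:c N:] * (of_nat (count N k) * (of_nat k * \<pi> (k - 1) * ?P (N - {#k#}))) else 0)"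
    by (rule sum.swap)
  also have "\<dots> = (\<Sum>k=1..d. \<Sum>N\<in>MP (d - k). [:pder k c N:] * (\<pi> (k - 1) * ?P N))"
  proof (rule sum.cong[OF refl])
    fix k assume "k \<in> {1..d}"
    then have k: "0 < k" "k \<le> d" by auto
    show "(\<Sum>N\<in>MP d. if k \<in># N then [:c N:] * (of_nat (count N k) * (of_nat k * \<pi> (k - 1) * ?P (N - {#k#}))) else 0)
       = (\<Sum>N\<in>MP (d - k). [:pder k c N:] * (\<pi> (k - 1) * ?P N))"
      unfolding sum_MP_contains[OF k(1)] if_P[OF k(2)]
    proof (intro sum.cong refl)
      fix N
      have "[:pder k c N:] = of_nat k * (of_nat (Suc (count N k)) * [:c (add_mset k N):])"
        by (simp add: pder_def of_nat_poly algebra_simps)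
      then show "[:c (add_mset k N):] * (of_nat (count (add_mset k N) k) * (of_nat k * \<pi> (k - 1) * ?P (add_mset k N - {#k#})))
        = [:pder k c N:] * (\<pi> (k - 1) * ?P N)" by (simp only: count_add_mset add_mset_remove_trivial if_True refl simp_thms mult_ac)
    qed
  qed
  also have "\<dots> = (\<Sum>k\<in>insert 1 {2..d}. \<Sum>N\<in>MP (d - k). [:pder k c N:] * (\<pi> (k - 1) * ?P N))"
    by (intro sum.cong) (use d in auto)
  also have "\<dots> = (\<Sum>N\<in>MP (d - 1). [:pder 1 c N:] * (\<pi> (1 - 1) * ?P N))
      + (\<Sum>k\<in>{2..d}. \<Sum>N\<in>MP (d - k). [:pder k c N:] * (\<pi> (k - 1) * ?P N))"
    by (rule sum.insert) auto
  also have "(\<Sum>k\<in>{2..d}. \<Sum>N\<in>MP (d - k). [:pder k c N:] * (\<pi> (k - 1) * ?P N))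
     = (\<Sum>k\<in>{2..d}. \<Sum>N\<in>MP (d - 1). [:pmul (k - 1) (pder k c) N:] * ?P N)"
  proof (rule sum.cong[OF refl])
    fix k assume k: "k \<in> {2..d}"
    then have k': "0 < k - 1" "k - 1 \<le> d - 1" "d - 1 - (k - 1) = d - k" by auto
    have "(\<Sum>N\<in>MP (d - 1). [:pmul (k - 1) (pder k c) N:] * ?P N)
        = (\<Sum>N\<in>MP (d - 1). if k - 1 \<in># N then [:pder k c (N - {#k - 1#}):] * ?P N else 0)"
      by (intro sum.cong refl) (simp add: pmul_def)
    also have "\<dots> = (\<Sum>N\<in>MP (d - k). [:pder k c N:] * (\<pi> (k - 1) * ?P N))"
      unfolding sum_MP_contains[OF k'(1)] if_P[OF k'(2)] k'(3) by simp
    finally show "(\<Sum>N\<in>MP (d - k). [:pder k c N:] * (\<pi> (k - 1) * ?P N)) = (\<Sum>N\<in>MP (d - 1). [:pmul (k - 1) (pder k c) N:] * ?P N)" ..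
  qed
  also have "\<dots> = (\<Sum>N\<in>MP (d - 1). [:plower d c N:] * ?P N)"
  proof -
    have "[:plower d c N:] = (\<Sum>k\<in>{2..d}. [:pmul (k - 1) (pder k c) N:])" for N
      unfolding plower_def by (rule const_poly_sum)
    then show ?thesis by (subst sum.swap) (simp add: sum_distrib_right)
  qed
  also have "(\<Sum>N\<in>MP (d - 1). [:pder 1 c N:] * (\<pi> (1 - 1) * ?P N)) = (\<Sum>N\<in>MP (d - 1). [:of_nat n * pder 1 c N:] * ?P N)"
    by (intro sum.cong refl) (simp add: \<pi>(2) of_nat_poly)
  finally show ?thesis
    unfolding peval_def sum.distrib[symmetric] by (simp add: algebra_simps flip: smult_add_left)
qed

section \<open>The derivative of a two-row Jack polynomial along the diagonal\<close>

lemma MP_0: "MP 0 = {{#}}"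
proof -
  have "N = {#}" if "0 \<notin># N" "sum_mset N = 0" for N :: "nat multiset"
  proof -
    have "size N \<le> 0" using size_le_sum_mset[OF that(1)] unfolding that(2) .
    then show ?thesis by simp
  qed
  then show ?thesis unfolding MP_def by auto
qed

definition rcoord :: "expvec \<Rightarrow> nat multiset \<Rightarrow> real poly fract" where
  "rcoord l N = ratfun_to_real (jcoord l N)"

definition jval :: "nat \<Rightarrow> expvec \<Rightarrow> (nat \<Rightarrow> real poly fract) \<Rightarrow> real poly fract" where
  "jval n l x = evaln n (part_size l) (\<lambda>e. ratfun_to_real (jackP l e)) x"

text \<open>At x = (1,...,1) all power sums equal n.\<close>

definition jnorm :: "nat \<Rightarrow> expvec \<Rightarrow> real poly fract" where
  "jnorm n l = peval (part_size l) (rcoord l) (\<lambda>_. of_nat n)"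

text \<open>The polynomial \<open>s \<mapsto> P\<^sub>\<lambda>(x + s\<one>)\<close>.\<close>

definition jpoly :: "nat \<Rightarrow> expvec \<Rightarrow> (nat \<Rightarrow> real poly fract) \<Rightarrow> real poly fract poly" where
  "jpoly n l x = peval (part_size l) (\<lambda>N. [:rcoord l N:]) (\<lambda>k. \<Sum>i<n. [:x i, 1:] ^ k)"

lemma psum_series_rcoord:
  assumes "is_partition l" "part_size e = part_size l"
  shows "psum_series (rcoord l) e = ratfun_to_real (jackP l e)"
  unfolding psum_series_jcoord[OF assms, symmetric]
  by (simp add: psum_series_def ratfun_to_real_sum ratfun_to_real_mult rcoord_def)

lemma jval_peval:
  assumes "is_partition l"
  shows "jval n l x = peval (part_size l) (rcoord l) (\<lambda>k. \<Sum>i<n. x i ^ k)"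
proof -
  have "jval n l x = evaln n (part_size l) (psum_series (rcoord l)) x"
    unfolding jval_def by (rule evaln_cong) (simp add: psum_series_rcoord[OF assms])
  then show ?thesis by (simp add: evaln_psum_series)
qed

lemma jnorm_jval: "is_partition l \<Longrightarrow> jnorm n l = jval n l (\<lambda>_. 1)"
  by (simp add: jval_peval jnorm_def)

lemma poly_prod_mset: "poly (\<Prod>k\<in>#N. f k) s = (\<Prod>k\<in>#N. poly (f k) s)"
  by (induction N) simp_all

lemma poly_jpoly:
  assumes "is_partition l"
  shows "poly (jpoly n l x) s = jval n l (\<lambda>i. x i + s)"
  unfolding jval_peval[OF assms] jpoly_def peval_def
  by (simp add: poly_sum poly_prod_mset)

lemma jval_nonneg:
  assumes "is_partition l" "\<And>i. i < n \<Longrightarrow> x i \<in> nonneg_ratfuns"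
  shows "jval n l x \<in> nonneg_ratfuns"
  unfolding jval_def evaln_def
  by (intro nonneg_ratfuns_sum nonneg_ratfuns_mult nonneg_ratfuns_prod nonneg_ratfuns_power good_nonneg good_jackP assms) (use assms in auto)

lemma jnorm_pos:
  assumes l: "is_partition l" "keys l \<subseteq> {..<n}"
  shows "0 < jnorm n l"
proof -
  let ?f = "\<lambda>e. ratfun_to_real (jackP l e)"
  have "l \<in> exps n (part_size l)" using l by (simp add: exps_def)
  moreover have "0 \<le> ?f e" for e by (intro nonneg_ratfuns_ge_0 good_nonneg good_jackP l)
  ultimately have "0 < (\<Sum>e\<in>exps n (part_size l). ?f e)"
    by (intro sum_pos2[of _ l]) (auto simp: jackP(2)[OF l(1)])
  then show ?thesis by (simp add: jnorm_jval[OF l(1)] jval_def evaln_def)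
qed

lemma jnorm_nonneg: "is_partition l \<Longrightarrow> jnorm n l \<in> nonneg_ratfuns"
  unfolding jnorm_jval by (rule jval_nonneg) (auto simp: nonneg_ratfuns_1)

text \<open>\<open>pder 1\<close> contributes n and \<open>plower\<close> the content over tau, so
  each Pieri coefficient is multiplied by n + content / tau of the removed box.\<close>

lemma jpoly_deriv:
  assumes ab: "b \<le> a" "0 < a + b"
    and y: "a = b \<Longrightarrow> y1 = 0" "b = 0 \<Longrightarrow> y2 = 0"
    "\<And>N. N \<in> MP (a + b - 1) \<Longrightarrow> pder 1 (jcoord (two_rows a b)) N
        = y1 * jcoord (two_rows (a - 1) b) N + y2 * jcoord (two_rows a (b - 1)) N"
  shows "pderiv (jpoly n (two_rows a b) x)
    = smult ((of_nat n + of_nat (a - 1) / real_tau) * ratfun_to_real y1) (jpoly n (two_rows (a - 1) b) x)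
    + smult ((of_nat n - 1 + of_nat (b - 1) / real_tau) * ratfun_to_real y2) (jpoly n (two_rows a (b - 1)) x)"
proof -
  let ?d = "a + b" and ?c = "jcoord (two_rows a b)" and ?\<phi> = ratfun_to_real
  let ?\<pi> = "\<lambda>k. \<Sum>i<n. [:x i, 1:] ^ k"
  let ?Z1 = "(of_nat n + of_nat (a - 1) / real_tau) * ?\<phi> y1" and ?Z2 = "(of_nat n - 1 + of_nat (b - 1) / real_tau) * ?\<phi> y2"
  let ?r1 = "rcoord (two_rows (a - 1) b)" and ?r2 = "rcoord (two_rows a (b - 1))"
  have "pderiv (?\<pi> k) = of_nat k * ?\<pi> (k - 1)" if "0 < k" for k
    using that by (simp add: pderiv_sum pderiv_power pderiv_pCons sum_distrib_left of_nat_poly)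
  moreover have "?\<pi> 0 = of_nat n" by simp
  ultimately have "pderiv (jpoly n (two_rows a b) x)
     = peval (?d - 1) (\<lambda>N. [:of_nat n * pder 1 (rcoord (two_rows a b)) N + plower ?d (rcoord (two_rows a b)) N:]) ?\<pi>"
    unfolding jpoly_def part_size_two_rows by (rule pderiv_peval) (use ab in auto)
  also have "\<dots> = peval (?d - 1) (\<lambda>N. [:?Z1 * ?r1 N + ?Z2 * ?r2 N:]) ?\<pi>"
    unfolding peval_def
  proof (rule sum.cong[OF refl])
    fix N assume N: "N \<in> MP (?d - 1)"
    have p: "pder k (rcoord (two_rows a b)) M = ?\<phi> (pder k ?c M)" for k M
      by (simp add: pder_def rcoord_def ratfun_to_real_mult ratfun_to_real_add)
    have pl: "plower ?d (rcoord (two_rows a b)) N = ?\<phi> (plower ?d ?c N)"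
      unfolding plower_def ratfun_to_real_sum by (intro sum.cong refl) (simp add: pmul_def p)
    have "tau * plower ?d ?c N = of_nat (a - 1) * y1 * jcoord (two_rows (a - 1) b) N + (of_nat (b - 1) - tau) * y2 * jcoord (two_rows a (b - 1)) N"
      by (rule plower_jcoord[OF ab N y])
    then have "?\<phi> (tau * plower ?d ?c N) = ?\<phi> (of_nat (a - 1) * y1 * jcoord (two_rows (a - 1) b) N + (of_nat (b - 1) - tau) * y2 * jcoord (two_rows a (b - 1)) N)"
      by (rule arg_cong)
    then have "real_tau * ?\<phi> (plower ?d ?c N) = of_nat (a - 1) * ?\<phi> y1 * ?r1 N + (of_nat (b - 1) - real_tau) * ?\<phi> y2 * ?r2 N"
      by (simp only: ratfun_to_real_mult ratfun_to_real_add ratfun_to_real_diff ratfun_to_real_of_nat ratfun_to_real_tau rcoord_def)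
    then have "?\<phi> (plower ?d ?c N) = of_nat (a - 1) / real_tau * ?\<phi> y1 * ?r1 N + (of_nat (b - 1) / real_tau - 1) * ?\<phi> y2 * ?r2 N"
      using real_tau_pos by (simp add: field_simps)
    moreover have "?\<phi> (pder 1 ?c N) = ?\<phi> y1 * ?r1 N + ?\<phi> y2 * ?r2 N"
      unfolding y(3)[OF N] by (simp add: ratfun_to_real_mult ratfun_to_real_add rcoord_def)
    ultimately have "of_nat n * pder 1 (rcoord (two_rows a b)) N + plower ?d (rcoord (two_rows a b)) N = ?Z1 * ?r1 N + ?Z2 * ?r2 N"
      unfolding p pl by (simp add: algebra_simps)
    then show "[:of_nat n * pder 1 (rcoord (two_rows a b)) N + plower ?d (rcoord (two_rows a b)) N:] * (\<Prod>k\<in>#N. ?\<pi> k)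
       = [:?Z1 * ?r1 N + ?Z2 * ?r2 N:] * (\<Prod>k\<in>#N. ?\<pi> k)" by simp
  qed
  also have "\<dots> = smult ?Z1 (peval (?d - 1) (\<lambda>N. [:?r1 N:]) ?\<pi>) + smult ?Z2 (peval (?d - 1) (\<lambda>N. [:?r2 N:]) ?\<pi>)"
  proof -
    have "smult c (sum g A) = (\<Sum>x\<in>A. smult c (g x))" for c and g :: "nat multiset \<Rightarrow> real poly fract poly" and A
      by (induction A rule: infinite_finite_induct) (simp_all add: smult_add_right)
    then show ?thesis
      unfolding peval_def by (simp add: smult_add_left sum.distrib)
  qed
  also have "smult ?Z1 (peval (?d - 1) (\<lambda>N. [:?r1 N:]) ?\<pi>) = smult ?Z1 (jpoly n (two_rows (a - 1) b) x)"
  proof (cases "a = b")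
    case True
    then show ?thesis by (simp add: y(1))
  next
    case False
    then have "?d - 1 = a - 1 + b" using ab by linarith
    then show ?thesis by (simp add: jpoly_def)
  qed
  also have "smult ?Z2 (peval (?d - 1) (\<lambda>N. [:?r2 N:]) ?\<pi>) = smult ?Z2 (jpoly n (two_rows a (b - 1)) x)"
  proof (cases "b = 0")
    case True
    then show ?thesis by (simp add: y(2))
  next
    case False
    then have "?d - 1 = a + (b - 1)" using ab by linarith
    then show ?thesis by (simp add: jpoly_def)
  qed
  finally show ?thesis .
qed

text \<open>Homogeneity along the diagonal. Combined with the derivative formula it yields a
  recursion for the normalization.\<close>

lemma jpoly_at_0: "jpoly n l (\<lambda>_. 0) = monom (jnorm n l) (part_size l)"
proof -
  have p: "(\<Sum>i<n. [:0, 1:] ^ k) = monom (of_nat n :: real poly fract) k" for k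
    by (simp add: monom_altdef of_nat_poly)
  have m: "(\<Prod>k\<in>#N. monom (of_nat n :: real poly fract) k) = monom (of_nat n ^ size N) (sum_mset N)" for N
    by (induction N) (simp_all add: mult_monom monom_0 one_pCons)
  have "jpoly n l (\<lambda>_. 0) = (\<Sum>N\<in>MP (part_size l). monom (rcoord l N * of_nat n ^ size N) (part_size l))"
    unfolding jpoly_def peval_def p m by (intro sum.cong refl) (auto simp: smult_monom MP_def)
  also have "\<dots> = monom (\<Sum>N\<in>MP (part_size l). rcoord l N * of_nat n ^ size N) (part_size l)"
    by (induction "MP (part_size l)" rule: infinite_finite_induct) (simp_all add: monom_sum)
  finally show ?thesis by (simp add: jnorm_def peval_def)
qed

lemma jnorm_recursion:
  assumes ab: "b \<le> a" "0 < a + b"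
    and y: "a = b \<Longrightarrow> y1 = 0" "b = 0 \<Longrightarrow> y2 = 0"
    "\<And>N. N \<in> MP (a + b - 1) \<Longrightarrow> pder 1 (jcoord (two_rows a b)) N
        = y1 * jcoord (two_rows (a - 1) b) N + y2 * jcoord (two_rows a (b - 1)) N"
  shows "of_nat (a + b) * jnorm n (two_rows a b)
    = (of_nat n + of_nat (a - 1) / real_tau) * ratfun_to_real y1 * jnorm n (two_rows (a - 1) b)
    + (of_nat n - 1 + of_nat (b - 1) / real_tau) * ratfun_to_real y2 * jnorm n (two_rows a (b - 1))"
proof -
  let ?d = "a + b"
  have e0: "coeff (pderiv (jpoly n (two_rows a b) (\<lambda>_. 0))) (?d - 1) = of_nat ?d * jnorm n (two_rows a b)"
    using ab by (simp add: jpoly_at_0 coeff_pderiv del: of_nat_add)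
  have e1: "ratfun_to_real y1 * coeff (jpoly n (two_rows (a - 1) b) (\<lambda>_. 0)) (?d - 1) = ratfun_to_real y1 * jnorm n (two_rows (a - 1) b)"
  proof (cases "a = b")
    case True
    then show ?thesis by (simp add: y(1))
  next
    case False
    then have "?d - 1 = a - 1 + b" using ab by linarith
    then show ?thesis by (simp add: jpoly_at_0)
  qed
  have e2: "ratfun_to_real y2 * coeff (jpoly n (two_rows a (b - 1)) (\<lambda>_. 0)) (?d - 1) = ratfun_to_real y2 * jnorm n (two_rows a (b - 1))"
  proof (cases "b = 0")
    case True
    then show ?thesis by (simp add: y(2))
  next
    case False
    then have "?d - 1 = a + (b - 1)" using ab by linarith
    then show ?thesis by (simp add: jpoly_at_0)
  qed
  have "pderiv (jpoly n (two_rows a b) (\<lambda>_. 0))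
    = smult ((of_nat n + of_nat (a - 1) / real_tau) * ratfun_to_real y1) (jpoly n (two_rows (a - 1) b) (\<lambda>_. 0))
    + smult ((of_nat n - 1 + of_nat (b - 1) / real_tau) * ratfun_to_real y2) (jpoly n (two_rows a (b - 1)) (\<lambda>_. 0))"
    by (rule jpoly_deriv[OF ab]) (rule y, assumption)+
  then show ?thesis
    unfolding e0[symmetric] by (simp only: coeff_add coeff_smult mult.assoc e1 e2)
qed

text \<open>The product of n + content / tau over all boxes.\<close>

definition cont_prod :: "nat \<Rightarrow> nat \<Rightarrow> nat \<Rightarrow> real poly fract" where
  "cont_prod n a b = (\<Prod>i<a. of_nat n + of_nat i / real_tau) * (\<Prod>i<b. of_nat n - 1 + of_nat i / real_tau)"

text \<open>After embedding, this is the coefficient of the highest power n^(a+b) in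
  \<open>jnorm\<close> as a polynomial in n.\<close>

definition lead :: "nat \<Rightarrow> nat \<Rightarrow> ratfun" where
  "lead a b = jcoord (two_rows a b) (replicate_mset (a + b) 1)"

lemma lead_recursion:
  assumes ab: "b \<le> a" "0 < a + b"
    and y: "a = b \<Longrightarrow> y1 = 0" "b = 0 \<Longrightarrow> y2 = 0"
    "\<And>N. N \<in> MP (a + b - 1) \<Longrightarrow> pder 1 (jcoord (two_rows a b)) N
        = y1 * jcoord (two_rows (a - 1) b) N + y2 * jcoord (two_rows a (b - 1)) N"
  shows "of_nat (a + b) * lead a b = y1 * lead (a - 1) b + y2 * lead a (b - 1)"
proof -
  have sD: "Suc (a + b - 1) = a + b" using ab by simp
  have "replicate_mset (a + b - 1) 1 \<in> MP (a + b - 1)" by (simp add: MP_def)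
  from y(3)[OF this] have "of_nat (a + b) * lead a b = y1 * jcoord (two_rows (a - 1) b) (replicate_mset (a + b - 1) 1)
      + y2 * jcoord (two_rows a (b - 1)) (replicate_mset (a + b - 1) 1)"
    unfolding pder_1_replicate sD lead_def .
  moreover have "y1 * jcoord (two_rows (a - 1) b) (replicate_mset (a + b - 1) 1) = y1 * lead (a - 1) b"
  proof (cases "a = b")
    case False
    then have "a + b - 1 = a - 1 + b" using ab by linarith
    then show ?thesis by (simp add: lead_def)
  qed (simp add: y(1))
  moreover have "y2 * jcoord (two_rows a (b - 1)) (replicate_mset (a + b - 1) 1) = y2 * lead a (b - 1)"
  proof (cases "b = 0")
    case False
    then have "a + b - 1 = a + (b - 1)" using ab by linarith
    then show ?thesis by (simp add: lead_def)
  qed (simp add: y(2))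
  ultimately show ?thesis by simp
qed

text \<open>The recursion for \<open>lead\<close> is the one for \<open>jnorm\<close> without the
  factor of the removed box, whatever the Pieri coefficients are.\<close>

lemma jnorm_two_rows:
  "b \<le> a \<Longrightarrow> jnorm n (two_rows a b) = ratfun_to_real (lead a b) * cont_prod n a b"
proof (induction "a + b" arbitrary: a b)
  case 0
  then have "a = 0" "b = 0" by auto
  then show ?case by (simp add: jnorm_def peval_def cont_prod_def lead_def rcoord_def MP_0)
next
  case (Suc d)
  have ab: "b \<le> a" "0 < a + b" using Suc by auto
  obtain y1 y2 where y: "a = b \<Longrightarrow> y1 = 0" "b = 0 \<Longrightarrow> y2 = 0"
    "\<And>N. N \<in> MP (a + b - 1) \<Longrightarrow> pder 1 (jcoord (two_rows a b)) N
        = y1 * jcoord (two_rows (a - 1) b) N + y2 * jcoord (two_rows a (b - 1)) N"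
    using pder_1_jcoord_two_rows[OF ab] by blast
  let ?\<phi> = ratfun_to_real
  have 1: "(of_nat n + of_nat (a - 1) / real_tau) * ?\<phi> y1 * jnorm n (two_rows (a - 1) b) = ?\<phi> (y1 * lead (a - 1) b) * cont_prod n a b"
  proof (cases "a = b")
    case False
    then obtain a' where a': "a = Suc a'" "b \<le> a'" using ab by (cases a) auto
    then have "jnorm n (two_rows a' b) = ?\<phi> (lead a' b) * cont_prod n a' b" by (intro Suc.hyps(1)) (use Suc.hyps(2) in auto)
    then show ?thesis using a' by (simp add: cont_prod_def ratfun_to_real_mult)
  qed (simp add: y(1))
  have 2: "(of_nat n - 1 + of_nat (b - 1) / real_tau) * ?\<phi> y2 * jnorm n (two_rows a (b - 1)) = ?\<phi> (y2 * lead a (b - 1)) * cont_prod n a b"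
  proof (cases "b = 0")
    case False
    then obtain b' where b': "b = Suc b'" by (cases b) auto
    then have "jnorm n (two_rows a b') = ?\<phi> (lead a b') * cont_prod n a b'" by (intro Suc.hyps(1)) (use Suc.hyps(2) ab in auto)
    then show ?thesis using b' by (simp add: cont_prod_def ratfun_to_real_mult)
  qed (simp add: y(2))
  have "of_nat (a + b) * jnorm n (two_rows a b) = (of_nat n + of_nat (a - 1) / real_tau) * ?\<phi> y1 * jnorm n (two_rows (a - 1) b)
    + (of_nat n - 1 + of_nat (b - 1) / real_tau) * ?\<phi> y2 * jnorm n (two_rows a (b - 1))"
    by (rule jnorm_recursion[OF ab]) (rule y, assumption)+
  also have "\<dots> = ?\<phi> (y1 * lead (a - 1) b + y2 * lead a (b - 1)) * cont_prod n a b"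
    unfolding 1 2 by (simp only: ratfun_to_real_add distrib_right)
  also have "y1 * lead (a - 1) b + y2 * lead a (b - 1) = of_nat (a + b) * lead a b"
    by (rule lead_recursion[OF ab, symmetric]) (rule y, assumption)+
  also have "?\<phi> (of_nat (a + b) * lead a b) * cont_prod n a b = of_nat (a + b) * (?\<phi> (lead a b) * cont_prod n a b)"
    by (simp only: ratfun_to_real_mult ratfun_to_real_of_nat mult.assoc)
  finally show ?case using ab by (simp del: of_nat_add)
qed

lemma keys_two_rows_subset: "1 \<le> n \<Longrightarrow> b = 0 \<or> 2 \<le> n \<Longrightarrow> keys (two_rows a b) \<subseteq> {..<n}"
  by (auto simp: in_keys_iff lookup_two_rows split: if_splits)

text \<open>\<open>coefA\<close> and \<open>coefB\<close> are the Pieri coefficients times the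
  ratios of the values of \<open>lead\<close>; they solve the two linear equations set up in
  \<open>lead_ratio\<close>.\<close>

definition coefA :: "nat \<Rightarrow> nat \<Rightarrow> ratfun" where
  "coefA a b = (of_nat a + tau) * of_nat (a - b) / (of_nat (a - b) + tau)"

definition coefB :: "nat \<Rightarrow> nat \<Rightarrow> ratfun" where
  "coefB a b = of_nat b * (of_nat (a - b) + 2 * tau) / (of_nat (a - b) + tau)"

lemma tau_add_nonzero: "of_nat n + tau \<noteq> 0"
  using add_nonneg_pos[OF of_nat_0_le_iff[of n] tau_pos] by simp

lemma coefA_plus_coefB: "b \<le> a \<Longrightarrow> coefA a b + coefB a b = of_nat (a + b)"
proof -
  assume "b \<le> a"
  then obtain m where m: "a = b + m" by (metis le_iff_add)
  have eq: "((B + M + t) * M + B * (M + 2 * t)) / (M + t) = B + M + B" if "M + t \<noteq> 0" for B M t :: ratfun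
  proof -
    have "(B + M + t) * M + B * (M + 2 * t) = (B + M + B) * (M + t)" by (simp add: algebra_simps)
    then show ?thesis using that by simp
  qed
  from eq[where B = "of_nat b" and M = "of_nat m" and t = tau, OF tau_add_nonzero] show ?thesis
    unfolding coefA_def coefB_def m by (simp add: add_divide_distrib)
qed

text \<open>With d = a + b, the coefficients of p_1^(d-1) and p_2 p_1^(d-3) in the Pieri expansion
  give two linear equations for the two products. For a = b or b = 0 one product vanishes and the
  first equation suffices.\<close>

lemma lead_ratio:
  assumes ab: "b \<le> a" "0 < a + b"
    and y: "a = b \<Longrightarrow> y1 = 0" "b = 0 \<Longrightarrow> y2 = 0"
    "\<And>N. N \<in> MP (a + b - 1) \<Longrightarrow> pder 1 (jcoord (two_rows a b)) N
        = y1 * jcoord (two_rows (a - 1) b) N + y2 * jcoord (two_rows a (b - 1)) N"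
  shows "y1 * lead (a - 1) b = coefA a b * lead a b" "y2 * lead a (b - 1) = coefB a b * lead a b"
proof -
  have rec: "of_nat (a + b) * lead a b = y1 * lead (a - 1) b + y2 * lead a (b - 1)"
    by (rule lead_recursion[OF ab y])
  have A: "y1 * lead (a - 1) b = coefA a b * lead a b"
  proof -
    consider "a = b" | "b = 0" | "b < a" "0 < b" using ab by linarith
    then show ?thesis
    proof cases
      case 1
      then show ?thesis using y(1) by (simp add: coefA_def)
    next
      case 2
      have "coefA a 0 = of_nat a" using tau_add_nonzero[of a] by (simp add: coefA_def)
      then show ?thesis using rec 2 y(2) by simp
    next
      case 3
      \<comment> \<open>Natural subtraction is avoided by writing a - b = m + 1 and a + b = d +
        3.\<close>
      obtain b' m where bm: "b = Suc b'" "a = Suc (b + m)"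
        using 3 by (metis Suc_pred less_iff_Suc_add)
      define d where "d = b' + b' + m"
      have d: "a + b = Suc (Suc (Suc d))" "a - 1 + b = Suc (Suc d)" "a + (b - 1) = Suc (Suc d)"
        using bm by (auto simp: d_def)
      define w where "w a b d = jcoord (two_rows a b) (add_mset 2 (replicate_mset d 1))" for a b d
      define q where "q a b = of_nat (a\<^sup>2 + b\<^sup>2) - of_nat (a + b) - 2 * tau * of_nat b" for a b
      have w0: "2 * tau * w a b (Suc d) = q a b * lead a b"
        unfolding w_def q_def lead_def by (rule leading_psum_coeffs[OF ab(1) d(1)])
      have w1: "2 * tau * w (a - 1) b d = q (a - 1) b * lead (a - 1) b"
        unfolding w_def q_def lead_def by (rule leading_psum_coeffs[OF _ d(2)]) (use bm in simp)
      have w2: "2 * tau * w a (b - 1) d = q a (b - 1) * lead a (b - 1)"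
        unfolding w_def q_def lead_def by (rule leading_psum_coeffs[OF _ d(3)]) (use bm in simp)
      have "add_mset 2 (replicate_mset d 1) \<in> MP (a + b - 1)" using d by (simp add: MP_def)
      from y(3)[OF this] have "of_nat (Suc d) * w a b (Suc d) = y1 * w (a - 1) b d + y2 * w a (b - 1) d"
        unfolding pder_def w_def by (simp add: add_mset_commute[of 1 2] add.commute)
      then have "2 * tau * (of_nat (Suc d) * w a b (Suc d)) = 2 * tau * (y1 * w (a - 1) b d + y2 * w a (b - 1) d)"
        by simp
      then have "of_nat (Suc d) * (2 * tau * w a b (Suc d)) = y1 * (2 * tau * w (a - 1) b d) + y2 * (2 * tau * w a (b - 1) d)"
        by (simp only: distrib_left mult_ac)
      then have eq2: "of_nat (Suc d) * q a b * lead a b = q (a - 1) b * (y1 * lead (a - 1) b) + q a (b - 1) * (y2 * lead a (b - 1))"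
        unfolding w0 w1 w2 by (simp only: mult_ac)
      have sd: "(of_nat (Suc d) :: ratfun) = of_nat b + of_nat b + of_nat m - 1"
        by (simp add: d_def bm(1))
      have qs: "q a b = (of_nat b + of_nat m + 1)\<^sup>2 + (of_nat b)\<^sup>2 - (of_nat b + of_nat m + 1 + of_nat b) - 2 * tau * of_nat b"
        "q (a - 1) b = (of_nat b + of_nat m)\<^sup>2 + (of_nat b)\<^sup>2 - (of_nat b + of_nat m + of_nat b) - 2 * tau * of_nat b"
        "q a (b - 1) = (of_nat b + of_nat m + 1)\<^sup>2 + (of_nat b - 1)\<^sup>2 - (of_nat b + of_nat m + 1 + (of_nat b - 1)) - 2 * tau * (of_nat b - 1)"
        by (simp_all add: q_def bm algebra_simps power2_eq_square)
      \<comment> \<open>Eliminating \<open>W\<close> from the two equations leaves twice the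
        claim.\<close>
      have lin: "(M + 1 + t) * U = (M + 1) * (B + M + 1 + t) * V"
        if "(B + B + M - 1) * ((B + M + 1)\<^sup>2 + B\<^sup>2 - (B + M + 1 + B) - 2 * t * B) * V
             = ((B + M)\<^sup>2 + B\<^sup>2 - (B + M + B) - 2 * t * B) * U + ((B + M + 1)\<^sup>2 + (B - 1)\<^sup>2 - (B + M + 1 + (B - 1)) - 2 * t * (B - 1)) * W"
           "(B + B + M + 1) * V = U + W" for B M t U V W :: ratfun
      proof -
        have W: "W = (B + B + M + 1) * V - U" using that(2) by simp
        have "2 * ((M + 1 + t) * U) = 2 * ((M + 1) * (B + M + 1 + t) * V)"
          using that(1) unfolding W by (simp add: algebra_simps power2_eq_square)
        then show ?thesis by simp
      qed
      have "(of_nat m + 1 + tau) * (y1 * lead (a - 1) b) = (of_nat m + 1) * (of_nat b + of_nat m + 1 + tau) * lead a b"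
      proof (rule lin)
        show "(of_nat b + of_nat b + of_nat m + 1) * lead a b = y1 * lead (a - 1) b + y2 * lead a (b - 1)"
          unfolding rec[symmetric] by (simp add: bm)
      qed (rule eq2[unfolded sd qs])
      moreover have "of_nat m + 1 + tau \<noteq> 0" using tau_add_nonzero[of "Suc m"] by (simp add: add.commute)
      ultimately have "y1 * lead (a - 1) b = (of_nat b + of_nat m + 1 + tau) * (of_nat m + 1) / (of_nat m + 1 + tau) * lead a b"
        by (simp add: field_simps)
      moreover have "coefA a b = (of_nat b + of_nat m + 1 + tau) * (of_nat m + 1) / (of_nat m + 1 + tau)"
      proof -
        have "a - b = Suc m" using bm by simp
        then show ?thesis unfolding coefA_def by (simp add: bm(2) add_ac)
      qed
      ultimately show ?thesis by simp
    qed
  qed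
  show "y1 * lead (a - 1) b = coefA a b * lead a b" by (rule A)
  have "y2 * lead a (b - 1) = (of_nat (a + b) - coefA a b) * lead a b"
    using rec unfolding A by (simp add: algebra_simps)
  also have "of_nat (a + b) - coefA a b = coefB a b" using coefA_plus_coefB[OF ab(1)] by (simp add: algebra_simps)
  finally show "y2 * lead a (b - 1) = coefB a b * lead a b" .
qed

definition npoly :: "nat \<Rightarrow> nat \<Rightarrow> nat \<Rightarrow> (nat \<Rightarrow> real poly fract) \<Rightarrow> real poly fract poly" where
  "npoly n a b x = smult (inverse (jnorm n (two_rows a b))) (jpoly n (two_rows a b) x)"

text \<open>The factor n + content / tau cancels against the ratio of the normalizations, so the
  weights do not depend on n. This is what permits the induction on the number of variables.\<close>

lemma npoly_deriv:
  assumes ab: "b \<le> a" and n: "1 \<le> n" "b = 0 \<or> 2 \<le> n"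
  shows "pderiv (npoly n a b x) = smult (ratfun_to_real (coefA a b)) (npoly n (a - 1) b x)
    + smult (ratfun_to_real (coefB a b)) (npoly n a (b - 1) x)"
proof (cases "a + b = 0")
  case True
  then have z: "a = 0" "b = 0" by auto
  have "degree (jpoly n (two_rows 0 0) x) = 0"
    by (simp add: jpoly_def peval_def MP_0)
  then have "pderiv (jpoly n (two_rows 0 0) x) = 0" by (simp add: pderiv_eq_0_iff)
  then show ?thesis by (simp add: z npoly_def pderiv_smult coefA_def coefB_def)
next
  case False
  then have ab0: "0 < a + b" by simp
  obtain y1 y2 where y: "a = b \<Longrightarrow> y1 = 0" "b = 0 \<Longrightarrow> y2 = 0"
    "\<And>N. N \<in> MP (a + b - 1) \<Longrightarrow> pder 1 (jcoord (two_rows a b)) N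
        = y1 * jcoord (two_rows (a - 1) b) N + y2 * jcoord (two_rows a (b - 1)) N"
    using pder_1_jcoord_two_rows[OF ab ab0] by blast
  let ?\<phi> = ratfun_to_real
  let ?N = "jnorm n (two_rows a b)"
  have N: "?N \<noteq> 0"
    using jnorm_pos[OF _ keys_two_rows_subset[OF n], of a] ab by simp
  have Nc: "?N = ?\<phi> (lead a b) * cont_prod n a b" by (rule jnorm_two_rows[OF ab])
  have v: "?\<phi> (lead a b) \<noteq> 0" "cont_prod n a b \<noteq> 0" using N unfolding Nc by auto
  have 1: "smult (inverse ?N * ((of_nat n + of_nat (a - 1) / real_tau) * ?\<phi> y1)) (jpoly n (two_rows (a - 1) b) x)
      = smult (?\<phi> (coefA a b)) (npoly n (a - 1) b x)"
  proof (cases "a = b")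
    case False
    then obtain a' where a': "a = Suc a'" "b \<le> a'" using ab by (cases a) auto
    let ?N' = "jnorm n (two_rows a' b)"
    have N': "?N' \<noteq> 0" using jnorm_pos[OF _ keys_two_rows_subset[OF n], of a'] a' by simp
    have "(of_nat n + of_nat a' / real_tau) * ?\<phi> y1 * ?N' = ?\<phi> (y1 * lead a' b) * cont_prod n a b"
      unfolding jnorm_two_rows[OF a'(2)] by (simp add: cont_prod_def a' ratfun_to_real_mult)
    also have "y1 * lead a' b = coefA a b * lead a b" using lead_ratio(1)[OF ab ab0 y] a' by simp
    finally have "(of_nat n + of_nat a' / real_tau) * ?\<phi> y1 * ?N' = ?\<phi> (coefA a b) * ?N"
      unfolding Nc by (simp add: ratfun_to_real_mult)
    then have "inverse ?N * ((of_nat n + of_nat a' / real_tau) * ?\<phi> y1) = ?\<phi> (coefA a b) * inverse ?N'"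
      using N N' by (simp add: field_simps)
    then show ?thesis using a' by (simp add: npoly_def)
  qed (simp add: y(1) coefA_def)
  have 2: "smult (inverse ?N * ((of_nat n - 1 + of_nat (b - 1) / real_tau) * ?\<phi> y2)) (jpoly n (two_rows a (b - 1)) x)
      = smult (?\<phi> (coefB a b)) (npoly n a (b - 1) x)"
  proof (cases "b = 0")
    case False
    then obtain b' where b': "b = Suc b'" "b' \<le> a" using ab by (cases b) auto
    let ?N' = "jnorm n (two_rows a b')"
    have N': "?N' \<noteq> 0" using jnorm_pos[OF _ keys_two_rows_subset[of n b' a], of ] n b' by simp
    have "(of_nat n - 1 + of_nat b' / real_tau) * ?\<phi> y2 * ?N' = ?\<phi> (y2 * lead a b') * cont_prod n a b"
      unfolding jnorm_two_rows[OF b'(2)] by (simp add: cont_prod_def b' ratfun_to_real_mult)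
    also have "y2 * lead a b' = coefB a b * lead a b" using lead_ratio(2)[OF ab ab0 y] b' by simp
    finally have "(of_nat n - 1 + of_nat b' / real_tau) * ?\<phi> y2 * ?N' = ?\<phi> (coefB a b) * ?N"
      unfolding Nc by (simp add: ratfun_to_real_mult)
    then have "inverse ?N * ((of_nat n - 1 + of_nat b' / real_tau) * ?\<phi> y2) = ?\<phi> (coefB a b) * inverse ?N'"
      using N N' by (simp add: field_simps)
    then show ?thesis using b' by (simp add: npoly_def)
  qed (simp add: y(2) coefB_def)
  have "pderiv (jpoly n (two_rows a b) x)
    = smult ((of_nat n + of_nat (a - 1) / real_tau) * ?\<phi> y1) (jpoly n (two_rows (a - 1) b) x)
    + smult ((of_nat n - 1 + of_nat (b - 1) / real_tau) * ?\<phi> y2) (jpoly n (two_rows a (b - 1)) x)"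
    by (rule jpoly_deriv[OF ab ab0]) (rule y, assumption)+
  then show ?thesis
    unfolding npoly_def[of n a b] pderiv_smult by (simp only: smult_add_right smult_smult 1 2)
qed

section \<open>Inequalities for two-row partitions\<close>

abbreviation cA :: "nat \<Rightarrow> nat \<Rightarrow> real poly fract" where
  "cA a b \<equiv> ratfun_to_real (coefA a b)"

abbreviation cB :: "nat \<Rightarrow> nat \<Rightarrow> real poly fract" where
  "cB a b \<equiv> ratfun_to_real (coefB a b)"

lemma real_tau_add_nonzero: "of_nat n + real_tau \<noteq> 0"
  using add_nonneg_pos[OF of_nat_0_le_iff[of n] real_tau_pos] by simp

lemma cA_eq: "cA a b = (of_nat a + real_tau) * of_nat (a - b) / (of_nat (a - b) + real_tau)"
  unfolding coefA_def by (simp only: ratfun_to_real_divide ratfun_to_real_mult ratfun_to_real_add ratfun_to_real_of_nat ratfun_to_real_tau)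

lemma ratfun_to_real_numeral [simp]: "ratfun_to_real (numeral n) = numeral n"
  using ratfun_to_real_of_nat[of "numeral n"] by simp

lemma cB_eq: "cB a b = of_nat b * (of_nat (a - b) + 2 * real_tau) / (of_nat (a - b) + real_tau)"
  unfolding coefB_def by (simp only: ratfun_to_real_divide ratfun_to_real_mult ratfun_to_real_add ratfun_to_real_of_nat ratfun_to_real_tau ratfun_to_real_numeral)

lemma cA_plus_cB: "b \<le> a \<Longrightarrow> cA a b + cB a b = of_nat (a + b)"
  unfolding ratfun_to_real_add[symmetric] coefA_plus_coefB by (rule ratfun_to_real_of_nat)

lemmas nonneg_intros = nonneg_ratfuns_0 nonneg_ratfuns_1 nonneg_ratfuns_of_nat nonneg_ratfuns_tau nonneg_ratfuns_add
  nonneg_ratfuns_mult nonneg_ratfuns_divide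

lemma nonneg_ratfuns_2: "2 \<in> nonneg_ratfuns"
  using nonneg_ratfuns_of_nat[of 2] by simp

lemma cA_nonneg: "cA a b \<in> nonneg_ratfuns" and cB_nonneg: "cB a b \<in> nonneg_ratfuns"
  unfolding cA_eq cB_eq by (intro nonneg_intros nonneg_ratfuns_2)+

lemma cA_diag [simp]: "cA a a = 0" and cB_0 [simp]: "cB a 0 = 0"
  by (simp_all add: cA_eq cB_eq)

text \<open>\<open>cB a b\<close> is b (1 + tau / (a - b + tau)), which decreases as the gap a - b
  grows.\<close>

lemma cB_antimono: "b \<le> a \<Longrightarrow> cB a b - cB (Suc a) b \<in> nonneg_ratfuns"
proof -
  assume "b \<le> a"
  then obtain m where m: "a = b + m" by (metis le_iff_add)
  have eq: "B * (M + 2 * t) / (M + t) - B * (M + 1 + 2 * t) / (M + 1 + t) = B * t / ((M + t) * (M + 1 + t))"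
    if "M + t \<noteq> 0" "M + 1 + t \<noteq> 0" for B M t :: "real poly fract"
  proof -
    have "B * (M + 2 * t) * (M + 1 + t) - B * (M + 1 + 2 * t) * (M + t) = B * t" by (simp add: algebra_simps)
    then show ?thesis using that by (simp add: diff_frac_eq)
  qed
  have "cB a b - cB (Suc a) b = of_nat b * real_tau / ((of_nat m + real_tau) * (of_nat m + 1 + real_tau))"
    unfolding cB_eq m using eq[of "of_nat m" real_tau "of_nat b"] real_tau_add_nonzero[of m] real_tau_add_nonzero[of "Suc m"]
    by (simp add: Suc_diff_le add.commute)
  then show ?thesis by (simp only:) (intro nonneg_intros)
qed

text \<open>\<open>cA a b\<close> is (a + tau) (1 - tau / (a - b + tau)), which decreases as the gap
  a - b shrinks.\<close>

lemma cA_antimono: "b < a \<Longrightarrow> cA a b - cA a (Suc b) \<in> nonneg_ratfuns"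
proof -
  assume "b < a"
  then obtain m where m: "a = Suc (b + m)" by (metis less_iff_Suc_add)
  have eq: "A * (M + 1) / (M + 1 + t) - A * M / (M + t) = A * t / ((M + t) * (M + 1 + t))"
    if "M + t \<noteq> 0" "M + 1 + t \<noteq> 0" for A M t :: "real poly fract"
  proof -
    have "A * (M + 1) * (M + t) - A * M * (M + 1 + t) = A * t" by (simp add: algebra_simps)
    then show ?thesis using that by (simp add: diff_frac_eq mult.commute)
  qed
  have d: "a - b = Suc m" "a - Suc b = m" using m by auto
  have nz: "of_nat m + real_tau \<noteq> 0" "of_nat m + 1 + real_tau \<noteq> 0"
    using real_tau_add_nonzero[of m] real_tau_add_nonzero[of "Suc m"] by (simp_all add: add.commute)
  have S: "(of_nat (Suc m) :: real poly fract) = of_nat m + 1" by simp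
  have "cA a b - cA a (Suc b) = (of_nat a + real_tau) * real_tau / ((of_nat m + real_tau) * (of_nat m + 1 + real_tau))"
    unfolding cA_eq d S by (rule eq[OF nz])
  then show ?thesis by (simp only:) (intro nonneg_intros)
qed

abbreviation ncoef :: "nat \<Rightarrow> nat \<Rightarrow> nat \<Rightarrow> (nat \<Rightarrow> real poly fract) \<Rightarrow> nat \<Rightarrow> real poly fract" where
  "ncoef n a b x k \<equiv> coeff (npoly n a b x) k"

lemma ncoef_Suc:
  assumes "b \<le> a" "1 \<le> n" "b = 0 \<or> 2 \<le> n"
  shows "of_nat (Suc k) * ncoef n a b x (Suc k) = cA a b * ncoef n (a - 1) b x k + cB a b * ncoef n a (b - 1) x k"
proof -
  have "of_nat (Suc k) * ncoef n a b x (Suc k) = coeff (pderiv (npoly n a b x)) k"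
    by (simp only: coeff_pderiv)
  also have "\<dots> = cA a b * ncoef n (a - 1) b x k + cB a b * ncoef n a (b - 1) x k"
    unfolding npoly_deriv[OF assms] by simp
  finally show ?thesis .
qed

lemma nonneg_cancel_Suc: "of_nat (Suc k) * y \<in> nonneg_ratfuns \<Longrightarrow> y \<in> nonneg_ratfuns"
proof -
  assume "of_nat (Suc k) * y \<in> nonneg_ratfuns"
  then have "of_nat (Suc k) * y / of_nat (Suc k) \<in> nonneg_ratfuns"
    by (intro nonneg_ratfuns_divide nonneg_ratfuns_of_nat)
  moreover have "of_nat (Suc k) * y / of_nat (Suc k) = y"
    using of_nat_neq_0[of k, where 'a = "real poly fract"] by (rule nonzero_mult_div_cancel_left)
  ultimately show ?thesis by simp
qed

text \<open>The derivative of the difference is a nonnegative combination of such differences in one degree less.\<close>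

lemma ncoef_move_box:
  assumes n: "2 \<le> n"
    and base: "\<And>a b. b + 2 \<le> a \<Longrightarrow> ncoef n a b x 0 - ncoef n (a - 1) (b + 1) x 0 \<in> nonneg_ratfuns"
  shows "b + 2 \<le> a \<Longrightarrow> ncoef n a b x k - ncoef n (a - 1) (b + 1) x k \<in> nonneg_ratfuns"
proof (induction k arbitrary: a b)
  case (Suc k)
  have n1: "1 \<le> n" using n by simp
  let ?f = "\<lambda>a b. ncoef n a b x k"
  have l: "of_nat (Suc k) * ncoef n a b x (Suc k) = cA a b * ?f (a - 1) b + cB a b * ?f a (b - 1)"
    by (rule ncoef_Suc) (use Suc.prems n n1 in auto)
  have m: "of_nat (Suc k) * ncoef n (a - 1) (b + 1) x (Suc k)
     = cA (a - 1) (b + 1) * ?f (a - 1 - 1) (b + 1) + cB (a - 1) (b + 1) * ?f (a - 1) (b + 1 - 1)"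
    by (rule ncoef_Suc) (use Suc.prems n n1 in auto)
  have b1: "b + 1 - 1 = b" by simp
  \<comment> \<open>The weights on both sides sum to a + b, which balances the coefficient of the
    common neighbour (a - 1, b).\<close>
  have "cA a b + cB a b = cA (a - 1) (b + 1) + cB (a - 1) (b + 1)"
    using cA_plus_cB[of b a] cA_plus_cB[of "b + 1" "a - 1"] Suc.prems by simp
  then have cBm: "cB (a - 1) (b + 1) = cA a b + cB a b - cA (a - 1) (b + 1)" by (simp add: algebra_simps)
  have "of_nat (Suc k) * (ncoef n a b x (Suc k) - ncoef n (a - 1) (b + 1) x (Suc k))
     = cB a b * (?f a (b - 1) - ?f (a - 1) b) + cA (a - 1) (b + 1) * (?f (a - 1) b - ?f (a - 1 - 1) (b + 1))"
    unfolding right_diff_distrib[of "of_nat (Suc k)"] l m b1 cBm by (simp add: algebra_simps)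
  moreover have "cB a b * (?f a (b - 1) - ?f (a - 1) b) \<in> nonneg_ratfuns"
  proof (cases "b = 0")
    case False
    then have "?f a (b - 1) - ?f (a - 1) (b - 1 + 1) \<in> nonneg_ratfuns" by (intro Suc.IH) (use Suc.prems in simp)
    then show ?thesis using False by (intro nonneg_ratfuns_mult cB_nonneg) simp
  qed (simp add: nonneg_ratfuns_0)
  \<comment> \<open>If a = b + 2, the rows of (a - 1, b + 1) are equal and the weight of removing a
    box from its first row is 0; this covers the case outside the induction hypothesis.\<close>
  moreover have "cA (a - 1) (b + 1) * (?f (a - 1) b - ?f (a - 1 - 1) (b + 1)) \<in> nonneg_ratfuns"
  proof (cases "a = b + 2")
    case True
    then have "a - 1 = b + 1" by simp
    then show ?thesis by (simp add: nonneg_ratfuns_0)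
  next
    case False
    then show ?thesis by (intro nonneg_ratfuns_mult cA_nonneg Suc.IH) (use Suc.prems in simp)
  qed
  ultimately have "of_nat (Suc k) * (ncoef n a b x (Suc k) - ncoef n (a - 1) (b + 1) x (Suc k)) \<in> nonneg_ratfuns"
    by (simp only: nonneg_ratfuns_add)
  then show ?case by (rule nonneg_cancel_Suc)
qed (rule base)

text \<open>Multiplying the smaller polynomial by s does not change its value at s = 1, so
  coefficient k + 1 is compared with coefficient k. Adding a box raises the sum of the weights by 1,
  and this 1 absorbs the difference between the factors k + 2 and k + 1 in the recursions.\<close>

lemma ncoef_add_box:
  assumes n: "1 \<le> n"
    and base: "\<And>a b. b \<le> a \<Longrightarrow> b = 0 \<or> 2 \<le> n \<Longrightarrow> ncoef n a b x 0 \<in> nonneg_ratfuns"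
  shows "(\<forall>a b. b \<le> a \<longrightarrow> b = 0 \<or> 2 \<le> n \<longrightarrow> ncoef n (Suc a) b x (Suc k) - ncoef n a b x k \<in> nonneg_ratfuns)
    \<and> (\<forall>a b. b < a \<longrightarrow> 2 \<le> n \<longrightarrow> ncoef n a (Suc b) x (Suc k) - ncoef n a b x k \<in> nonneg_ratfuns)"
proof (induction k)
  case 0
  let ?f = "\<lambda>a b. ncoef n a b x 0"
  have 1: "ncoef n (Suc a) b x (Suc 0) - ?f a b \<in> nonneg_ratfuns" if ab: "b \<le> a" "b = 0 \<or> 2 \<le> n" for a b
  proof -
    have "of_nat (Suc 0) * ncoef n (Suc a) b x (Suc 0) = cA (Suc a) b * ?f (Suc a - 1) b + cB (Suc a) b * ?f (Suc a) (b - 1)"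
      by (rule ncoef_Suc) (use ab n in auto)
    then have r: "ncoef n (Suc a) b x (Suc 0) = cA (Suc a) b * ?f a b + cB (Suc a) b * ?f (Suc a) (b - 1)" by simp
    have A: "cA (Suc a) b = 1 + (cA a b + (cB a b - cB (Suc a) b))"
      using cA_plus_cB[of b a] cA_plus_cB[of b "Suc a"] ab(1) by (simp add: algebra_simps)
    have "ncoef n (Suc a) b x (Suc 0) - ?f a b = (cA a b + (cB a b - cB (Suc a) b)) * ?f a b + cB (Suc a) b * ?f (Suc a) (b - 1)"
      unfolding r A by (simp add: algebra_simps)
    moreover have "?f (Suc a) (b - 1) \<in> nonneg_ratfuns" "?f a b \<in> nonneg_ratfuns"
      by (rule base; use ab in auto)+
    ultimately show ?thesis
      by (simp only:) (intro nonneg_ratfuns_add nonneg_ratfuns_mult cA_nonneg cB_nonneg cB_antimono ab)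
  qed
  have 2: "ncoef n a (Suc b) x (Suc 0) - ?f a b \<in> nonneg_ratfuns" if ab: "b < a" "2 \<le> n" for a b
  proof -
    have "of_nat (Suc 0) * ncoef n a (Suc b) x (Suc 0) = cA a (Suc b) * ?f (a - 1) (Suc b) + cB a (Suc b) * ?f a (Suc b - 1)"
      by (rule ncoef_Suc) (use ab n in auto)
    then have r: "ncoef n a (Suc b) x (Suc 0) = cA a (Suc b) * ?f (a - 1) (Suc b) + cB a (Suc b) * ?f a b" by simp
    have B: "cB a (Suc b) = 1 + (cB a b + (cA a b - cA a (Suc b)))"
      using cA_plus_cB[of b a] cA_plus_cB[of "Suc b" a] ab(1) by (simp add: algebra_simps)
    have "ncoef n a (Suc b) x (Suc 0) - ?f a b = (cB a b + (cA a b - cA a (Suc b))) * ?f a b + cA a (Suc b) * ?f (a - 1) (Suc b)"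
      unfolding r B by (simp add: algebra_simps)
    moreover have "cA a (Suc b) * ?f (a - 1) (Suc b) \<in> nonneg_ratfuns"
    proof (cases "a = Suc b")
      case False
      then show ?thesis by (intro nonneg_ratfuns_mult cA_nonneg base) (use ab in auto)
    qed (simp add: nonneg_ratfuns_0)
    moreover have "(cB a b + (cA a b - cA a (Suc b))) * ?f a b \<in> nonneg_ratfuns"
      by (intro nonneg_ratfuns_add nonneg_ratfuns_mult cB_nonneg cA_antimono base) (use ab in auto)
    ultimately show ?thesis
      by (simp only: nonneg_ratfuns_add)
  qed
  show ?case using 1 2 by blast
next
  case (Suc k)
  let ?f = "\<lambda>a b. ncoef n a b x k" and ?g = "\<lambda>a b. ncoef n a b x (Suc k)"
  have IH1: "?g (Suc a) b - ?f a b \<in> nonneg_ratfuns" if "b \<le> a" "b = 0 \<or> 2 \<le> n" for a b using Suc that by blast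
  have IH2: "?g a (Suc b) - ?f a b \<in> nonneg_ratfuns" if "b < a" "2 \<le> n" for a b using Suc that by blast
  have two: "of_nat (Suc (Suc k)) * ?g a b = ?g a b + (cA a b * ?f (a - 1) b + cB a b * ?f a (b - 1))"
    if "b \<le> a" "b = 0 \<or> 2 \<le> n" for a b
    unfolding ncoef_Suc[OF that(1) n that(2), symmetric] by (simp add: algebra_simps)
  have tA: "cA a b * (?g a b - ?f (a - 1) b) \<in> nonneg_ratfuns" if ab: "b \<le> a" "b = 0 \<or> 2 \<le> n" for a b
  proof (cases "a = b")
    case False
    then obtain a' where a': "a = Suc a'" "b \<le> a'" using ab by (cases a) auto
    then show ?thesis using IH1[of b a'] ab by (intro nonneg_ratfuns_mult cA_nonneg) simp
  qed (simp add: nonneg_ratfuns_0)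
  have tB: "c * (?g a b - ?f a (b - 1)) \<in> nonneg_ratfuns" if ab: "b \<le> a" "b = 0 \<or> 2 \<le> n" and c: "c \<in> nonneg_ratfuns" "b = 0 \<Longrightarrow> c = 0" for a b c
  proof (cases "b = 0")
    case False
    then obtain b' where b': "b = Suc b'" by (cases b) auto
    then show ?thesis using IH2[of b' a] ab by (intro nonneg_ratfuns_mult c) simp
  qed (simp add: nonneg_ratfuns_0 c)
  have 1: "ncoef n (Suc a) b x (Suc (Suc k)) - ?g a b \<in> nonneg_ratfuns" if ab: "b \<le> a" "b = 0 \<or> 2 \<le> n" for a b
  proof (rule nonneg_cancel_Suc)
    have r: "of_nat (Suc (Suc k)) * ncoef n (Suc a) b x (Suc (Suc k)) = cA (Suc a) b * ?g (Suc a - 1) b + cB (Suc a) b * ?g (Suc a) (b - 1)"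
      by (rule ncoef_Suc) (use ab n in auto)
    have s: "Suc a - 1 = a" by simp
    have A: "cA (Suc a) b = 1 + (cA a b + (cB a b - cB (Suc a) b))"
      using cA_plus_cB[of b a] cA_plus_cB[of b "Suc a"] ab(1) by (simp add: algebra_simps)
    have "of_nat (Suc (Suc k)) * (ncoef n (Suc a) b x (Suc (Suc k)) - ?g a b)
       = cA a b * (?g a b - ?f (a - 1) b) + (cB a b - cB (Suc a) b) * (?g a b - ?f a (b - 1))
         + cB (Suc a) b * (?g (Suc a) (b - 1) - ?f a (b - 1))"
      unfolding right_diff_distrib[of "of_nat (Suc (Suc k))"] r two[OF ab] s A by (simp add: algebra_simps)
    moreover have "cB (Suc a) b * (?g (Suc a) (b - 1) - ?f a (b - 1)) \<in> nonneg_ratfuns"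
      using IH1[of "b - 1" a] ab by (intro nonneg_ratfuns_mult cB_nonneg) auto
    moreover have "(cB a b - cB (Suc a) b) * (?g a b - ?f a (b - 1)) \<in> nonneg_ratfuns"
      by (rule tB[OF ab cB_antimono[OF ab(1)]]) simp
    ultimately show "of_nat (Suc (Suc k)) * (ncoef n (Suc a) b x (Suc (Suc k)) - ?g a b) \<in> nonneg_ratfuns"
      using tA[OF ab] by (simp only: nonneg_ratfuns_add)
  qed
  have 2: "ncoef n a (Suc b) x (Suc (Suc k)) - ?g a b \<in> nonneg_ratfuns" if ab: "b < a" "2 \<le> n" for a b
  proof (rule nonneg_cancel_Suc)
    have ab': "b \<le> a" "b = 0 \<or> 2 \<le> n" using ab by auto
    have r: "of_nat (Suc (Suc k)) * ncoef n a (Suc b) x (Suc (Suc k)) = cA a (Suc b) * ?g (a - 1) (Suc b) + cB a (Suc b) * ?g a (Suc b - 1)"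
      by (rule ncoef_Suc) (use ab n in auto)
    have s: "Suc b - 1 = b" by simp
    have B: "cB a (Suc b) = 1 + (cB a b + (cA a b - cA a (Suc b)))"
      using cA_plus_cB[of b a] cA_plus_cB[of "Suc b" a] ab(1) by (simp add: algebra_simps)
    have "of_nat (Suc (Suc k)) * (ncoef n a (Suc b) x (Suc (Suc k)) - ?g a b)
       = cB a b * (?g a b - ?f a (b - 1)) + (cA a b - cA a (Suc b)) * (?g a b - ?f (a - 1) b)
         + cA a (Suc b) * (?g (a - 1) (Suc b) - ?f (a - 1) b)"
      unfolding right_diff_distrib[of "of_nat (Suc (Suc k))"] r two[OF ab'] s B by (simp add: algebra_simps)
    moreover have "cB a b * (?g a b - ?f a (b - 1)) \<in> nonneg_ratfuns"
      by (rule tB[OF ab' cB_nonneg]) simp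
    moreover have "(cA a b - cA a (Suc b)) * (?g a b - ?f (a - 1) b) \<in> nonneg_ratfuns"
    proof -
      obtain a' where a': "a = Suc a'" "b \<le> a'" using ab by (cases a) auto
      then have "?g a b - ?f (a - 1) b \<in> nonneg_ratfuns" using IH1[of b a'] ab' by simp
      then show ?thesis by (intro nonneg_ratfuns_mult cA_antimono ab)
    qed
    moreover have "cA a (Suc b) * (?g (a - 1) (Suc b) - ?f (a - 1) b) \<in> nonneg_ratfuns"
    proof (cases "a = Suc b")
      case False
      then show ?thesis using IH2[of b "a - 1"] ab by (intro nonneg_ratfuns_mult cA_nonneg) auto
    qed (simp add: nonneg_ratfuns_0)
    ultimately show "of_nat (Suc (Suc k)) * (ncoef n a (Suc b) x (Suc (Suc k)) - ?g a b) \<in> nonneg_ratfuns"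
      by (simp only: nonneg_ratfuns_add)
  qed
  show ?case using 1 2 by blast
qed

definition nval :: "nat \<Rightarrow> expvec \<Rightarrow> (nat \<Rightarrow> real poly fract) \<Rightarrow> real poly fract" where
  "nval n l x = jval n l x / jnorm n l"

lemma poly_npoly: "b \<le> a \<Longrightarrow> poly (npoly n a b x) s = nval n (two_rows a b) (\<lambda>i. x i + s)"
  by (simp add: npoly_def poly_jpoly nval_def divide_inverse mult.commute)

lemma ncoef_0: "b \<le> a \<Longrightarrow> ncoef n a b x 0 = nval n (two_rows a b) x"
  using poly_npoly[of b a n x 0] by (simp add: poly_0_coeff_0)

lemma nval_nonneg:
  assumes "is_partition l" "\<And>i. i < n \<Longrightarrow> x i \<in> nonneg_ratfuns"
  shows "nval n l x \<in> nonneg_ratfuns"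
  unfolding nval_def by (intro nonneg_ratfuns_divide jval_nonneg jnorm_nonneg assms)

lemma poly_diff_nonneg:
  assumes "\<And>k. coeff p k - coeff q k \<in> nonneg_ratfuns" "s \<in> nonneg_ratfuns"
  shows "poly p s - poly q s \<in> nonneg_ratfuns"
proof -
  have "poly p s - poly q s = poly (p - q) s" by simp
  also have "\<dots> = (\<Sum>k\<le>degree (p - q). (coeff p k - coeff q k) * s ^ k)" by (simp add: poly_altdef)
  also have "\<dots> \<in> nonneg_ratfuns"
    by (intro nonneg_ratfuns_sum nonneg_ratfuns_mult nonneg_ratfuns_power assms)
  finally show ?thesis .
qed

lemma poly_1_shift_nonneg:
  assumes "coeff p 0 \<in> nonneg_ratfuns" "\<And>k. coeff p (Suc k) - coeff q k \<in> nonneg_ratfuns"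
  shows "poly p 1 - poly q 1 \<in> nonneg_ratfuns"
proof -
  have "poly p 1 - poly q 1 = poly p 1 - poly (pCons 0 q) 1" by simp
  also have "\<dots> \<in> nonneg_ratfuns"
    by (rule poly_diff_nonneg) (use assms nonneg_ratfuns_1 in \<open>auto simp: coeff_pCons split: nat.splits\<close>)
  finally show ?thesis .
qed

definition rconst :: "real \<Rightarrow> real poly fract" where
  "rconst r = Fract [:r:] 1"

lemma rconst_add: "rconst (r + s) = rconst r + rconst s"
  by (simp add: rconst_def)

lemma rconst_0 [simp]: "rconst 0 = 0" and rconst_1 [simp]: "rconst 1 = 1"
  by (simp_all add: rconst_def fract_collapse flip: One_fract_def one_pCons)

lemma rconst_nonneg: "0 \<le> r \<Longrightarrow> rconst r \<in> nonneg_ratfuns"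
  unfolding rconst_def by (rule nonneg_ratfuns_const)

section \<open>Permuting the variables and setting one of them to 0\<close>

lemma evaln_permute:
  assumes f: "symmetric_series f" and i: "i < n" and j: "j < n"
  shows "evaln n d f (\<lambda>k. x (Transposition.transpose i j k)) = evaln n d f x"
proof -
  let ?t = "Transposition.transpose i j"
  have lk: "lookup (eswap i j e) k = lookup e (?t k)" for e k
    by (auto simp: lookup_eswap Transposition.transpose_def)
  have sw: "eswap i j (eswap i j e) = e" for e
    by (rule poly_mapping_eqI) (simp add: lk)
  have ex: "eswap i j e \<in> exps n d" if "e \<in> exps n d" for e
  proof -
    have "keys (eswap i j e) \<subseteq> {..<n}"
    proof
      fix k assume "k \<in> keys (eswap i j e)"
      then have "?t k \<in> keys e" by (simp add: in_keys_iff lk)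
      then have "?t k < n" using that by (auto simp: exps_def)
      then show "k \<in> {..<n}" using i j by (auto simp: Transposition.transpose_def split: if_splits)
    qed
    then show ?thesis using that by (simp add: exps_def)
  qed
  show ?thesis
    unfolding evaln_def
  proof (rule sum.reindex_bij_witness[of _ "eswap i j" "eswap i j"])
    fix e assume "e \<in> exps n d"
    have "f (eswap i j e) = f e" by (rule symmetric_seriesD[OF f]) simp
    moreover have "(\<Prod>k<n. x k ^ lookup (eswap i j e) k) = (\<Prod>k<n. x (?t k) ^ lookup e k)"
    proof (rule prod.reindex_bij_witness[of _ ?t ?t])
      fix k assume "k \<in> {..<n}"
      then show "?t k \<in> {..<n}" using i j by (auto simp: Transposition.transpose_def)
      then show "?t k \<in> {..<n}" .
      show "x (?t (?t k)) ^ lookup e (?t k) = x k ^ lookup (eswap i j e) k" by (simp add: lk)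
    qed auto
    ultimately show "f (eswap i j e) * (\<Prod>k<n. x k ^ lookup (eswap i j e) k) = f e * (\<Prod>k<n. x (?t k) ^ lookup e k)" by simp
  qed (use sw ex in auto)
qed

lemma evaln_last_zero:
  assumes "x n = 0"
  shows "evaln (Suc n) d f x = evaln n d f x"
  unfolding evaln_def
proof (rule sum.mono_neutral_cong_right)
  show "exps n d \<subseteq> exps (Suc n) d" by (auto simp: exps_def)
  show "\<forall>e\<in>exps (Suc n) d - exps n d. f e * (\<Prod>i<Suc n. x i ^ lookup e i) = 0"
  proof
    fix e assume e: "e \<in> exps (Suc n) d - exps n d"
    have "n \<in> keys e"
    proof (rule ccontr)
      assume "n \<notin> keys e"
      then have "keys e \<subseteq> {..<n}" using e by (auto simp: exps_def less_Suc_eq)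
      then show False using e by (auto simp: exps_def)
    qed
    then have "0 < lookup e n" by (simp add: in_keys_iff)
    then have "x n ^ lookup e n = 0" unfolding assms by (rule zero_power)
    then show "f e * (\<Prod>i<Suc n. x i ^ lookup e i) = 0" by simp
  qed
  fix e assume "e \<in> exps n d"
  then have "n \<notin> keys e" by (auto simp: exps_def)
  then show "f e * (\<Prod>i<Suc n. x i ^ lookup e i) = f e * (\<Prod>i<n. x i ^ lookup e i)" by (simp add: in_keys_iff)
qed simp

lemma jval_last_zero: "x n = 0 \<Longrightarrow> jval (Suc n) l x = jval n l x"
  unfolding jval_def by (rule evaln_last_zero)

lemma jval_permute:
  assumes "is_partition l" "i < n" "j < n"
  shows "jval n l (\<lambda>k. x (Transposition.transpose i j k)) = jval n l x"
  unfolding jval_def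
proof (rule evaln_permute)
  show "symmetric_series (\<lambda>e. ratfun_to_real (jackP l e))"
    unfolding symmetric_series_def
    using symmetric_seriesD[OF dom_space_symmetric[OF jackP(1)[OF assms(1)]]] by metis
qed (use assms in auto)

lemma jval_1_two_rows:
  assumes "b \<le> a" "0 < b"
  shows "jval 1 (two_rows a b) x = 0"
  unfolding jval_def evaln_def
proof (rule sum.neutral, rule ballI)
  fix e assume e: "e \<in> exps 1 (part_size (two_rows a b))"
  have "part_size e = (\<Sum>i\<in>{0}. lookup e i)" by (rule part_size_superset) (use e in \<open>auto simp: exps_def\<close>)
  then have "lookup e 0 = a + b" using e by (simp add: exps_def)
  then have "\<not> dominates (two_rows a b) e" using assms by (auto simp: dominates_two_rows intro!: exI[of _ 0])
  then show "ratfun_to_real (jackP (two_rows a b) e) * (\<Prod>i<1. x i ^ lookup e i) = 0"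
    using assms by (simp add: jackP_zero)
qed

lemma cont_prod_nonneg: "2 \<le> n \<or> b = 0 \<Longrightarrow> cont_prod n a b \<in> nonneg_ratfuns"
proof -
  assume n: "2 \<le> n \<or> b = 0"
  have *: "(of_nat n - 1 + of_nat i / real_tau) \<in> nonneg_ratfuns" if "2 \<le> n" for i
  proof -
    have "of_nat n - 1 = (of_nat (n - 1) :: real poly fract)" using that by (simp add: of_nat_diff)
    then show ?thesis by (simp only:) (intro nonneg_intros)
  qed
  have "(of_nat n + of_nat i / real_tau) \<in> nonneg_ratfuns" for i by (intro nonneg_intros)
  moreover have "(\<Prod>i<b. of_nat n - 1 + of_nat i / real_tau) \<in> nonneg_ratfuns"
  proof (cases "b = 0")
    case False
    then have "2 \<le> n" using n by simp
    then show ?thesis by (intro nonneg_ratfuns_prod *)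
  qed (simp add: nonneg_ratfuns_1)
  ultimately show ?thesis unfolding cont_prod_def
    by (intro nonneg_ratfuns_mult[OF nonneg_ratfuns_prod])
qed

text \<open>Setting a variable to zero multiplies the normalized polynomial by the factor \<open>jnorm n \<lambda> / jnorm (n+1) \<lambda>\<close>,
  which is a product over the boxes of an increasing function of the content.\<close>

lemma jnorm_ratio_mono:
  assumes n: "2 \<le> n" and ab: "b + 2 \<le> a"
  shows "jnorm n (two_rows a b) / jnorm (Suc n) (two_rows a b)
     - jnorm n (two_rows (a - 1) (b + 1)) / jnorm (Suc n) (two_rows (a - 1) (b + 1)) \<in> nonneg_ratfuns"
proof -
  obtain a' where a': "a = Suc a'" using ab by (cases a) auto
  have v: "ratfun_to_real (lead p q) \<noteq> 0" if "q \<le> p" for p q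
    using jnorm_pos[of "two_rows p q" 2] keys_two_rows_subset[of 2 q p] that unfolding jnorm_two_rows[OF that] by auto
  have ratio: "jnorm n (two_rows p q) / jnorm (Suc n) (two_rows p q) = cont_prod n p q / cont_prod (Suc n) p q" if "q \<le> p" for p q
    unfolding jnorm_two_rows[OF that] using v[OF that] by simp
  define R where "R = cont_prod n a' b / cont_prod (Suc n) a' b"
  define X where "X = of_nat n + of_nat a' / real_tau"
  define Y where "Y = of_nat n - 1 + of_nat b / real_tau"
  have Yn: "Y = of_nat (n - 1) + of_nat b / real_tau" using n by (simp add: Y_def of_nat_diff)
  have X: "X \<in> nonneg_ratfuns" "Y \<in> nonneg_ratfuns" unfolding X_def Yn by (intro nonneg_intros)+
  have XY: "X - Y = 1 + of_nat (a' - b) / real_tau"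
    using ab a' by (simp add: X_def Y_def of_nat_diff diff_divide_distrib)
  have pos: "X + 1 \<noteq> 0" "Y + 1 \<noteq> 0"
    using nonneg_ratfuns_ge_0[OF X(1)] nonneg_ratfuns_ge_0[OF X(2)] by auto
  have SX: "of_nat (Suc n) + of_nat a' / real_tau = X + 1" "of_nat (Suc n) - 1 + of_nat b / real_tau = Y + 1"
    by (simp_all add: X_def Y_def)
  have "jnorm n (two_rows a b) / jnorm (Suc n) (two_rows a b) = R * (X / (X + 1))"
    using ratio[of b a] ab unfolding a' R_def cont_prod_def by (simp add: X_def[symmetric] SX[simplified] mult_ac)
  moreover have "jnorm n (two_rows (a - 1) (b + 1)) / jnorm (Suc n) (two_rows (a - 1) (b + 1)) = R * (Y / (Y + 1))"
    using ratio[of "Suc b" a'] ab unfolding a' R_def cont_prod_def by (simp add: Y_def[symmetric] SX[simplified] mult_ac One_nat_def)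
  moreover have "X / (X + 1) - Y / (Y + 1) = (X - Y) / ((X + 1) * (Y + 1))"
    using pos by (simp add: diff_frac_eq algebra_simps)
  ultimately have "jnorm n (two_rows a b) / jnorm (Suc n) (two_rows a b)
     - jnorm n (two_rows (a - 1) (b + 1)) / jnorm (Suc n) (two_rows (a - 1) (b + 1)) = R * ((X - Y) / ((X + 1) * (Y + 1)))"
    by (simp only: right_diff_distrib[symmetric])
  also have "\<dots> \<in> nonneg_ratfuns"
    unfolding R_def XY using n X by (intro nonneg_intros cont_prod_nonneg) auto
  finally show ?thesis .
qed

lemma nval_move_box:
  assumes "2 \<le> n" "b + 2 \<le> a" "\<And>i. i < n \<Longrightarrow> 0 \<le> r i"
  shows "nval n (two_rows a b) (\<lambda>i. rconst (r i)) - nval n (two_rows (a - 1) (b + 1)) (\<lambda>i. rconst (r i)) \<in> nonneg_ratfuns"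
  using assms
proof (induction n arbitrary: a b r)
  case (Suc n)
  let ?\<Delta> = "\<lambda>r a b. nval (Suc n) (two_rows a b) (\<lambda>i. rconst (r i)) - nval (Suc n) (two_rows (a - 1) (b + 1)) (\<lambda>i. rconst (r i))"
  have last: "?\<Delta> r a b \<in> nonneg_ratfuns" if r: "\<And>i. i < Suc n \<Longrightarrow> 0 \<le> r i" "r n = 0" and ab: "b + 2 \<le> a" for r a b
  proof -
    let ?x = "\<lambda>i. rconst (r i)"
    let ?l = "two_rows a b" and ?m = "two_rows (a - 1) (b + 1)"
    have xn: "?x n = 0" using r(2) by simp
    have pl: "is_partition ?l" "is_partition ?m" using ab by auto
    have nn: "nval n ?l ?x \<in> nonneg_ratfuns" by (intro nval_nonneg pl rconst_nonneg r(1)) simp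
    show ?thesis
    proof (cases "2 \<le> n")
      case True
      have N: "jnorm n ?l \<noteq> 0" "jnorm n ?m \<noteq> 0"
        using jnorm_pos[OF pl(1), of n] jnorm_pos[OF pl(2), of n] keys_two_rows_subset[of n] True by auto
      have e: "nval (Suc n) p ?x = nval n p ?x * (jnorm n p / jnorm (Suc n) p)" if "jnorm n p \<noteq> 0" for p
        using that by (simp add: nval_def jval_last_zero[of ?x n, OF xn])
      \<comment> \<open>A difference of products, split so that each summand contains one difference
        already known to be nonnegative.\<close>
      have "?\<Delta> r a b = (nval n ?l ?x - nval n ?m ?x) * (jnorm n ?m / jnorm (Suc n) ?m)
         + nval n ?l ?x * (jnorm n ?l / jnorm (Suc n) ?l - jnorm n ?m / jnorm (Suc n) ?m)"
        unfolding e[OF N(1)] e[OF N(2)] by (simp only: left_diff_distrib right_diff_distrib diff_add_eq)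
      moreover have "nval n ?l ?x - nval n ?m ?x \<in> nonneg_ratfuns"
        by (rule Suc.IH[OF True ab]) (use r(1) in simp)
      ultimately show ?thesis
        using nn by (simp only:) (intro nonneg_ratfuns_add nonneg_ratfuns_mult nonneg_ratfuns_divide jnorm_nonneg pl jnorm_ratio_mono True ab)
    next
      case False
      then have n1: "n = 1" using Suc.prems(1) by simp
      \<comment> \<open>In one variable only one-row partitions survive, so the subtracted term is
        0.\<close>
      have "jval n ?m ?x = 0"
        unfolding n1 by (rule jval_1_two_rows) (use ab in auto)
      then have "nval (Suc n) ?m ?x = 0"
        by (simp add: nval_def jval_last_zero[of ?x n, OF xn])
      moreover have "nval (Suc n) ?l ?x \<in> nonneg_ratfuns" by (intro nval_nonneg pl rconst_nonneg r(1))
      ultimately show ?thesis by simp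
    qed
  qed
  have zero: "?\<Delta> r a b \<in> nonneg_ratfuns" if r: "\<And>i. i < Suc n \<Longrightarrow> 0 \<le> r i" "j < Suc n" "r j = 0" and ab: "b + 2 \<le> a" for r a b j
  proof -
    let ?t = "Transposition.transpose j n"
    have "nval (Suc n) p (\<lambda>i. rconst (r (?t i))) = nval (Suc n) p (\<lambda>i. rconst (r i))" if "is_partition p" for p
      unfolding nval_def using jval_permute[OF that, of j "Suc n" n "\<lambda>i. rconst (r i)"] r(2) by simp
    moreover have "?\<Delta> (\<lambda>i. r (?t i)) a b \<in> nonneg_ratfuns"
    proof (rule last[OF _ _ ab])
      fix i assume "i < Suc n"
      then have "?t i < Suc n" using r(2) by (auto simp: Transposition.transpose_def)
      then show "0 \<le> r (?t i)" by (rule r(1))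
    qed (use r in simp)
    ultimately show ?thesis using ab by simp
  qed
  define s where "s = Min (r ` {..<Suc n})"
  have "s \<in> r ` {..<Suc n}" unfolding s_def by (rule Min_in) auto
  then obtain j where j: "j < Suc n" "r j = s" by auto
  have sle: "s \<le> r i" if "i < Suc n" for i using that by (simp add: s_def)
  have s0: "0 \<le> s" using j Suc.prems(3) by auto
  define r' where "r' i = r i - s" for i
  let ?x = "\<lambda>i. rconst (r' i)"
  have coef: "ncoef (Suc n) a b ?x k - ncoef (Suc n) (a - 1) (b + 1) ?x k \<in> nonneg_ratfuns" for k
  proof (rule ncoef_move_box[OF Suc.prems(1) _ Suc.prems(2)])
    fix a b :: nat assume ab: "b + 2 \<le> a"
    have "?\<Delta> r' a b \<in> nonneg_ratfuns"
      by (rule zero[OF _ j(1) _ ab]) (use sle j in \<open>auto simp: r'_def\<close>)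
    then show "ncoef (Suc n) a b ?x 0 - ncoef (Suc n) (a - 1) (b + 1) ?x 0 \<in> nonneg_ratfuns"
      using ab by (simp add: ncoef_0)
  qed
  have "poly (npoly (Suc n) a b ?x) (rconst s) - poly (npoly (Suc n) (a - 1) (b + 1) ?x) (rconst s) \<in> nonneg_ratfuns"
    by (rule poly_diff_nonneg[OF coef rconst_nonneg[OF s0]])
  moreover have "(\<lambda>i. ?x i + rconst s) = (\<lambda>i. rconst (r i))"
    by (simp add: r'_def flip: rconst_add)
  ultimately show ?case using Suc.prems(2) by (simp add: poly_npoly)
qed simp

lemma nval_move_boxes:
  assumes "2 \<le> n" "\<And>i. i < n \<Longrightarrow> 0 \<le> r i" "b + k \<le> a - k" "k \<le> a"
  shows "nval n (two_rows a b) (\<lambda>i. rconst (r i)) - nval n (two_rows (a - k) (b + k)) (\<lambda>i. rconst (r i)) \<in> nonneg_ratfuns"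
  using assms(3,4)
proof (induction k)
  case 0
  then show ?case by (simp add: nonneg_ratfuns_0)
next
  case (Suc k)
  let ?f = "\<lambda>a b. nval n (two_rows a b) (\<lambda>i. rconst (r i))"
  have "?f a b - ?f (a - k) (b + k) \<in> nonneg_ratfuns" using Suc by auto
  moreover have "?f (a - k) (b + k) - ?f (a - k - 1) (b + k + 1) \<in> nonneg_ratfuns"
    by (rule nval_move_box[OF assms(1) _ assms(2)]) (use Suc.prems in auto)
  ultimately have "(?f a b - ?f (a - k) (b + k)) + (?f (a - k) (b + k) - ?f (a - k - 1) (b + k + 1)) \<in> nonneg_ratfuns"
    by (rule nonneg_ratfuns_add)
  then show ?case by (simp add: One_nat_def)
qed

lemma nval_add_box:
  assumes "1 \<le> n" "\<And>i. i < n \<Longrightarrow> 0 \<le> r i"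
  shows "b \<le> a \<Longrightarrow> b = 0 \<or> 2 \<le> n \<Longrightarrow>
      nval n (two_rows (Suc a) b) (\<lambda>i. rconst (r i + 1)) - nval n (two_rows a b) (\<lambda>i. rconst (r i + 1)) \<in> nonneg_ratfuns"
    and "b < a \<Longrightarrow> 2 \<le> n \<Longrightarrow>
      nval n (two_rows a (Suc b)) (\<lambda>i. rconst (r i + 1)) - nval n (two_rows a b) (\<lambda>i. rconst (r i + 1)) \<in> nonneg_ratfuns"
proof -
  let ?x = "\<lambda>i. rconst (r i)"
  have base: "ncoef n a b ?x 0 \<in> nonneg_ratfuns" if "b \<le> a" for a b
    unfolding ncoef_0[OF that] by (intro nval_nonneg rconst_nonneg assms(2)) (use that in auto)
  have x1: "(\<lambda>i. ?x i + 1) = (\<lambda>i. rconst (r i + 1))" by (simp add: rconst_add)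
  note D = ncoef_add_box[OF assms(1) base]
  show "nval n (two_rows (Suc a) b) (\<lambda>i. rconst (r i + 1)) - nval n (two_rows a b) (\<lambda>i. rconst (r i + 1)) \<in> nonneg_ratfuns"
    if "b \<le> a" "b = 0 \<or> 2 \<le> n"
  proof -
    have "poly (npoly n (Suc a) b ?x) 1 - poly (npoly n a b ?x) 1 \<in> nonneg_ratfuns"
      by (rule poly_1_shift_nonneg[OF base D[THEN conjunct1, rule_format]]) (use that in auto)
    then show ?thesis using that by (simp add: poly_npoly x1)
  qed
  show "nval n (two_rows a (Suc b)) (\<lambda>i. rconst (r i + 1)) - nval n (two_rows a b) (\<lambda>i. rconst (r i + 1)) \<in> nonneg_ratfuns"
    if "b < a" "2 \<le> n"
  proof -
    have "poly (npoly n a (Suc b) ?x) 1 - poly (npoly n a b ?x) 1 \<in> nonneg_ratfuns"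
      by (rule poly_1_shift_nonneg[OF base D[THEN conjunct2, rule_format]]) (use that in auto)
    then show ?thesis using that by (simp add: poly_npoly x1)
  qed
qed

lemma jack_gen_jval:
  assumes "is_partition l"
  shows "jack_gen n l x = jval n l (\<lambda>i. rconst (x i))"
proof -
  have "homogeneous (part_size l) (\<lambda>e. ratfun_to_real (jackP l e))"
    unfolding homogeneous_def using jackP_zero[OF assms] dominates_part_size by fastforce
  then show ?thesis
    unfolding jack_gen_def jval_def jack_eq_jackP[OF assms] rconst_def by (rule eval_vars_evaln)
qed

lemma diff_gen_nval:
  assumes "is_partition l" "is_partition m"
  shows "diff_gen n l m x = nval n l (\<lambda>i. rconst (x i)) - nval n m (\<lambda>i. rconst (x i))"
  unfolding diff_gen_def nval_def by (simp add: jack_gen_jval jnorm_jval assms)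

lemma two_rows_cases:
  assumes "l \<in> partitions_upto n" "plength l \<le> 2" "1 \<le> n"
  obtains a b where "l = two_rows a b" "b \<le> a" "b = 0 \<or> 2 \<le> n"
proof -
  have "is_partition l" "keys l \<subseteq> {..<n}" using assms by (auto simp: partitions_upto_def)
  moreover have "lookup l 1 = 0 \<or> 2 \<le> n"
  proof (rule ccontr)
    assume "\<not> ?thesis"
    then have "1 \<in> keys l" "n = 1" using assms(3) by (auto simp: in_keys_iff)
    then show False using \<open>keys l \<subseteq> {..<n}\<close> by auto
  qed
  ultimately show ?thesis using plength_le_2_two_rows[of l] assms(2) that by blast
qed

lemma weakly_majorizes_two_rowsD:
  assumes "weakly_majorizes (two_rows a b) (two_rows c d)"
  shows "c \<le> a" "c + d \<le> a + b"
  using assms[unfolded weakly_majorizes_def, rule_format, of 1] assms[unfolded weakly_majorizes_def, rule_format, of 2]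
  by (simp add: lookup_two_rows, simp only: sum_two_rows[OF order_refl])

lemma majorizes_two_rows_imp_A1:
  assumes "1 \<le> n" "l \<in> partitions_upto n" "m \<in> partitions_upto n" "plength l \<le> 2" "plength m \<le> 2"
    and "majorizes l m"
  shows "A1 n l m"
  unfolding A1_def
proof (intro allI impI)
  fix x :: "nat \<Rightarrow> real" assume x: "\<forall>i<n. 0 \<le> x i"
  obtain a b where l: "l = two_rows a b" "b \<le> a" "b = 0 \<or> 2 \<le> n"
    using assms by (elim two_rows_cases[of l n])
  obtain c d where m: "m = two_rows c d" "d \<le> c" "d = 0 \<or> 2 \<le> n"
    using assms by (elim two_rows_cases[of m n])
  have ac: "c \<le> a" "c + d = a + b"
    using assms(6) weakly_majorizes_two_rowsD(1)[of a b c d] by (auto simp: majorizes_def l m)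
  show "diff_gen n l m x \<in> nonneg_ratfuns"
  proof (cases "2 \<le> n")
    case True
    have cd: "c = a - (a - c)" "d = b + (a - c)" using ac by auto
    have "nval n (two_rows a b) (\<lambda>i. rconst (x i)) - nval n (two_rows (a - (a - c)) (b + (a - c))) (\<lambda>i. rconst (x i)) \<in> nonneg_ratfuns"
      by (rule nval_move_boxes[OF True]) (use x m ac in auto)
    then show ?thesis using l m cd by (simp add: diff_gen_nval)
  next
    case False
    then have "l = m" using l m ac by simp
    then show ?thesis by (simp add: diff_gen_def nonneg_ratfuns_0)
  qed
qed

lemma nval_add_boxes:
  assumes "1 \<le> n" "\<And>i. i < n \<Longrightarrow> 0 \<le> r i"
  shows "b \<le> a \<Longrightarrow> b = 0 \<or> 2 \<le> n \<Longrightarrow>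
      nval n (two_rows (a + k) b) (\<lambda>i. rconst (r i + 1)) - nval n (two_rows a b) (\<lambda>i. rconst (r i + 1)) \<in> nonneg_ratfuns"
    and "b + k \<le> a \<Longrightarrow> 2 \<le> n \<or> k = 0 \<Longrightarrow>
      nval n (two_rows a (b + k)) (\<lambda>i. rconst (r i + 1)) - nval n (two_rows a b) (\<lambda>i. rconst (r i + 1)) \<in> nonneg_ratfuns"
proof -
  let ?f = "\<lambda>a b. nval n (two_rows a b) (\<lambda>i. rconst (r i + 1))"
  show "?f (a + k) b - ?f a b \<in> nonneg_ratfuns" if "b \<le> a" "b = 0 \<or> 2 \<le> n"
  proof (induction k)
    case (Suc k)
    have "?f (Suc (a + k)) b - ?f (a + k) b \<in> nonneg_ratfuns"
      by (rule nval_add_box(1)[OF assms]) (use that in auto)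
    from nonneg_ratfuns_add[OF this Suc] show ?case by simp
  qed (simp add: nonneg_ratfuns_0)
  show "?f a (b + k) - ?f a b \<in> nonneg_ratfuns" if "b + k \<le> a" "2 \<le> n \<or> k = 0"
    using that
  proof (induction k)
    case (Suc k)
    have "?f a (Suc (b + k)) - ?f a (b + k) \<in> nonneg_ratfuns"
      by (rule nval_add_box(2)[OF assms]) (use Suc.prems in auto)
    moreover have "?f a (b + k) - ?f a b \<in> nonneg_ratfuns" by (rule Suc.IH) (use Suc.prems in auto)
    ultimately have "(?f a (Suc (b + k)) - ?f a (b + k)) + (?f a (b + k) - ?f a b) \<in> nonneg_ratfuns"
      by (rule nonneg_ratfuns_add)
    then show ?case by simp
  qed (simp add: nonneg_ratfuns_0)
qed

text \<open>All intermediate shapes must be partitions. If the second row of m = (c, d) may grow,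
  the first row is lengthened before it. Otherwise d - b boxes of l = (a, b) are moved down, and the
  result differs from m only in a longer first row.\<close>

lemma weakly_majorizes_two_rows_imp_B1:
  assumes "1 \<le> n" "l \<in> partitions_upto n" "m \<in> partitions_upto n" "plength l \<le> 2" "plength m \<le> 2"
    and "weakly_majorizes l m"
  shows "B1 n l m"
  unfolding B1_def
proof (intro allI impI)
  fix x :: "nat \<Rightarrow> real" assume x: "\<forall>i<n. 0 \<le> x i"
  obtain a b where l: "l = two_rows a b" "b \<le> a" "b = 0 \<or> 2 \<le> n"
    using assms by (elim two_rows_cases[of l n])
  obtain c d where m: "m = two_rows c d" "d \<le> c" "d = 0 \<or> 2 \<le> n"
    using assms by (elim two_rows_cases[of m n])
  have ac: "c \<le> a" "c + d \<le> a + b"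
    using assms(6) weakly_majorizes_two_rowsD[of a b c d] by (auto simp: l m)
  let ?f = "\<lambda>a b. nval n (two_rows a b) (\<lambda>i. rconst (x i + 1))"
  have "?f a b - ?f c d \<in> nonneg_ratfuns"
  proof (cases "d \<le> b")
    case True
    have "?f (c + (a - c)) d - ?f c d \<in> nonneg_ratfuns"
      by (rule nval_add_boxes(1)[OF assms(1)]) (use x m in auto)
    moreover have "?f a (d + (b - d)) - ?f a d \<in> nonneg_ratfuns"
      by (rule nval_add_boxes(2)[OF assms(1)]) (use x l True in auto)
    ultimately have "(?f a b - ?f a d) + (?f a d - ?f c d) \<in> nonneg_ratfuns"
      using ac True by (intro nonneg_ratfuns_add) auto
    then show ?thesis by simp
  next
    case False
    then have n: "2 \<le> n" using m by auto
    have "?f a b - ?f (a - (d - b)) (b + (d - b)) \<in> nonneg_ratfuns"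
      by (rule nval_move_boxes[OF n]) (use x False ac m in auto)
    moreover have "?f (c + (a - (d - b) - c)) d - ?f c d \<in> nonneg_ratfuns"
      by (rule nval_add_boxes(1)[OF assms(1)]) (use x m in auto)
    moreover have "c + (a - (d - b) - c) = a - (d - b)" "b + (d - b) = d" using False ac m by auto
    ultimately have "(?f a b - ?f (a - (d - b)) d) + (?f (a - (d - b)) d - ?f c d) \<in> nonneg_ratfuns"
      by (intro nonneg_ratfuns_add) auto
    then show ?thesis by simp
  qed
  then show "diff_gen n l m (\<lambda>i. x i + 1) \<in> nonneg_ratfuns" using l m by (simp add: diff_gen_nval)
qed

section \<open>Monomial means\<close>

text \<open>The sum runs over all n! permutations rather than over distinct monomials, so its value
  at (1,...,1) is n! for every \<open>e\<close>.\<close>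

definition sym_mono :: "nat \<Rightarrow> (nat \<Rightarrow> real) \<Rightarrow> expvec \<Rightarrow> real" where
  "sym_mono n x e = (\<Sum>\<sigma> | \<sigma> permutes {..<n}. \<Prod>i<n. x (\<sigma> i) ^ lookup e i)"

lemma sym_mono_compose:
  assumes "\<rho> permutes {..<n}"
  shows "sym_mono n x e = (\<Sum>\<sigma> | \<sigma> permutes {..<n}. \<Prod>i<n. x (\<sigma> (\<rho> i)) ^ lookup e i)"
  unfolding sym_mono_def by (subst sum_permutations_compose_right[OF assms]) simp

lemma shape_padded:
  assumes "keys e \<subseteq> {..<n}"
  shows "image_mset (lookup e) (mset_set {..<n}) = shape e + replicate_mset (n - plength e) 0"
proof -
  have "mset_set {..<n} = mset_set (keys e \<union> ({..<n} - keys e))"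
    using assms by (simp add: Un_absorb1)
  also have "\<dots> = mset_set (keys e) + mset_set ({..<n} - keys e)"
    by (rule mset_set_Union) auto
  finally have "image_mset (lookup e) (mset_set {..<n}) = shape e + image_mset (lookup e) (mset_set ({..<n} - keys e))"
    by (simp add: shape_def)
  also have "image_mset (lookup e) (mset_set ({..<n} - keys e)) = image_mset (\<lambda>_. 0) (mset_set ({..<n} - keys e))"
    by (rule image_mset_cong) (simp add: in_keys_iff)
  also have "\<dots> = replicate_mset (n - plength e) 0"
    using assms by (simp add: image_mset_const_eq plength_def card_Diff_subset)
  finally show ?thesis .
qed

lemma sym_mono_shape:
  assumes "keys e \<subseteq> {..<n}" "keys e' \<subseteq> {..<n}" "shape e = shape e'"
  shows "sym_mono n x e = sym_mono n x e'"
proof -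
  have "plength e = plength e'" using assms(3) by (metis size_shape)
  then have "image_mset (lookup e) (mset_set {..<n}) = image_mset (lookup e') (mset_set {..<n})"
    by (simp add: shape_padded assms)
  from image_mset_eq_bij_betw[OF _ _ this] obtain h where h: "bij_betw h {..<n} {..<n}" "\<forall>k\<in>{..<n}. lookup e k = lookup e' (h k)"
    by auto
  define \<rho> where "\<rho> k = (if k < n then h k else k)" for k
  have "bij_betw \<rho> {..<n} {..<n}" by (rule bij_betw_cong[THEN iffD1, OF _ h(1)]) (simp add: \<rho>_def)
  then have p: "\<rho> permutes {..<n}" by (rule bij_imp_permutes) (simp add: \<rho>_def)
  have "sym_mono n x e' = (\<Sum>\<sigma> | \<sigma> permutes {..<n}. \<Prod>i<n. x (\<sigma> (\<rho> i)) ^ lookup e' (\<rho> i))"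
    unfolding sym_mono_def by (rule sum.cong[OF refl], subst prod.permute[OF p]) simp
  also have "\<dots> = (\<Sum>\<sigma> | \<sigma> permutes {..<n}. \<Prod>i<n. x (\<sigma> (\<rho> i)) ^ lookup e i)"
    by (intro sum.cong[OF refl] prod.cong[OF refl]) (simp add: h(2) \<rho>_def)
  also have "\<dots> = sym_mono n x e" by (rule sym_mono_compose[OF p, symmetric])
  finally show ?thesis by (rule sym)
qed

text \<open>Pairing each permutation with its composition with the transposition of i and j reduces
  the claim to (u^(q+1) - v^(q+1)) (u - v) >= 0, where the entry at i is q + 2.\<close>

lemma sym_mono_move:
  assumes ij: "i < n" "j < n" "i \<noteq> j" and e: "2 \<le> lookup e i" "lookup e j = 0" and x: "\<And>k. k < n \<Longrightarrow> 0 \<le> x k"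
  shows "sym_mono n x (upd2 i j e (lookup e i - 1) 1) \<le> sym_mono n x e"
proof -
  let ?t = "Transposition.transpose i j" and ?e' = "upd2 i j e (lookup e i - 1) 1"
  let ?R = "\<lambda>\<sigma>. \<Prod>k\<in>{..<n} - {i, j}. x (\<sigma> k) ^ lookup e k"
  obtain q where q: "lookup e i = Suc (Suc q)" using e(1) by (metis add_2_eq_Suc le_Suc_ex)
  have t: "?t permutes {..<n}" by (rule permutes_swap_id) (use ij in auto)
  have split: "(\<Prod>k<n. f k) = f i * f j * (\<Prod>k\<in>{..<n} - {i, j}. f k)" for f :: "nat \<Rightarrow> real"
    using ij by (subst prod.remove[of _ i], simp, simp, subst prod.remove[of _ j]) (auto simp: insert_commute mult.assoc Diff_insert[symmetric])
  have rest: "(\<Prod>k\<in>{..<n} - {i, j}. x (\<sigma> (?t k)) ^ lookup e k) = ?R \<sigma>"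
    "(\<Prod>k\<in>{..<n} - {i, j}. x (\<sigma> k) ^ lookup ?e' k) = ?R \<sigma>"
    "(\<Prod>k\<in>{..<n} - {i, j}. x (\<sigma> (?t k)) ^ lookup ?e' k) = ?R \<sigma>" for \<sigma>
    by (rule prod.cong; auto simp: lookup_upd2 Transposition.transpose_def)+
  have "2 * sym_mono n x e = sym_mono n x e + sym_mono n x e" by simp
  also have "\<dots> = (\<Sum>\<sigma> | \<sigma> permutes {..<n}. (x (\<sigma> i) ^ Suc (Suc q) + x (\<sigma> j) ^ Suc (Suc q)) * ?R \<sigma>)"
    by (subst (2) sym_mono_compose[OF t], subst sym_mono_def)
      (simp only: split rest e(2) q Transposition.transpose_apply_first Transposition.transpose_apply_second power_0 mult_1_right
        flip: sum.distrib distrib_right)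
  finally have 1: "2 * sym_mono n x e = (\<Sum>\<sigma> | \<sigma> permutes {..<n}. (x (\<sigma> i) ^ Suc (Suc q) + x (\<sigma> j) ^ Suc (Suc q)) * ?R \<sigma>)" .
  have l': "lookup ?e' i = Suc q" "lookup ?e' j = 1" using ij q by (auto simp: lookup_upd2)
  have "2 * sym_mono n x ?e' = sym_mono n x ?e' + sym_mono n x ?e'" by simp
  also have "\<dots> = (\<Sum>\<sigma> | \<sigma> permutes {..<n}. (x (\<sigma> i) ^ Suc q * x (\<sigma> j) + x (\<sigma> j) ^ Suc q * x (\<sigma> i)) * ?R \<sigma>)"
    by (subst (2) sym_mono_compose[OF t], subst sym_mono_def)
      (simp only: split rest l' Transposition.transpose_apply_first Transposition.transpose_apply_second power_one_right
        flip: sum.distrib distrib_right)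
  finally have 2: "2 * sym_mono n x ?e' = (\<Sum>\<sigma> | \<sigma> permutes {..<n}. (x (\<sigma> i) ^ Suc q * x (\<sigma> j) + x (\<sigma> j) ^ Suc q * x (\<sigma> i)) * ?R \<sigma>)" .
  have "2 * sym_mono n x ?e' \<le> 2 * sym_mono n x e"
    unfolding 1 2
  proof (rule sum_mono)
    fix \<sigma> assume "\<sigma> \<in> {\<sigma>. \<sigma> permutes {..<n}}"
    then have nn: "0 \<le> x (\<sigma> k)" if "k < n" for k
      using that x permutes_in_image[of \<sigma> "{..<n}" k] by simp
    let ?a = "x (\<sigma> i)" and ?b = "x (\<sigma> j)"
    have ab: "0 \<le> ?a" "0 \<le> ?b" using nn ij by auto
    have "0 \<le> (?a ^ Suc q - ?b ^ Suc q) * (?a - ?b)"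
      using ab power_mono[of ?a ?b "Suc q"] power_mono[of ?b ?a "Suc q"]
      by (cases "?a \<le> ?b") (auto intro: mult_nonpos_nonpos mult_nonneg_nonneg)
    then have "?a ^ Suc q * ?b + ?b ^ Suc q * ?a \<le> ?a ^ Suc (Suc q) + ?b ^ Suc (Suc q)"
      by (simp add: algebra_simps)
    moreover have "0 \<le> ?R \<sigma>" by (intro prod_nonneg zero_le_power nn) auto
    ultimately show "(?a ^ Suc q * ?b + ?b ^ Suc q * ?a) * ?R \<sigma> \<le> (?a ^ Suc (Suc q) + ?b ^ Suc (Suc q)) * ?R \<sigma>"
      by (rule mult_right_mono)
  qed
  then show ?thesis by simp
qed

lemma lookup_ones: "lookup (ones k) i = (if i < k then 1 else 0)"
proof -
  have "lookup (ones k) i = (\<Sum>j<k. if j = i then 1 else 0)"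
    unfolding ones_def by (simp add: lookup_sum lookup_single when_def)
  then show ?thesis by simp
qed

lemma keys_ones [simp]: "keys (ones k) = {..<k}"
  by (auto simp: in_keys_iff lookup_ones split: if_splits)

lemma part_size_ones [simp]: "part_size (ones k) = k"
  by (simp add: part_size_def lookup_ones)

lemma is_partition_ones [simp]: "is_partition (ones k)"
  by (auto simp: is_partition_def lookup_ones)

lemma shape_le_1:
  assumes "\<And>i. lookup e i \<le> 1"
  shows "shape e = shape (ones (part_size e))"
proof -
  have rep: "shape e = replicate_mset (part_size e) 1" if "\<And>i. lookup e i \<le> 1" for e
  proof -
    have "v = 1" if "v \<in># shape e" for v
    proof -
      obtain i where "v = lookup e i" "i \<in> keys e" using \<open>v \<in># shape e\<close> by (auto simp: shape_def)
      then show ?thesis using \<open>\<And>i. lookup e i \<le> 1\<close>[of i] by (simp add: in_keys_iff)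
    qed
    then have "shape e = replicate_mset (size (shape e)) 1"
      by (intro set_mset_subset_singletonD) auto
    moreover have "size (shape e) = part_size e"
      using arg_cong[OF calculation, of sum_mset] by simp
    ultimately show ?thesis by simp
  qed
  show ?thesis using rep[OF assms] rep[of "ones (part_size e)"] by (simp add: lookup_ones)
qed

text \<open>Muirhead's argument: move a unit from an entry at least \<open>2\<close> to an empty position.\<close>

lemma sym_mono_ones_le:
  assumes "keys e \<subseteq> {..<n}" "part_size e \<le> n" and x: "\<And>k. k < n \<Longrightarrow> 0 \<le> x k"
  shows "sym_mono n x (ones (part_size e)) \<le> sym_mono n x e"
  using assms(1,2)
proof (induction "n - plength e" arbitrary: e rule: less_induct)
  case less
  show ?case
  proof (cases "\<exists>i. 2 \<le> lookup e i")
    case False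
    then have "lookup e i < 2" for i by (simp add: not_le)
    then have "lookup e i \<le> 1" for i by (metis less_2_cases le_numeral_extra(4) zero_le_one One_nat_def)
    then have "shape e = shape (ones (part_size e))" by (rule shape_le_1)
    then have "sym_mono n x e = sym_mono n x (ones (part_size e))"
      by (rule sym_mono_shape[rotated 2]) (use less.prems(1,2) in \<open>simp_all only: keys_ones lessThan_subset_iff\<close>)
    then show ?thesis by simp
  next
    case True
    then obtain i where i: "2 \<le> lookup e i" by blast
    have ik: "i \<in> keys e" using i by (auto simp: in_keys_iff)
    have "plength e = (\<Sum>i\<in>keys e. 1)" by (simp add: plength_def)
    also have "\<dots> < part_size e"
      unfolding part_size_def
    proof (rule sum_strict_mono_ex1)
      show "\<forall>x\<in>keys e. 1 \<le> lookup e x" by (auto simp: in_keys_iff Suc_le_eq One_nat_def)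
      show "\<exists>x\<in>keys e. 1 < lookup e x" using ik i by (intro bexI[of _ i]) simp_all
    qed simp
    finally have pl: "plength e < n" using less.prems(2) by simp
    then have "keys e \<noteq> {..<n}" unfolding plength_def by (metis card_lessThan nat_neq_iff)
    then obtain j where j: "j < n" "j \<notin> keys e" using less.prems(1) by blast
    let ?e = "upd2 i j e (lookup e i - 1) 1"
    have ij: "i < n" "i \<noteq> j" using ik j(2) less.prems(1) by blast+
    have k: "keys ?e = insert j (keys e)"
      using i ij by (auto simp: in_keys_iff lookup_upd2 split: if_splits)
    have s: "part_size ?e = part_size e"
      by (rule part_size_upd2) (use ij i j in \<open>auto simp: in_keys_iff\<close>)
    have "sym_mono n x (ones (part_size ?e)) \<le> sym_mono n x ?e"
      by (rule less.hyps) (use pl k s j less.prems in \<open>auto simp: plength_def\<close>)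
    also have "\<dots> \<le> sym_mono n x e"
      by (rule sym_mono_move) (use ij i j x in \<open>auto simp: in_keys_iff\<close>)
    finally show ?thesis by (simp only: s)
  qed
qed

lemma jval_permutes:
  assumes "is_partition l" "\<sigma> permutes {..<n}"
  shows "jval n l (\<lambda>k. x (\<sigma> k)) = jval n l x"
proof -
  have "\<forall>x. jval n l (\<lambda>k. x (\<sigma> k)) = jval n l x"
    using assms(2) finite_lessThan
  proof (induction rule: permutes_induct)
    case id
    then show ?case by simp
  next
    case (swap a b p)
    show ?case
    proof
      fix x
      have "jval n l (\<lambda>k. x (Transposition.transpose a b (p k))) = jval n l (\<lambda>k. x (Transposition.transpose a b k))"
        using swap.IH[rule_format, of "\<lambda>k. x (Transposition.transpose a b k)"] .
      also have "\<dots> = jval n l x" by (rule jval_permute[OF assms(1)]) (use swap.hyps in auto)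
      finally show "jval n l (\<lambda>k. x ((Transposition.transpose a b \<circ> p) k)) = jval n l x" by (simp only: comp_apply)
    qed
  qed
  then show ?thesis by simp
qed

lemma rconst_mult: "rconst (r * s) = rconst r * rconst s"
  by (simp add: rconst_def mult.commute)

lemma rconst_diff: "rconst (r - s) = rconst r - rconst s"
  by (simp add: rconst_def)

lemma rconst_sum: "rconst (sum f A) = (\<Sum>x\<in>A. rconst (f x))"
  by (induction A rule: infinite_finite_induct) (simp_all add: rconst_add)

lemma rconst_prod: "rconst (prod f A) = (\<Prod>x\<in>A. rconst (f x))"
  by (induction A rule: infinite_finite_induct) (simp_all add: rconst_mult)

lemma rconst_power: "rconst (r ^ k) = rconst r ^ k"
  by (induction k) (simp_all add: rconst_mult)

lemma jval_sym_mono: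
  assumes "is_partition l"
  shows "of_nat (fact n) * jval n l (\<lambda>i. rconst (x i))
     = (\<Sum>e\<in>exps n (part_size l). ratfun_to_real (jackP l e) * rconst (sym_mono n x e))"
proof -
  have "of_nat (fact n) * jval n l (\<lambda>i. rconst (x i)) = (\<Sum>\<sigma> | \<sigma> permutes {..<n}. jval n l (\<lambda>i. rconst (x (\<sigma> i))))"
    using jval_permutes[OF assms, of _ n "\<lambda>i. rconst (x i)"] by (simp add: card_permutations[OF refl])
  also have "\<dots> = (\<Sum>e\<in>exps n (part_size l). \<Sum>\<sigma> | \<sigma> permutes {..<n}. ratfun_to_real (jackP l e) * (\<Prod>i<n. rconst (x (\<sigma> i)) ^ lookup e i))"
    unfolding jval_def evaln_def by (rule sum.swap)
  also have "\<dots> = (\<Sum>e\<in>exps n (part_size l). ratfun_to_real (jackP l e) * rconst (sym_mono n x e))"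
    by (simp add: sym_mono_def rconst_sum rconst_prod rconst_power sum_distrib_left)
  finally show ?thesis .
qed

lemma jnorm_exps:
  "is_partition l \<Longrightarrow> jnorm n l = (\<Sum>e\<in>exps n (part_size l). ratfun_to_real (jackP l e))"
  by (simp add: jnorm_jval jval_def evaln_def)

text \<open>The normalized Jack polynomial is a mean of the normalized values of
  \<open>sym_mono\<close>, weighted by its coefficients, so a constant can be subtracted term by
  term.\<close>

lemma nval_sym_mono:
  assumes l: "l \<in> partitions_upto n"
  shows "nval n l (\<lambda>i. rconst (x i)) - rconst r
    = (\<Sum>e\<in>exps n (part_size l). ratfun_to_real (jackP l e) * rconst (sym_mono n x e - fact n * r))
        / (of_nat (fact n) * jnorm n l)"
proof -
  have p: "is_partition l" and k: "keys l \<subseteq> {..<n}" using l by (auto simp: partitions_upto_def)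
  have N: "jnorm n l \<noteq> 0" using jnorm_pos[OF p k] by simp
  have F: "(of_nat (fact n) :: real poly fract) \<noteq> 0" by simp
  have f: "rconst (fact n) = of_nat (fact n)"
    by (simp add: rconst_def of_nat_fract of_nat_poly)
  have "(\<Sum>e\<in>exps n (part_size l). ratfun_to_real (jackP l e) * rconst (sym_mono n x e - fact n * r))
    = of_nat (fact n) * (jval n l (\<lambda>i. rconst (x i)) - jnorm n l * rconst r)"
    unfolding rconst_diff rconst_mult f right_diff_distrib sum_subtractf jval_sym_mono[OF p] jnorm_exps[OF p]
    by (simp add: sum_distrib_left sum_distrib_right mult_ac)
  then show ?thesis using N F by (simp add: nval_def diff_divide_distrib)
qed

lemma ones_imp_A1:
  assumes l: "l \<in> partitions_upto n" and d: "part_size l \<le> n"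
  shows "A1 n l (ones (part_size l))"
  unfolding A1_def
proof (intro allI impI)
  fix x :: "nat \<Rightarrow> real" assume x: "\<forall>i<n. 0 \<le> x i"
  let ?d = "part_size l" let ?m = "ones ?d" let ?X = "\<lambda>i. rconst (x i)"
  let ?r = "sym_mono n x ?m / fact n"
  have p: "is_partition l" using l by (simp add: partitions_upto_def)
  have m: "?m \<in> partitions_upto n" using d by (auto simp: partitions_upto_def)
  \<comment> \<open>Only permutations of (1^d) lie below (1^d), so here the mean is taken over equal
    terms.\<close>
  have "jackP ?m e = 0 \<or> sym_mono n x e = sym_mono n x ?m" if e: "e \<in> exps n ?d" for e
  proof (cases "dominates ?m e")
    case True
    have "lookup e i \<le> 1" for i
      using True[unfolded dominates_def, THEN conjunct2, rule_format, of "{i}"] by (auto simp: lookup_ones split: if_splits)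
    then have "shape e = shape ?m" using shape_le_1[of e] e by (simp add: exps_def)
    then show ?thesis using e d by (intro disjI2 sym_mono_shape) (auto simp: exps_def)
  qed (simp add: jackP_zero)
  then have "nval n ?m ?X - rconst ?r = 0"
    unfolding nval_sym_mono[OF m] part_size_ones by (subst sum.neutral) fastforce+
  moreover have "nval n l ?X - rconst ?r \<in> nonneg_ratfuns"
    unfolding nval_sym_mono[OF l]
  proof (intro nonneg_ratfuns_divide nonneg_ratfuns_sum nonneg_ratfuns_mult nonneg_ratfuns_of_nat jnorm_nonneg p
      good_nonneg good_jackP rconst_nonneg)
    fix e assume "e \<in> exps n ?d"
    then show "0 \<le> sym_mono n x e - fact n * ?r"
      using sym_mono_ones_le[of e n x] d x by (auto simp: exps_def)
  qed
  ultimately show "diff_gen n l ?m x \<in> nonneg_ratfuns" by (simp add: diff_gen_nval p)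
qed

lemma A1_imp_B1: "A1 n l m \<Longrightarrow> B1 n l m"
  unfolding A1_def B1_def by auto

section \<open>Specialization\<close>

definition ratval :: "ratfun \<Rightarrow> real \<Rightarrow> real" where
  "ratval r s = poly (real_num r) s / poly (real_den r) s"

lemma poly_pos:
  fixes g :: "real poly"
  assumes "\<forall>i. 0 \<le> coeff g i" "0 < coeff g 0" "0 \<le> s"
  shows "0 < poly g s"
proof -
  have "coeff g 0 * s ^ 0 \<le> (\<Sum>i\<le>degree g. coeff g i * s ^ i)"
    by (rule member_le_sum) (use assms in auto)
  then show ?thesis using assms(2) by (simp add: poly_altdef)
qed

lemma poly_nonneg:
  fixes g :: "real poly"
  assumes "\<forall>i. 0 \<le> coeff g i" "0 \<le> s"
  shows "0 \<le> poly g s"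
  unfolding poly_altdef using assms by (intro sum_nonneg) simp

text \<open>\<open>good\<close> provides some quotient, while \<open>ratval\<close> uses lowest
  terms. The reduced denominator divides the good one, so it has no zero on [0, infinity) and both
  quotients have the same values there.\<close>

lemma good_ratval:
  assumes "good r"
  obtains f g :: "real poly" where "ratfun_to_real r = Fract f g" "\<forall>i. 0 \<le> coeff f i" "\<forall>i. 0 \<le> coeff g i"
    "0 < coeff g 0" "degree f \<le> degree g" "\<And>s. 0 \<le> s \<Longrightarrow> ratval r s = poly f s / poly g s"
proof -
  obtain f g where r: "r = Fract f g" "\<forall>i. 0 \<le> coeff f i" "\<forall>i. 0 \<le> coeff g i" "0 < coeff g 0" "degree f \<le> degree g"
    using assms unfolding good_def by blast
  let ?q = "quot_of_fract r"
  let ?F = "of_rat_poly f" and ?G = "of_rat_poly g"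
  have g0: "g \<noteq> 0" using r(4) by auto
  have "Fract (fst ?q) (snd ?q) = Fract f g" using Fract_quot_of_fract[of r] unfolding r(1) .
  then have eq: "fst ?q * g = f * snd ?q"
    using eq_fract(1)[OF snd_quot_of_fract_nonzero g0] by blast
  have "coprime (snd ?q) (fst ?q)" using coprime_quot_of_fract[of r] by (simp add: coprime_commute)
  moreover have "snd ?q dvd fst ?q * g" unfolding eq by simp
  ultimately have "snd ?q dvd g" by (simp add: coprime_dvd_mult_right_iff)
  then obtain h where h: "g = snd ?q * h" by blast
  have G: "\<forall>i. 0 \<le> coeff ?G i" "0 < coeff ?G 0" "\<forall>i. 0 \<le> coeff ?F i"
    using r by (auto simp: coeff_map_poly)
  have val: "ratval r s = poly ?F s / poly ?G s" if "0 \<le> s" for s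
  proof -
    have pg: "0 < poly ?G s" by (rule poly_pos[OF G(1,2) that])
    have "?G = real_den r * of_rat_poly h" using h by (simp add: real_den_def flip: of_rat_poly_mult)
    then have "poly (real_den r) s \<noteq> 0" using pg by auto
    moreover have "real_num r * ?G = ?F * real_den r"
      unfolding real_num_def real_den_def by (simp add: eq flip: of_rat_poly_mult)
    then have "poly (real_num r) s * poly ?G s = poly ?F s * poly (real_den r) s" by (metis poly_mult)
    ultimately show ?thesis using pg unfolding ratval_def by (simp add: frac_eq_eq)
  qed
  have "degree ?F \<le> degree f" by (rule degree_le) (simp add: coeff_map_poly coeff_eq_0)
  moreover have "degree g \<le> degree ?G" by (rule le_degree) (use g0 in \<open>simp add: coeff_map_poly\<close>)
  ultimately have "degree ?F \<le> degree ?G" using r(5) by simp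
  moreover have "ratfun_to_real r = Fract ?F ?G" unfolding r(1) by (rule ratfun_to_real_Fract[OF g0])
  ultimately show ?thesis using that[of ?F ?G] G val by blast
qed

text \<open>Every point of [0, infinity] is approached through positive values. This matters at 0,
  where a denominator with nonnegative coefficients may vanish.\<close>

definition tau_filter :: "ennreal \<Rightarrow> real filter" where
  "tau_filter t = (if t = \<infinity> then at_top else at_right (enn2real t))"

lemma tau_filter_neq_bot: "tau_filter t \<noteq> bot"
  by (simp add: tau_filter_def)

lemma eventually_tau_filter_pos: "eventually (\<lambda>s. 0 < s) (tau_filter t)"
proof (cases "t = \<infinity>")
  case True
  then show ?thesis by (simp add: tau_filter_def eventually_gt_at_top)
next
  case False
  have "eventually (\<lambda>s. enn2real t < s) (at_right (enn2real t))" by (simp add: eventually_at_right_less)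
  then have "eventually (\<lambda>s. 0 < s) (at_right (enn2real t))"
    by (rule eventually_mono) (rule le_less_trans[OF enn2real_nonneg])
  then show ?thesis using False by (simp add: tau_filter_def)
qed

text \<open>In u = 1/s both polynomials are replaced by the reversed ones, and that of
  \<open>g\<close> has the leading coefficient of \<open>g\<close> as its value at u = 0.\<close>

lemma rational_limit_at_top:
  fixes f g :: "real poly"
  assumes "degree f \<le> degree g" "g \<noteq> 0"
  shows "\<exists>c. ((\<lambda>s. poly f s / poly g s) \<longlongrightarrow> c) at_top"
proof -
  let ?h = "\<lambda>u. u ^ (degree g - degree f) * poly (reflect_poly f) u / poly (reflect_poly g) u"
  have "(?h \<longlongrightarrow> ?h 0) (at 0)"
    by (intro tendsto_intros) (use assms(2) in auto)
  then have "((\<lambda>s. ?h (inverse s)) \<longlongrightarrow> ?h 0) at_top"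
    by (rule filterlim_compose) (auto intro!: filterlim_atI tendsto_inverse_0_at_top filterlim_ident eventually_mono[OF eventually_gt_at_top[of 0]])
  moreover have "eventually (\<lambda>s. ?h (inverse s) = poly f s / poly g s) at_top"
    using eventually_gt_at_top[of 0]
  proof eventually_elim
    case (elim s)
    have "poly f s = s ^ degree f * poly (reflect_poly f) (inverse s)" "poly g s = s ^ degree g * poly (reflect_poly g) (inverse s)"
      using elim poly_reflect_poly_nz[of "inverse s" f] poly_reflect_poly_nz[of "inverse s" g]
      by (simp_all add: power_inverse)
    moreover have "s ^ degree g = s ^ degree f * s ^ (degree g - degree f)"
      using assms(1) by (simp flip: power_add)
    ultimately show ?case using elim by (simp add: power_inverse field_simps)
  qed
  ultimately have "((\<lambda>s. poly f s / poly g s) \<longlongrightarrow> ?h 0) at_top" by (rule Lim_transform_eventually)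
  then show ?thesis ..
qed

lemma specialize_limit:
  assumes "good r"
  shows "(ratval r \<longlongrightarrow> specialize t r) (tau_filter t)"
proof -
  obtain f g where *: "\<forall>i. 0 \<le> coeff g i" "0 < coeff g 0" "degree f \<le> degree g"
      "\<And>s. 0 \<le> s \<Longrightarrow> ratval r s = poly f s / poly g s"
    using good_ratval[OF assms] by metis
  show ?thesis
  proof (cases "t = \<infinity>")
    case True
    have "g \<noteq> 0" using *(2) by auto
    then obtain c where "((\<lambda>s. poly f s / poly g s) \<longlongrightarrow> c) at_top"
      using rational_limit_at_top[OF *(3)] by blast
    then have c: "(ratval r \<longlongrightarrow> c) at_top"
      by (rule Lim_transform_eventually) (use *(4) in \<open>auto intro: eventually_mono[OF eventually_ge_at_top[of 0]]\<close>)
    then have "specialize t r = c"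
      using True unfolding specialize_def ratval_def[symmetric] by (simp add: tendsto_Lim)
    then show ?thesis using c True by (simp add: tau_filter_def)
  next
    case False
    let ?s = "enn2real t"
    have "((\<lambda>s. poly f s / poly g s) \<longlongrightarrow> poly f ?s / poly g ?s) (at_right ?s)"
      by (intro tendsto_intros) (use poly_pos[OF *(1,2), of ?s] in simp)
    moreover have "eventually (\<lambda>s. poly f s / poly g s = ratval r s) (at_right ?s)"
      using eventually_tau_filter_pos[of t] False *(4) by (auto simp: tau_filter_def elim: eventually_mono)
    ultimately have "(ratval r \<longlongrightarrow> poly f ?s / poly g ?s) (at_right ?s)"
      by (rule Lim_transform_eventually)
    moreover have "specialize t r = poly f ?s / poly g ?s"
      using False *(4)[of ?s] by (simp add: specialize_def ratval_def)
    ultimately show ?thesis using False by (simp add: tau_filter_def)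
  qed
qed

lemma ratval_nonneg: "good r \<Longrightarrow> 0 \<le> s \<Longrightarrow> 0 \<le> ratval r s"
  using good_ratval poly_nonneg by (metis divide_nonneg_nonneg)

lemma specialize_nonneg: "good r \<Longrightarrow> 0 \<le> specialize t r"
  by (rule tendsto_lowerbound[OF specialize_limit _ tau_filter_neq_bot])
    (use ratval_nonneg in \<open>auto intro: eventually_mono[OF eventually_tau_filter_pos]\<close>)

lemma ratval_of_nat: "0 \<le> s \<Longrightarrow> ratval (of_nat n) s = of_nat n"
proof -
  have "of_nat n = Fract (of_nat n) (1::rat poly)" by (simp add: of_nat_fract)
  then have "quot_of_fract (of_nat n :: ratfun) = (of_nat n, 1)"
    by (simp add: quot_of_fract_to_fract[unfolded to_fract_def])
  then show ?thesis by (simp add: ratval_def real_num_def real_den_def of_nat_poly map_poly_pCons)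
qed

lemma specialize_of_nat: "specialize t (of_nat n) = of_nat n"
proof (rule tendsto_unique[OF tau_filter_neq_bot specialize_limit[OF good_of_nat]])
  show "(ratval (of_nat n) \<longlongrightarrow> of_nat n) (tau_filter t)"
    by (rule tendsto_eventually) (use ratval_of_nat in \<open>auto intro: eventually_mono[OF eventually_tau_filter_pos]\<close>)
qed

lemma specialize_0 [simp]: "specialize t 0 = 0" and specialize_1 [simp]: "specialize t 1 = 1"
  using specialize_of_nat[of t 0] specialize_of_nat[of t 1] by simp_all

lemma jack_at_evaln:
  assumes "is_partition l"
  shows "jack_at n t l x = evaln n (part_size l) (\<lambda>e. specialize t (jackP l e)) x"
proof -
  have "homogeneous (part_size l) (\<lambda>e. specialize t (jackP l e))"
    unfolding homogeneous_def using jackP_zero[OF assms] dominates_part_size specialize_0 by metis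
  then show ?thesis unfolding jack_at_def jack_eq_jackP[OF assms] by (rule eval_vars_evaln)
qed

abbreviation jack_val :: "nat \<Rightarrow> real \<Rightarrow> expvec \<Rightarrow> (nat \<Rightarrow> real) \<Rightarrow> real" where
  "jack_val n s l x \<equiv> evaln n (part_size l) (\<lambda>e. ratval (jackP l e) s) x"

lemma jack_at_limit:
  assumes "is_partition l"
  shows "((\<lambda>s. jack_val n s l x) \<longlongrightarrow> jack_at n t l x) (tau_filter t)"
  unfolding jack_at_evaln[OF assms] evaln_def
  by (intro tendsto_intros specialize_limit good_jackP assms)

lemma jack_at_1_pos:
  assumes "l \<in> partitions_upto n"
  shows "1 \<le> jack_at n t l (\<lambda>_. 1)"
proof -
  have l: "is_partition l" "keys l \<subseteq> {..<n}" using assms by (auto simp: partitions_upto_def)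
  have "specialize t (jackP l l) \<le> (\<Sum>e\<in>exps n (part_size l). specialize t (jackP l e))"
    by (rule member_le_sum[OF _ _ finite_exps]) (use l in \<open>auto simp: exps_def specialize_nonneg good_jackP\<close>)
  then show ?thesis by (simp add: jack_at_evaln l evaln_def jackP(2))
qed

lemma jack_val_1_pos:
  assumes "l \<in> partitions_upto n" "0 \<le> s"
  shows "1 \<le> jack_val n s l (\<lambda>_. 1)"
proof -
  have l: "is_partition l" "keys l \<subseteq> {..<n}" using assms by (auto simp: partitions_upto_def)
  have "ratval (jackP l l) s \<le> (\<Sum>e\<in>exps n (part_size l). ratval (jackP l e) s)"
    by (rule member_le_sum[OF _ _ finite_exps]) (use l assms(2) in \<open>auto simp: exps_def ratval_nonneg good_jackP\<close>)
  then show ?thesis using ratval_of_nat[of s 1] assms(2) l by (simp add: evaln_def jackP(2))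
qed

text \<open>A relation on arbitrary representing fractions: values add and multiply without passing
  to lowest terms.\<close>

definition has_val :: "real \<Rightarrow> real poly fract \<Rightarrow> real \<Rightarrow> bool" where
  "has_val s q r \<longleftrightarrow> (\<exists>f g. q = Fract f g \<and> poly g s \<noteq> 0 \<and> r = poly f s / poly g s)"

lemma has_valI: "poly g s \<noteq> 0 \<Longrightarrow> has_val s (Fract f g) (poly f s / poly g s)"
  unfolding has_val_def by blast

lemma has_val_add: "has_val s q r \<Longrightarrow> has_val s q' r' \<Longrightarrow> has_val s (q + q') (r + r')"
proof (unfold has_val_def, elim exE conjE)
  fix f g f' g' assume *: "q = Fract f g" "poly g s \<noteq> 0" "r = poly f s / poly g s" "q' = Fract f' g'" "poly g' s \<noteq> 0" "r' = poly f' s / poly g' s"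
  then have "g \<noteq> 0" "g' \<noteq> 0" by auto
  then show "\<exists>f g. q + q' = Fract f g \<and> poly g s \<noteq> 0 \<and> r + r' = poly f s / poly g s"
    using * by (intro exI[of _ "f * g' + f' * g"] exI[of _ "g * g'"]) (simp add: add_frac_eq)
qed

lemma has_val_mult: "has_val s q r \<Longrightarrow> has_val s q' r' \<Longrightarrow> has_val s (q * q') (r * r')"
proof (unfold has_val_def, elim exE conjE)
  fix f g f' g' assume *: "q = Fract f g" "poly g s \<noteq> 0" "r = poly f s / poly g s" "q' = Fract f' g'" "poly g' s \<noteq> 0" "r' = poly f' s / poly g' s"
  then show "\<exists>f g. q * q' = Fract f g \<and> poly g s \<noteq> 0 \<and> r * r' = poly f s / poly g s"
    by (intro exI[of _ "f * f'"] exI[of _ "g * g'"]) simp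
qed

lemma has_val_inverse: "has_val s q r \<Longrightarrow> r \<noteq> 0 \<Longrightarrow> has_val s (inverse q) (inverse r)"
proof (unfold has_val_def, elim exE conjE)
  fix f g assume *: "r \<noteq> 0" "q = Fract f g" "poly g s \<noteq> 0" "r = poly f s / poly g s"
  then show "\<exists>f g. inverse q = Fract f g \<and> poly g s \<noteq> 0 \<and> inverse r = poly f s / poly g s"
    by (intro exI[of _ g] exI[of _ f]) auto
qed

lemma has_val_rconst: "has_val s (rconst c) c"
  using has_valI[of 1 s "[:c:]"] by (simp add: rconst_def)

lemma has_val_diff: "has_val s q r \<Longrightarrow> has_val s q' r' \<Longrightarrow> has_val s (q - q') (r - r')"
  using has_val_add[of s q r "rconst (- 1) * q'" "- 1 * r'"] has_val_mult[OF has_val_rconst[of s "-1"], of q' r']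
  by (simp add: rconst_diff[of 0 1, simplified])

lemma has_val_divide: "has_val s q r \<Longrightarrow> has_val s q' r' \<Longrightarrow> r' \<noteq> 0 \<Longrightarrow> has_val s (q / q') (r / r')"
  unfolding divide_inverse by (intro has_val_mult has_val_inverse)

lemma has_val_sum: "(\<And>x. x \<in> A \<Longrightarrow> has_val s (q x) (r x)) \<Longrightarrow> has_val s (sum q A) (sum r A)"
  using has_val_rconst[of s 0] by (induction A rule: infinite_finite_induct) (simp_all add: has_val_add)

lemma has_val_good:
  assumes "good r" "0 \<le> s"
  shows "has_val s (ratfun_to_real r) (ratval r s)"
proof -
  obtain f g where *: "ratfun_to_real r = Fract f g" "\<forall>i. 0 \<le> coeff g i" "0 < coeff g 0" "ratval r s = poly f s / poly g s"
    using good_ratval[OF assms(1)] assms(2) by metis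
  then show ?thesis using has_valI[of g s f] poly_pos[OF *(2,3) assms(2)] by simp
qed

text \<open>The fraction with nonnegative coefficients need not be the one that gives the value;
  cross multiplication compares them. For s > 0 its denominator is positive, at s = 0 it could
  vanish.\<close>

lemma nonneg_ratfuns_has_val:
  assumes "q \<in> nonneg_ratfuns" "has_val s q r" "0 < s"
  shows "0 \<le> r"
  using assms(1)
proof (elim nonneg_ratfunsE)
  fix f g assume q: "q = Fract f g" "\<forall>i. 0 \<le> coeff f i" "\<forall>i. 0 \<le> coeff g i" "g \<noteq> 0"
  obtain f' g' where q': "q = Fract f' g'" "poly g' s \<noteq> 0" "r = poly f' s / poly g' s"
    using assms(2) unfolding has_val_def by blast
  have "g' \<noteq> 0" using q'(2) by auto
  then have "f * g' = f' * g" using q(1) eq_fract(1)[OF q(4)] q'(1) by blast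
  then have e: "poly f s * poly g' s = poly f' s * poly g s" by (metis poly_mult)
  have "coeff g (degree g) * s ^ degree g \<le> poly g s"
    unfolding poly_altdef by (rule member_le_sum) (use q(3) assms(3) in auto)
  moreover have "0 < coeff g (degree g)" using q(3)[rule_format, of "degree g"] q(4) by (simp add: order_le_less)
  then have "0 < coeff g (degree g) * s ^ degree g" using assms(3) by simp
  ultimately have "0 < poly g s" by simp
  moreover have "r = poly f s / poly g s" using e q'(2,3) \<open>0 < poly g s\<close> by (simp add: frac_eq_eq)
  ultimately show "0 \<le> r" using poly_nonneg[OF q(2), of s] assms(3) by simp
qed

lemma jval_has_val:
  assumes "is_partition l" "0 \<le> s"
  shows "has_val s (jval n l (\<lambda>i. rconst (x i))) (jack_val n s l x)"
  unfolding jval_def evaln_def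
  by (intro has_val_sum has_val_mult has_val_good good_jackP assms)
    (simp flip: rconst_power rconst_prod, rule has_val_rconst)

text \<open>Nonnegativity is read off at every s > 0 and carried to \<open>t\<close> by the limit
  along \<open>tau_filter\<close>.\<close>

lemma diff_gen_nonneg_imp_diff_at:
  assumes l: "l \<in> partitions_upto n" and m: "m \<in> partitions_upto n"
    and "diff_gen n l m x \<in> nonneg_ratfuns"
  shows "0 \<le> diff_at n t l m x"
proof -
  have p: "is_partition l" "is_partition m" using l m by (auto simp: partitions_upto_def)
  let ?D = "\<lambda>s. jack_val n s l x / jack_val n s l (\<lambda>_. 1) - jack_val n s m x / jack_val n s m (\<lambda>_. 1)"
  have lim: "(?D \<longlongrightarrow> diff_at n t l m x) (tau_filter t)"
    unfolding diff_at_def using jack_at_1_pos[OF l, of t] jack_at_1_pos[OF m, of t]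
    by (intro tendsto_intros jack_at_limit p) auto
  have D: "0 \<le> ?D s" if s: "0 < s" for s
  proof -
    have nz: "jack_val n s l (\<lambda>_. 1) \<noteq> 0" "jack_val n s m (\<lambda>_. 1) \<noteq> 0"
      using jack_val_1_pos[OF l, of s] jack_val_1_pos[OF m, of s] s by auto
    have "has_val s (diff_gen n l m x) (?D s)"
      unfolding diff_gen_def jack_gen_jval[OF p(1)] jack_gen_jval[OF p(2)]
      by (intro has_val_diff has_val_divide jval_has_val p nz less_imp_le s)
    then show ?thesis by (rule nonneg_ratfuns_has_val[OF assms(3) _ s])
  qed
  show ?thesis
    by (rule tendsto_lowerbound[OF lim eventually_mono[OF eventually_tau_filter_pos D] tau_filter_neq_bot])
qed

lemma A1_imp_A2: "l \<in> partitions_upto n \<Longrightarrow> m \<in> partitions_upto n \<Longrightarrow> A1 n l m \<Longrightarrow> A2 n l m"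
  unfolding A1_def A2_def by (intro allI impI) (rule diff_gen_nonneg_imp_diff_at; simp)

lemma B1_imp_B2: "l \<in> partitions_upto n \<Longrightarrow> m \<in> partitions_upto n \<Longrightarrow> B1 n l m \<Longrightarrow> B2 n l m"
  unfolding B1_def B2_def by (intro allI impI) (rule diff_gen_nonneg_imp_diff_at; simp)

lemma A2_imp_A3:
  assumes "A2 n l m"
  shows "A3 n l m"
  unfolding A3_def
proof (intro exI[of _ 0] allI impI)
  fix x :: "nat \<Rightarrow> real"
  assume x: "(\<forall>i<n. 0 < x i \<and> x i < 1) \<or> (\<forall>i<n. 1 < x i)"
  have "0 \<le> x i" if "i < n" for i
    using x
  proof
    assume "\<forall>i<n. 1 < x i"
    then have "1 < x i" using that by blast
    then show ?thesis by linarith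
  qed (use that in \<open>simp add: less_imp_le\<close>)
  then show "0 \<le> diff_at n 0 l m x" using assms unfolding A2_def by blast
qed

lemma B2_imp_B3: "B2 n l m \<Longrightarrow> B3 n l m"
  unfolding B2_def B3_def by blast

section \<open>Necessity of majorization\<close>

lemma jack_at_const:
  assumes "is_partition l"
  shows "jack_at n t l (\<lambda>_. c) = c ^ part_size l * jack_at n t l (\<lambda>_. 1)"
proof -
  have "(\<Prod>i<n. c ^ lookup e i) = c ^ part_size l" if "e \<in> exps n (part_size l)" for e
    using that part_size_superset[of "{..<n}" e] by (simp add: exps_def flip: power_sum)
  then show ?thesis
    unfolding jack_at_evaln[OF assms] evaln_def sum_distrib_left
    by (intro sum.cong[OF refl]) simp
qed

lemma step_monomial:
  assumes "e \<in> exps n d"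
  shows "(\<Prod>i<n. (if i < k then s else 2) ^ lookup e i)
    = (s :: real) ^ (\<Sum>i<k. lookup e i) * (\<Prod>i<n. if i < k then 1 else 2 ^ lookup e i)"
proof -
  have "(\<Sum>i<n. if i < k then lookup e i else 0) = (\<Sum>i\<in>{..<n} \<inter> {..<k}. lookup e i)"
    by (simp add: sum.inter_restrict)
  also have "\<dots> = (\<Sum>i<k. lookup e i)"
    by (rule sum.mono_neutral_left) (use assms in \<open>auto simp: exps_def subset_iff in_keys_iff\<close>)
  finally have S: "(\<Sum>i<n. if i < k then lookup e i else 0) = (\<Sum>i<k. lookup e i)" .
  have "(\<Prod>i<n. (if i < k then s else 2) ^ lookup e i)
    = (\<Prod>i<n. s ^ (if i < k then lookup e i else 0) * (if i < k then 1 else 2 ^ lookup e i))"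
    by (rule prod.cong) auto
  then show ?thesis by (simp only: prod.distrib S flip: power_sum)
qed

lemma step_factor:
  assumes "e \<in> exps n d"
  shows "(1 :: real) \<le> (\<Prod>i<n. if i < k then 1 else 2 ^ lookup e i)"
    "(\<Prod>i<n. if i < k then 1 else 2 ^ lookup e i) \<le> (2 :: real) ^ d"
proof -
  show "(1 :: real) \<le> (\<Prod>i<n. if i < k then 1 else 2 ^ lookup e i)" by (rule prod_ge_1) simp
  have "(\<Prod>i<n. if i < k then 1 else 2 ^ lookup e i) \<le> (\<Prod>i<n. 2 ^ lookup e i :: real)"
    by (rule prod_mono) simp
  also have "\<dots> = 2 ^ d" using assms part_size_superset[of "{..<n}" e] by (simp add: exps_def flip: power_sum)
  finally show "(\<Prod>i<n. if i < k then 1 else 2 ^ lookup e i) \<le> (2 :: real) ^ d" .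
qed

text \<open>The leading monomial alone, with coefficient 1, already gives this bound, since all
  other terms are nonnegative.\<close>

lemma jack_at_step_lower:
  assumes l: "l \<in> partitions_upto n" and s: "1 \<le> s"
  shows "s ^ (\<Sum>i<k. lookup l i) \<le> jack_at n t l (\<lambda>i. if i < k then s else 2)"
proof -
  let ?x = "\<lambda>i. if i < k then s else 2"
  have p: "is_partition l" and le: "l \<in> exps n (part_size l)" using l by (auto simp: partitions_upto_def exps_def)
  have "s ^ (\<Sum>i<k. lookup l i) * 1 \<le> (\<Prod>i<n. ?x i ^ lookup l i)"
    unfolding step_monomial[OF le] by (rule mult_left_mono[OF step_factor(1)[OF le]]) (use s in simp)
  also have "\<dots> = specialize t (jackP l l) * (\<Prod>i<n. ?x i ^ lookup l i)" by (simp add: jackP(2)[OF p])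
  also have "\<dots> \<le> jack_at n t l ?x"
    unfolding jack_at_evaln[OF p] evaln_def
    by (rule member_le_sum[OF le _ finite_exps])
      (use s in \<open>auto intro!: mult_nonneg_nonneg specialize_nonneg good_jackP p prod_nonneg\<close>)
  finally show ?thesis by simp
qed

text \<open>By dominance no monomial carries a higher power of s than the leading one, and the
  remaining variables contribute at most 2^d.\<close>

lemma jack_at_step_upper:
  assumes l: "is_partition l" and s: "1 \<le> s"
  shows "jack_at n t l (\<lambda>i. if i < k then s else 2) \<le> s ^ (\<Sum>i<k. lookup l i) * 2 ^ part_size l * jack_at n t l (\<lambda>_. 1)"
proof -
  let ?x = "\<lambda>i. if i < k then s else 2" and ?d = "part_size l"
  let ?a = "\<lambda>e. specialize t (jackP l e)"
  have "?a e * (\<Prod>i<n. ?x i ^ lookup e i) \<le> s ^ (\<Sum>i<k. lookup l i) * 2 ^ ?d * ?a e" if e: "e \<in> exps n ?d" for e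
  proof (cases "dominates l e")
    case True
    then have "(\<Sum>i<k. lookup e i) \<le> (\<Sum>i<k. lookup l i)"
      unfolding dominates_def by (metis finite_lessThan card_lessThan)
    then have "s ^ (\<Sum>i<k. lookup e i) \<le> s ^ (\<Sum>i<k. lookup l i)" using s by (rule power_increasing)
    then have "(\<Prod>i<n. ?x i ^ lookup e i) \<le> s ^ (\<Sum>i<k. lookup l i) * 2 ^ ?d"
      unfolding step_monomial[OF e] by (rule mult_mono[OF _ step_factor(2)[OF e]]) (use s step_factor(1)[OF e, of k] in auto)
    then have "?a e * (\<Prod>i<n. ?x i ^ lookup e i) \<le> ?a e * (s ^ (\<Sum>i<k. lookup l i) * 2 ^ ?d)"
      by (rule mult_left_mono[OF _ specialize_nonneg[OF good_jackP[OF l]]])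
    then show ?thesis by (simp only: mult.commute)
  qed (simp add: jackP_zero[OF l])
  then have "jack_at n t l ?x \<le> (\<Sum>e\<in>exps n ?d. s ^ (\<Sum>i<k. lookup l i) * 2 ^ ?d * ?a e)"
    unfolding jack_at_evaln[OF l] evaln_def by (rule sum_mono)
  then show ?thesis by (simp add: jack_at_evaln[OF l] evaln_def sum_distrib_left)
qed

lemma diff_at_imp_weakly_majorizes:
  assumes l: "l \<in> partitions_upto n" and m: "m \<in> partitions_upto n"
    and D: "\<And>x. \<forall>i<n. 1 < x i \<Longrightarrow> 0 \<le> diff_at n t l m x"
  shows "weakly_majorizes l m"
  unfolding weakly_majorizes_def
proof (rule allI, rule ccontr)
  fix k
  let ?L = "\<Sum>i<k. lookup l i" and ?M = "\<Sum>i<k. lookup m i"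
  assume "\<not> ?M \<le> ?L"
  then have gap: "Suc ?L \<le> ?M" by simp
  have p: "is_partition l" "is_partition m" using l m by (auto simp: partitions_upto_def)
  let ?Nl = "jack_at n t l (\<lambda>_. 1)" and ?Nm = "jack_at n t m (\<lambda>_. 1)"
  have N: "0 < ?Nl" "0 < ?Nm" using jack_at_1_pos[OF l, of t] jack_at_1_pos[OF m, of t] by auto
  \<comment> \<open>The other coordinates are 2 to keep the point in (1, infinity)^n at the cost of
    a bounded factor. If weak majorization fails at \<open>k\<close>, the comparison of growth
    bounds s itself.\<close>
  have bound: "s \<le> 2 ^ part_size l * ?Nm" if s: "1 < s" for s
  proof -
    let ?x = "\<lambda>i. if i < k then s else 2"
    have s1: "1 \<le> s" "0 < s" using s by auto
    have "s ^ Suc ?L \<le> s ^ ?M" by (rule power_increasing[OF gap s1(1)])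
    also have "\<dots> \<le> jack_at n t m ?x" by (rule jack_at_step_lower[OF m s1(1)])
    also have "\<dots> = jack_at n t m ?x / ?Nm * ?Nm" using N by simp
    also have "\<dots> \<le> jack_at n t l ?x / ?Nl * ?Nm"
      using D[of ?x] s N by (intro mult_right_mono) (auto simp: diff_at_def)
    also have "\<dots> \<le> (s ^ ?L * 2 ^ part_size l) * ?Nm"
      using jack_at_step_upper[OF p(1) s1(1), of n t k] N by (intro mult_right_mono) (auto simp: divide_le_eq)
    finally have "s ^ ?L * s \<le> s ^ ?L * (2 ^ part_size l * ?Nm)" by (simp add: mult_ac)
    then show ?thesis using s1(2) by simp
  qed
  have "1 < 2 + 2 ^ part_size l * ?Nm" using N by (simp add: add_pos_pos)
  then show False using bound[of "2 + 2 ^ part_size l * ?Nm"] by simp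
qed

lemma A3_imp_A4:
  assumes l: "l \<in> partitions_upto n" and m: "m \<in> partitions_upto n" and "A3 n l m"
  shows "A4 n l m"
proof -
  obtain t where t: "\<forall>x. (\<forall>i<n. 0 < x i \<and> x i < 1) \<or> (\<forall>i<n. 1 < x i) \<longrightarrow> 0 \<le> diff_at n t l m x"
    using assms(3) unfolding A3_def by blast
  have p: "is_partition l" "is_partition m" and k: "keys l \<subseteq> {..<n}" "keys m \<subseteq> {..<n}"
    using l m by (auto simp: partitions_upto_def)
  have w: "weakly_majorizes l m" by (rule diff_at_imp_weakly_majorizes[OF l m]) (use t in blast)
  then have "part_size m \<le> part_size l"
    unfolding weakly_majorizes_def part_size_superset[OF finite_lessThan k(1)] part_size_superset[OF finite_lessThan k(2)] by blast
  moreover have "part_size l \<le> part_size m"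
  proof (rule ccontr)
    assume "\<not> part_size l \<le> part_size m"
    then have "(1 / 2 :: real) ^ part_size l < (1 / 2) ^ part_size m" by (intro power_strict_decreasing) auto
    moreover have "0 \<le> diff_at n t l m (\<lambda>_. 1 / 2)" using t by simp
    moreover have "diff_at n t l m (\<lambda>_. 1 / 2) = (1 / 2) ^ part_size l - (1 / 2) ^ part_size m"
      using jack_at_1_pos[OF l, of t] jack_at_1_pos[OF m, of t]
      unfolding diff_at_def jack_at_const[OF p(1), of n t "1 / 2"] jack_at_const[OF p(2), of n t "1 / 2"] by simp
    ultimately show False by simp
  qed
  ultimately show ?thesis using w by (simp add: A4_def majorizes_def)
qed

lemma B3_imp_B4:
  assumes l: "l \<in> partitions_upto n" and m: "m \<in> partitions_upto n" and "B3 n l m"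
  shows "B4 n l m"
proof -
  obtain t where t: "\<forall>x. (\<forall>i<n. 0 \<le> x i) \<longrightarrow> 0 \<le> diff_at n t l m (\<lambda>i. x i + 1)"
    using assms(3) unfolding B3_def by blast
  have "0 \<le> diff_at n t l m x" if "\<forall>i<n. 1 < x i" for x
    using t[rule_format, of "\<lambda>i. x i - 1"] that by (simp add: less_imp_le)
  then show ?thesis unfolding B4_def by (rule diff_at_imp_weakly_majorizes[OF l m])
qed

lemma plength_le: "l \<in> partitions_upto n \<Longrightarrow> plength l \<le> n"
  unfolding plength_def partitions_upto_def using card_mono[of "{..<n}" "keys l"] by auto

lemma assertions_equivalent:
  assumes "l \<in> partitions_upto n" "m \<in> partitions_upto n"
    and "A4 n l m \<Longrightarrow> A1 n l m" "B4 n l m \<Longrightarrow> B1 n l m"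
  shows "(A1 n l m \<longleftrightarrow> A2 n l m) \<and> (A2 n l m \<longleftrightarrow> A3 n l m) \<and> (A3 n l m \<longleftrightarrow> A4 n l m) \<and>
    (B1 n l m \<longleftrightarrow> B2 n l m) \<and> (B2 n l m \<longleftrightarrow> B3 n l m) \<and> (B3 n l m \<longleftrightarrow> B4 n l m)"
  using assms A1_imp_A2[OF assms(1,2)] B1_imp_B2[OF assms(1,2)] A2_imp_A3[of n l m] B2_imp_B3[of n l m]
    A3_imp_A4[OF assms(1,2)] B3_imp_B4[OF assms(1,2)] by blast

lemma two_rows_equivalent:
  assumes "1 \<le> n" "l \<in> partitions_upto n" "m \<in> partitions_upto n" "plength l \<le> 2" "plength m \<le> 2"
  shows "(A1 n l m \<longleftrightarrow> A2 n l m) \<and> (A2 n l m \<longleftrightarrow> A3 n l m) \<and> (A3 n l m \<longleftrightarrow> A4 n l m) \<and>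
    (B1 n l m \<longleftrightarrow> B2 n l m) \<and> (B2 n l m \<longleftrightarrow> B3 n l m) \<and> (B3 n l m \<longleftrightarrow> B4 n l m)"
  using majorizes_two_rows_imp_A1[OF assms] weakly_majorizes_two_rows_imp_B1[OF assms]
  by (intro assertions_equivalent assms) (simp_all add: A4_def B4_def)

text \<open>Here A1 and B1 hold outright, and with them all other assertions.\<close>

lemma ones_equivalent:
  assumes "l \<in> partitions_upto n" "part_size l \<le> n"
  defines "m \<equiv> ones (part_size l)"
  shows "(A1 n l m \<longleftrightarrow> A2 n l m) \<and> (A2 n l m \<longleftrightarrow> A3 n l m) \<and> (A3 n l m \<longleftrightarrow> A4 n l m) \<and>
    (B1 n l m \<longleftrightarrow> B2 n l m) \<and> (B2 n l m \<longleftrightarrow> B3 n l m) \<and> (B3 n l m \<longleftrightarrow> B4 n l m)"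
proof (rule assertions_equivalent)
  show "m \<in> partitions_upto n" using assms(2) by (auto simp: m_def partitions_upto_def)
  show "A1 n l m" unfolding m_def by (rule ones_imp_A1[OF assms(1,2)])
  then show "B1 n l m" by (rule A1_imp_B1)
qed (rule assms)

theorem theorem3p2:
  shows
    "(\<forall>l \<in> partitions_upto 2. \<forall>m \<in> partitions_upto 2.
        (A1 2 l m \<longleftrightarrow> A2 2 l m) \<and> (A2 2 l m \<longleftrightarrow> A3 2 l m) \<and> (A3 2 l m \<longleftrightarrow> A4 2 l m) \<and>
        (B1 2 l m \<longleftrightarrow> B2 2 l m) \<and> (B2 2 l m \<longleftrightarrow> B3 2 l m) \<and> (B3 2 l m \<longleftrightarrow> B4 2 l m)) \<and>
     (\<forall>n \<ge> 1. \<forall>l \<in> partitions_upto n. part_size l \<le> n \<longrightarrow>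
        (\<forall>m. m = ones (part_size l) \<longrightarrow>
        (A1 n l m \<longleftrightarrow> A2 n l m) \<and> (A2 n l m \<longleftrightarrow> A3 n l m) \<and> (A3 n l m \<longleftrightarrow> A4 n l m) \<and>
        (B1 n l m \<longleftrightarrow> B2 n l m) \<and> (B2 n l m \<longleftrightarrow> B3 n l m) \<and> (B3 n l m \<longleftrightarrow> B4 n l m))) \<and>
     (\<forall>n \<ge> 1. \<forall>l \<in> partitions_upto n. \<forall>m \<in> partitions_upto n.
        plength l \<le> 2 \<and> plength m \<le> 2 \<longrightarrow>
        (A2 n l m \<longleftrightarrow> A3 n l m) \<and> (A3 n l m \<longleftrightarrow> A4 n l m) \<and>
        (B2 n l m \<longleftrightarrow> B3 n l m) \<and> (B3 n l m \<longleftrightarrow> B4 n l m))"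
  (is "?i \<and> ?ii \<and> ?iii")
proof (intro conjI)
  \<comment> \<open>In two variables every partition has at most two rows.\<close>
  show ?i using two_rows_equivalent[OF one_le_numeral] plength_le by simp
  show ?ii using ones_equivalent by blast
  show ?iii using two_rows_equivalent by blast
qed

end
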